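(* Let $(\mathcal{A},\tau)$ be a tracial $W^*$-probability space and let $S$ be a standard semicircular variable. For every self-adjoint element $F$ of $(\mathcal{A},\tau)$, $$W_2(F,S)\leq \Sigma^*(F|S).$$
   Context: A tracial $W^*$-probability space $(\mathcal{A},\tau)$ is a von Neumann algebra $\mathcal{A}$ with a faithful normal tracial state $\tau$. $L^2(\mathcal{A},\tau)$ is the completion of $\mathcal{A}$ for $\langle A,B\rangle=\tau(A^*B)$; $L^2(\mathcal{A},\tau)\otimes L^2(\mathcal{A},\tau)$ is the Hilbert space tensor product. The distribution of a self-adjoint $A$ is the probability measure $\mu$ on $\mathbb{R}$ with $\tau(h(A))=\int h\,d\mu$ for all bounded Borel $h$. A standard semicircular variable is a self-adjoint element whose distribution has density $\frac{1}{2\pi}\sqrt{4-t^2}$ on $[-2,2]$. $W_2(A,B)^2=\inf_{\pi\in\Pi(A,B)}\int_{\mathbb{R}^2}|x-y|^2\,d\pi(x,y)$, where $\Pi(A,B)$ is the set of probability measures on $\mathbb{R}^2$ with marginals the distributions of $A$ and of $B$. Let $\partial:\mathbb{C}[X]\to\mathbb{C}[X]\otimes\mathbb{C}[X]$ be the linear map $\partial X^m=\sum_{k=1}^m X^{k-1}\otimes X^{m-k}$; $\partial P(F)$ is its evaluation under $X^a\otimes X^b\mapsto F^a\otimes F^b$. A free Stein kernel of $F$ is $A\in L^2(\mathcal{A},\tau)\otimes L^2(\mathcal{A},\tau)$ with $\langle F,P(F)\rangle_{L^2(\mathcal{A},\tau)}=\langle A,\partial P(F)\rangle_{L^2(\mathcal{A},\tau)\otimes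 L^2(\mathcal{A},\tau)}$ for all $P\in\mathbb{C}[X]$. The free Stein discrepancy is $\Sigma^*(F|S)=\inf_A\|A-1_{\mathcal{A}}\otimes 1_{\mathcal{A}}\|_{L^2(\mathcal{A},\tau)\otimes L^2(\mathcal{A},\tau)}$ over all free Stein kernels $A$ of $F$ ($+\infty$ if there is none). *)

theory Defs
  imports "HOL-Probability.Probability" "HOL-Computational_Algebra.Polynomial"
begin

section \<open>Complex Hilbert spaces\<close>

text \<open>Inner products are linear in the second argument, as in $\langle A, B\rangle = \tau(A^*B)$.
  The norm, the topology and completeness come from the class \<^class>\<open>banach\<close>.\<close>

class complex_hilbert = banach +
  fixes scaleC :: "complex \<Rightarrow> 'a \<Rightarrow> 'a" (infixr \<open>*\<^sub>C\<close> 75)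
    and cinner :: "'a \<Rightarrow> 'a \<Rightarrow> complex"
  assumes scaleC_add_right: "c *\<^sub>C (x + y) = c *\<^sub>C x + c *\<^sub>C y"
    and scaleC_add_left: "(c + d) *\<^sub>C x = c *\<^sub>C x + d *\<^sub>C x"
    and scaleC_scaleC: "c *\<^sub>C d *\<^sub>C x = (c * d) *\<^sub>C x"
    and scaleC_of_real: "complex_of_real r *\<^sub>C x = scaleR r x"
    and cinner_add_right: "cinner x (y + z) = cinner x y + cinner x z"
    and cinner_scaleC_right: "cinner x (c *\<^sub>C y) = c * cinner x y"
    and cinner_commute: "cinner x y = cnj (cinner y x)"
    and cinner_self: "cinner x x = complex_of_real ((norm x)\<^sup>2)"

lemma norm_scaleC: "norm (c *\<^sub>C x) = cmod c * norm (x::'a::complex_hilbert)"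
proof -
  have "cinner (c *\<^sub>C x) (c *\<^sub>C x) = c * cnj c * cinner x x"
    by (metis cinner_commute cinner_scaleC_right complex_cnj_mult mult.assoc)
  then have "complex_of_real ((norm (c *\<^sub>C x))\<^sup>2) = complex_of_real ((cmod c * norm x)\<^sup>2)"
    unfolding cinner_self
    by (metis complex_norm_square of_real_mult of_real_power power_mult_distrib)
  then show ?thesis
    by (metis mult_nonneg_nonneg norm_ge_zero of_real_eq_iff power2_eq_imp_eq)
qed

lemma bounded_linear_scaleC: "bounded_linear ((*\<^sub>C) c :: 'a::complex_hilbert \<Rightarrow> 'a)"
proof (rule bounded_linear_intro[where K = "cmod c"])
  show "c *\<^sub>C (r *\<^sub>R x) = r *\<^sub>R (c *\<^sub>C x)" for r and x :: 'a
    by (metis mult.commute scaleC_of_real scaleC_scaleC)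
qed (simp_all add: scaleC_add_right norm_scaleC mult.commute)

section \<open>Bounded operators and von Neumann algebras\<close>

text \<open>Operators have the library type of bounded real-linear maps; \<open>B(H)\<close> is the set
  \<open>clinear_ops\<close> of the complex-linear ones.\<close>

type_synonym 'h op = "'h \<Rightarrow>\<^sub>L 'h"

definition clinear_ops :: "('h::complex_hilbert) op set" where
  "clinear_ops = {T :: 'h op. \<forall>c x. T (c *\<^sub>C x) = c *\<^sub>C T x}"

definition op_scaleC :: "complex \<Rightarrow> 'h op \<Rightarrow> ('h::complex_hilbert) op" where
  "op_scaleC c T = Blinfun (\<lambda>x. c *\<^sub>C T x)"

lemma op_scaleC_apply [simp]: "op_scaleC c T x = c *\<^sub>C T x"
proof -
  have "bounded_linear (\<lambda>x. c *\<^sub>C T x)"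
    by (rule bounded_linear_compose[OF bounded_linear_scaleC blinfun.bounded_linear_right])
  then show ?thesis
    by (simp add: op_scaleC_def bounded_linear_Blinfun_apply)
qed

definition op_power :: "'h op \<Rightarrow> nat \<Rightarrow> ('h::complex_hilbert) op" where
  "op_power T n = ((o\<^sub>L) T ^^ n) id_blinfun"

definition op_poly :: "complex poly \<Rightarrow> 'h op \<Rightarrow> ('h::complex_hilbert) op" where
  "op_poly P T = (\<Sum>m\<le>degree P. op_scaleC (coeff P m) (op_power T m))"

definition is_adjoint :: "('h::complex_hilbert) op \<Rightarrow> 'h op \<Rightarrow> bool" where
  "is_adjoint T U \<longleftrightarrow> (\<forall>x y. cinner (U x) y = cinner x (T y))"

definition adj :: "('h::complex_hilbert) op \<Rightarrow> 'h op" where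
  "adj T = (THE U. is_adjoint T U)"

definition self_adjoint :: "('h::complex_hilbert) op \<Rightarrow> bool" where
  "self_adjoint T \<longleftrightarrow> T \<in> clinear_ops \<and> is_adjoint T T"

definition op_le :: "('h::complex_hilbert) op \<Rightarrow> 'h op \<Rightarrow> bool" where
  "op_le T U \<longleftrightarrow> (\<forall>x. cinner x ((U - T) x) \<in> \<real>\<^sub>\<ge>\<^sub>0)"

definition commutant :: "('h::complex_hilbert) op set \<Rightarrow> 'h op set" where
  "commutant M = {T \<in> clinear_ops. \<forall>U\<in>M. T o\<^sub>L U = U o\<^sub>L T}"

text \<open>A von Neumann algebra is a self-adjoint set of operators equal to its bicommutant; such a set
  is automatically a unital complex subalgebra of \<open>B(H)\<close>.\<close>

definition von_neumann_algebra :: "('h::complex_hilbert) op set \<Rightarrow> bool" where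
  "von_neumann_algebra M \<longleftrightarrow>
     (\<forall>a\<in>M. \<exists>b\<in>M. is_adjoint a b) \<and> commutant (commutant M) = M"

section \<open>Tracial W*-probability spaces\<close>

text \<open>Functionals on \<open>M\<close> are total functions of which only the values on \<open>M\<close> matter.\<close>

definition state_on :: "('h::complex_hilbert) op set \<Rightarrow> ('h op \<Rightarrow> complex) \<Rightarrow> bool" where
  "state_on M \<tau> \<longleftrightarrow>
     (\<forall>a\<in>M. \<forall>b\<in>M. \<tau> (a + b) = \<tau> a + \<tau> b) \<and>
     (\<forall>c. \<forall>a\<in>M. \<tau> (op_scaleC c a) = c * \<tau> a) \<and>
     (\<forall>a\<in>M. \<tau> (adj a o\<^sub>L a) \<in> \<real>\<^sub>\<ge>\<^sub>0) \<and>
     \<tau> id_blinfun = 1"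

definition faithful_on :: "('h::complex_hilbert) op set \<Rightarrow> ('h op \<Rightarrow> complex) \<Rightarrow> bool" where
  "faithful_on M \<tau> \<longleftrightarrow> (\<forall>a\<in>M. \<tau> (adj a o\<^sub>L a) = 0 \<longrightarrow> a = 0)"

definition tracial_on :: "('h::complex_hilbert) op set \<Rightarrow> ('h op \<Rightarrow> complex) \<Rightarrow> bool" where
  "tracial_on M \<tau> \<longleftrightarrow> (\<forall>a\<in>M. \<forall>b\<in>M. \<tau> (a o\<^sub>L b) = \<tau> (b o\<^sub>L a))"

text \<open>Normality: \<open>\<tau>\<close> preserves suprema of upward directed sets of self-adjoint elements of \<open>M\<close>.\<close>

definition is_op_lub :: "('h::complex_hilbert) op set \<Rightarrow> 'h op set \<Rightarrow> 'h op \<Rightarrow> bool" where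
  "is_op_lub M D a \<longleftrightarrow> a \<in> M \<and> self_adjoint a \<and> (\<forall>d\<in>D. op_le d a) \<and>
     (\<forall>b\<in>M. self_adjoint b \<longrightarrow> (\<forall>d\<in>D. op_le d b) \<longrightarrow> op_le a b)"

definition normal_on :: "('h::complex_hilbert) op set \<Rightarrow> ('h op \<Rightarrow> complex) \<Rightarrow> bool" where
  "normal_on M \<tau> \<longleftrightarrow>
     (\<forall>D a. D \<noteq> {} \<and> D \<subseteq> M \<and> (\<forall>d\<in>D. self_adjoint d) \<and>
        (\<forall>d\<in>D. \<forall>e\<in>D. \<exists>f\<in>D. op_le d f \<and> op_le e f) \<and> is_op_lub M D a
        \<longrightarrow> Re (\<tau> a) = (SUP d\<in>D. Re (\<tau> d)))"

definition tracial_W_star_space :: "('h::complex_hilbert) op set \<Rightarrow> ('h op \<Rightarrow> complex) \<Rightarrow> bool" where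
  "tracial_W_star_space M \<tau> \<longleftrightarrow>
     von_neumann_algebra M \<and> state_on M \<tau> \<and> normal_on M \<tau> \<and> faithful_on M \<tau> \<and> tracial_on M \<tau>"

section \<open>Distributions\<close>

text \<open>\<open>E\<close> is a projection-valued measure on the Borel sets of the line.\<close>

definition projection_valued_measure :: "(real set \<Rightarrow> ('h::complex_hilbert) op) \<Rightarrow> bool" where
  "projection_valued_measure E \<longleftrightarrow>
     (\<forall>B\<in>sets borel. self_adjoint (E B) \<and> E B o\<^sub>L E B = E B) \<and>
     E UNIV = id_blinfun \<and>
     (\<forall>B::nat \<Rightarrow> real set. range B \<subseteq> sets borel \<longrightarrow> disjoint_family B \<longrightarrow>
        (\<forall>x. (\<lambda>n. E (B n) x) sums E (\<Union>n. B n) x))"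

text \<open>The scalar measure \<open>B \<mapsto> \<langle>x, E(B) x\<rangle>\<close>.\<close>

definition scalar_measure :: "(real set \<Rightarrow> ('h::complex_hilbert) op) \<Rightarrow> 'h \<Rightarrow> real measure" where
  "scalar_measure E x = measure_of UNIV (sets borel) (\<lambda>B. ennreal (Re (cinner x (E B x))))"

text \<open>\<open>T = \<integral> h dE\<close>, in the weak sense. By polarization the diagonal matrix coefficients determine
  \<open>T\<close>.\<close>

definition is_spectral_integral ::
    "(real set \<Rightarrow> ('h::complex_hilbert) op) \<Rightarrow> (real \<Rightarrow> complex) \<Rightarrow> 'h op \<Rightarrow> bool" where
  "is_spectral_integral E h T \<longleftrightarrow>
     T \<in> clinear_ops \<and> (\<forall>x. cinner x (T x) = (\<integral>t. h t \<partial>scalar_measure E x))"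

text \<open>The spectral measure of \<open>A\<close>: \<open>A = \<integral> t dE(t)\<close>. The condition on the support makes all the
  integrals converge.\<close>

definition is_spectral_measure :: "('h::complex_hilbert) op \<Rightarrow> (real set \<Rightarrow> 'h op) \<Rightarrow> bool" where
  "is_spectral_measure A E \<longleftrightarrow>
     projection_valued_measure E \<and> E {- norm A..norm A} = id_blinfun \<and>
     is_spectral_integral E complex_of_real A"

text \<open>Borel functional calculus: \<open>T = h(A)\<close>.\<close>

definition is_borel_calculus ::
    "('h::complex_hilbert) op \<Rightarrow> (real \<Rightarrow> complex) \<Rightarrow> 'h op \<Rightarrow> bool" where
  "is_borel_calculus A h T \<longleftrightarrow> (\<exists>E. is_spectral_measure A E \<and> is_spectral_integral E h T)"

definition is_distribution ::
    "(('h::complex_hilbert) op \<Rightarrow> complex) \<Rightarrow> 'h op \<Rightarrow> real measure \<Rightarrow> bool" where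
  "is_distribution \<tau> A \<mu> \<longleftrightarrow>
     prob_space \<mu> \<and> sets \<mu> = sets borel \<and>
     (\<forall>h \<in> borel_measurable borel. bounded (range h) \<longrightarrow>
        (\<exists>T. is_borel_calculus A h T \<and> \<tau> T = (\<integral>t. h t \<partial>\<mu>)))"

definition semicircle_density :: "real \<Rightarrow> real" where
  "semicircle_density t = (if t \<in> {-2..2} then sqrt (4 - t\<^sup>2) / (2 * pi) else 0)"

definition standard_semicircular ::
    "('h::complex_hilbert) op set \<Rightarrow> ('h op \<Rightarrow> complex) \<Rightarrow> 'h op \<Rightarrow> bool" where
  "standard_semicircular M \<tau> S \<longleftrightarrow>
     S \<in> M \<and> self_adjoint S \<and> is_distribution \<tau> S (density lborel (\<lambda>t. ennreal (semicircle_density t)))"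

text \<open>The two variables of a coupling may live in different spaces, since only their distributions
  enter.\<close>

definition couplings ::
    "(('h::complex_hilbert) op \<Rightarrow> complex) \<Rightarrow> 'h op \<Rightarrow>
     (('g::complex_hilbert) op \<Rightarrow> complex) \<Rightarrow> 'g op \<Rightarrow> (real \<times> real) measure set" where
  "couplings \<tau> A \<sigma> B =
     {\<pi>. prob_space \<pi> \<and> sets \<pi> = sets borel \<and>
         is_distribution \<tau> A (distr \<pi> borel fst) \<and> is_distribution \<sigma> B (distr \<pi> borel snd)}"

definition ennreal_sqrt :: "ennreal \<Rightarrow> ennreal" where
  "ennreal_sqrt c = (if c = \<infinity> then \<infinity> else ennreal (sqrt (enn2real c)))"

definition W2 ::
    "(('h::complex_hilbert) op \<Rightarrow> complex) \<Rightarrow> 'h op \<Rightarrow>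
     (('g::complex_hilbert) op \<Rightarrow> complex) \<Rightarrow> 'g op \<Rightarrow> ennreal" where
  "W2 \<tau> A \<sigma> B =
     ennreal_sqrt (INF \<pi>\<in>couplings \<tau> A \<sigma> B. \<integral>\<^sup>+ (x, y). ennreal (\<bar>x - y\<bar>\<^sup>2) \<partial>\<pi>)"

section \<open>The Hilbert spaces \<open>L\<^sup>2(M, \<tau>)\<close> and \<open>L\<^sup>2(M, \<tau>) \<otimes> L\<^sup>2(M, \<tau>)\<close>\<close>

text \<open>Completions and Hilbert space tensor products are unique up to a unique unitary respecting the
  structure maps, so they are given here by an arbitrary Hilbert space together with its structure
  map: \<open>\<iota>\<close> realises the type \<open>'l\<close> as the completion of \<open>M\<close> for \<open>\<langle>a, b\<rangle> = \<tau>(a* b)\<close>, and \<open>tens\<close>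
  realises the type \<open>'k\<close> as the Hilbert space tensor product of \<open>'l\<close> with itself.\<close>

definition is_L2_completion ::
    "('h::complex_hilbert) op set \<Rightarrow> ('h op \<Rightarrow> complex) \<Rightarrow> ('h op \<Rightarrow> 'l::complex_hilbert) \<Rightarrow> bool" where
  "is_L2_completion M \<tau> \<iota> \<longleftrightarrow>
     (\<forall>a\<in>M. \<forall>b\<in>M. \<iota> (a + b) = \<iota> a + \<iota> b) \<and>
     (\<forall>c. \<forall>a\<in>M. \<iota> (op_scaleC c a) = c *\<^sub>C \<iota> a) \<and>
     (\<forall>a\<in>M. \<forall>b\<in>M. cinner (\<iota> a) (\<iota> b) = \<tau> (adj a o\<^sub>L b)) \<and>
     closure (\<iota> ` M) = UNIV"

text \<open>The real span of the elementary tensors below is already a complex subspace.\<close>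

definition is_hilbert_tensor_product ::
    "('l::complex_hilbert \<Rightarrow> 'l \<Rightarrow> 'k::complex_hilbert) \<Rightarrow> bool" where
  "is_hilbert_tensor_product tens \<longleftrightarrow>
     (\<forall>x x' y. tens (x + x') y = tens x y + tens x' y) \<and>
     (\<forall>x y y'. tens x (y + y') = tens x y + tens x y') \<and>
     (\<forall>c x y. tens (c *\<^sub>C x) y = c *\<^sub>C tens x y \<and> tens x (c *\<^sub>C y) = c *\<^sub>C tens x y) \<and>
     (\<forall>x y x' y'. cinner (tens x y) (tens x' y') = cinner x x' * cinner y y') \<and>
     closure (span (range (\<lambda>(x, y). tens x y))) = UNIV"

section \<open>Free Stein kernels and free Stein discrepancy\<close>

text \<open>\<open>\<complex>[X] \<otimes> \<complex>[X]\<close> is identified with the polynomials in one variable over \<open>\<complex>[X]\<close>, where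
  \<open>X^a \<otimes> X^b\<close> is \<open>poly_tensor a b\<close>: the exponent of the left leg is that of the inner variable.\<close>

definition poly_tensor :: "nat \<Rightarrow> nat \<Rightarrow> complex poly poly" where
  "poly_tensor a b = monom (monom 1 a) b"

definition free_difference_quotient :: "complex poly \<Rightarrow> complex poly poly" where
  "free_difference_quotient P =
     (\<Sum>m\<le>degree P. smult [:coeff P m:] (\<Sum>k = 1..m. poly_tensor (k - 1) (m - k)))"

text \<open>Evaluation under \<open>X^a \<otimes> X^b \<mapsto> F^a \<otimes> F^b\<close>.\<close>

definition eval_tensor ::
    "(('h::complex_hilbert) op \<Rightarrow> 'l::complex_hilbert) \<Rightarrow> ('l \<Rightarrow> 'l \<Rightarrow> 'k::complex_hilbert) \<Rightarrow>
     'h op \<Rightarrow> complex poly poly \<Rightarrow> 'k" where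
  "eval_tensor \<iota> tens F Q =
     (\<Sum>b\<le>degree Q. \<Sum>a\<le>degree (coeff Q b).
        coeff (coeff Q b) a *\<^sub>C tens (\<iota> (op_power F a)) (\<iota> (op_power F b)))"

definition free_stein_kernel ::
    "(('h::complex_hilbert) op \<Rightarrow> 'l::complex_hilbert) \<Rightarrow> ('l \<Rightarrow> 'l \<Rightarrow> 'k::complex_hilbert) \<Rightarrow>
     'h op \<Rightarrow> 'k \<Rightarrow> bool" where
  "free_stein_kernel \<iota> tens F A \<longleftrightarrow>
     (\<forall>P. cinner (\<iota> F) (\<iota> (op_poly P F)) =
          cinner A (eval_tensor \<iota> tens F (free_difference_quotient P)))"

text \<open>The infimum of the empty set is \<open>\<infinity>\<close>.\<close>

definition free_stein_discrepancy ::
    "(('h::complex_hilbert) op \<Rightarrow> 'l::complex_hilbert) \<Rightarrow> ('l \<Rightarrow> 'l \<Rightarrow> 'k::complex_hilbert) \<Rightarrow>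
     'h op \<Rightarrow> ennreal" where
  "free_stein_discrepancy \<iota> tens F =
     (INF A\<in>{A. free_stein_kernel \<iota> tens F A}.
        ennreal (norm (A - tens (\<iota> id_blinfun) (\<iota> id_blinfun))))"

end

theory Submission
  imports Defs
begin

text \<open>Let \<open>\<mu>\<close> be the law of \<open>F\<close> and \<open>A\<close> a free Stein kernel. By Cauchy--Schwarz,
  \<open>(\<integral>x P(x) d\<mu>)\<^sup>2 \<le> \<parallel>A\<parallel>\<^sup>2 \<integral>\<integral>((P(x) - P(y)) / (x - y))\<^sup>2 d\<mu> d\<mu>\<close> for real polynomials \<open>P\<close>; this passes to \<open>C\<^sup>1\<close>
  functions, and then the diagonal can be dropped on the right. Since
  \<open>\<parallel>A - 1 \<otimes> 1\<parallel>\<^sup>2 = \<parallel>A\<parallel>\<^sup>2 - 2 \<integral>x\<^sup>2 d\<mu> + 1\<close>, it remains to show \<open>2 E(XY) \<ge> 3 E(X\<^sup>2) - \<parallel>A\<parallel>\<^sup>2\<close> for the comonotone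
  coupling of \<open>X \<sim> \<mu>\<close> with a semicircular \<open>Y\<close>.

  Discretize \<open>X\<close> to a grid and let \<open>h\<close> be the minimizer for the Stein inequality: up to small corrections,
  \<open>E(X f(X)) = E(a \<Delta>f(X) / \<Delta>X)\<close> for all \<open>f\<close>, where \<open>\<Delta>\<close> is the difference of two independent copies and
  \<open>a = \<Delta>h(X) / \<Delta>X\<close>. A discrete maximum principle shows that \<open>h\<close> is increasing, so \<open>a \<ge> 0\<close>; and \<open>E(a) = E(X\<^sup>2)\<close>,
  \<open>E(a\<^sup>2) \<le> \<parallel>A\<parallel>\<^sup>2\<close>. Taking for \<open>f(X)\<close> the conditional mean of \<open>Y\<close> gives \<open>E(XY) = E(a \<Delta>Y / \<Delta>X)\<close>, while the Stein
  identity of the semicircle law, applied to \<open>X\<close> as an increasing step function of \<open>Y\<close>, gives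
  \<open>E(XY) \<ge> E(\<Delta>X / \<Delta>Y)\<close>. Adding up, \<open>2 E(XY) \<ge> E(2 sqrt a) \<ge> E(3 a - a\<^sup>2)\<close>.\<close>

section \<open>Equilibria of a chain with long-range interactions\<close>

text \<open>The two estimates of \<open>E(XY)\<close> are combined because their integrands,
  \<open>a \<Delta>Y / \<Delta>X\<close> and \<open>\<Delta>X / \<Delta>Y\<close>, multiply to
  \<open>a\<close>; AM-GM needs both to be nonnegative, so the monotonicity of the minimizer is
  essential. Only the first two moments of \<open>a\<close> are controlled, so
  \<open>2 sqrt a\<close> is replaced by \<open>3 a - a\<^sup>2\<close>, which touches it to first
  order at \<open>a = 1\<close>, the value for a semicircular law. The obstacle is the short range,
  where \<open>1 / (x - y)\<^sup>2\<close> is singular and atoms give distance 0 positive mass. With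
  the diagonal dropped, pairs at positive distance below a fixed number of meshes have vanishing
  probability, so the kernel can be truncated and the close pairs charged to nearest-neighbour links
  of small total size. This dictates the order of limits: first the mesh, then the truncation range
  and the regularization. The operator side has to produce \<mu> itself, since a distribution is
  defined through Borel functional calculus: the Hausdorff moment problem supplies scalar spectral
  measures, and normality of \<tau> makes \<mu> countably additive.\<close>

lemma pos_def_solvable:
  fixes A :: "'a \<Rightarrow> 'a \<Rightarrow> real"
  assumes "finite I" and "\<And>v. \<exists>i\<in>I. v i \<noteq> 0 \<Longrightarrow> (\<Sum>i\<in>I. v i * (\<Sum>j\<in>I. A i j * v j)) > 0"
  shows "\<exists>h. \<forall>i\<in>I. (\<Sum>j\<in>I. A i j * h j) = b i"
  using assms
proof (induction I arbitrary: b rule: finite_induct)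
  case empty
  then show ?case by simp
next
  case (insert a I)
  have IH: "\<exists>h. \<forall>i\<in>I. (\<Sum>j\<in>I. A i j * h j) = b i" for b
  proof (rule insert.IH)
    fix v :: "'a \<Rightarrow> real" assume "\<exists>i\<in>I. v i \<noteq> 0"
    then have "\<exists>i\<in>insert a I. (v(a := 0)) i \<noteq> 0"
      using insert.hyps(2) by (metis fun_upd_other insertCI)
    from insert.prems[OF this] show "(\<Sum>i\<in>I. v i * (\<Sum>j\<in>I. A i j * v j)) > 0"
      using insert.hyps by (simp add: sum.insert_if cong: sum.cong_simp) (smt (verit) sum.cong)
  qed
  obtain g where g: "\<And>i. i \<in> I \<Longrightarrow> (\<Sum>j\<in>I. A i j * g j) = b i" using IH[of b] by blast
  obtain u where u: "\<And>i. i \<in> I \<Longrightarrow> (\<Sum>j\<in>I. A i j * u j) = A i a" using IH[of "\<lambda>i. A i a"] by blast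
  \<comment> \<open>Schur complement: eliminating the old unknowns leaves one scalar equation with
    coefficient \<open>S\<close>, which is positive because it is the value of the form at the
    vector with entries \<open>- u j\<close> and 1.\<close>
  define S where "S = A a a - (\<Sum>j\<in>I. A a j * u j)"
  have row: "(\<Sum>j\<in>insert a I. A i j * ((\<lambda>j. g' j - t * u j)(a := t)) j)
      = (\<Sum>j\<in>I. A i j * g' j) + t * (A i a - (\<Sum>j\<in>I. A i j * u j))" for i t g'
  proof -
    have "(\<Sum>j\<in>I. A i j * ((\<lambda>j. g' j - t * u j)(a := t)) j) = (\<Sum>j\<in>I. A i j * g' j - t * (A i j * u j))"
      using insert.hyps by (intro sum.cong) (auto simp: algebra_simps)
    also have "\<dots> = (\<Sum>j\<in>I. A i j * g' j) - t * (\<Sum>j\<in>I. A i j * u j)"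
      by (simp add: sum_subtractf sum_distrib_left)
    finally show ?thesis using insert.hyps by (simp add: algebra_simps)
  qed
  define v where "v = (\<lambda>j. 0 - 1 * u j)(a := 1::real)"
  have "0 < (\<Sum>i\<in>insert a I. v i * (\<Sum>j\<in>insert a I. A i j * v j))"
    by (rule insert.prems) (auto simp: v_def)
  also have "\<dots> = (\<Sum>i\<in>insert a I. v i * (A i a - (\<Sum>j\<in>I. A i j * u j)))"
    using row[where g'="\<lambda>_. 0" and t=1] unfolding v_def by simp
  also have "\<dots> = S" using insert.hyps by (simp add: u v_def S_def)
  finally have S: "S > 0" .
  define t where "t = (b a - (\<Sum>j\<in>I. A a j * g j)) / S"
  show ?case
  proof (intro exI ballI)
    fix i assume "i \<in> insert a I"
    then show "(\<Sum>j\<in>insert a I. A i j * ((\<lambda>j. g j - t * u j)(a := t)) j) = b i"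
      unfolding row using S by (auto simp: g u t_def S_def[symmetric])
  qed
qed

text \<open>The Dirichlet form of a resistor network: conductances \<open>l\<close> on
  nearest-neighbour links and \<open>c\<close> between arbitrary nodes. Ordered pairs are summed, so
  a symmetric \<open>c\<close> counts every edge twice.\<close>

definition chain_form :: "nat \<Rightarrow> (nat \<Rightarrow> real) \<Rightarrow> (nat \<Rightarrow> nat \<Rightarrow> real) \<Rightarrow> (nat \<Rightarrow> real) \<Rightarrow> (nat \<Rightarrow> real) \<Rightarrow> real" where
  "chain_form m l c h f = (\<Sum>i<m. l i * (h (Suc i) - h i) * (f (Suc i) - f i))
     + (\<Sum>i\<le>m. \<Sum>j\<le>m. c i j * (h i - h j) * (f i - f j))"

lemma chain_form_commute: "chain_form m l c h f = chain_form m l c f h"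
  unfolding chain_form_def by (simp add: mult.commute mult.left_commute)

lemma chain_form_cong: "(\<And>i. i \<le> m \<Longrightarrow> f i = f' i) \<Longrightarrow> chain_form m l c h f = chain_form m l c h f'"
  unfolding chain_form_def by simp

lemma chain_form_const: "chain_form m l c h (\<lambda>_. a) = 0"
  unfolding chain_form_def by simp

lemma chain_form_add: "chain_form m l c h (\<lambda>i. f i + g i) = chain_form m l c h f + chain_form m l c h g"
  unfolding chain_form_def by (simp add: sum.distrib[symmetric] algebra_simps)

lemma chain_form_mult: "chain_form m l c h (\<lambda>i. a * f i) = a * chain_form m l c h f"
  unfolding chain_form_def by (simp add: sum_distrib_left algebra_simps)

lemma chain_form_sum:
  "finite J \<Longrightarrow> chain_form m l c h (\<lambda>k. \<Sum>j\<in>J. v j * f j k) = (\<Sum>j\<in>J. v j * chain_form m l c h (f j))"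
  by (induction rule: finite_induct) (simp_all add: chain_form_const chain_form_add chain_form_mult)

text \<open>Kirchhoff's law at the node \<open>x\<close>: testing with a point mass isolates the
  currents through \<open>x\<close>. The factor 2 comes from the sum over ordered pairs.\<close>

lemma chain_form_unit:
  assumes "x \<le> m" and sym: "\<And>i j. c i j = c j i"
  shows "chain_form m l c h (\<lambda>k. of_bool (k = x)) =
    (if 0 < x then l (x - 1) * (h x - h (x - 1)) else 0) - (if x < m then l x * (h (Suc x) - h x) else 0)
    + 2 * (\<Sum>z\<le>m. c x z * (h x - h z))"
proof -
  have 1: "(\<Sum>i<m. l i * (h (Suc i) - h i) * (of_bool (Suc i = x) - of_bool (i = x))) =
     (\<Sum>i<m. if i = x - 1 \<and> 0 < x then l i * (h (Suc i) - h i) else 0) - (\<Sum>i<m. if i = x then l i * (h (Suc i) - h i) else 0)"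
    unfolding sum_subtractf[symmetric] by (intro sum.cong) auto
  have "(\<Sum>i\<le>m. \<Sum>j\<le>m. c i j * (h i - h j) * (of_bool (i = x) - of_bool (j = x)))
      = (\<Sum>i\<le>m. \<Sum>j\<le>m. (if i = x then c i j * (h i - h j) else 0) - (if j = x then c i j * (h i - h j) else 0))"
    by (intro sum.cong refl) auto
  also have "\<dots> = (\<Sum>i\<le>m. \<Sum>j\<le>m. if i = x then c i j * (h i - h j) else 0) -
        (\<Sum>i\<le>m. (\<Sum>j\<le>m. if j = x then c i j * (h i - h j) else 0))"
    by (simp add: sum_subtractf)
  also have "(\<Sum>i\<le>m. \<Sum>j\<le>m. if i = x then c i j * (h i - h j) else 0)
      = (\<Sum>i\<le>m. if i = x then (\<Sum>j\<le>m. c i j * (h i - h j)) else 0)"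
    by (intro sum.cong refl) auto
  finally have 2: "(\<Sum>i\<le>m. \<Sum>j\<le>m. c i j * (h i - h j) * (of_bool (i = x) - of_bool (j = x)))
      = (\<Sum>i\<le>m. if i = x then (\<Sum>j\<le>m. c i j * (h i - h j)) else 0) -
        (\<Sum>i\<le>m. (\<Sum>j\<le>m. if j = x then c i j * (h i - h j) else 0))" .
  have 3: "(\<Sum>i\<le>m. c i x * (h i - h x)) = - (\<Sum>i\<le>m. c x i * (h x - h i))"
    unfolding sum_negf[symmetric] using sym by (intro sum.cong) (auto simp: algebra_simps)
  show ?thesis unfolding chain_form_def 1 2 using assms(1) 3 by (auto simp: sum.delta)
qed

text \<open>The link part alone suffices: a function without increments along the chain is constant,
  hence 0 if it vanishes at node 0.\<close>

lemma chain_form_pos: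
  assumes l: "\<And>i. i < m \<Longrightarrow> l i > 0" and c: "\<And>i j. c i j \<ge> 0" and "h 0 = 0" "x \<le> m" "h x \<noteq> 0"
  shows "chain_form m l c h h > 0"
proof -
  have "\<exists>i<m. h (Suc i) \<noteq> h i"
  proof (rule ccontr)
    assume "\<not> ?thesis"
    then have "i \<le> m \<Longrightarrow> h i = 0" for i by (induction i) (auto simp: \<open>h 0 = 0\<close>)
    then show False using assms by auto
  qed
  then obtain i where i: "i < m" "h (Suc i) \<noteq> h i" by auto
  have "0 < (\<Sum>i<m. l i * (h (Suc i) - h i) * (h (Suc i) - h i))"
    by (rule sum_pos2[of _ i])
       (use i l in \<open>auto simp: mult.assoc mult_nonneg_nonneg less_imp_le zero_less_mult_iff neq_iff\<close>)
  moreover have "0 \<le> (\<Sum>i\<le>m. \<Sum>j\<le>m. c i j * (h i - h j) * (h i - h j))"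
    by (intro sum_nonneg) (simp add: mult.assoc c)
  ultimately show ?thesis unfolding chain_form_def by linarith
qed

text \<open>Constants lie in the kernel of the form, so the load must have total 0 and the solution
  is normalized by \<open>h 0 = 0\<close>. The remaining unknowns sit at the nodes
  \<open>1..m\<close>, where the form is positive definite.\<close>

lemma chain_form_solvable:
  assumes l: "\<And>i. i < m \<Longrightarrow> l i > 0" and c: "\<And>i j. c i j \<ge> 0"
    and b: "(\<Sum>i\<le>m. b i) = 0"
  shows "\<exists>h. h 0 = 0 \<and> (\<forall>f. chain_form m l c h f = (\<Sum>i\<le>m. b i * f i))"
proof -
  define e where "e j = (\<lambda>k. of_bool (k = j) :: real)" for j :: nat
  define I where "I = {1..m}"
  have fin: "finite I" by (simp add: I_def)
  define ext where "ext v = (\<lambda>k. \<Sum>j\<in>I. v j * e j k)" for v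
  have ext: "ext v k = (if k \<in> I then v k else 0)" for v k
  proof -
    have "ext v k = (\<Sum>j\<in>I. if j = k then v j else 0)"
      unfolding ext_def e_def by (intro sum.cong) auto
    then show ?thesis using fin by (simp add: sum.delta)
  qed
  have lin: "chain_form m l c h (ext v) = (\<Sum>j\<in>I. v j * chain_form m l c h (e j))" for h v
    unfolding ext_def by (rule chain_form_sum[OF fin])
  have "\<exists>h. \<forall>i\<in>I. (\<Sum>j\<in>I. chain_form m l c (e i) (e j) * h j) = b i"
  proof (rule pos_def_solvable[OF fin])
    fix v :: "nat \<Rightarrow> real" assume "\<exists>i\<in>I. v i \<noteq> 0"
    then obtain i where i: "i \<in> I" "v i \<noteq> 0" by auto
    have "0 < chain_form m l c (ext v) (ext v)"
      by (rule chain_form_pos[where x = i]) (use i l c in \<open>auto simp: ext I_def\<close>)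
    also have "\<dots> = (\<Sum>i\<in>I. v i * chain_form m l c (e i) (ext v))"
      unfolding lin[of "ext v"] by (simp add: chain_form_commute)
    also have "\<dots> = (\<Sum>i\<in>I. v i * (\<Sum>j\<in>I. chain_form m l c (e i) (e j) * v j))"
      unfolding lin by (simp add: mult.commute)
    finally show "0 < (\<Sum>i\<in>I. v i * (\<Sum>j\<in>I. chain_form m l c (e i) (e j) * v j))" .
  qed
  then obtain g where g: "\<And>i. i \<in> I \<Longrightarrow> (\<Sum>j\<in>I. chain_form m l c (e i) (e j) * g j) = b i" by auto
  define h where "h = ext g"
  have h0: "h 0 = 0" by (simp add: h_def ext I_def)
  have he: "chain_form m l c h (e i) = b i" if "i \<in> I" for i
    using g[OF that] lin[of "e i" g] by (simp add: h_def chain_form_commute[of m l c "ext g"] mult.commute)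
  have "chain_form m l c h f = (\<Sum>i\<le>m. b i * f i)" for f
  proof -
    \<comment> \<open>Shifting the test function by \<open>f 0\<close> puts it into the span of the
      unit vectors \<open>e j\<close>; the total load 0 makes the shift free.\<close>
    have "chain_form m l c h f = chain_form m l c h (\<lambda>i. ext (\<lambda>i. f i - f 0) i + f 0)"
      by (rule chain_form_cong) (auto simp: ext I_def not_less_eq_eq)
    also have "\<dots> = (\<Sum>j\<in>I. (f j - f 0) * b j)"
      by (simp add: chain_form_add chain_form_const lin he)
    also have "\<dots> = (\<Sum>j\<le>m. (f j - f 0) * b j)"
      by (rule sum.mono_neutral_left) (auto simp: I_def not_less_eq_eq)
    also have "\<dots> = (\<Sum>i\<le>m. b i * f i) - f 0 * (\<Sum>i\<le>m. b i)"
      by (simp add: sum_subtractf sum_distrib_left algebra_simps)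
    finally show ?thesis by (simp add: b)
  qed
  with h0 show ?thesis by blast
qed

text \<open>Maximum principle for a pair of nodes. Among the pairs \<open>y < x\<close> with the
  most negative \<open>h x - h y\<close> take one of least length. The links then force the nonlocal
  part above the load at \<open>x\<close> and below it at \<open>y\<close>, whereas the decreasing
  kernel gives the opposite order of the nonlocal parts; an increasing load makes this a
  contradiction.\<close>

lemma chain_equilibrium_mono:
  fixes w \<xi> :: "nat \<Rightarrow> real" and K :: "nat \<Rightarrow> real"
  assumes l: "\<And>i. i < m \<Longrightarrow> l i > 0" and w: "\<And>i. w i \<ge> 0" and K: "\<And>i. K i \<ge> 0" "antimono K"
    and \<xi>: "mono \<xi>"
    and eq: "\<And>f. chain_form m l (\<lambda>i j. K (nat \<bar>int i - int j\<bar>) * w i * w j) h f = (\<Sum>i\<le>m. w i * \<xi> i * f i)"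
    and "i \<le> j" "j \<le> m"
  shows "h i \<le> h j"
proof (rule ccontr)
  assume neg: "\<not> h i \<le> h j"
  let ?k = "\<lambda>i j. K (nat \<bar>int i - int j\<bar>)"
  define Pr where "Pr = {(x,y). y < x \<and> x \<le> m}"
  have finPr: "finite Pr"
    by (rule finite_subset[of _ "{..m} \<times> {..m}"]) (auto simp: Pr_def)
  have "i \<noteq> j" using neg by auto
  then have ij: "(j, i) \<in> Pr" using assms by (auto simp: Pr_def)
  define \<delta> where "\<delta> = Min ((\<lambda>(x,y). h x - h y) ` Pr)"
  have \<delta>le: "\<delta> \<le> h x - h y" if "y < x" "x \<le> m" for x y
    unfolding \<delta>_def using finPr that by (intro Min_le) (auto simp: Pr_def)
  have "\<delta> \<le> h j - h i" using \<delta>le[of i j] ij by (auto simp: Pr_def)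
  then have \<delta>0: "\<delta> < 0" using neg by auto
  define P where "P n \<longleftrightarrow> (\<exists>x y. y < x \<and> x \<le> m \<and> h x - h y = \<delta> \<and> n = x - y)" for n
  have "\<delta> \<in> (\<lambda>(x,y). h x - h y) ` Pr"
    unfolding \<delta>_def using finPr ij by (intro Min_in) auto
  then have "\<exists>n. P n" unfolding P_def Pr_def by fastforce
  then have PL: "P (LEAST n. P n)" by (metis LeastI)
  have PLe: "(LEAST n. P n) \<le> n" if "P n" for n using that by (rule Least_le)
  from PL obtain x y where xy: "y < x" "x \<le> m" "h x - h y = \<delta>" and least: "\<And>n. P n \<Longrightarrow> x - y \<le> n"
    using PLe unfolding P_def by metis
  have above: "h x \<le> h z" if "y < z" "z \<le> m" for z using \<delta>le[of y z] that xy by auto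
  have below: "h z \<le> h y" if "z < x" for z using \<delta>le[of z x] that xy by auto
  \<comment> \<open>An intermediate node with the value \<open>h x\<close> would form a shorter
    extremal pair with \<open>y\<close>. Strictness is needed for the neighbour
    \<open>x - 1\<close>, where it fixes the sign of \<open>Loc x\<close>.\<close>
  have strict_above: "h x < h z" if "y < z" "z < x" for z
  proof -
    have "h x \<noteq> h z"
    proof
      assume "h x = h z"
      then have "P (z - y)" unfolding P_def using that xy by force
      then show False using least[of "z - y"] that by auto
    qed
    then show ?thesis using above[of z] that xy by auto
  qed
  have strict_below: "h z < h y" if "y < z" "z < x" for z
  proof -
    have "h y \<noteq> h z"
    proof
      assume "h y = h z"
      then have "P (x - z)" unfolding P_def using that xy by force
      then show False using least[of "x - z"] that by auto
    qed
    then show ?thesis using below[of z] that xy by auto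
  qed
  define NL where "NL x = 2 * (\<Sum>z\<le>m. ?k x z * w z * (h x - h z))" for x
  define Loc where "Loc x = (if 0 < x then l (x - 1) * (h x - h (x - 1)) else 0) - (if x < m then l x * (h (Suc x) - h x) else 0)" for x
  have node: "Loc v + w v * NL v = w v * \<xi> v" if "v \<le> m" for v
  proof -
    have "chain_form m l (\<lambda>i j. ?k i j * w i * w j) h (\<lambda>k. of_bool (k = v)) =
       Loc v + 2 * (\<Sum>z\<le>m. ?k v z * w v * w z * (h v - h z))"
      unfolding Loc_def by (rule chain_form_unit[OF that]) (simp add: abs_minus_commute mult.commute mult.left_commute)
    also have "2 * (\<Sum>z\<le>m. ?k v z * w v * w z * (h v - h z)) = w v * NL v"
      unfolding NL_def sum_distrib_left by (intro sum.cong) auto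
    finally have "Loc v + w v * NL v = (\<Sum>i\<le>m. w i * \<xi> i * of_bool (i = v))" using eq by simp
    also have "\<dots> = (\<Sum>i\<le>m. if i = v then w i * \<xi> i else 0)" by (intro sum.cong) auto
    finally show ?thesis using that by (simp add: sum.delta)
  qed
  have hx1: "h x < h (x - 1)"
  proof (cases "x - 1 = y")
    case True then show ?thesis using xy \<delta>0 by auto
  next
    case False then show ?thesis using strict_above[of "x-1"] xy by auto
  qed
  have Lx: "Loc x < 0"
  proof -
    have "l (x - 1) * (h x - h (x - 1)) < 0" using hx1 l[of "x-1"] xy by (intro mult_pos_neg) auto
    moreover have "x < m \<Longrightarrow> l x * (h (Suc x) - h x) \<ge> 0" using above[of "Suc x"] l[of x] xy by auto
    ultimately show ?thesis unfolding Loc_def using xy by auto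
  qed
  have hy1: "h (Suc y) < h y"
  proof (cases "Suc y = x")
    case True then show ?thesis using xy \<delta>0 by auto
  next
    case False then show ?thesis using strict_below[of "Suc y"] xy by auto
  qed
  have Ly: "Loc y > 0"
  proof -
    have "l y * (h (Suc y) - h y) < 0" using hy1 l[of y] xy by (intro mult_pos_neg) auto
    moreover have "l (y - 1) * (h y - h (y - 1)) \<ge> 0" if "y > 0"
      using below[of "y-1"] l[of "y-1"] xy that by (intro mult_nonneg_nonneg) (auto intro: less_imp_le)
    ultimately show ?thesis unfolding Loc_def using xy by auto
  qed
  \<comment> \<open>At a node of weight 0 the equation \<open>node\<close> reduces to
    \<open>Loc = 0\<close>, which the strict signs at \<open>x\<close> and \<open>y\<close>
    exclude.\<close>
  have "w x \<noteq> 0" using node[of x] Lx xy by auto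
  then have wx: "w x > 0" using w[of x] by auto
  have "w y \<noteq> 0" using node[of y] Ly xy by auto
  then have wy: "w y > 0" using w[of y] by auto
  have "w x * \<xi> x < w x * NL x" using node[of x] Lx xy by auto
  then have NLx: "\<xi> x < NL x" using wx by auto
  have "w y * NL y < w y * \<xi> y" using node[of y] Ly xy by auto
  then have NLy: "NL y < \<xi> y" using wy by auto
  have "NL x \<le> NL y"
    unfolding NL_def
  proof (intro mult_left_mono sum_mono)
    fix z assume z: "z \<in> {..m}"
    have "?k x z * (h x - h z) \<le> ?k y z * (h y - h z)"
    proof -
      \<comment> \<open>Outside the interval the nearer endpoint sees the larger kernel, and
        extremality orders the differences of \<open>h\<close>; between the endpoints the two
        summands have opposite signs.\<close>
      consider "z < y" | "z = y" | "y < z" "z < x" | "z = x" | "x < z" by linarith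
      then show ?thesis
      proof cases
        case 1
        have a: "h z \<le> h y" using below[of z] 1 xy by auto
        have b: "h x - h z \<le> h y - h z" using xy \<delta>0 by auto
        have k: "?k x z \<le> ?k y z" using 1 xy by (intro antimonoD[OF K(2)]) auto
        have "?k x z * (h x - h z) \<le> ?k x z * (h y - h z)" using b K by (intro mult_left_mono) auto
        also have "\<dots> \<le> ?k y z * (h y - h z)" using a k by (intro mult_right_mono) auto
        finally show ?thesis .
      next
        case 2 then show ?thesis using xy \<delta>0 K by (auto simp: mult_nonneg_nonpos)
      next
        case 3
        have "h x - h z \<le> 0" "h y - h z \<ge> 0" using above[of z] below[of z] 3 z by auto
        then have "?k x z * (h x - h z) \<le> 0" "0 \<le> ?k y z * (h y - h z)" using K by (auto simp: mult_nonneg_nonpos)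
        then show ?thesis by linarith
      next
        case 4 then show ?thesis using xy \<delta>0 K by auto
      next
        case 5
        have a: "h x \<le> h z" using above[of z] 5 xy z by auto
        have b: "h z - h y \<le> h z - h x" using xy \<delta>0 by auto
        have k: "?k y z \<le> ?k x z" using 5 xy by (intro antimonoD[OF K(2)]) auto
        have "?k y z * (h z - h y) \<le> ?k y z * (h z - h x)" using b K by (intro mult_left_mono) auto
        also have "\<dots> \<le> ?k x z * (h z - h x)" using a k by (intro mult_right_mono) auto
        finally show ?thesis by (simp add: algebra_simps)
      qed
    qed
    from mult_left_mono[OF this w[of z]]
    show "?k x z * w z * (h x - h z) \<le> ?k y z * w z * (h y - h z)" by (simp add: algebra_simps)
  qed simp
  moreover have "\<xi> y \<le> \<xi> x" using \<xi> xy by (auto simp: mono_def)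
  ultimately show False using NLx NLy by linarith
qed

theorem chain_equilibrium:
  fixes w \<xi> :: "nat \<Rightarrow> real" and K :: "nat \<Rightarrow> real"
  assumes l: "\<And>i. i < m \<Longrightarrow> l i > 0" and w: "\<And>i. w i \<ge> 0" and K: "\<And>i. K i \<ge> 0" "antimono K"
    and \<xi>: "mono \<xi>" and sum0: "(\<Sum>i\<le>m. w i * \<xi> i) = 0"
  obtains h where "h 0 = 0" "\<And>i j. i \<le> j \<Longrightarrow> j \<le> m \<Longrightarrow> h i \<le> h j"
    "\<And>f. chain_form m l (\<lambda>i j. K (nat \<bar>int i - int j\<bar>) * w i * w j) h f = (\<Sum>i\<le>m. w i * \<xi> i * f i)"
proof -
  have "\<exists>h. h 0 = 0 \<and> (\<forall>f. chain_form m l (\<lambda>i j. K (nat \<bar>int i - int j\<bar>) * w i * w j) h f = (\<Sum>i\<le>m. w i * \<xi> i * f i))"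
    by (rule chain_form_solvable) (use assms in auto)
  then obtain h where h: "h 0 = 0" "\<And>f. chain_form m l (\<lambda>i j. K (nat \<bar>int i - int j\<bar>) * w i * w j) h f = (\<Sum>i\<le>m. w i * \<xi> i * f i)" by auto
  show ?thesis
    by (rule that[of h]) (use chain_equilibrium_mono[OF l w K \<xi> h(2)] h in auto)
qed

section \<open>Polynomial approximation of \<open>C\<^sup>1\<close> functions\<close>

lemma poly_antiderivative: "\<exists>P::real poly. pderiv P = p \<and> poly P a = c"
proof -
  define Q where "Q = (\<Sum>i\<le>degree p. monom (coeff p i / of_nat (Suc i)) (Suc i))"
  have "pderiv Q = (\<Sum>i\<le>degree p. monom (coeff p i) i)"
    unfolding Q_def using higher_pderiv_sum[of 1 "\<lambda>i. monom (coeff p i / of_nat (Suc i)) (Suc i)" "{..degree p}"]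
    by (simp add: pderiv_monom del: of_nat_Suc)
  then have "pderiv Q = p" by (simp add: poly_as_sum_of_monoms)
  then show ?thesis by (intro exI[of _ "Q + [:c - poly Q a:]"]) (simp add: pderiv_add pderiv_pCons)
qed

lemma weierstrass_poly:
  fixes g :: "real \<Rightarrow> real"
  assumes "continuous_on {a..b} g" "e > 0"
  obtains p where "\<And>x. x \<in> {a..b} \<Longrightarrow> \<bar>poly p x - g x\<bar> < e"
proof -
  obtain q where q: "real_polynomial_function q" "\<And>x. x \<in> {a..b} \<Longrightarrow> \<bar>g x - q x\<bar> < e"
    using Stone_Weierstrass_real_polynomial_function[OF compact_Icc assms] by blast
  then obtain c n where c: "q = (\<lambda>x. \<Sum>i\<le>n. c i * x ^ i)"
    unfolding real_polynomial_function_iff_sum by auto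
  have "poly (\<Sum>i\<le>n. monom (c i) i) x = q x" for x
    by (simp add: c poly_sum poly_monom)
  then show ?thesis using q(2) by (intro that[of "\<Sum>i\<le>n. monom (c i) i"]) (auto simp: abs_minus_commute)
qed

text \<open>Approximate the derivative uniformly and integrate. The bound on increments is the one
  that controls difference quotients up to the diagonal, which uniform closeness of the functions
  would not.\<close>

lemma C1_poly_approx:
  fixes f g :: "real \<Rightarrow> real"
  assumes f: "\<And>x. (f has_real_derivative g x) (at x)" and g: "continuous_on UNIV g" and "e > 0" "a \<le> b"
  obtains P where "\<And>x. x \<in> {a..b} \<Longrightarrow> \<bar>poly (pderiv P) x - g x\<bar> \<le> e"
    "\<And>x. x \<in> {a..b} \<Longrightarrow> \<bar>poly P x - f x\<bar> \<le> e * (b - a)"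
    "\<And>x y. x \<in> {a..b} \<Longrightarrow> y \<in> {a..b} \<Longrightarrow> \<bar>(poly P x - poly P y) - (f x - f y)\<bar> \<le> e * \<bar>x - y\<bar>"
proof -
  obtain p where p: "\<And>x. x \<in> {a..b} \<Longrightarrow> \<bar>poly p x - g x\<bar> < e"
    using weierstrass_poly[OF continuous_on_subset[OF g], of a b] \<open>e > 0\<close> by blast
  obtain P where P: "pderiv P = p" "poly P a = f a" using poly_antiderivative by blast
  have L: "\<bar>(poly P x - poly P y) - (f x - f y)\<bar> \<le> e * \<bar>x - y\<bar>" if "x \<in> {a..b}" "y \<in> {a..b}" for x y
  proof -
    have "norm ((poly P x - f x) - (poly P y - f y)) \<le> e * norm (x - y)"
    proof (rule field_differentiable_bound[where S="{a..b}" and f' = "\<lambda>x. poly p x - g x"])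
      show "((\<lambda>x. poly P x - f x) has_real_derivative poly p z - g z) (at z within {a..b})" for z
        unfolding P(1)[symmetric]
        by (intro derivative_intros DERIV_subset[OF poly_DERIV] DERIV_subset[OF f]) auto
    qed (use that p in \<open>auto simp: less_imp_le\<close>)
    then show ?thesis by (simp add: algebra_simps)
  qed
  show ?thesis
  proof (rule that[of P])
    show "\<bar>poly P x - f x\<bar> \<le> e * (b - a)" if "x \<in> {a..b}" for x
    proof -
      have "\<bar>poly P x - f x\<bar> \<le> e * \<bar>x - a\<bar>" using L[of x a] that \<open>a \<le> b\<close> P by auto
      also have "\<dots> \<le> e * (b - a)" using that \<open>e > 0\<close> by (intro mult_left_mono) auto
      finally show ?thesis .
    qed
  qed (use p P L in \<open>auto simp: less_imp_le\<close>)
qed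

text \<open>The \<open>C\<^sup>1\<close> quadratic spline that rises from 0 at \<open>u = 0\<close>
  to 1 at \<open>u = 1\<close>: a second difference of truncated squares with step 1/2. Its
  derivative is a tent of height 2 on \<open>[0, 1]\<close>.\<close>

definition smooth_step :: "real \<Rightarrow> real" where
  "smooth_step u = 2 * (max 0 u)\<^sup>2 - 4 * (max 0 (u - 1/2))\<^sup>2 + 2 * (max 0 (u - 1))\<^sup>2"

definition smooth_step' :: "real \<Rightarrow> real" where
  "smooth_step' u = 4 * max 0 u - 8 * max 0 (u - 1/2) + 4 * max 0 (u - 1)"

lemma DERIV_max0_square: "((\<lambda>u. (max 0 u)\<^sup>2) has_real_derivative 2 * max 0 u) (at u)" for u :: real
proof -
  have A: "((\<lambda>u. u * \<bar>u\<bar>) has_real_derivative 2 * \<bar>u\<bar>) (at u)"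
  proof (cases "u = 0")
    case True
    have "(\<lambda>h::real. h * \<bar>h\<bar> / h) \<midarrow>0\<rightarrow> 0"
      by (rule Lim_transform_eventually[of "\<lambda>h. \<bar>h\<bar>"]) (auto simp: eventually_at intro!: tendsto_eq_intros exI[of _ 1])
    then show ?thesis unfolding DERIV_def True by simp
  next
    case False
    have "((\<lambda>v. v * (sgn u * v)) has_real_derivative 2 * \<bar>u\<bar>) (at u)"
      by (auto intro!: derivative_eq_intros simp: abs_sgn)
    moreover have "\<forall>\<^sub>F v in nhds u. v * (sgn u * v) = v * \<bar>v\<bar>"
    proof (cases "u > 0")
      case True
      then have "\<forall>\<^sub>F v in nhds u. v > 0" by (simp add: eventually_nhds) (auto intro!: exI[of _ "{0<..}"])
      then show ?thesis by eventually_elim (use True in auto)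
    next
      case False2: False
      then have "\<forall>\<^sub>F v in nhds u. v < 0" using False by (simp add: eventually_nhds) (auto intro!: exI[of _ "{..<0}"])
      then show ?thesis by eventually_elim (use False False2 in auto)
    qed
    ultimately show ?thesis
      using DERIV_cong_ev[of u u "\<lambda>v. v * (sgn u * v)" "\<lambda>v. v * \<bar>v\<bar>" "2 * \<bar>u\<bar>" "2 * \<bar>u\<bar>"] by simp
  qed
  have eq: "(\<lambda>u::real. (max 0 u)\<^sup>2) = (\<lambda>u. (u\<^sup>2 + u * \<bar>u\<bar>) / 2)"
    by (auto simp: max_def power2_eq_square)
  show ?thesis unfolding eq
    by (rule derivative_eq_intros A refl | simp add: max_def)+
qed

lemma smooth_step_DERIV: "(smooth_step has_real_derivative smooth_step' u) (at u)"
proof -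
  have shift: "((\<lambda>u. (max 0 (u - c))\<^sup>2) has_real_derivative 2 * max 0 (u - c)) (at u)" for c
    using DERIV_shift[of "\<lambda>u. (max 0 u)\<^sup>2" "2 * max 0 (u - c)" u "-c"] DERIV_max0_square[of "u - c"] by simp
  show ?thesis unfolding smooth_step_def[abs_def] smooth_step'_def
    by (rule derivative_eq_intros shift DERIV_max0_square refl | simp)+
qed

lemma continuous_smooth_step': "continuous_on S smooth_step'"
  unfolding smooth_step'_def[abs_def] by (intro continuous_intros)

lemma smooth_step'_bounds: "0 \<le> smooth_step' u" "smooth_step' u \<le> 2"
  unfolding smooth_step'_def by (auto simp: max_def)

lemma smooth_step_0: "u \<le> 0 \<Longrightarrow> smooth_step u = 0"
  unfolding smooth_step_def by (auto simp: max_def)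

lemma smooth_step_1: "1 \<le> u \<Longrightarrow> smooth_step u = 1"
  unfolding smooth_step_def by (auto simp: max_def power2_eq_square algebra_simps)

lemma smooth_step_lipschitz: "\<bar>smooth_step u - smooth_step v\<bar> \<le> 2 * \<bar>u - v\<bar>"
proof -
  have "norm (smooth_step u - smooth_step v) \<le> 2 * norm (u - v)"
    by (rule field_differentiable_bound[where S=UNIV and f' = smooth_step'])
       (use smooth_step_DERIV smooth_step'_bounds in auto)
  then show ?thesis by simp
qed

lemma smooth_step_mono: "u \<le> v \<Longrightarrow> smooth_step u \<le> smooth_step v"
  by (rule DERIV_nonneg_imp_nondecreasing[of u v smooth_step]) (use smooth_step_DERIV smooth_step'_bounds in blast)+

lemma smooth_step_range: "0 \<le> smooth_step u" "smooth_step u \<le> 1"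
proof -
  show "0 \<le> smooth_step u"
    using smooth_step_mono[of 0 u] smooth_step_0[of u] smooth_step_0[of 0] by (cases "u \<le> 0") auto
  show "smooth_step u \<le> 1"
    using smooth_step_mono[of u 1] smooth_step_1[of u] smooth_step_1[of 1] by (cases "u \<le> 1") auto
qed

text \<open>For \<open>g\<close> the derivative of \<open>f\<close> this is the commutative image of
  the free difference quotient. A separate \<open>g\<close> allows the values on the diagonal to be
  changed alone.\<close>

definition dquot :: "(real \<Rightarrow> real) \<Rightarrow> (real \<Rightarrow> real) \<Rightarrow> real \<times> real \<Rightarrow> real" where
  "dquot f g = (\<lambda>(x, y). if x = y then g x else (f x - f y) / (x - y))"

section \<open>Laws of bounded support and dominated convergence for them\<close>

locale bounded_support = prob_space \<mu> for \<mu> :: "real measure" +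
  fixes R :: real
  assumes sets_borel [simp, measurable_cong]: "sets \<mu> = sets borel"
    and AE_support: "AE x in \<mu>. x \<in> {-R..R}"
begin

lemma space_UNIV [simp]: "space \<mu> = UNIV"
  using sets_eq_imp_space_eq[OF sets_borel] by simp

lemma R_nonneg: "R \<ge> 0"
proof (rule ccontr)
  assume "\<not> R \<ge> 0"
  then have "AE x in \<mu>. False" using AE_support by (auto elim!: eventually_mono)
  then show False by simp
qed

sublocale pair: pair_prob_space \<mu> \<mu> ..

lemma AE_support_pair: "AE z in \<mu> \<Otimes>\<^sub>M \<mu>. fst z \<in> {-R..R} \<and> snd z \<in> {-R..R}"
proof -
  have *: "AE x in \<mu>. AE y in \<mu>. fst (x, y) \<in> {-R..R} \<and> snd (x, y) \<in> {-R..R}"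
    using AE_support by eventually_elim (use AE_support in auto)
  show ?thesis by (rule pair.AE_pair_measure[OF _ *]) measurable
qed

lemma integrable_bounded:
  assumes [measurable]: "f \<in> borel_measurable borel" and "\<And>x. x \<in> {-R..R} \<Longrightarrow> \<bar>f x\<bar> \<le> C"
  shows "integrable \<mu> (f :: real \<Rightarrow> real)"
proof (rule integrable_const_bound[of _ C])
  show "AE x in \<mu>. norm (f x) \<le> C" using AE_support by eventually_elim (use assms in auto)
qed (simp add: measurable_def[symmetric])

lemma integral_limit:
  fixes u :: "nat \<Rightarrow> real \<Rightarrow> real"
  assumes [measurable]: "\<And>n. u n \<in> borel_measurable borel"  "v \<in> borel_measurable borel"
    and bd: "\<And>n x. x \<in> {-R..R} \<Longrightarrow> \<bar>u n x\<bar> \<le> C" and lim: "\<And>x. x \<in> {-R..R} \<Longrightarrow> (\<lambda>n. u n x) \<longlonglongrightarrow> v x"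
  shows "(\<lambda>n. \<integral>x. u n x \<partial>\<mu>) \<longlonglongrightarrow> (\<integral>x. v x \<partial>\<mu>)"
proof (rule integral_dominated_convergence[where w="\<lambda>_. C"])
  show "AE x in \<mu>. (\<lambda>n. u n x) \<longlonglongrightarrow> v x" using AE_support by eventually_elim (rule lim)
  show "AE x in \<mu>. norm (u n x) \<le> C" for n using AE_support by eventually_elim (use bd in auto)
qed auto

lemma integral_pair_limit:
  fixes u :: "nat \<Rightarrow> real \<times> real \<Rightarrow> real"
  assumes [measurable]: "\<And>n. u n \<in> borel_measurable (borel \<Otimes>\<^sub>M borel)"  "v \<in> borel_measurable (borel \<Otimes>\<^sub>M borel)"
    and bd: "\<And>n x y. x \<in> {-R..R} \<Longrightarrow> y \<in> {-R..R} \<Longrightarrow> \<bar>u n (x,y)\<bar> \<le> C"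
    and lim: "\<And>x y. x \<in> {-R..R} \<Longrightarrow> y \<in> {-R..R} \<Longrightarrow> (\<lambda>n. u n (x,y)) \<longlonglongrightarrow> v (x,y)"
  shows "(\<lambda>n. \<integral>z. u n z \<partial>(\<mu> \<Otimes>\<^sub>M \<mu>)) \<longlonglongrightarrow> (\<integral>z. v z \<partial>(\<mu> \<Otimes>\<^sub>M \<mu>))"
proof (rule integral_dominated_convergence[where w="\<lambda>_. C"])
  show "AE x in \<mu> \<Otimes>\<^sub>M \<mu>. (\<lambda>n. u n x) \<longlonglongrightarrow> v x"
    using AE_support_pair by eventually_elim (use lim in auto)
  show "AE x in \<mu> \<Otimes>\<^sub>M \<mu>. norm (u n x) \<le> C" for n
    using AE_support_pair by eventually_elim (use bd in auto)
qed auto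

lemma dquot_measurable [measurable]:
  assumes [measurable]: "f \<in> borel_measurable borel" "g \<in> borel_measurable borel"
  shows "dquot f g \<in> borel_measurable (borel \<Otimes>\<^sub>M borel)"
  unfolding dquot_def by measurable

lemma C1_measurable:
  assumes "\<And>x. (f has_real_derivative g x) (at x)"
  shows "f \<in> borel_measurable borel"
  by (rule borel_measurable_continuous_onI) (intro continuous_at_imp_continuous_on ballI DERIV_isCont[OF assms])

lemma C1_dquot_bounded:
  assumes f: "\<And>x. (f has_real_derivative g x) (at x)" and g: "continuous_on UNIV g"
  obtains G where "G \<ge> 0" "\<And>x. x \<in> {-R..R} \<Longrightarrow> \<bar>g x\<bar> \<le> G" "\<And>x. x \<in> {-R..R} \<Longrightarrow> \<bar>f x\<bar> \<le> G"
    "\<And>x y. x \<in> {-R..R} \<Longrightarrow> y \<in> {-R..R} \<Longrightarrow> \<bar>dquot f g (x,y)\<bar> \<le> G"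
proof -
  have "compact (g ` {-R..R})" by (intro compact_continuous_image continuous_on_subset[OF g]) auto
  then obtain G1 where G1: "\<And>x. x \<in> {-R..R} \<Longrightarrow> \<bar>g x\<bar> \<le> G1"
    using compact_imp_bounded bounded_iff by (metis imageI real_norm_def)
  have cf: "continuous_on UNIV f" by (intro continuous_at_imp_continuous_on ballI DERIV_isCont[OF f])
  have "compact (f ` {-R..R})" by (intro compact_continuous_image continuous_on_subset[OF cf]) auto
  then obtain G2 where G2: "\<And>x. x \<in> {-R..R} \<Longrightarrow> \<bar>f x\<bar> \<le> G2"
    using compact_imp_bounded bounded_iff by (metis imageI real_norm_def)
  have *: "\<bar>dquot f g (x,y)\<bar> \<le> G1" if "x \<in> {-R..R}" "y \<in> {-R..R}" for x y
  proof (cases "x = y")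
    case False
    have "norm (f x - f y) \<le> G1 * norm (x - y)"
      by (rule field_differentiable_bound[where S="{-R..R}" and f' = g])
         (use that f G1 in \<open>auto intro: DERIV_subset\<close>)
    then show ?thesis using False by (simp add: dquot_def divide_simps)
  qed (use that G1 in \<open>auto simp: dquot_def\<close>)
  show ?thesis
  proof (rule that[of "max (max G1 G2) 0"])
    show "\<bar>g x\<bar> \<le> max (max G1 G2) 0" if "x \<in> {-R..R}" for x using G1[OF that] by auto
    show "\<bar>f x\<bar> \<le> max (max G1 G2) 0" if "x \<in> {-R..R}" for x using G2[OF that] by auto
    show "\<bar>dquot f g (x, y)\<bar> \<le> max (max G1 G2) 0" if "x \<in> {-R..R}" "y \<in> {-R..R}" for x y
      using *[OF that] by auto
  qed auto
qed

text \<open>The functions and their difference quotients converge together and boundedly, the form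
  in which dominated convergence transfers polynomial identities to \<open>C\<^sup>1\<close>
  functions.\<close>

lemma C1_poly_seq:
  assumes f: "\<And>x. (f has_real_derivative g x) (at x)" and g: "continuous_on UNIV g"
  obtains P :: "nat \<Rightarrow> real poly" and C where
     "\<And>n x. x \<in> {-R..R} \<Longrightarrow> \<bar>poly (P n) x\<bar> \<le> C"
     "\<And>n x y. x \<in> {-R..R} \<Longrightarrow> y \<in> {-R..R} \<Longrightarrow> \<bar>dquot (poly (P n)) (poly (pderiv (P n))) (x, y)\<bar> \<le> C"
     "\<And>x. x \<in> {-R..R} \<Longrightarrow> (\<lambda>n. poly (P n) x) \<longlonglongrightarrow> f x"
     "\<And>x y. x \<in> {-R..R} \<Longrightarrow> y \<in> {-R..R} \<Longrightarrow> (\<lambda>n. dquot (poly (P n)) (poly (pderiv (P n))) (x, y)) \<longlonglongrightarrow> dquot f g (x, y)"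
proof -
  obtain G where G: "G \<ge> 0" "\<And>x. x \<in> {-R..R} \<Longrightarrow> \<bar>g x\<bar> \<le> G" "\<And>x. x \<in> {-R..R} \<Longrightarrow> \<bar>f x\<bar> \<le> G"
    "\<And>x y. x \<in> {-R..R} \<Longrightarrow> y \<in> {-R..R} \<Longrightarrow> \<bar>dquot f g (x,y)\<bar> \<le> G"
    using C1_dquot_bounded[OF f g] by blast
  define e where "e n = 1 / real (Suc n)" for n
  have e: "e n > 0" "e n \<le> 1" for n by (auto simp: e_def)
  have elim: "e \<longlonglongrightarrow> 0" unfolding e_def by (rule LIMSEQ_Suc[OF lim_1_over_n])
  have "\<exists>P. \<forall>x\<in>{-R..R}. \<forall>y\<in>{-R..R}. \<bar>poly (pderiv P) x - g x\<bar> \<le> e n \<and> \<bar>poly P x - f x\<bar> \<le> e n * (2 * R)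
     \<and> \<bar>(poly P x - poly P y) - (f x - f y)\<bar> \<le> e n * \<bar>x - y\<bar>" for n
  proof -
    have "- R \<le> R" using R_nonneg by auto
    obtain P where "\<And>x. x \<in> {-R..R} \<Longrightarrow> \<bar>poly (pderiv P) x - g x\<bar> \<le> e n"
    "\<And>x. x \<in> {-R..R} \<Longrightarrow> \<bar>poly P x - f x\<bar> \<le> e n * (R - - R)"
    "\<And>x y. x \<in> {-R..R} \<Longrightarrow> y \<in> {-R..R} \<Longrightarrow> \<bar>(poly P x - poly P y) - (f x - f y)\<bar> \<le> e n * \<bar>x - y\<bar>"
      using C1_poly_approx[OF f g e(1)[of n] \<open>- R \<le> R\<close>] by blast
    then show ?thesis by (intro exI[of _ P]) auto
  qed
  then obtain P where P: "\<And>n x y. x \<in> {-R..R} \<Longrightarrow> y \<in> {-R..R} \<Longrightarrow> \<bar>poly (pderiv (P n)) x - g x\<bar> \<le> e n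
     \<and> \<bar>poly (P n) x - f x\<bar> \<le> e n * (2 * R)
     \<and> \<bar>(poly (P n) x - poly (P n) y) - (f x - f y)\<bar> \<le> e n * \<bar>x - y\<bar>"
    by metis
  have D: "\<bar>dquot (poly (P n)) (poly (pderiv (P n))) (x, y) - dquot f g (x, y)\<bar> \<le> e n"
    if "x \<in> {-R..R}" "y \<in> {-R..R}" for x y n
  proof (cases "x = y")
    case False
    have "dquot (poly (P n)) (poly (pderiv (P n))) (x, y) - dquot f g (x, y)
      = ((poly (P n) x - poly (P n) y) - (f x - f y)) / (x - y)"
      using False by (simp add: dquot_def diff_divide_distrib)
    also have "\<bar>\<dots>\<bar> \<le> e n" using P[OF that, of n] False by (auto simp: abs_divide divide_le_eq)
    finally show ?thesis .
  qed (use P[OF that, of n] in \<open>auto simp: dquot_def\<close>)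
  show ?thesis
  proof (rule that[of P "G + 1 + 2 * R"])
    fix n x assume x: "x \<in> {-R..R}"
    have "e n * (2 * R) \<le> 2 * R" using e[of n] R_nonneg by (intro mult_left_le_one_le) auto
    then show "\<bar>poly (P n) x\<bar> \<le> G + 1 + 2 * R" using P[OF x x, of n] G(3)[OF x] by linarith
  next
    fix n x y assume x: "x \<in> {-R..R}" "y \<in> {-R..R}"
    show "\<bar>dquot (poly (P n)) (poly (pderiv (P n))) (x, y)\<bar> \<le> G + 1 + 2 * R"
      using D[OF x, of n] G(4)[OF x] e[of n] R_nonneg by linarith
  next
    fix x assume x: "x \<in> {-R..R}"
    have "(\<lambda>n. e n * (2 * R)) \<longlonglongrightarrow> 0" using tendsto_mult_left_zero[OF elim, of "2*R"] by simp
    then have "(\<lambda>n. poly (P n) x - f x) \<longlonglongrightarrow> 0"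
      by (rule Lim_null_comparison[rotated]) (use P[OF x x] in auto)
    then show "(\<lambda>n. poly (P n) x) \<longlonglongrightarrow> f x" using LIM_zero_iff by blast
  next
    fix x y assume x: "x \<in> {-R..R}" "y \<in> {-R..R}"
    have "(\<lambda>n. dquot (poly (P n)) (poly (pderiv (P n))) (x, y) - dquot f g (x, y)) \<longlonglongrightarrow> 0"
      by (rule Lim_null_comparison[OF _ elim]) (use D[OF x] in auto)
    then show "(\<lambda>n. dquot (poly (P n)) (poly (pderiv (P n))) (x, y)) \<longlonglongrightarrow> dquot f g (x, y)"
      using LIM_zero_iff by blast
  qed
qed

end

section \<open>Removing the diagonal from the Stein inequality\<close>

text \<open>Slope 1 at the origin but height at most \<open>1 / (2 * N)\<close>: subtracting a
  multiple corrects the derivative at one point while the function hardly moves.\<close>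

definition bump :: "real \<Rightarrow> real \<Rightarrow> real" where "bump N u = u / (1 + N\<^sup>2 * u\<^sup>2)"
definition bump' :: "real \<Rightarrow> real \<Rightarrow> real" where "bump' N u = (1 - N\<^sup>2 * u\<^sup>2) / (1 + N\<^sup>2 * u\<^sup>2)\<^sup>2"

lemma bump_denom_pos: "1 + N\<^sup>2 * u\<^sup>2 > (0::real)"
  by (smt (verit) mult_nonneg_nonneg zero_le_power2)

lemma bump_DERIV: "((\<lambda>x. bump N (x - z)) has_real_derivative bump' N (x - z)) (at x)"
  unfolding bump_def bump'_def using bump_denom_pos[of N "x - z"]
  by (auto intro!: derivative_eq_intros simp: power2_eq_square)

lemma continuous_bump': "continuous_on S (\<lambda>x. bump' N (x - z))"
  unfolding bump'_def using bump_denom_pos[of N]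
  by (intro continuous_intros) (metis less_irrefl zero_less_power)

lemma bump_bound: assumes "N > 0" shows "\<bar>bump N u\<bar> \<le> 1 / (2 * N)"
proof -
  have "0 \<le> (1 - N * \<bar>u\<bar>)\<^sup>2" by simp
  then have "2 * N * \<bar>u\<bar> \<le> 1 + N\<^sup>2 * u\<^sup>2" by (simp add: power2_diff power_mult_distrib)
  then show ?thesis using bump_denom_pos[of N u] assms
    by (simp add: bump_def abs_divide divide_simps) (simp add: mult.commute mult.left_commute)
qed

lemma bump'_bound: "\<bar>bump' N u\<bar> \<le> 1 / (1 + N\<^sup>2 * u\<^sup>2)"
proof -
  have "\<bar>1 - N\<^sup>2 * u\<^sup>2\<bar> \<le> 1 + N\<^sup>2 * u\<^sup>2" by (smt (verit) mult_nonneg_nonneg zero_le_power2)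
  then show ?thesis using bump_denom_pos[of N u]
    by (simp add: bump'_def abs_divide divide_simps power2_eq_square[of "1 + N\<^sup>2 * u\<^sup>2"])
qed

lemma bump'_bound1: "\<bar>bump' N u\<bar> \<le> 1"
proof -
  have "1 / (1 + N\<^sup>2 * u\<^sup>2) \<le> 1" using bump_denom_pos[of N u] by (simp add: divide_le_eq_1)
  then show ?thesis using bump'_bound[of N u] by linarith
qed

lemma bump_limit: "(\<lambda>n. bump (real (Suc n)) u) \<longlonglongrightarrow> 0"
proof (rule Lim_null_comparison)
  show "(\<lambda>n. 1 / (2 * real (Suc n))) \<longlonglongrightarrow> 0"
    using tendsto_mult_right_zero[OF LIMSEQ_Suc[OF lim_1_over_n], of "1/2"] by simp
  show "\<forall>\<^sub>F n in sequentially. norm (bump (real (Suc n)) u) \<le> 1 / (2 * real (Suc n))"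
    unfolding real_norm_def by (intro always_eventually allI bump_bound) simp
qed

lemma bump'_limit: "(\<lambda>n. bump' (real (Suc n)) u) \<longlonglongrightarrow> (if u = 0 then 1 else 0)"
proof (cases "u = 0")
  case False
  have "(\<lambda>n. 1 / (1 + (real (Suc n))\<^sup>2 * u\<^sup>2)) \<longlonglongrightarrow> 0"
  proof (rule Lim_null_comparison)
    show "(\<lambda>n. (1 / u\<^sup>2) * (1 / real (Suc n))) \<longlonglongrightarrow> 0"
      using tendsto_mult_right_zero[OF LIMSEQ_Suc[OF lim_1_over_n]] .
    have "1 / (1 + (real (Suc n))\<^sup>2 * u\<^sup>2) \<le> (1 / u\<^sup>2) * (1 / real (Suc n))" for n
    proof -
      have "real (Suc n) * u\<^sup>2 \<le> (real (Suc n))\<^sup>2 * u\<^sup>2"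
        by (intro mult_right_mono) (auto simp: power2_eq_square)
      then have "real (Suc n) * u\<^sup>2 \<le> 1 + (real (Suc n))\<^sup>2 * u\<^sup>2" by linarith
      then have "1 / (1 + (real (Suc n))\<^sup>2 * u\<^sup>2) \<le> 1 / (real (Suc n) * u\<^sup>2)"
        using False by (intro divide_left_mono) (auto intro!: mult_pos_pos bump_denom_pos)
      then show ?thesis by (simp add: mult.commute)
    qed
    then show "\<forall>\<^sub>F n in sequentially. norm (1 / (1 + (real (Suc n))\<^sup>2 * u\<^sup>2)) \<le> (1 / u\<^sup>2) * (1 / real (Suc n))"
      using bump_denom_pos[of _ u] by (intro always_eventually allI) (simp add: less_imp_le)
  qed
  then show ?thesis using False bump'_bound[of _ u] by (auto intro: Lim_null_comparison[rotated])
qed (simp add: bump'_def)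

lemma tendsto_le_trans:
  fixes a :: "nat \<Rightarrow> real"
  assumes "a \<longlonglongrightarrow> A" "b \<longlonglongrightarrow> B" "\<And>n. (a n)\<^sup>2 \<le> D\<^sup>2 * b n"
  shows "A\<^sup>2 \<le> D\<^sup>2 * B"
  by (rule LIMSEQ_le[of "\<lambda>n. (a n)\<^sup>2" _ "\<lambda>n. D\<^sup>2 * b n"]) (use assms in \<open>auto intro!: tendsto_intros\<close>)

context bounded_support begin

lemma C1_inequality:
  assumes poly: "\<And>P :: real poly. (\<integral>x. x * poly P x \<partial>\<mu>)\<^sup>2 \<le> D\<^sup>2 * (\<integral>z. (dquot (poly P) (poly (pderiv P)) z)\<^sup>2 \<partial>(\<mu> \<Otimes>\<^sub>M \<mu>))"
    and f: "\<And>x. (f has_real_derivative g x) (at x)" and g: "continuous_on UNIV g"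
  shows "(\<integral>x. x * f x \<partial>\<mu>)\<^sup>2 \<le> D\<^sup>2 * (\<integral>z. (dquot f g z)\<^sup>2 \<partial>(\<mu> \<Otimes>\<^sub>M \<mu>))"
proof -
  note [measurable] = C1_measurable[OF f] borel_measurable_continuous_onI[OF g]
  obtain P C where P: "\<And>n x. x \<in> {-R..R} \<Longrightarrow> \<bar>poly (P n) x\<bar> \<le> C"
     "\<And>n x y. x \<in> {-R..R} \<Longrightarrow> y \<in> {-R..R} \<Longrightarrow> \<bar>dquot (poly (P n)) (poly (pderiv (P n))) (x, y)\<bar> \<le> C"
     "\<And>x. x \<in> {-R..R} \<Longrightarrow> (\<lambda>n. poly (P n) x) \<longlonglongrightarrow> f x"
     "\<And>x y. x \<in> {-R..R} \<Longrightarrow> y \<in> {-R..R} \<Longrightarrow> (\<lambda>n. dquot (poly (P n)) (poly (pderiv (P n))) (x, y)) \<longlonglongrightarrow> dquot f g (x, y)"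
    using C1_poly_seq[OF f g] by blast
  have [measurable]: "poly p \<in> borel_measurable borel" for p :: "real poly"
    by (intro borel_measurable_continuous_onI continuous_intros)
  show ?thesis
  proof (rule tendsto_le_trans)
    show "(\<lambda>n. \<integral>x. x * poly (P n) x \<partial>\<mu>) \<longlonglongrightarrow> (\<integral>x. x * f x \<partial>\<mu>)"
    proof (rule integral_limit[where C="R * C"])
      fix n x assume x: "x \<in> {-R..R}"
      then show "\<bar>x * poly (P n) x\<bar> \<le> R * C" unfolding abs_mult using P(1)[OF x, of n] R_nonneg
        by (intro mult_mono) auto
    qed (auto intro!: tendsto_intros P)
    show "(\<lambda>n. \<integral>z. (dquot (poly (P n)) (poly (pderiv (P n))) z)\<^sup>2 \<partial>(\<mu> \<Otimes>\<^sub>M \<mu>)) \<longlonglongrightarrow> (\<integral>z. (dquot f g z)\<^sup>2 \<partial>(\<mu> \<Otimes>\<^sub>M \<mu>))"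
    proof (rule integral_pair_limit[where C="C\<^sup>2"])
      fix n x y assume "x \<in> {-R..R}" "y \<in> {-R..R}"
      then show "\<bar>(dquot (poly (P n)) (poly (pderiv (P n))) (x, y))\<^sup>2\<bar> \<le> C\<^sup>2"
        using P(2)[of x y n] by (simp add: abs_le_square_iff[symmetric])
    qed (auto intro!: tendsto_intros P)
  qed (rule poly)
qed

text \<open>Subtracting the bumps \<open>g z * bump N (x - z)\<close>, which converge uniformly to 0, makes the derivative
  vanish at the points of the finite set \<open>Z\<close>.\<close>

lemma C1_inequality_remove_finite:
  assumes poly: "\<And>P :: real poly. (\<integral>x. x * poly P x \<partial>\<mu>)\<^sup>2 \<le> D\<^sup>2 * (\<integral>z. (dquot (poly P) (poly (pderiv P)) z)\<^sup>2 \<partial>(\<mu> \<Otimes>\<^sub>M \<mu>))"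
    and f: "\<And>x. (f has_real_derivative g x) (at x)" and g: "continuous_on UNIV g" and Z: "finite Z"
  shows "(\<integral>x. x * f x \<partial>\<mu>)\<^sup>2 \<le> D\<^sup>2 * (\<integral>z. (dquot f (\<lambda>x. if x \<in> Z then 0 else g x) z)\<^sup>2 \<partial>(\<mu> \<Otimes>\<^sub>M \<mu>))"
proof -
  note [measurable] = C1_measurable[OF f] borel_measurable_continuous_onI[OF g]
  have Zb[measurable]: "Z \<in> sets borel" by (rule borel_closed[OF finite_imp_closed[OF Z]])
  define fn where "fn n x = f x - (\<Sum>z\<in>Z. g z * bump (real (Suc n)) (x - z))" for n x
  define gn where "gn n x = g x - (\<Sum>z\<in>Z. g z * bump' (real (Suc n)) (x - z))" for n x
  have fn: "(fn n has_real_derivative gn n x) (at x)" for n x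
    unfolding fn_def[abs_def] gn_def by (intro derivative_intros f bump_DERIV DERIV_cmult)
  have gn: "continuous_on UNIV (gn n)" for n
    unfolding gn_def[abs_def] by (intro continuous_intros g continuous_bump')
  note [measurable] = C1_measurable[OF fn] borel_measurable_continuous_onI[OF gn]
  obtain G where G: "G \<ge> 0" "\<And>x. x \<in> {-R..R} \<Longrightarrow> \<bar>g x\<bar> \<le> G" "\<And>x. x \<in> {-R..R} \<Longrightarrow> \<bar>f x\<bar> \<le> G"
    "\<And>x y. x \<in> {-R..R} \<Longrightarrow> y \<in> {-R..R} \<Longrightarrow> \<bar>dquot f g (x,y)\<bar> \<le> G"
    using C1_dquot_bounded[OF f g] by blast
  define B where "B = (\<Sum>z\<in>Z. \<bar>g z\<bar>)"
  have B0: "B \<ge> 0" unfolding B_def by (intro sum_nonneg) auto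
  have sumB: "\<bar>\<Sum>z\<in>Z. g z * c z\<bar> \<le> B" if "\<And>z. \<bar>c z\<bar> \<le> 1" for c
  proof -
    have "\<bar>\<Sum>z\<in>Z. g z * c z\<bar> \<le> (\<Sum>z\<in>Z. \<bar>g z * c z\<bar>)" by (rule sum_abs)
    also have "\<dots> \<le> B" unfolding B_def abs_mult using that by (intro sum_mono mult_left_le) auto
    finally show ?thesis .
  qed
  have bump1: "\<bar>bump (real (Suc n)) u\<bar> \<le> 1" for n u
    using bump_bound[of "real (Suc n)" u] by (rule order_trans) auto
  \<comment> \<open>All bumps have Lipschitz constant 1, so the quotients are bounded independently
    of \<open>n\<close>, as dominated convergence requires.\<close>
  have bdiff: "\<bar>(bump (real (Suc n)) (x - z) - bump (real (Suc n)) (y - z)) / (x - y)\<bar> \<le> 1" for n x y z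
  proof (cases "x = y")
    case False
    have "norm (bump (real (Suc n)) (x - z) - bump (real (Suc n)) (y - z)) \<le> 1 * norm (x - y)"
      by (rule field_differentiable_bound[where S=UNIV and f' = "\<lambda>x. bump' (real (Suc n)) (x - z)"])
         (use bump_DERIV bump'_bound1 in auto)
    then show ?thesis using False by (simp add: divide_simps)
  qed simp
  have dq: "dquot (fn n) (gn n) (x, y) = dquot f g (x, y)
     - (\<Sum>z\<in>Z. g z * (if x = y then bump' (real (Suc n)) (x - z)
          else (bump (real (Suc n)) (x - z) - bump (real (Suc n)) (y - z)) / (x - y)))" for n x y
  proof (cases "x = y")
    case False
    have "fn n x - fn n y = (f x - f y) - (\<Sum>z\<in>Z. g z * (bump (real (Suc n)) (x - z) - bump (real (Suc n)) (y - z)))"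
      by (simp add: fn_def right_diff_distrib sum_subtractf)
    then show ?thesis using False
      by (simp add: dquot_def diff_divide_distrib sum_divide_distrib right_diff_distrib)
  qed (simp add: dquot_def gn_def)
  show ?thesis
  proof (rule tendsto_le_trans)
    show "(\<lambda>n. \<integral>x. x * fn n x \<partial>\<mu>) \<longlonglongrightarrow> (\<integral>x. x * f x \<partial>\<mu>)"
    proof (rule integral_limit[where C="R * (G + B)"])
      fix n x assume x: "x \<in> {-R..R}"
      have "\<bar>fn n x\<bar> \<le> G + B" unfolding fn_def using G(3)[OF x] sumB[of "\<lambda>z. bump (real (Suc n)) (x - z)"] bump1
        by (smt (verit))
      then show "\<bar>x * fn n x\<bar> \<le> R * (G + B)" unfolding abs_mult using x R_nonneg
        by (intro mult_mono) auto
    next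
      fix x
      have "(\<lambda>n. f x - (\<Sum>z\<in>Z. g z * bump (real (Suc n)) (x - z))) \<longlonglongrightarrow> f x - (\<Sum>z\<in>Z. g z * 0)"
        by (intro tendsto_intros bump_limit)
      then show "(\<lambda>n. x * fn n x) \<longlonglongrightarrow> x * f x" unfolding fn_def by (intro tendsto_intros) simp
    qed auto
    show "(\<lambda>n. \<integral>z. (dquot (fn n) (gn n) z)\<^sup>2 \<partial>(\<mu> \<Otimes>\<^sub>M \<mu>)) \<longlonglongrightarrow>
        (\<integral>z. (dquot f (\<lambda>x. if x \<in> Z then 0 else g x) z)\<^sup>2 \<partial>(\<mu> \<Otimes>\<^sub>M \<mu>))"
    proof (rule integral_pair_limit[where C="(G + B)\<^sup>2"])
      fix n x y assume xy: "x \<in> {-R..R}" "y \<in> {-R..R}"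
      have "\<bar>dquot (fn n) (gn n) (x, y)\<bar> \<le> G + B"
        unfolding dq using G(4)[OF xy] sumB[of "\<lambda>z. (if x = y then bump' (real (Suc n)) (x - z)
          else (bump (real (Suc n)) (x - z) - bump (real (Suc n)) (y - z)) / (x - y))"] bdiff[of n x _ y] bump'_bound1
        by (smt (verit))
      then show "\<bar>(dquot (fn n) (gn n) (x, y))\<^sup>2\<bar> \<le> (G + B)\<^sup>2"
        using G(1) B0 by (simp add: abs_le_square_iff[symmetric])
    next
      fix x y
      have tlim: "(\<lambda>n. if x = y then bump' (real (Suc n)) (x - z)
          else (bump (real (Suc n)) (x - z) - bump (real (Suc n)) (y - z)) / (x - y)) \<longlonglongrightarrow>
          (if x = y then (if x - z = 0 then 1 else 0) else (0 - 0) / (x - y))" for z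
      proof (cases "x = y")
        case True
        then show ?thesis using bump'_limit[of "x - z"] by simp
      next
        case False
        then show ?thesis unfolding if_not_P[OF False] by (intro tendsto_intros bump_limit) auto
      qed
      have "(\<lambda>n. dquot (fn n) (gn n) (x, y)) \<longlonglongrightarrow> dquot f g (x, y) - (\<Sum>z\<in>Z. g z * (if x = y then (if x - z = 0 then 1 else 0)
          else (0 - 0) / (x - y)))"
        unfolding dq by (intro tendsto_diff tendsto_const tendsto_sum tendsto_mult tlim)
      also have "(\<Sum>z\<in>Z. g z * (if x = y then (if x - z = 0 then 1 else 0) else (0 - 0) / (x - y))) = (\<Sum>z\<in>Z. if z = x then (if x = y then g x else 0) else 0)"
        by (intro sum.cong) auto
      also have "dquot f g (x, y) - \<dots> = dquot f (\<lambda>x. if x \<in> Z then 0 else g x) (x, y)"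
        using Z by (simp add: sum.delta dquot_def)
      finally show "(\<lambda>n. (dquot (fn n) (gn n) (x, y))\<^sup>2) \<longlonglongrightarrow> (dquot f (\<lambda>x. if x \<in> Z then 0 else g x) (x, y))\<^sup>2"
        by (intro tendsto_intros)
    qed (auto intro!: dquot_measurable measurable_compose[OF dquot_measurable] borel_measurable_power)
  qed (rule C1_inequality[OF poly fn gn])
qed

text \<open>The product measure charges the diagonal only at atoms, of which there are countably
  many; an exhaustion by finite sets removes the derivative at all of them. On the diagonal the
  quotient on the right is \<open>0 / 0 = 0\<close>.\<close>

theorem C1_inequality_off_diagonal:
  assumes poly: "\<And>P :: real poly. (\<integral>x. x * poly P x \<partial>\<mu>)\<^sup>2 \<le> D\<^sup>2 * (\<integral>z. (dquot (poly P) (poly (pderiv P)) z)\<^sup>2 \<partial>(\<mu> \<Otimes>\<^sub>M \<mu>))"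
    and f: "\<And>x. (f has_real_derivative g x) (at x)" and g: "continuous_on UNIV g"
  shows "(\<integral>x. x * f x \<partial>\<mu>)\<^sup>2 \<le> D\<^sup>2 * (\<integral>z. ((f (fst z) - f (snd z)) / (fst z - snd z))\<^sup>2 \<partial>(\<mu> \<Otimes>\<^sub>M \<mu>))"
proof -
  note [measurable] = C1_measurable[OF f] borel_measurable_continuous_onI[OF g]
  \<comment> \<open>The extra point 0 makes the set nonempty, so that \<open>from_nat_into\<close>
    enumerates it even if the law has no atoms.\<close>
  define A where "A = insert 0 {x. measure \<mu> {x} \<noteq> 0}"
  have A: "countable A" "A \<noteq> {}" unfolding A_def using countable_support by auto
  define p where "p = from_nat_into A"
  have p: "range p = A" unfolding p_def using A by (simp add: range_from_nat_into)
  have [measurable]: "A \<in> sets borel" using A(1) by (rule sets.countable[rotated]) auto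
  have [measurable]: "p ` {..<n} \<in> sets borel" for n by (rule sets.countable) auto
  obtain G where G: "G \<ge> 0" "\<And>x. x \<in> {-R..R} \<Longrightarrow> \<bar>g x\<bar> \<le> G" "\<And>x. x \<in> {-R..R} \<Longrightarrow> \<bar>f x\<bar> \<le> G"
    "\<And>x y. x \<in> {-R..R} \<Longrightarrow> y \<in> {-R..R} \<Longrightarrow> \<bar>dquot f g (x,y)\<bar> \<le> G"
    using C1_dquot_bounded[OF f g] by blast
  have "(\<integral>x. x * f x \<partial>\<mu>)\<^sup>2 \<le> D\<^sup>2 * (\<integral>z. (dquot f (\<lambda>x. if x \<in> A then 0 else g x) z)\<^sup>2 \<partial>(\<mu> \<Otimes>\<^sub>M \<mu>))"
  proof (rule tendsto_le_trans[OF tendsto_const _ C1_inequality_remove_finite[OF poly f g]])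
    show "(\<lambda>n. \<integral>z. (dquot f (\<lambda>x. if x \<in> p ` {..<n} then 0 else g x) z)\<^sup>2 \<partial>(\<mu> \<Otimes>\<^sub>M \<mu>)) \<longlonglongrightarrow>
        (\<integral>z. (dquot f (\<lambda>x. if x \<in> A then 0 else g x) z)\<^sup>2 \<partial>(\<mu> \<Otimes>\<^sub>M \<mu>))"
    proof (rule integral_pair_limit[where C="G\<^sup>2"])
      fix n x y assume xy: "x \<in> {-R..R}" "y \<in> {-R..R}"
      have "\<bar>dquot f (\<lambda>x. if x \<in> p ` {..<n} then 0 else g x) (x, y)\<bar> \<le> G"
        using G(4)[OF xy] G(1) by (auto simp: dquot_def)
      then show "\<bar>(dquot f (\<lambda>x. if x \<in> p ` {..<n} then 0 else g x) (x, y))\<^sup>2\<bar> \<le> G\<^sup>2"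
        using G(1) by (simp add: abs_le_square_iff[symmetric])
    next
      fix x y
      have "\<forall>\<^sub>F n in sequentially. (x \<in> p ` {..<n}) = (x \<in> A)"
      proof (cases "x \<in> A")
        case True
        then obtain i where "x = p i" using p by auto
        then show ?thesis using True by (auto simp: eventually_sequentially intro!: exI[of _ "Suc i"])
      next
        case False
        then have "x \<notin> p ` {..<n}" for n using p by auto
        then show ?thesis using False by simp
      qed
      then have "\<forall>\<^sub>F n in sequentially. (dquot f (\<lambda>x. if x \<in> p ` {..<n} then 0 else g x) (x, y))\<^sup>2 = (dquot f (\<lambda>x. if x \<in> A then 0 else g x) (x, y))\<^sup>2"
        by eventually_elim (auto simp: dquot_def)
      then show "(\<lambda>n. (dquot f (\<lambda>x. if x \<in> p ` {..<n} then 0 else g x) (x, y))\<^sup>2) \<longlonglongrightarrow> (dquot f (\<lambda>x. if x \<in> A then 0 else g x) (x, y))\<^sup>2"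
        by (rule tendsto_eventually)
    qed (auto intro!: dquot_measurable measurable_compose[OF dquot_measurable] borel_measurable_power)
  qed auto
  also have "(\<integral>z. (dquot f (\<lambda>x. if x \<in> A then 0 else g x) z)\<^sup>2 \<partial>(\<mu> \<Otimes>\<^sub>M \<mu>)) =
     (\<integral>z. ((f (fst z) - f (snd z)) / (fst z - snd z))\<^sup>2 \<partial>(\<mu> \<Otimes>\<^sub>M \<mu>))"
  proof (rule integral_cong_AE)
    have *: "AE x in \<mu>. AE y in \<mu>. \<not> (fst (x, y) = snd (x, y) \<and> fst (x, y) \<notin> A)"
      unfolding fst_conv snd_conv
    proof (rule AE_I2)
      fix x
      show "AE y in \<mu>. \<not> (x = y \<and> x \<notin> A)"
      proof (cases "x \<in> A")
        case False
        then have "emeasure \<mu> {x} = 0" by (auto simp: A_def emeasure_eq_measure)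
        then show ?thesis by (intro AE_I[of _ _ "{x}"]) auto
      qed auto
    qed
    have "AE z in \<mu> \<Otimes>\<^sub>M \<mu>. \<not> (fst z = snd z \<and> fst z \<notin> A)"
      by (rule pair.AE_pair_measure[OF _ *]) measurable
    then show "AE z in \<mu> \<Otimes>\<^sub>M \<mu>. (dquot f (\<lambda>x. if x \<in> A then 0 else g x) z)\<^sup>2 = ((f (fst z) - f (snd z)) / (fst z - snd z))\<^sup>2"
      by eventually_elim (auto simp: dquot_def split: prod.splits)
  qed (auto intro!: dquot_measurable measurable_compose[OF dquot_measurable] borel_measurable_power)
  finally show ?thesis .
qed

end

section \<open>The Stein identity of the semicircle law\<close>

text \<open>Chebyshev polynomials of the second kind at \<open>x / 2\<close>, the orthogonal
  polynomials of the semicircle law.\<close>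

fun cheb :: "nat \<Rightarrow> real poly" where
  "cheb 0 = 1"
| "cheb (Suc 0) = [:0, 1:]"
| "cheb (Suc (Suc n)) = [:0, 1:] * cheb (Suc n) - cheb n"

lemma cheb_cos: "poly (cheb n) (2 * cos t) * sin t = sin (real (Suc n) * t)"
proof (induction n rule: cheb.induct)
  case 2
  then show ?case using sin_double[of t] by (simp add: mult.commute mult.left_commute)
next
  case (3 n)
  have "poly (cheb (Suc (Suc n))) (2 * cos t) * sin t
      = 2 * cos t * (poly (cheb (Suc n)) (2 * cos t) * sin t) - poly (cheb n) (2 * cos t) * sin t"
    by (simp add: algebra_simps)
  also have "\<dots> = 2 * cos t * sin (real (Suc (Suc n)) * t) - sin (real (Suc n) * t)"
    unfolding 3 ..
  also have "real (Suc n) * t = real (Suc (Suc n)) * t - t" by (simp add: algebra_simps)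
  also have "2 * cos t * sin (real (Suc (Suc n)) * t) - sin (real (Suc (Suc n)) * t - t) = sin (real (Suc (Suc n)) * t + t)"
    by (simp add: sin_add sin_diff)
  also have "real (Suc (Suc n)) * t + t = real (Suc (Suc (Suc n))) * t" by (simp add: algebra_simps)
  finally show ?case .
qed simp

lemma cheb_monic: "degree (cheb n) = n \<and> coeff (cheb n) n = 1"
proof (induction n rule: cheb.induct)
  case (3 n)
  have "degree (cheb (Suc (Suc n))) \<le> Suc (Suc n)"
    using 3 by (auto intro!: degree_diff_le order_trans[OF degree_mult_le])
  moreover have "coeff (cheb (Suc (Suc n))) (Suc (Suc n)) = 1"
    using 3 by (simp add: coeff_eq_0)
  ultimately show ?case by (metis le_antisym le_degree zero_neq_one)
qed auto

text \<open>Both sides obey the same three-term recurrence. The difference quotient thus splits into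
  products of one factor in \<open>x\<close> and one in \<open>y\<close>, which the product of two
  semicircle laws integrates factor by factor.\<close>

lemma cheb_diff:
  "poly (cheb n) x - poly (cheb n) y = (x - y) * (\<Sum>k<n. poly (cheb k) x * poly (cheb (n - Suc k)) y)"
proof (induction n rule: cheb.induct)
  case (3 n)
  define S where "S n = (\<Sum>k<n. poly (cheb k) x * poly (cheb (n - Suc k)) y)" for n
  have "x * S (Suc n) = x * poly (cheb n) y + (\<Sum>k<n. x * poly (cheb (Suc k)) x * poly (cheb (n - Suc k)) y)"
    unfolding S_def sum.lessThan_Suc_shift by (simp add: algebra_simps sum_distrib_left)
  also have "(\<Sum>k<n. x * poly (cheb (Suc k)) x * poly (cheb (n - Suc k)) y) =
      (\<Sum>k<n. poly (cheb (Suc (Suc k))) x * poly (cheb (n - Suc k)) y) + S n"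
    unfolding S_def sum.distrib[symmetric] by (intro sum.cong) (auto simp: algebra_simps)
  also have "x * poly (cheb n) y + ((\<Sum>k<n. poly (cheb (Suc (Suc k))) x * poly (cheb (n - Suc k)) y) + S n)
     = S (Suc (Suc n)) - poly (cheb (Suc n)) y + S n"
    unfolding S_def sum.lessThan_Suc_shift[of _ "Suc n"] sum.lessThan_Suc_shift[of _ n] by simp
  finally have S: "S (Suc (Suc n)) = poly (cheb (Suc n)) y + x * S (Suc n) - S n" by simp
  have "(x - y) * S (Suc (Suc n)) = (x - y) * poly (cheb (Suc n)) y + x * ((x - y) * S (Suc n)) - (x - y) * S n"
    unfolding S by (simp add: algebra_simps)
  also have "\<dots> = (x - y) * poly (cheb (Suc n)) y + x * (poly (cheb (Suc n)) x - poly (cheb (Suc n)) y) - (poly (cheb n) x - poly (cheb n) y)"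
    unfolding 3[folded S_def] ..
  also have "\<dots> = poly (cheb (Suc (Suc n))) x - poly (cheb (Suc (Suc n))) y" by (simp add: algebra_simps)
  finally show ?case unfolding S_def by simp
qed auto

text \<open>Under \<open>s = 2 cos t\<close> the integrand becomes a product of two sines, and
  \<open>A\<close> is its antiderivative by the product-to-sum formula; for \<open>n = 0\<close> the
  first cosine is constant and contributes \<open>t\<close>.\<close>

lemma integral_cheb_sqrt:
  "((\<lambda>s. poly (cheb n) s * sqrt (4 - s\<^sup>2)) has_integral (if n = 0 then 2 * pi else 0)) {-2..2}"
proof -
  define A where "A t = (if n = 0 then t else sin (real n * t) / real n) - sin (real (n + 2) * t) / real (n + 2)" for t
  have A: "(A has_real_derivative 2 * sin (real (Suc n) * t) * sin t) (at t)" for t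
  proof -
    have "(A has_real_derivative cos (real n * t) - cos (real (n + 2) * t)) (at t)"
      unfolding A_def[abs_def] by (cases "n = 0") (auto intro!: derivative_eq_intros)
    moreover have "cos (real n * t) - cos (real (n + 2) * t) = 2 * sin (real (Suc n) * t) * sin t"
    proof -
      have 1: "real n * t = real (Suc n) * t - t" "real (n + 2) * t = real (Suc n) * t + t" by (simp_all add: algebra_simps)
      show ?thesis unfolding 1 by (simp add: cos_add cos_diff)
    qed
    ultimately show ?thesis by simp
  qed
  define \<Phi> where "\<Phi> s = - 2 * A (arccos (s / 2))" for s
  have "((\<lambda>s. poly (cheb n) s * sqrt (4 - s\<^sup>2)) has_integral (\<Phi> 2 - \<Phi> (-2))) {-2..2}"
  \<comment> \<open>\<open>arccos\<close> is not differentiable at the endpoints, so the derivative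
    is available in the open interval only.\<close>
  proof (rule fundamental_theorem_of_calculus_interior)
    have cA: "continuous_on UNIV A" by (intro continuous_at_imp_continuous_on ballI DERIV_isCont[OF A])
    show "continuous_on {-2..2} \<Phi>" unfolding \<Phi>_def[abs_def]
      by (intro continuous_intros continuous_on_compose2[OF cA]) auto
    fix s :: real assume s: "s \<in> {-2<..<2}"
    define t where "t = arccos (s / 2)"
    have c: "cos t = s / 2" unfolding t_def using s by (intro cos_arccos) auto
    have t: "0 < t" "t < pi" unfolding t_def using s arccos_lt_bounded[of "s/2"] by auto
    have st: "sin t > 0" using t by (rule sin_gt_zero)
    have sq: "sqrt (4 - s\<^sup>2) = 2 * sin t"
    proof (rule real_sqrt_unique)
      have "(sin t)\<^sup>2 + (s / 2)\<^sup>2 = 1" using sin_cos_squared_add[of t] c by simp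
      then show "(2 * sin t)\<^sup>2 = 4 - s\<^sup>2" by (simp add: power2_eq_square field_simps)
    qed (use st in auto)
    have sq1: "sqrt (1 - (s / 2)\<^sup>2) = sin t"
    proof (rule real_sqrt_unique)
      show "(sin t)\<^sup>2 = 1 - (s / 2)\<^sup>2" using sin_cos_squared_add[of t] c by simp
    qed (use st in auto)
    have "((\<lambda>s. arccos (s / 2)) has_real_derivative inverse (- sqrt (1 - (s / 2)\<^sup>2)) * (1 / 2)) (at s)"
      by (rule DERIV_chain'[OF _ DERIV_arccos, of "\<lambda>s. s / 2" "1/2"]) (use s in \<open>auto intro!: derivative_eq_intros\<close>)
    then have "((\<lambda>s. arccos (s / 2)) has_real_derivative inverse (- sin t) * (1 / 2)) (at s)" unfolding sq1 .
    from DERIV_chain'[OF this A[of "arccos (s / 2)", folded t_def, unfolded t_def]]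
    have "((\<lambda>s. A (arccos (s / 2))) has_real_derivative 2 * sin (real (Suc n) * t) * sin t * (inverse (- sin t) * (1 / 2))) (at s)"
      unfolding t_def .
    then have "(\<Phi> has_real_derivative - 2 * (2 * sin (real (Suc n) * t) * sin t * (inverse (- sin t) * (1 / 2)))) (at s)"
      unfolding \<Phi>_def[abs_def] by (rule DERIV_cmult)
    also have "- 2 * (2 * sin (real (Suc n) * t) * sin t * (inverse (- sin t) * (1 / 2))) = 2 * sin (real (Suc n) * t)"
      using st by (simp add: field_simps)
    also have "\<dots> = poly (cheb n) s * sqrt (4 - s\<^sup>2)"
      unfolding sq using cheb_cos[of n t] by (simp add: c mult.commute mult.left_commute)
    finally show "(\<Phi> has_vector_derivative poly (cheb n) s * sqrt (4 - s\<^sup>2)) (at s)"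
      by (simp add: has_real_derivative_iff_has_vector_derivative)
  qed simp
  also have "\<Phi> 2 - \<Phi> (-2) = 2 * (A pi - A 0)" by (simp add: \<Phi>_def)
  also have "\<dots> = (if n = 0 then 2 * pi else 0)"
    unfolding A_def using sin_npi2[of n] sin_npi2[of "n+2"] by (auto simp: mult.commute)
  finally show ?thesis .
qed

lemma poly_measurable [measurable]: "poly p \<in> borel_measurable (borel :: real measure)" for p :: "real poly"
  by (intro borel_measurable_continuous_onI continuous_intros)

abbreviation semicircle :: "real measure" where
  "semicircle \<equiv> density lborel (\<lambda>t. ennreal (semicircle_density t))"

lemma semicircle_density_measurable [measurable]: "semicircle_density \<in> borel_measurable borel"
  unfolding semicircle_density_def[abs_def] by measurable

lemma semicircle_density_nonneg: "semicircle_density t \<ge> 0"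
proof (cases "t \<in> {-2..2}")
  case True
  then have "t\<^sup>2 \<le> 4" using abs_le_square_iff[of t 2] by auto
  then show ?thesis by (auto simp: semicircle_density_def)
qed (auto simp: semicircle_density_def)

lemma integral_semicircle_continuous:
  assumes "continuous_on {-2..2} f"  "((\<lambda>s. f s * sqrt (4 - s\<^sup>2)) has_integral I) {-2..2}"
    and [measurable]: "f \<in> borel_measurable borel"
  shows "(\<integral>s. f s \<partial>semicircle) = I / (2 * pi)"
proof -
  have "(\<integral>s. f s \<partial>semicircle) = (\<integral>s. semicircle_density s * f s \<partial>lborel)"
    by (subst integral_density) (auto simp: semicircle_density_nonneg)
  also have "\<dots> = (LINT s:{-2..2}|lborel. f s * sqrt (4 - s\<^sup>2)) / (2 * pi)"
    unfolding set_lebesgue_integral_def integral_divide_zero[symmetric]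
    by (intro Bochner_Integration.integral_cong) (auto simp: semicircle_density_def indicator_def)
  also have "(LINT s:{-2..2}|lborel. f s * sqrt (4 - s\<^sup>2)) = integral {-2..2} (\<lambda>s. f s * sqrt (4 - s\<^sup>2))"
    by (intro set_borel_integral_eq_integral borel_integrable_atLeastAtMost' continuous_intros assms)
  also have "\<dots> = I" using assms(2) by (rule integral_unique)
  finally show ?thesis .
qed

lemma integral_cheb: "(\<integral>s. poly (cheb n) s \<partial>semicircle) = (if n = 0 then 1 else 0)"
  by (subst integral_semicircle_continuous[OF _ integral_cheb_sqrt])
     (auto intro!: continuous_intros borel_measurable_continuous_onI)

lemma AE_semicircle: "AE s in semicircle. s \<in> {-2..2}"
  by (subst AE_density) (auto intro!: AE_I2 simp: semicircle_density_def)

lemma semicircle_null_singleton: "emeasure semicircle {t} = 0"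
  by (subst emeasure_density) (auto simp: nn_integral_indicator_singleton)

lemma prob_space_semicircle: "prob_space semicircle"
proof
  have fin: "emeasure semicircle (space semicircle) = (\<integral>\<^sup>+ s. ennreal (semicircle_density s) \<partial>lborel)"
    by (subst emeasure_density) auto
  have "set_integrable lborel {-2..2} (\<lambda>s::real. sqrt (4 - s\<^sup>2) / (2 * pi))"
    by (intro borel_integrable_atLeastAtMost' continuous_intros) auto
  then have "integrable lborel (\<lambda>s::real. indicator {-2..2} s *\<^sub>R (sqrt (4 - s\<^sup>2) / (2 * pi)))"
    unfolding set_integrable_def .
  also have "(\<lambda>s. indicator {-2..2} s *\<^sub>R (sqrt (4 - s\<^sup>2) / (2 * pi))) = semicircle_density"
    by (auto simp: semicircle_density_def indicator_def)
  finally have "(\<integral>\<^sup>+ s. ennreal (semicircle_density s) \<partial>lborel) = ennreal (\<integral>s. semicircle_density s \<partial>lborel)"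
    by (intro nn_integral_eq_integral) (auto simp: semicircle_density_nonneg)
  also have "(\<integral>s. semicircle_density s \<partial>lborel) = (\<integral>s. poly (cheb 0) s \<partial>semicircle)"
    by (subst integral_density) (auto simp: semicircle_density_nonneg)
  also have "\<dots> = 1" unfolding integral_cheb by simp
  finally show "emeasure semicircle (space semicircle) = 1" unfolding fin by simp
qed

interpretation SC: bounded_support semicircle 2
proof -
  interpret prob_space semicircle by (rule prob_space_semicircle)
  show "bounded_support semicircle 2" by unfold_locales (use AE_semicircle in auto)
qed

lemma integrable_poly_semicircle: "integrable semicircle (poly p)"
proof -
  have "compact (poly p ` {-2..2})" by (intro compact_continuous_image continuous_intros) auto
  then obtain G where G: "\<And>x. x \<in> {-2..2} \<Longrightarrow> \<bar>poly p x\<bar> \<le> G"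
    using compact_imp_bounded bounded_iff by (metis imageI real_norm_def)
  then show ?thesis by (intro SC.integrable_bounded[of _ G] borel_measurable_continuous_onI continuous_intros) auto
qed

lemma AE_semicircle_off_diagonal: "AE z in semicircle \<Otimes>\<^sub>M semicircle. fst z \<noteq> snd z"
proof -
  have "AE y in semicircle. x \<noteq> y" for x
    by (rule AE_I[of _ _ "{x}"]) (auto simp: semicircle_null_singleton)
  then have *: "AE x in semicircle. AE y in semicircle. fst (x, y) \<noteq> snd (x, y)" by simp
  show ?thesis by (rule SC.pair.AE_pair_measure[OF _ *]) measurable
qed

lemma integral_x_cheb: "(\<integral>s. s * poly (cheb n) s \<partial>semicircle) = (if n = 1 then 1 else 0)"
proof (cases n)
  case 0
  then show ?thesis using integral_cheb[of 1] by simp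
next
  case (Suc k)
  have "(\<lambda>s. s * poly (cheb n) s) = (\<lambda>s. poly (cheb (Suc n)) s + poly (cheb k) s)"
    using Suc by auto
  then have "(\<integral>s. s * poly (cheb n) s \<partial>semicircle) = (\<integral>s. poly (cheb (Suc n)) s \<partial>semicircle) + (\<integral>s. poly (cheb k) s \<partial>semicircle)"
    by (simp only: Bochner_Integration.integral_add[OF integrable_poly_semicircle integrable_poly_semicircle])
  then show ?thesis unfolding integral_cheb using Suc by auto
qed

text \<open>A product in the expansion \<open>cheb_diff\<close> survives integration only if both
  indices \<open>k\<close> and \<open>n - Suc k\<close> are 0, that is, for \<open>n = 1\<close>.
  This is the value found in \<open>integral_x_cheb\<close>.\<close>

lemma cheb_quotient_integral:
  shows "integrable (semicircle \<Otimes>\<^sub>M semicircle) (\<lambda>z. (poly (cheb n) (fst z) - poly (cheb n) (snd z)) / (fst z - snd z))"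
    and "(\<integral>z. (poly (cheb n) (fst z) - poly (cheb n) (snd z)) / (fst z - snd z) \<partial>(semicircle \<Otimes>\<^sub>M semicircle)) = (if n = 1 then 1 else 0)"
proof -
  have I: "integrable (semicircle \<Otimes>\<^sub>M semicircle) (\<lambda>z. poly p (fst z) * poly q (snd z))" for p q
  proof -
    have "integrable (semicircle \<Otimes>\<^sub>M semicircle) (\<lambda>(x, y). poly p x * poly q y)"
      by (rule SC.pair.Fubini_integrable)
         (auto intro!: AE_I2 integrable_mult_right integrable_poly_semicircle integrable_mult_left integrable_abs simp: abs_mult)
    then show ?thesis by (simp add: case_prod_beta')
  qed
  have V: "(\<integral>z. poly p (fst z) * poly q (snd z) \<partial>(semicircle \<Otimes>\<^sub>M semicircle)) = (\<integral>s. poly p s \<partial>semicircle) * (\<integral>s. poly q s \<partial>semicircle)" for p q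
    using SC.pair.integral_fst'[OF I[of p q], symmetric] by simp
  let ?S = "\<lambda>z. \<Sum>k<n. poly (cheb k) (fst z) * poly (cheb (n - Suc k)) (snd z)"
  have eq: "AE z in semicircle \<Otimes>\<^sub>M semicircle. (poly (cheb n) (fst z) - poly (cheb n) (snd z)) / (fst z - snd z) = ?S z"
    using AE_semicircle_off_diagonal by eventually_elim (simp add: cheb_diff)
  show "integrable (semicircle \<Otimes>\<^sub>M semicircle) (\<lambda>z. (poly (cheb n) (fst z) - poly (cheb n) (snd z)) / (fst z - snd z))"
    by (subst integrable_cong_AE[OF _ _ eq]) (auto intro!: Bochner_Integration.integrable_sum I)
  have "(\<integral>z. (poly (cheb n) (fst z) - poly (cheb n) (snd z)) / (fst z - snd z) \<partial>(semicircle \<Otimes>\<^sub>M semicircle)) = (\<integral>z. ?S z \<partial>(semicircle \<Otimes>\<^sub>M semicircle))"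
    by (rule integral_cong_AE[OF _ _ eq]) auto
  also have "\<dots> = (\<Sum>k<n. (if k = 0 then 1 else 0) * (if n - Suc k = 0 then 1 else 0))"
    by (subst Bochner_Integration.integral_sum) (auto simp: I V integral_cheb intro!: sum.cong)
  also have "\<dots> = (\<Sum>k<n. if k = 0 then (if n = 1 then 1 else 0) else 0)"
    by (intro sum.cong) auto
  also have "\<dots> = (if n = 1 then 1 else 0)" by (auto simp: sum.delta)
  finally show "(\<integral>z. (poly (cheb n) (fst z) - poly (cheb n) (snd z)) / (fst z - snd z) \<partial>(semicircle \<Otimes>\<^sub>M semicircle)) = (if n = 1 then 1 else 0)" .
qed

text \<open>Both sides are linear in \<open>P\<close> and agree on each \<open>cheb n\<close>. As
  these are monic of every degree, induction can strip off the leading term.\<close>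

lemma semicircle_stein_poly:
  "integrable (semicircle \<Otimes>\<^sub>M semicircle) (\<lambda>z. (poly P (fst z) - poly P (snd z)) / (fst z - snd z)) \<and>
   (\<integral>z. (poly P (fst z) - poly P (snd z)) / (fst z - snd z) \<partial>(semicircle \<Otimes>\<^sub>M semicircle)) = (\<integral>s. s * poly P s \<partial>semicircle)"
  (is "?I P \<and> ?E P")
proof (induction "degree P" arbitrary: P rule: less_induct)
  case less
  define c where "c = lead_coeff P"
  define Q where "Q = P - smult c (cheb (degree P))"
  have PQ: "P = Q + smult c (cheb (degree P))" by (simp add: Q_def)
  have Q: "?I Q \<and> ?E Q"
  proof (cases "degree P = 0")
    case True
    then obtain a where "P = [:a:]" by (metis degree_eq_zeroE)
    then have "Q = 0" by (simp add: Q_def c_def one_pCons)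
    then show ?thesis by simp
  next
    case False
    have "degree Q < degree P"
    proof (rule coeff_0_degree_minus_1[THEN le_less_trans])
      show "degree Q \<le> degree P" unfolding Q_def using cheb_monic[of "degree P"] by (intro degree_diff_le order_trans[OF degree_smult_le]) auto
      show "coeff Q (degree P) = 0" unfolding Q_def using cheb_monic[of "degree P"] by (simp add: c_def)
    qed (use False in auto)
    then show ?thesis by (rule less)
  qed
  have dq: "(poly P (fst z) - poly P (snd z)) / (fst z - snd z) = (poly Q (fst z) - poly Q (snd z)) / (fst z - snd z) +
      c * ((poly (cheb (degree P)) (fst z) - poly (cheb (degree P)) (snd z)) / (fst z - snd z))" for z
    by (subst (1 2) PQ) (simp add: add_divide_distrib[symmetric] algebra_simps diff_divide_distrib[symmetric])
  have Ix: "integrable semicircle (\<lambda>s. s * poly q s)" for q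
  proof -
    have "(\<lambda>s. s * poly q s) = poly ([:0,1:] * q)" by (rule ext) simp
    then show ?thesis using integrable_poly_semicircle[of "[:0,1:] * q"] by (simp only:)
  qed
  have x: "s * poly P s = s * poly Q s + c * (s * poly (cheb (degree P)) s)" for s
    by (subst (1) PQ) (simp add: algebra_simps)
  have "(\<integral>s. s * poly P s \<partial>semicircle) = (\<integral>s. s * poly Q s \<partial>semicircle) + c * (\<integral>s. s * poly (cheb (degree P)) s \<partial>semicircle)"
    unfolding x using Ix by simp
  note eqx = this
  have I: "integrable (semicircle \<Otimes>\<^sub>M semicircle)
      (\<lambda>z. c * ((poly (cheb (degree P)) (fst z) - poly (cheb (degree P)) (snd z)) / (fst z - snd z)))"
    using cheb_quotient_integral(1)[of "degree P"] by (rule integrable_mult_right)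
  show ?case
  proof
    show "?I P" unfolding dq by (rule Bochner_Integration.integrable_add[OF conjunct1[OF Q] I])
    show "?E P" unfolding dq Bochner_Integration.integral_add[OF conjunct1[OF Q] I] integral_mult_right_zero
      cheb_quotient_integral(2) conjunct2[OF Q] eqx integral_x_cheb ..
  qed
qed

text \<open>The semicircle law has no atoms, so the diagonal is a null set and \<open>dquot\<close>
  may replace the plain quotient; the identity then passes along approximating polynomials.\<close>

lemma semicircle_stein_C1:
  assumes f: "\<And>x. (f has_real_derivative g x) (at x)" and g: "continuous_on UNIV g"
  shows "(\<integral>z. (f (fst z) - f (snd z)) / (fst z - snd z) \<partial>(semicircle \<Otimes>\<^sub>M semicircle)) = (\<integral>s. s * f s \<partial>semicircle)"
proof -
  note [measurable] = SC.C1_measurable[OF f] borel_measurable_continuous_onI[OF g]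
  obtain P C where P: "\<And>n x. x \<in> {-2..2} \<Longrightarrow> \<bar>poly (P n) x\<bar> \<le> C"
     "\<And>n x y. x \<in> {-2..2} \<Longrightarrow> y \<in> {-2..2} \<Longrightarrow> \<bar>dquot (poly (P n)) (poly (pderiv (P n))) (x, y)\<bar> \<le> C"
     "\<And>x. x \<in> {-2..2} \<Longrightarrow> (\<lambda>n. poly (P n) x) \<longlonglongrightarrow> f x"
     "\<And>x y. x \<in> {-2..2} \<Longrightarrow> y \<in> {-2..2} \<Longrightarrow> (\<lambda>n. dquot (poly (P n)) (poly (pderiv (P n))) (x, y)) \<longlonglongrightarrow> dquot f g (x, y)"
    using SC.C1_poly_seq[OF f g] by blast
  have dq: "(\<integral>z. (f (fst z) - f (snd z)) / (fst z - snd z) \<partial>(semicircle \<Otimes>\<^sub>M semicircle)) = (\<integral>z. dquot f g z \<partial>(semicircle \<Otimes>\<^sub>M semicircle))"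
    if [measurable]: "f \<in> borel_measurable borel" "g \<in> borel_measurable borel" for f g
  proof (rule integral_cong_AE)
    show "AE z in semicircle \<Otimes>\<^sub>M semicircle. (f (fst z) - f (snd z)) / (fst z - snd z) = dquot f g z"
      using AE_semicircle_off_diagonal by eventually_elim (auto simp: dquot_def split: prod.splits)
  qed auto
  have 1: "(\<lambda>n. \<integral>z. dquot (poly (P n)) (poly (pderiv (P n))) z \<partial>(semicircle \<Otimes>\<^sub>M semicircle)) \<longlonglongrightarrow> (\<integral>z. dquot f g z \<partial>(semicircle \<Otimes>\<^sub>M semicircle))"
    by (rule SC.integral_pair_limit[where C=C]) (auto intro: P(2) P(4))
  have 2: "(\<lambda>n. \<integral>s. s * poly (P n) s \<partial>semicircle) \<longlonglongrightarrow> (\<integral>s. s * f s \<partial>semicircle)"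
  proof (rule SC.integral_limit[where C="2 * C"])
    fix n x assume x: "x \<in> {-2..2::real}"
    show "\<bar>x * poly (P n) x\<bar> \<le> 2 * C" unfolding abs_mult using P(1)[OF x, of n] x by (intro mult_mono) auto
  qed (auto intro!: tendsto_intros P)
  have "(\<integral>z. dquot (poly (P n)) (poly (pderiv (P n))) z \<partial>(semicircle \<Otimes>\<^sub>M semicircle)) = (\<integral>s. s * poly (P n) s \<partial>semicircle)" for n
    using semicircle_stein_poly[of "P n"] dq[of "poly (P n)" "poly (pderiv (P n))"] by simp
  then show ?thesis using LIMSEQ_unique[OF 1] 2 dq[of f g] by simp
qed

text \<open>In the limit from \<open>C\<^sup>1\<close> ramps to a step, Fatou's lemma keeps one direction of the Stein identity.\<close>

lemma semicircle_step:
  "(\<integral>\<^sup>+ z. ennreal ((indicator {t<..} (fst z) - indicator {t<..} (snd z)) / (fst z - snd z)) \<partial>(semicircle \<Otimes>\<^sub>M semicircle))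
     \<le> ennreal (\<integral>s. s * indicator {t<..} s \<partial>semicircle)"
proof -
  define f where "f n s = smooth_step (real (Suc n) * (s - t))" for n s
  define g where "g n s = smooth_step' (real (Suc n) * (s - t)) * real (Suc n)" for n s
  have f: "(f n has_real_derivative g n s) (at s)" for n s
    unfolding f_def[abs_def] g_def
    by (rule DERIV_chain'[OF _ smooth_step_DERIV]) (auto intro!: derivative_eq_intros)
  have g: "continuous_on UNIV (g n)" for n
    unfolding g_def[abs_def] by (intro continuous_intros continuous_on_compose2[OF continuous_smooth_step'[of UNIV]]) auto
  note [measurable] = SC.C1_measurable[OF f]
  have lim: "(\<lambda>n. f n s) \<longlonglongrightarrow> indicator {t<..} s" for s
  proof (cases "s > t")
    case True
    then obtain N where N: "1 / (s - t) < real N" using reals_Archimedean2 by blast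
    have "f n s = 1" if "n \<ge> N" for n
    proof -
      have "1 / (s - t) < real (Suc n)" using N that by simp
      then show ?thesis unfolding f_def using True by (intro smooth_step_1) (simp add: divide_less_eq)
    qed
    then show ?thesis using True by (intro tendsto_eventually) (auto simp: eventually_sequentially)
  next
    case False
    then show ?thesis by (simp add: f_def smooth_step_0 mult_nonneg_nonpos del: of_nat_Suc)
  qed
  have nonneg: "0 \<le> (f n (fst z) - f n (snd z)) / (fst z - snd z)" for n z
  proof (cases "fst z \<le> snd z")
    case True
    then have "f n (fst z) \<le> f n (snd z)" unfolding f_def by (intro smooth_step_mono mult_left_mono) auto
    then show ?thesis using True by (simp add: divide_nonpos_nonpos)
  next
    case False
    then have "f n (snd z) \<le> f n (fst z)" unfolding f_def by (intro smooth_step_mono mult_left_mono) auto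
    then show ?thesis using False by (intro divide_nonneg_nonneg) auto
  qed
  have int: "(\<integral>\<^sup>+ z. ennreal ((f n (fst z) - f n (snd z)) / (fst z - snd z)) \<partial>(semicircle \<Otimes>\<^sub>M semicircle)) = ennreal (\<integral>s. s * f n s \<partial>semicircle)" for n
  proof -
    have "\<bar>(f n (fst z) - f n (snd z)) / (fst z - snd z)\<bar> \<le> 2 * real (Suc n)" for z
    proof (cases "fst z = snd z")
      case False
      have "\<bar>f n (fst z) - f n (snd z)\<bar> \<le> 2 * \<bar>real (Suc n) * (fst z - t) - real (Suc n) * (snd z - t)\<bar>"
        unfolding f_def by (rule smooth_step_lipschitz)
      also have "\<dots> = 2 * real (Suc n) * \<bar>fst z - snd z\<bar>"
        by (simp add: right_diff_distrib[symmetric] abs_mult del: of_nat_Suc)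
      finally show ?thesis using False by (simp add: abs_divide divide_le_eq del: of_nat_Suc)
    qed simp
    then have "integrable (semicircle \<Otimes>\<^sub>M semicircle) (\<lambda>z. (f n (fst z) - f n (snd z)) / (fst z - snd z))"
      by (intro SC.pair.P.integrable_const_bound[of _ "2 * real (Suc n)"]) auto
    then show ?thesis using nonneg semicircle_stein_C1[OF f g, of n] by (subst nn_integral_eq_integral) auto
  qed
  have "(\<integral>\<^sup>+ z. ennreal ((indicator {t<..} (fst z) - indicator {t<..} (snd z)) / (fst z - snd z)) \<partial>(semicircle \<Otimes>\<^sub>M semicircle))
      = (\<integral>\<^sup>+ z. liminf (\<lambda>n. ennreal ((f n (fst z) - f n (snd z)) / (fst z - snd z))) \<partial>(semicircle \<Otimes>\<^sub>M semicircle))"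
  proof (intro nn_integral_cong)
    fix z :: "real \<times> real"
    show "ennreal ((indicator {t<..} (fst z) - indicator {t<..} (snd z)) / (fst z - snd z)) = liminf (\<lambda>n. ennreal ((f n (fst z) - f n (snd z)) / (fst z - snd z)))"
    proof (cases "fst z = snd z")
      case False
      then have "(\<lambda>n. ennreal ((f n (fst z) - f n (snd z)) / (fst z - snd z))) \<longlonglongrightarrow> ennreal ((indicator {t<..} (fst z) - indicator {t<..} (snd z)) / (fst z - snd z))"
        by (intro tendsto_ennrealI tendsto_intros lim) auto
      then show ?thesis by (metis lim_imp_Liminf trivial_limit_sequentially)
    qed (simp add: Liminf_const)
  qed
  also have "\<dots> \<le> liminf (\<lambda>n. \<integral>\<^sup>+ z. ennreal ((f n (fst z) - f n (snd z)) / (fst z - snd z)) \<partial>(semicircle \<Otimes>\<^sub>M semicircle))"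
    by (rule nn_integral_liminf) auto
  also have "\<dots> = liminf (\<lambda>n. ennreal (\<integral>s. s * f n s \<partial>semicircle))" unfolding int ..
  also have "\<dots> = ennreal (\<integral>s. s * indicator {t<..} s \<partial>semicircle)"
  proof (rule lim_imp_Liminf)
    show "(\<lambda>n. ennreal (\<integral>s. s * f n s \<partial>semicircle)) \<longlonglongrightarrow> ennreal (\<integral>s. s * indicator {t<..} s \<partial>semicircle)"
    proof (intro tendsto_ennrealI SC.integral_limit[where C="2 * 1"])
      fix n x assume x: "x \<in> {-2..2::real}"
      show "\<bar>x * f n x\<bar> \<le> 2 * 1" unfolding abs_mult using x smooth_step_range[of "real (Suc n) * (x - t)"]
        by (intro mult_mono) (auto simp: f_def)
    qed (auto intro!: tendsto_intros lim)
  qed simp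
  finally show ?thesis .
qed

section \<open>Discretization of a comonotone coupling\<close>

context prob_space begin

lemma pair_prod:
  fixes a b :: "'a \<Rightarrow> real"
  assumes "integrable M a" "integrable M b"
  shows "integrable (M \<Otimes>\<^sub>M M) (\<lambda>z. a (fst z) * b (snd z))"
    and "(\<integral>z. a (fst z) * b (snd z) \<partial>(M \<Otimes>\<^sub>M M)) = (\<integral>x. a x \<partial>M) * (\<integral>x. b x \<partial>M)"
proof -
  interpret P: pair_prob_space M M ..
  note [measurable] = borel_measurable_integrable[OF assms(1)] borel_measurable_integrable[OF assms(2)]
  have "integrable (M \<Otimes>\<^sub>M M) (\<lambda>(x, y). a x * b y)"
    by (rule P.Fubini_integrable)
       (auto intro!: AE_I2 integrable_mult_right integrable_mult_left integrable_abs assms simp: abs_mult)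
  then show I: "integrable (M \<Otimes>\<^sub>M M) (\<lambda>z. a (fst z) * b (snd z))" by (simp add: case_prod_beta')
  show "(\<integral>z. a (fst z) * b (snd z) \<partial>(M \<Otimes>\<^sub>M M)) = (\<integral>x. a x \<partial>M) * (\<integral>x. b x \<partial>M)"
    using P.integral_fst'[OF I, symmetric] by simp
qed

context
  fixes J :: "'a \<Rightarrow> nat" and m :: nat
  assumes J [measurable]: "J \<in> measurable M (count_space UNIV)" and Jm: "\<And>p. p \<in> space M \<Longrightarrow> J p \<le> m"
begin

lemma integrable_discrete_part:
  fixes Z :: "'a \<Rightarrow> real"
  assumes "integrable M Z"
  shows "integrable M (\<lambda>p. of_bool (J p = i) * Z p)"
proof -
  note [measurable] = borel_measurable_integrable[OF assms]
  show ?thesis by (rule Bochner_Integration.integrable_bound[OF assms]) auto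
qed

lemma expectation_discrete:
  fixes Z :: "'a \<Rightarrow> real"
  assumes Z: "integrable M Z"
  shows "integrable M (\<lambda>p. g (J p) * Z p)"
    and "(\<integral>p. g (J p) * Z p \<partial>M) = (\<Sum>i\<le>m. g i * (\<integral>p. of_bool (J p = i) * Z p \<partial>M))"
proof -
  have eq: "g (J p) * Z p = (\<Sum>i\<le>m. g i * (of_bool (J p = i) * Z p))" if "p \<in> space M" for p
  proof -
    have "(\<Sum>i\<le>m. g i * (of_bool (J p = i) * Z p)) = (\<Sum>i\<le>m. if i = J p then g i * Z p else 0)"
      by (intro sum.cong) auto
    then show ?thesis using Jm[OF that] by simp
  qed
  show "integrable M (\<lambda>p. g (J p) * Z p)"
    by (subst Bochner_Integration.integrable_cong[OF refl eq]) (auto intro!: Bochner_Integration.integrable_sum integrable_mult_right integrable_discrete_part Z)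
  show "(\<integral>p. g (J p) * Z p \<partial>M) = (\<Sum>i\<le>m. g i * (\<integral>p. of_bool (J p = i) * Z p \<partial>M))"
    by (subst Bochner_Integration.integral_cong[OF refl eq]) (auto simp: integrable_discrete_part Z)
qed

lemma pair_expectation_discrete:
  fixes Z W :: "'a \<Rightarrow> real"
  assumes Z: "integrable M Z" and W: "integrable M W"
  shows "integrable (M \<Otimes>\<^sub>M M) (\<lambda>z. G (J (fst z)) (J (snd z)) * (Z (fst z) * W (snd z)))"
    and "(\<integral>z. G (J (fst z)) (J (snd z)) * (Z (fst z) * W (snd z)) \<partial>(M \<Otimes>\<^sub>M M)) =
      (\<Sum>i\<le>m. \<Sum>j\<le>m. G i j * ((\<integral>p. of_bool (J p = i) * Z p \<partial>M) * (\<integral>p. of_bool (J p = j) * W p \<partial>M)))"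
proof -
  have eq: "G (J (fst z)) (J (snd z)) * (Z (fst z) * W (snd z)) =
     (\<Sum>i\<le>m. \<Sum>j\<le>m. G i j * ((of_bool (J (fst z) = i) * Z (fst z)) * (of_bool (J (snd z) = j) * W (snd z))))"
    if "z \<in> space (M \<Otimes>\<^sub>M M)" for z
  proof -
    have J: "J (fst z) \<le> m" "J (snd z) \<le> m" using that by (auto simp: space_pair_measure intro: Jm)
    have inner: "(\<Sum>j\<le>m. G i j * ((of_bool (J (fst z) = i) * Z (fst z)) * (of_bool (J (snd z) = j) * W (snd z))))
      = (if i = J (fst z) then G i (J (snd z)) * (Z (fst z) * W (snd z)) else 0)" for i
    proof -
      have "(\<Sum>j\<le>m. G i j * ((of_bool (J (fst z) = i) * Z (fst z)) * (of_bool (J (snd z) = j) * W (snd z))))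
        = (\<Sum>j\<le>m. if j = J (snd z) then of_bool (J (fst z) = i) * (G i j * (Z (fst z) * W (snd z))) else 0)"
        by (intro sum.cong) auto
      also have "\<dots> = of_bool (J (fst z) = i) * (G i (J (snd z)) * (Z (fst z) * W (snd z)))" using J by simp
      finally show ?thesis by auto
    qed
    show ?thesis unfolding inner using J by simp
  qed
  note I = pair_prod[OF integrable_discrete_part[OF Z] integrable_discrete_part[OF W]]
  show "integrable (M \<Otimes>\<^sub>M M) (\<lambda>z. G (J (fst z)) (J (snd z)) * (Z (fst z) * W (snd z)))"
    by (subst Bochner_Integration.integrable_cong[OF refl eq]) (auto intro!: Bochner_Integration.integrable_sum integrable_mult_right I)
  have "(\<integral>z. G (J (fst z)) (J (snd z)) * (Z (fst z) * W (snd z)) \<partial>(M \<Otimes>\<^sub>M M)) =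
     (\<integral>z. (\<Sum>i\<le>m. \<Sum>j\<le>m. G i j * ((of_bool (J (fst z) = i) * Z (fst z)) * (of_bool (J (snd z) = j) * W (snd z)))) \<partial>(M \<Otimes>\<^sub>M M))"
    by (rule Bochner_Integration.integral_cong[OF refl eq])
  also have "\<dots> = (\<Sum>i\<le>m. \<integral>z. (\<Sum>j\<le>m. G i j * ((of_bool (J (fst z) = i) * Z (fst z)) * (of_bool (J (snd z) = j) * W (snd z)))) \<partial>(M \<Otimes>\<^sub>M M))"
    by (intro Bochner_Integration.integral_sum Bochner_Integration.integrable_sum integrable_mult_right I)
  also have "\<dots> = (\<Sum>i\<le>m. \<Sum>j\<le>m. (\<integral>z. G i j * ((of_bool (J (fst z) = i) * Z (fst z)) * (of_bool (J (snd z) = j) * W (snd z))) \<partial>(M \<Otimes>\<^sub>M M)))"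
    by (intro sum.cong refl Bochner_Integration.integral_sum integrable_mult_right I)
  also have "\<dots> = (\<Sum>i\<le>m. \<Sum>j\<le>m. G i j * ((\<integral>p. of_bool (J p = i) * Z p \<partial>M) * (\<integral>p. of_bool (J p = j) * W p \<partial>M)))"
    unfolding integral_mult_right_zero I(2) ..
  finally show "(\<integral>z. G (J (fst z)) (J (snd z)) * (Z (fst z) * W (snd z)) \<partial>(M \<Otimes>\<^sub>M M)) =
      (\<Sum>i\<le>m. \<Sum>j\<le>m. G i j * ((\<integral>p. of_bool (J p = i) * Z p \<partial>M) * (\<integral>p. of_bool (J p = j) * W p \<partial>M)))" .
qed

end

end

text \<open>AM-GM, followed by \<open>2 * sqrt a \<ge> 3 * a - a\<^sup>2\<close> for \<open>a = A * B\<close>.\<close>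

lemma amgm_quartic:
  fixes A B :: real
  assumes "A \<ge> 0" "B \<ge> 0"
  shows "A + B \<ge> 3 * (A * B) - (A * B)\<^sup>2"
proof -
  define u where "u = sqrt (A * B)"
  have u: "u \<ge> 0" "u * u = A * B" using assms by (auto simp: u_def)
  have "(sqrt A - sqrt B)\<^sup>2 \<ge> 0" by simp
  then have "A + B \<ge> 2 * u" using assms by (simp add: power2_diff u_def real_sqrt_mult)
  moreover have "0 \<le> u * (u - 1)\<^sup>2 * (u + 2)" using u by auto
  then have "2 * u \<ge> 3 * (u * u) - (u * u)\<^sup>2" by (simp add: power2_eq_square algebra_simps)
  ultimately show ?thesis using u by simp
qed

lemma diff_square_le: "0 \<le> a * b \<Longrightarrow> (a - b)\<^sup>2 \<le> a\<^sup>2 + b\<^sup>2" for a b :: real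
  by (simp add: power2_diff)

text \<open>\<open>D\<close> stands for the norm of the Stein kernel. The range of \<open>X\<close>
  is half-open so that half-open grid cells cover it, and \<open>Y_step\<close> is an inequality
  because steps are reached only through Fatou's lemma.\<close>

locale comonotone_stein = prob_space \<Omega> for \<Omega> :: "'a measure" +
  fixes X Y :: "'a \<Rightarrow> real" and R D :: real
  assumes X_measurable [measurable]: "X \<in> borel_measurable \<Omega>" and Y_measurable [measurable]: "Y \<in> borel_measurable \<Omega>"
    and R_pos: "R > 0" and D_nonneg: "D \<ge> 0"
    and X_range: "\<And>p. p \<in> space \<Omega> \<Longrightarrow> -R \<le> X p \<and> X p < R"
    and Y_range: "\<And>p. p \<in> space \<Omega> \<Longrightarrow> -2 \<le> Y p \<and> Y p \<le> 2"
    and comono: "\<And>p q. p \<in> space \<Omega> \<Longrightarrow> q \<in> space \<Omega> \<Longrightarrow> X p < X q \<Longrightarrow> Y p \<le> Y q"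
    and X_mean: "(\<integral>p. X p \<partial>\<Omega>) = 0"
    and X_stein: "\<And>f g. (\<And>x. (f has_real_derivative g x) (at x)) \<Longrightarrow> continuous_on UNIV g \<Longrightarrow>
       (\<integral>p. X p * f (X p) \<partial>\<Omega>)\<^sup>2 \<le> D\<^sup>2 * (\<integral>z. ((f (X (fst z)) - f (X (snd z))) / (X (fst z) - X (snd z)))\<^sup>2 \<partial>(\<Omega> \<Otimes>\<^sub>M \<Omega>))"
    and Y_mean: "(\<integral>p. Y p \<partial>\<Omega>) = 0" and Y_var: "(\<integral>p. (Y p)\<^sup>2 \<partial>\<Omega>) = 1"
    and Y_step: "\<And>t. (\<integral>\<^sup>+ z. ennreal ((indicator {t<..} (Y (fst z)) - indicator {t<..} (Y (snd z))) / (Y (fst z) - Y (snd z))) \<partial>(\<Omega> \<Otimes>\<^sub>M \<Omega>))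
        \<le> ennreal (\<integral>p. Y p * indicator {t<..} (Y p) \<partial>\<Omega>)"
    and Y_null: "\<And>t. AE p in \<Omega>. Y p \<noteq> t"
begin

sublocale pair: pair_prob_space \<Omega> \<Omega> ..

lemma integrable_X: "integrable \<Omega> X"
  by (rule integrable_const_bound[of _ R]) (auto intro!: AE_I2 dest!: X_range)

lemma integrable_Y: "integrable \<Omega> Y"
  by (rule integrable_const_bound[of _ 2]) (auto intro!: AE_I2 dest!: Y_range)

lemma Y_AE_neq: "AE z in \<Omega> \<Otimes>\<^sub>M \<Omega>. Y (fst z) \<noteq> Y (snd z)"
proof -
  have *: "AE x in \<Omega>. AE y in \<Omega>. Y (fst (x, y)) \<noteq> Y (snd (x, y))"
    unfolding fst_conv snd_conv using Y_null by (auto simp: eq_commute)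
  show ?thesis by (rule pair.AE_pair_measure[OF _ *]) measurable
qed

text \<open>For \<open>t < 0\<close> the mean 0 of \<open>Y\<close> turns the upper tail into minus
  the lower tail, where \<open>Y\<close> is negative.\<close>

lemma Y_tail_nonneg: "(\<integral>p. Y p * indicator {t<..} (Y p) \<partial>\<Omega>) \<ge> 0"
proof (cases "t \<ge> 0")
  case True
  then show ?thesis by (intro integral_nonneg_AE) (auto intro!: AE_I2 simp: indicator_def)
next
  case False
  have [simp]: "integrable \<Omega> (\<lambda>p. Y p * indicator {t<..} (Y p))" "integrable \<Omega> (\<lambda>p. Y p * indicator {..t} (Y p))"
    "integrable \<Omega> (\<lambda>p. - (Y p) * indicator {..t} (Y p))"
    by (rule Bochner_Integration.integrable_bound[OF integrable_Y]; auto simp: indicator_def)+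
  have "(\<integral>p. Y p * indicator {t<..} (Y p) \<partial>\<Omega>) = (\<integral>p. Y p + - (Y p) * indicator {..t} (Y p) \<partial>\<Omega>)"
    by (intro Bochner_Integration.integral_cong) (auto simp: indicator_def)
  also have "\<dots> = (\<integral>p. Y p \<partial>\<Omega>) + (\<integral>p. - (Y p) * indicator {..t} (Y p) \<partial>\<Omega>)"
    by (rule Bochner_Integration.integral_add[OF integrable_Y]) simp
  finally have "(\<integral>p. Y p * indicator {t<..} (Y p) \<partial>\<Omega>) = (\<integral>p. - (Y p) * indicator {..t} (Y p) \<partial>\<Omega>)"
    unfolding Y_mean by simp
  moreover have "0 \<le> (\<integral>p. - (Y p) * indicator {..t} (Y p) \<partial>\<Omega>)"
    by (intro integral_nonneg_AE AE_I2) (use False in \<open>auto simp: indicator_def\<close>)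
  ultimately show ?thesis by simp
qed

end

text \<open>\<open>m\<close> is the number of cells, \<open>k\<close> the index distance up to which
  the kernel is truncated, and \<rho> the strength of the uniform links.\<close>

locale stein_grid = comonotone_stein +
  fixes m k :: nat and \<rho> :: real
  assumes m_pos: "m > 0" and k_pos: "k > 0" and rho_pos: "\<rho> > 0"
begin

definition mesh :: real where "mesh = 2 * R / real m"
definition node :: "nat \<Rightarrow> real" where "node i = - R + real i * mesh"
definition cell :: "'a \<Rightarrow> nat" where "cell p = nat \<lfloor>(X p + R) / mesh\<rfloor>"
definition weight :: "nat \<Rightarrow> real" where "weight i = (\<integral>p. of_bool (cell p = i) \<partial>\<Omega>)"
text \<open>The mean of the discretized variable. Rounding moves it away from 0, and it is
  subtracted to give the equilibrium problem a load of total 0.\<close>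

definition center :: real where "center = (\<Sum>i\<le>m. weight i * node i)"
text \<open>The inverse squared distance, frozen below index distance \<open>k + 1\<close>: finite
  at 0, and still antitone as the maximum principle demands.\<close>

definition kernel :: "nat \<Rightarrow> real" where "kernel r = 1 / (real (max r (k + 1)) * mesh)\<^sup>2"
definition dist_idx :: "nat \<Rightarrow> nat \<Rightarrow> nat" where "dist_idx i j = nat \<bar>int i - int j\<bar>"
definition cond :: "nat \<Rightarrow> nat \<Rightarrow> real" where "cond i j = kernel (dist_idx i j) * weight i * weight j"
text \<open>Pairs with equal \<open>X\<close> are excluded, in accordance with the Stein inequality
  off the diagonal. Without this exclusion atoms of the law would keep the probability of close
  pairs away from 0.\<close>

definition close :: "'a \<times> 'a \<Rightarrow> bool" where
  "close z \<longleftrightarrow> X (fst z) \<noteq> X (snd z) \<and> \<bar>X (fst z) - X (snd z)\<bar> < (real k + 1) * mesh"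
definition near :: "nat \<Rightarrow> real" where
  "near p = (\<integral>z. of_bool (close z \<and> dist_idx p (cell (fst z)) \<le> k) \<partial>(\<Omega> \<Otimes>\<^sub>M \<Omega>))"
text \<open>In the energy of the interpolation of a grid function, \<open>kernel\<close> pays for the pairs in distant cells and
  \<open>link\<close> for the others; the small uniform part of \<open>link\<close> makes the form positive definite.\<close>

definition link :: "nat \<Rightarrow> real" where "link p = \<rho> * mesh + 4 / real k * weight p + 4 * (real k + 1) * near p"

lemma mesh_pos: "mesh > 0"
  using m_pos R_pos by (simp add: mesh_def)

lemma cell_measurable [measurable]: "cell \<in> measurable \<Omega> (count_space UNIV)"
  unfolding cell_def[abs_def] by measurable

lemma cell_range:
  assumes "p \<in> space \<Omega>"
  shows "cell p < m" "node (cell p) \<le> X p" "X p < node (cell p) + mesh"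
proof -
  define u where "u = (X p + R) / mesh"
  have mm: "real m * mesh = 2 * R" using m_pos by (simp add: mesh_def)
  have u: "u \<ge> 0" "u < m" unfolding u_def pos_divide_less_eq[OF mesh_pos] mm
    using X_range[OF assms] mesh_pos by (auto intro!: divide_nonneg_pos)
  have fl: "real (cell p) = of_int \<lfloor>u\<rfloor>" using u by (simp add: cell_def u_def[symmetric])
  have "real (cell p) \<le> u" "u < real (cell p) + 1" unfolding fl by linarith+
  moreover from this u have "cell p < m" using of_nat_less_iff by fastforce
  ultimately show "cell p < m" "node (cell p) \<le> X p" "X p < node (cell p) + mesh"
    using u mesh_pos by (auto simp: node_def u_def field_simps)
qed

lemma node_cell_close: "p \<in> space \<Omega> \<Longrightarrow> \<bar>node (cell p) - X p\<bar> \<le> mesh"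
  using cell_range(2,3)[of p] mesh_pos by auto

lemma cell_le: "p \<in> space \<Omega> \<Longrightarrow> cell p \<le> m"
  using cell_range(1) by (simp add: less_imp_le)

lemma cell_mono: "p \<in> space \<Omega> \<Longrightarrow> q \<in> space \<Omega> \<Longrightarrow> cell p < cell q \<Longrightarrow> X p < X q"
proof (rule ccontr)
  assume *: "p \<in> space \<Omega>" "q \<in> space \<Omega>" "cell p < cell q" "\<not> X p < X q"
  then have "(X q + R) / mesh \<le> (X p + R) / mesh" using mesh_pos by (intro divide_right_mono) auto
  then have "cell q \<le> cell p" unfolding cell_def by (intro nat_mono floor_mono)
  then show False using * by simp
qed

lemma comono_cell: "p \<in> space \<Omega> \<Longrightarrow> q \<in> space \<Omega> \<Longrightarrow> cell p < cell q \<Longrightarrow> Y p \<le> Y q"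
  using comono cell_mono by blast

lemmas disc = expectation_discrete[OF cell_measurable cell_le]
lemmas disc_pair = pair_expectation_discrete[OF cell_measurable cell_le]

lemma disc1:
  shows "integrable \<Omega> (\<lambda>p. g (cell p))" and "(\<integral>p. g (cell p) \<partial>\<Omega>) = (\<Sum>i\<le>m. weight i * g i)"
  using disc[of "\<lambda>_. 1" g] by (simp_all add: weight_def mult.commute)

lemma disc_pair1:
  shows "integrable (\<Omega> \<Otimes>\<^sub>M \<Omega>) (\<lambda>z. G (cell (fst z)) (cell (snd z)))"
    and "(\<integral>z. G (cell (fst z)) (cell (snd z)) \<partial>(\<Omega> \<Otimes>\<^sub>M \<Omega>)) = (\<Sum>i\<le>m. \<Sum>j\<le>m. weight i * weight j * G i j)"
  using disc_pair[of "\<lambda>_. 1" "\<lambda>_. 1" G] by (simp_all add: weight_def mult.commute)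

lemma weight_nonneg: "weight i \<ge> 0"
  unfolding weight_def by (intro integral_nonneg_AE) auto

lemma weight_sum: "(\<Sum>i\<le>m. weight i) = 1"
  using disc1(2)[of "\<lambda>_. 1"] prob_space by simp

text \<open>Cell indices stop at \<open>m - 1\<close> because \<open>X\<close> stays below
  \<open>R\<close>; node \<open>m\<close> is the right end of the last link.\<close>

lemma weight_last: "weight m = 0"
proof -
  have "weight m = (\<integral>p. 0 \<partial>\<Omega>)" unfolding weight_def
    by (intro Bochner_Integration.integral_cong) (auto dest: cell_range(1))
  then show ?thesis by simp
qed

lemma center_bound: "\<bar>center\<bar> \<le> mesh"
proof -
  have c: "center = (\<integral>p. node (cell p) \<partial>\<Omega>)" unfolding center_def disc1(2) ..
  have "(\<integral>p. node (cell p) \<partial>\<Omega>) - (\<integral>p. X p \<partial>\<Omega>) = (\<integral>p. node (cell p) - X p \<partial>\<Omega>)"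
    by (rule Bochner_Integration.integral_diff[symmetric, OF disc1(1) integrable_X])
  also have "\<bar>\<dots>\<bar> \<le> (\<integral>p. \<bar>node (cell p) - X p\<bar> \<partial>\<Omega>)" by (rule integral_abs_bound)
  also have "\<dots> \<le> (\<integral>p. mesh \<partial>\<Omega>)"
    by (intro integral_mono integrable_abs Bochner_Integration.integrable_diff disc1(1) integrable_X) (auto intro: node_cell_close)
  also have "\<dots> = mesh" by (simp add: prob_space)
  finally show ?thesis unfolding c X_mean by simp
qed

lemma kernel_nonneg: "kernel r \<ge> 0"
  unfolding kernel_def by simp

lemma kernel_antimono: "antimono kernel"
  unfolding kernel_def
  by (intro antimonoI divide_left_mono power_mono mult_right_mono) (use mesh_pos in \<open>auto intro!: mult_pos_pos simp: max_def\<close>)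

text \<open>Freezing the kernel can only lower it below the inverse squared distance of the nodes.
  Later this bounds the second moment of the discrete \<open>a\<close> by the nonlocal
  energy.\<close>

lemma kernel_node: "kernel (dist_idx i j) * (node i - node j)\<^sup>2 \<le> 1"
proof -
  define r where "r = dist_idx i j"
  have "(node i - node j)\<^sup>2 = (real r * mesh)\<^sup>2"
    unfolding r_def dist_idx_def by (simp add: node_def power_mult_distrib left_diff_distrib[symmetric] power2_commute abs_if of_nat_diff)
  also have "\<dots> \<le> (real (max r (k + 1)) * mesh)\<^sup>2"
    using mesh_pos by (intro power_mono mult_right_mono) auto
  finally show ?thesis using mesh_pos unfolding kernel_def r_def[symmetric]
    by (simp add: divide_le_eq_1 zero_less_mult_iff)
qed

lemma kernel_far: "dist_idx i j > k \<Longrightarrow> kernel (dist_idx i j) = 1 / (real (dist_idx i j) * mesh)\<^sup>2"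
  by (simp add: kernel_def max_absorb1)

lemma close_measurable [measurable]: "Measurable.pred (\<Omega> \<Otimes>\<^sub>M \<Omega>) close"
  unfolding close_def[abs_def] by measurable

lemma near_nonneg: "near p \<ge> 0"
  unfolding near_def by (intro integral_nonneg_AE) auto

lemma link_pos: "link p > 0"
proof -
  have "\<rho> * mesh > 0" using rho_pos mesh_pos by simp
  moreover have "4 / real k * weight p \<ge> 0" "4 * (real k + 1) * near p \<ge> 0"
    using weight_nonneg near_nonneg by auto
  ultimately show ?thesis unfolding link_def by linarith
qed

text \<open>A close pair is counted once for every index within \<open>k\<close> of its first cell,
  hence at most \<open>2 * k + 1\<close> times.\<close>

lemma near_sum: "(\<Sum>p<m. near p) \<le> (2 * real k + 1) * (\<integral>z. of_bool (close z) \<partial>(\<Omega> \<Otimes>\<^sub>M \<Omega>))"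
proof -
  have int: "integrable (\<Omega> \<Otimes>\<^sub>M \<Omega>) (\<lambda>z. of_bool (close z \<and> dist_idx p (cell (fst z)) \<le> k) :: real)" for p
    by (rule pair.P.integrable_const_bound[of _ 1]) auto
  have int1: "integrable (\<Omega> \<Otimes>\<^sub>M \<Omega>) (\<lambda>z. of_bool (close z) :: real)"
    by (rule pair.P.integrable_const_bound[of _ 1]) auto
  have "(\<Sum>p<m. near p) = (\<integral>z. (\<Sum>p<m. of_bool (close z \<and> dist_idx p (cell (fst z)) \<le> k)) \<partial>(\<Omega> \<Otimes>\<^sub>M \<Omega>))"
    unfolding near_def by (rule Bochner_Integration.integral_sum[symmetric]) (rule int)
  also have "\<dots> \<le> (\<integral>z. (2 * real k + 1) * of_bool (close z) \<partial>(\<Omega> \<Otimes>\<^sub>M \<Omega>))"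
  proof (intro integral_mono Bochner_Integration.integrable_sum int integrable_mult_right int1)
    fix z :: "'a \<times> 'a"
    define i where "i = cell (fst z)"
    have "(\<Sum>p<m. of_bool (dist_idx p i \<le> k)) = real (card {p\<in>{..<m}. dist_idx p i \<le> k})"
      by (simp add: of_bool_def sum.If_cases Int_def)
    also have "\<dots> \<le> real (card {i - k..i + k})"
      by (intro of_nat_mono card_mono) (auto simp: dist_idx_def)
    also have "\<dots> \<le> 2 * real k + 1" by simp
    finally have "(\<Sum>p<m. of_bool (dist_idx p i \<le> k)) \<le> 2 * real k + 1" .
    then show "(\<Sum>p<m. of_bool (close z \<and> dist_idx p (cell (fst z)) \<le> k)) \<le> (2 * real k + 1) * of_bool (close z)"
      unfolding i_def[symmetric] by (cases "close z") auto
  qed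
  finally show ?thesis by simp
qed

text \<open>The total link strength is the error of the grid argument. The quadratic factor in
  \<open>k\<close> before the probability of close pairs is the reason to keep \<open>k\<close>
  fixed while the mesh shrinks.\<close>

lemma link_sum: "(\<Sum>p<m. link p) \<le> 2 * R * \<rho> + 4 / real k + 4 * (real k + 1) * (2 * real k + 1) * (\<integral>z. of_bool (close z) \<partial>(\<Omega> \<Otimes>\<^sub>M \<Omega>))"
proof -
  have "(\<Sum>p<m. link p) = real m * (\<rho> * mesh) + 4 / real k * (\<Sum>p<m. weight p) + 4 * (real k + 1) * (\<Sum>p<m. near p)"
    unfolding link_def by (simp add: sum.distrib sum_distrib_left)
  also have "(\<Sum>p<m. weight p) = 1" using weight_sum weight_last by (simp add: lessThan_Suc_atMost[symmetric])
  also have "real m * (\<rho> * mesh) = 2 * R * \<rho>" using m_pos by (simp add: mesh_def)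
  also have "4 * (real k + 1) * (\<Sum>p<m. near p) \<le> 4 * (real k + 1) * ((2 * real k + 1) * (\<integral>z. of_bool (close z) \<partial>(\<Omega> \<Otimes>\<^sub>M \<Omega>)))"
    by (intro mult_left_mono near_sum) auto
  finally show ?thesis by (simp add: mult.assoc)
qed

end

text \<open>\<open>h_eq\<close> is the Euler equation of the discrete Stein functional, with the
  centered node as load; its solution \<open>h\<close> plays the part of the minimizer.\<close>

locale grid_equilibrium = stein_grid +
  fixes h :: "nat \<Rightarrow> real"
  assumes h0: "h 0 = 0" and h_mono: "\<And>i j. i \<le> j \<Longrightarrow> j \<le> m \<Longrightarrow> h i \<le> h j"
    and h_eq: "\<And>f. chain_form m (\<lambda>i. link i / mesh\<^sup>2) cond h f = (\<Sum>i\<le>m. weight i * (node i - center) * f i)"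
begin

definition energy :: real where "energy = chain_form m (\<lambda>i. link i / mesh\<^sup>2) cond h h"
definition slope :: "nat \<Rightarrow> real" where "slope i = (h (Suc i) - h i) / mesh"
text \<open>A \<open>C\<^sup>1\<close> function with the value \<open>h i\<close> at
  \<open>node i\<close> that climbs to \<open>h (Suc i)\<close> across cell \<open>i\<close>, hence
  an admissible test function for \<open>X_stein\<close>.\<close>

definition interp :: "real \<Rightarrow> real" where
  "interp x = (\<Sum>p<m. (h (Suc p) - h p) * smooth_step ((x - node p) / mesh))"
definition interp' :: "real \<Rightarrow> real" where
  "interp' x = (\<Sum>p<m. (h (Suc p) - h p) * (smooth_step' ((x - node p) / mesh) * (1 / mesh)))"
definition nonlocal :: real where "nonlocal = (\<Sum>i\<le>m. \<Sum>j\<le>m. cond i j * (h i - h j)\<^sup>2)"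

lemma diff_slope: "h (Suc i) - h i = slope i * mesh"
  using mesh_pos by (simp add: slope_def)

lemma slope_nonneg: "i < m \<Longrightarrow> slope i \<ge> 0"
  unfolding slope_def using h_mono[of i "Suc i"] mesh_pos by simp

lemma interp_DERIV: "(interp has_real_derivative interp' x) (at x)"
  unfolding interp_def[abs_def] interp'_def
  using mesh_pos
  by (intro DERIV_sum DERIV_cmult DERIV_chain'[OF _ smooth_step_DERIV]) (auto intro!: derivative_eq_intros)

lemma continuous_interp': "continuous_on UNIV interp'"
  unfolding interp'_def[abs_def] using mesh_pos
  by (intro continuous_intros continuous_on_compose2[OF continuous_smooth_step'[of UNIV]]) auto

lemma interp_measurable [measurable]: "interp \<in> borel_measurable borel"
  by (intro borel_measurable_continuous_onI continuous_at_imp_continuous_on ballI DERIV_isCont[OF interp_DERIV])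

lemma smooth_step_node:
  assumes "node i \<le> x" "x < node i + mesh"
  shows "p < i \<Longrightarrow> smooth_step ((x - node p) / mesh) = 1" "i < p \<Longrightarrow> smooth_step ((x - node p) / mesh) = 0"
proof -
  assume "p < i"
  then have "real p + 1 \<le> real i" by simp
  then have "(real p + 1) * mesh \<le> real i * mesh" using mesh_pos by (intro mult_right_mono) auto
  then have "mesh \<le> x - node p" using assms by (simp add: node_def algebra_simps)
  then show "smooth_step ((x - node p) / mesh) = 1" using mesh_pos by (intro smooth_step_1) (simp add: le_divide_eq)
next
  assume "i < p"
  then have "real i + 1 \<le> real p" by simp
  then have "(real i + 1) * mesh \<le> real p * mesh" using mesh_pos by (intro mult_right_mono) auto
  then have "x - node p \<le> 0" using assms by (simp add: node_def algebra_simps)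
  then show "smooth_step ((x - node p) / mesh) = 0" using mesh_pos by (intro smooth_step_0) (simp add: divide_le_0_iff)
qed

lemma interp_cell:
  assumes "i < m" "node i \<le> x" "x < node i + mesh"
  shows "interp x = h i + (h (Suc i) - h i) * smooth_step ((x - node i) / mesh)"
proof -
  have "interp x = (\<Sum>p<m. (if p < i then h (Suc p) - h p else 0) + (if p = i then (h (Suc i) - h i) * smooth_step ((x - node i) / mesh) else 0))"
    unfolding interp_def using smooth_step_node[OF assms(2,3)]
    by (intro sum.cong refl) (auto simp: not_less_iff_gr_or_eq)
  also have "\<dots> = (\<Sum>p<m. if p < i then h (Suc p) - h p else 0) + (h (Suc i) - h i) * smooth_step ((x - node i) / mesh)"
    using assms(1) by (simp add: sum.distrib)
  also have "(\<Sum>p<m. if p < i then h (Suc p) - h p else 0) = (\<Sum>p<i. h (Suc p) - h p)"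
    using assms(1) by (intro sum.mono_neutral_cong_right) auto
  also have "\<dots> = h i" unfolding sum_lessThan_telescope using h0 by simp
  finally show ?thesis .
qed

lemma interp_cell_bounds:
  assumes "i < m" "node i \<le> x" "x < node i + mesh"
  shows "0 \<le> interp x - h i" "interp x - h i \<le> slope i * mesh"
  unfolding interp_cell[OF assms] diff_slope
  using slope_nonneg[OF assms(1)] smooth_step_range[of "(x - node i) / mesh"] mesh_pos
  by (auto intro!: mult_nonneg_nonneg mult_left_le)

text \<open>For far pairs the difference of node values dominates. Young's inequality with parameter
  \<open>1 / k\<close> splits off the interpolation error and costs one factor
  \<open>1 + 1 / k\<close>; replacing the distance of the points by that of the nodes costs two
  more. For near pairs the increment is spread over at most \<open>k + 1\<close> cells, and
  Cauchy-Schwarz bounds it by the slopes there.\<close>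

lemma interp_quotient_bound:
  assumes i: "i < m" "node i \<le> x" "x < node i + mesh" and j: "j < m" "node j \<le> y" "y < node j + mesh"
  shows "((interp x - interp y) / (x - y))\<^sup>2 \<le> (1 + 1 / real k) ^ 3 * (kernel (dist_idx i j) * (h i - h j)\<^sup>2)
     + 2 / real k * ((slope i)\<^sup>2 + (slope j)\<^sup>2)
     + 4 * (real k + 1) * (of_bool (x \<noteq> y \<and> \<bar>x - y\<bar> < (real k + 1) * mesh) * (\<Sum>p<m. of_bool (dist_idx p i \<le> k) * (slope p)\<^sup>2))"
proof -
  define r where "r = dist_idx i j"
  define T1 where "T1 = (1 + 1 / real k) ^ 3 * (kernel r * (h i - h j)\<^sup>2)"
  define T2 where "T2 = 2 / real k * ((slope i)\<^sup>2 + (slope j)\<^sup>2)"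
  define T3 where "T3 = (\<Sum>p<m. of_bool (dist_idx p i \<le> k) * (slope p)\<^sup>2)"
  have T: "T1 \<ge> 0" "T2 \<ge> 0" "T3 \<ge> 0" unfolding T1_def T2_def T3_def
    using kernel_nonneg by (auto intro!: sum_nonneg)
  have k1: "real k \<ge> 1" using k_pos by simp
  have dij: "\<bar>real i - real j\<bar> = real r" unfolding r_def dist_idx_def by simp
  have nij: "\<bar>node i - node j\<bar> = real r * mesh"
    unfolding node_def dij[symmetric] using mesh_pos by (simp add: abs_mult left_diff_distrib[symmetric])
  show ?thesis
  proof (cases "r > k")
    case True
    have low: "(real r - 1) * mesh \<le> \<bar>x - y\<bar>"
      using nij i j by (simp add: algebra_simps)
    have r1: "real k \<le> real r - 1" using True by simp
    have kmesh: "0 < real k * mesh" using k1 mesh_pos by simp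
    \<comment> \<open>As \<open>r\<close> is at least \<open>k + 1\<close>, the ratio
      \<open>(r - 1) / r\<close> is at least \<open>k / (k + 1)\<close>.\<close>
    have rk: "real r * real k / (real k + 1) \<le> real r - 1"
      using r1 k1 by (subst pos_divide_le_eq) (simp_all add: algebra_simps)
    have xy0: "\<bar>x - y\<bar> > 0" using low mult_right_mono[OF r1, of mesh] kmesh mesh_pos by linarith
    define A where "A = h i - h j"
    define B where "B = (interp x - h i) - (interp y - h j)"
    \<comment> \<open>\<open>B\<close> is the difference of two nonnegative excesses over the node
      values, since \<open>h\<close> increases, so its square needs no factor 2.\<close>
    have B2: "B\<^sup>2 \<le> mesh\<^sup>2 * ((slope i)\<^sup>2 + (slope j)\<^sup>2)"
    proof -
      note a = interp_cell_bounds[OF i] and b = interp_cell_bounds[OF j]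
      have "B\<^sup>2 \<le> (interp x - h i)\<^sup>2 + (interp y - h j)\<^sup>2"
        unfolding B_def by (rule diff_square_le[OF mult_nonneg_nonneg[OF a(1) b(1)]])
      also have "\<dots> \<le> (slope i * mesh)\<^sup>2 + (slope j * mesh)\<^sup>2"
        using a b by (intro add_mono power_mono) auto
      finally show ?thesis by (simp add: power_mult_distrib algebra_simps)
    qed
    have AB: "(A + B)\<^sup>2 \<le> (1 + 1 / real k) * A\<^sup>2 + (1 + real k) * B\<^sup>2"
    proof -
      have "0 \<le> (A - real k * B)\<^sup>2 / real k" by simp
      also have "\<dots> = A\<^sup>2 / real k - 2 * A * B + real k * B\<^sup>2"
        using k1 by (simp add: power2_eq_square field_simps)
      finally show ?thesis by (simp add: power2_eq_square algebra_simps)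
    qed
    have q1: "1 / (x - y)\<^sup>2 \<le> (1 + 1 / real k)\<^sup>2 * kernel r"
    proof -
      have "real r * real k / (real k + 1) * mesh \<le> \<bar>x - y\<bar>"
        using low mult_right_mono[OF rk, of mesh] mesh_pos by linarith
      then have "(real r * real k / (real k + 1) * mesh)\<^sup>2 \<le> (x - y)\<^sup>2"
        using k1 mesh_pos by (subst power2_abs[symmetric, of "x - y"], intro power_mono) auto
      then have "1 / (x - y)\<^sup>2 \<le> 1 / (real r * real k / (real k + 1) * mesh)\<^sup>2"
        using k1 mesh_pos True by (intro divide_left_mono mult_pos_pos) (use xy0 in auto)
      also have "\<dots> = (1 + 1 / real k)\<^sup>2 * kernel r"
        using k1 mesh_pos True unfolding kernel_far[OF True[unfolded r_def], folded r_def]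
        by (simp add: field_simps power2_eq_square)
      finally show ?thesis .
    qed
    have q2: "1 / (x - y)\<^sup>2 \<le> 1 / (real k * mesh)\<^sup>2"
    proof -
      have "real k * mesh \<le> \<bar>x - y\<bar>" using low mult_right_mono[OF r1, of mesh] mesh_pos by linarith
      then have "(real k * mesh)\<^sup>2 \<le> (x - y)\<^sup>2"
        using kmesh by (subst power2_abs[symmetric, of "x - y"], intro power_mono) auto
      then show ?thesis using kmesh xy0 k_pos mesh_pos by (intro divide_left_mono mult_pos_pos) auto
    qed
    have "((interp x - interp y) / (x - y))\<^sup>2 = (A + B)\<^sup>2 * (1 / (x - y)\<^sup>2)"
      by (simp add: A_def B_def power_divide)
    also have "\<dots> \<le> ((1 + 1 / real k) * A\<^sup>2 + (1 + real k) * B\<^sup>2) * (1 / (x - y)\<^sup>2)"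
      using AB by (intro mult_right_mono) auto
    also have "\<dots> = (1 + 1 / real k) * A\<^sup>2 * (1 / (x - y)\<^sup>2) + (1 + real k) * B\<^sup>2 * (1 / (x - y)\<^sup>2)"
      by (rule distrib_right)
    also have "\<dots> \<le> (1 + 1 / real k) * A\<^sup>2 * ((1 + 1 / real k)\<^sup>2 * kernel r)
        + (1 + real k) * (mesh\<^sup>2 * ((slope i)\<^sup>2 + (slope j)\<^sup>2)) * (1 / (real k * mesh)\<^sup>2)"
      using q1 q2 B2 by (intro add_mono mult_mono mult_left_mono mult_nonneg_nonneg) auto
    also have "(1 + 1 / real k) * A\<^sup>2 * ((1 + 1 / real k)\<^sup>2 * kernel r) = T1"
      unfolding T1_def A_def by (simp add: power2_eq_square power3_eq_cube)
    also have "(1 + real k) * (mesh\<^sup>2 * ((slope i)\<^sup>2 + (slope j)\<^sup>2)) * (1 / (real k * mesh)\<^sup>2)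
       = (1 + real k) / (real k)\<^sup>2 * ((slope i)\<^sup>2 + (slope j)\<^sup>2)"
      using mesh_pos by (simp add: power_mult_distrib)
    also have "\<dots> \<le> T2"
    proof -
      have "(1 + real k) / (real k)\<^sup>2 \<le> 2 / real k" using k1 by (simp add: power2_eq_square field_simps)
      then show ?thesis unfolding T2_def by (intro mult_right_mono) auto
    qed
    finally have "((interp x - interp y) / (x - y))\<^sup>2 \<le> T1 + T2" by simp
    moreover have "0 \<le> 4 * (real k + 1) * (of_bool (x \<noteq> y \<and> \<bar>x - y\<bar> < (real k + 1) * mesh) * T3)" using T by auto
    ultimately show ?thesis unfolding T1_def T2_def T3_def r_def by linarith
  next
    case False
    show ?thesis
    proof (cases "x = y")
      case True
      then show ?thesis using T unfolding T1_def T2_def T3_def r_def by simp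
    next
      case xy: False
      have "\<bar>x - y\<bar> < \<bar>node i - node j\<bar> + mesh" using i j by linarith
      also have "\<dots> \<le> (real k + 1) * mesh" unfolding nij using False mesh_pos
        by (simp add: algebra_simps mult_right_mono)
      finally have cl: "x \<noteq> y \<and> \<bar>x - y\<bar> < (real k + 1) * mesh" using xy by simp
      \<comment> \<open>Only the steps in cells from \<open>i\<close> to \<open>j\<close>
        contribute; at any other index both smooth steps are 0 or both are 1.\<close>
      define P where "P = {min i j..max i j}"
      define s where "s p = mesh * (smooth_step ((x - node p) / mesh) - smooth_step ((y - node p) / mesh))" for p
      have Pm: "P \<subseteq> {..<m}" unfolding P_def using i j by auto
      have cardP: "real (card P) \<le> real k + 1" using False unfolding P_def r_def dist_idx_def by auto
      have "interp x - interp y = (\<Sum>p<m. slope p * s p)"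
        unfolding interp_def s_def sum_subtractf[symmetric] diff_slope by (intro sum.cong) (auto simp: algebra_simps)
      also have "\<dots> = (\<Sum>p\<in>P. slope p * s p)"
      proof (rule sum.mono_neutral_right[OF _ Pm])
        show "\<forall>p\<in>{..<m} - P. slope p * s p = 0"
        proof
          fix p assume "p \<in> {..<m} - P"
          then have "(p < i \<and> p < j) \<or> (i < p \<and> j < p)" unfolding P_def by (auto simp: min_def max_def split: if_splits)
          then show "slope p * s p = 0" using smooth_step_node[OF i(2,3), of p] smooth_step_node[OF j(2,3), of p]
            by (auto simp: s_def)
        qed
      qed simp
      finally have "(interp x - interp y)\<^sup>2 \<le> (\<Sum>p\<in>P. (slope p)\<^sup>2) * (\<Sum>p\<in>P. (s p)\<^sup>2)"
        using Cauchy_Schwarz_ineq_sum[of slope s P] by simp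
      also have "\<dots> \<le> T3 * ((real k + 1) * (4 * (x - y)\<^sup>2))"
      proof (intro mult_mono)
        have "(\<Sum>p\<in>P. (slope p)\<^sup>2) = (\<Sum>p\<in>P. of_bool (dist_idx p i \<le> k) * (slope p)\<^sup>2)"
          using False by (intro sum.cong) (auto simp: P_def r_def dist_idx_def min_def max_def split: if_splits)
        also have "\<dots> \<le> T3" unfolding T3_def by (rule sum_mono2) (use Pm in auto)
        finally show "(\<Sum>p\<in>P. (slope p)\<^sup>2) \<le> T3" .
        \<comment> \<open>The 4 is the square of the Lipschitz constant 2 of
          \<open>smooth_step\<close>; the scaling by \<open>mesh\<close> cancels.\<close>
        have "(s p)\<^sup>2 \<le> 4 * (x - y)\<^sup>2" for p
        proof -
          have "\<bar>s p\<bar> \<le> mesh * (2 * \<bar>(x - node p) / mesh - (y - node p) / mesh\<bar>)"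
            unfolding s_def abs_mult using mesh_pos smooth_step_lipschitz by (simp add: mult_left_mono)
          also have "\<dots> = 2 * \<bar>x - y\<bar>" using mesh_pos
            by (simp add: diff_divide_distrib[symmetric] abs_divide)
          finally have "\<bar>s p\<bar>\<^sup>2 \<le> (2 * \<bar>x - y\<bar>)\<^sup>2" by (intro power_mono) auto
          then show ?thesis by (simp add: power_mult_distrib)
        qed
        then have "(\<Sum>p\<in>P. (s p)\<^sup>2) \<le> (\<Sum>p\<in>P. 4 * (x - y)\<^sup>2)" by (intro sum_mono)
        also have "\<dots> \<le> (real k + 1) * (4 * (x - y)\<^sup>2)" using cardP by (simp add: mult_right_mono)
        finally show "(\<Sum>p\<in>P. (s p)\<^sup>2) \<le> (real k + 1) * (4 * (x - y)\<^sup>2)" .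
      qed (use T in \<open>auto intro: sum_nonneg\<close>)
      finally have bnd: "((interp x - interp y) / (x - y))\<^sup>2 \<le> 4 * (real k + 1) * T3"
        using xy by (simp add: power_divide divide_le_eq algebra_simps)
      have cl1: "of_bool (x \<noteq> y \<and> \<bar>x - y\<bar> < (real k + 1) * mesh) = (1::real)"
        by (subst eqTrueI[OF cl]) (rule of_bool_eq(2))
      show ?thesis unfolding cl1 mult_1_left using bnd T unfolding T1_def T2_def T3_def r_def by linarith
    qed
  qed
qed

lemma cond_nonneg: "cond i j \<ge> 0"
  unfolding cond_def using kernel_nonneg weight_nonneg by simp

lemma nonlocal_nonneg: "nonlocal \<ge> 0"
  unfolding nonlocal_def using cond_nonneg by (auto intro!: sum_nonneg)

lemma energy_eq: "energy = (\<Sum>p<m. link p * (slope p)\<^sup>2) + nonlocal"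
proof -
  have "link p / mesh\<^sup>2 * (h (Suc p) - h p) * (h (Suc p) - h p) = link p * (slope p)\<^sup>2" for p
    using mesh_pos by (simp add: slope_def power_divide power2_eq_square)
  then show ?thesis unfolding energy_def chain_form_def nonlocal_def by (simp add: power2_eq_square mult.assoc)
qed

text \<open>Only the uniform part of \<open>link\<close> is kept. It gives a control of
  \<open>H\<^sup>1\<close> type, from which the uniform bounds on the slopes and on \<open>h\<close>
  follow.\<close>

lemma link_slope_le_energy: "(\<Sum>p<m. \<rho> * mesh * (slope p)\<^sup>2) \<le> energy"
proof -
  have "(\<Sum>p<m. \<rho> * mesh * (slope p)\<^sup>2) \<le> (\<Sum>p<m. link p * (slope p)\<^sup>2)"
    unfolding link_def using weight_nonneg near_nonneg by (intro sum_mono mult_right_mono) auto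
  then show ?thesis unfolding energy_eq using nonlocal_nonneg by linarith
qed

lemma energy_nonneg: "energy \<ge> 0"
proof -
  have "(\<Sum>p<m. \<rho> * mesh * (slope p)\<^sup>2) \<ge> 0" using rho_pos mesh_pos by (intro sum_nonneg) auto
  then show ?thesis using link_slope_le_energy by linarith
qed

text \<open>Integrating the pointwise bound turns its kernel term into \<open>nonlocal\<close> and
  its slope terms into the last two summands of \<open>link\<close>, whose constants are chosen for
  this purpose; the symmetry between the two cells turns \<open>2 / k\<close> into
  \<open>4 / k\<close>.\<close>

lemma interp_energy:
  "(\<integral>z. ((interp (X (fst z)) - interp (X (snd z))) / (X (fst z) - X (snd z)))\<^sup>2 \<partial>(\<Omega> \<Otimes>\<^sub>M \<Omega>)) \<le> (1 + 1 / real k) ^ 3 * energy"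
proof -
  define B where "B = (1 + 1 / real k) ^ 3"
  have B1: "B \<ge> 1" unfolding B_def by (rule one_le_power) simp
  define G1 where "G1 i j = B * (kernel (dist_idx i j) * (h i - h j)\<^sup>2) + 2 / real k * ((slope i)\<^sup>2 + (slope j)\<^sup>2)" for i j
  define g where "g p z = (of_bool (close z \<and> dist_idx p (cell (fst z)) \<le> k) :: real)" for p z
  define G where "G z = G1 (cell (fst z)) (cell (snd z)) + 4 * (real k + 1) * (\<Sum>p<m. (slope p)\<^sup>2 * g p z)" for z
  have Ig: "integrable (\<Omega> \<Otimes>\<^sub>M \<Omega>) (g p)" for p
    unfolding g_def by (rule pair.P.integrable_const_bound[of _ 1]) auto
  note IG1 = disc_pair1(1)[of G1]
  have IG: "integrable (\<Omega> \<Otimes>\<^sub>M \<Omega>) G"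
    unfolding G_def by (intro Bochner_Integration.integrable_add IG1 integrable_mult_right Bochner_Integration.integrable_sum Ig)
  have bound: "((interp (X (fst z)) - interp (X (snd z))) / (X (fst z) - X (snd z)))\<^sup>2 \<le> G z" if "z \<in> space (\<Omega> \<Otimes>\<^sub>M \<Omega>)" for z
  proof -
    have z: "fst z \<in> space \<Omega>" "snd z \<in> space \<Omega>" using that by (auto simp: space_pair_measure)
    have "(\<Sum>p<m. (slope p)\<^sup>2 * g p z) = of_bool (close z) * (\<Sum>p<m. of_bool (dist_idx p (cell (fst z)) \<le> k) * (slope p)\<^sup>2)"
      unfolding g_def sum_distrib_left by (intro sum.cong) auto
    then show ?thesis
      using interp_quotient_bound[OF cell_range[OF z(1)] cell_range[OF z(2)]]
      unfolding G_def G1_def B_def close_def by simp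
  qed
  have "(\<integral>z. ((interp (X (fst z)) - interp (X (snd z))) / (X (fst z) - X (snd z)))\<^sup>2 \<partial>(\<Omega> \<Otimes>\<^sub>M \<Omega>)) \<le> (\<integral>z. G z \<partial>(\<Omega> \<Otimes>\<^sub>M \<Omega>))"
  proof (rule integral_mono[OF _ IG bound])
    show "integrable (\<Omega> \<Otimes>\<^sub>M \<Omega>) (\<lambda>z. ((interp (X (fst z)) - interp (X (snd z))) / (X (fst z) - X (snd z)))\<^sup>2)"
      by (rule Bochner_Integration.integrable_bound[OF IG]) (auto intro!: AE_I2 order_trans[OF bound])
  qed
  also have "\<dots> = (\<integral>z. G1 (cell (fst z)) (cell (snd z)) \<partial>(\<Omega> \<Otimes>\<^sub>M \<Omega>)) + 4 * (real k + 1) * (\<Sum>p<m. (slope p)\<^sup>2 * near p)"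
  proof -
    have "(\<integral>z. G z \<partial>(\<Omega> \<Otimes>\<^sub>M \<Omega>)) = (\<integral>z. G1 (cell (fst z)) (cell (snd z)) \<partial>(\<Omega> \<Otimes>\<^sub>M \<Omega>)) +
       (\<integral>z. 4 * (real k + 1) * (\<Sum>p<m. (slope p)\<^sup>2 * g p z) \<partial>(\<Omega> \<Otimes>\<^sub>M \<Omega>))"
      unfolding G_def by (intro Bochner_Integration.integral_add IG1 integrable_mult_right Bochner_Integration.integrable_sum Ig)
    also have "(\<integral>z. 4 * (real k + 1) * (\<Sum>p<m. (slope p)\<^sup>2 * g p z) \<partial>(\<Omega> \<Otimes>\<^sub>M \<Omega>)) = 4 * (real k + 1) * (\<Sum>p<m. (slope p)\<^sup>2 * near p)"
      unfolding integral_mult_right_zero near_def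
      by (subst Bochner_Integration.integral_sum) (auto simp: g_def[symmetric] Ig)
    finally show ?thesis .
  qed
  also have "(\<integral>z. G1 (cell (fst z)) (cell (snd z)) \<partial>(\<Omega> \<Otimes>\<^sub>M \<Omega>)) = B * nonlocal + 4 / real k * (\<Sum>i<m. weight i * (slope i)\<^sup>2)"
  proof -
    have "(\<integral>z. G1 (cell (fst z)) (cell (snd z)) \<partial>(\<Omega> \<Otimes>\<^sub>M \<Omega>)) = (\<Sum>i\<le>m. \<Sum>j\<le>m. weight i * weight j * G1 i j)"
      by (rule disc_pair1(2))
    also have "\<dots> = (\<Sum>i\<le>m. \<Sum>j\<le>m. B * (cond i j * (h i - h j)\<^sup>2) + (2 / real k * (weight i * (slope i)\<^sup>2) * weight j + 2 / real k * (weight j * (slope j)\<^sup>2) * weight i))"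
      by (intro sum.cong refl) (simp add: G1_def cond_def algebra_simps)
    also have "\<dots> = B * nonlocal + (\<Sum>i\<le>m. \<Sum>j\<le>m. 2 / real k * (weight i * (slope i)\<^sup>2) * weight j) + (\<Sum>i\<le>m. \<Sum>j\<le>m. 2 / real k * (weight j * (slope j)\<^sup>2) * weight i)"
      by (simp only: sum.distrib nonlocal_def sum_distrib_left add.assoc)
    also have "(\<Sum>i\<le>m. \<Sum>j\<le>m. 2 / real k * (weight j * (slope j)\<^sup>2) * weight i) = (\<Sum>i\<le>m. \<Sum>j\<le>m. 2 / real k * (weight i * (slope i)\<^sup>2) * weight j)"
      by (rule sum.swap)
    also have "(\<Sum>i\<le>m. \<Sum>j\<le>m. 2 / real k * (weight i * (slope i)\<^sup>2) * weight j) = 2 / real k * (\<Sum>i\<le>m. weight i * (slope i)\<^sup>2)"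
      unfolding sum_distrib_left[symmetric] weight_sum by (simp add: sum_distrib_left)
    also have "(\<Sum>i\<le>m. weight i * (slope i)\<^sup>2) = (\<Sum>i<m. weight i * (slope i)\<^sup>2)"
      using weight_last by (simp add: lessThan_Suc_atMost[symmetric])
    finally show ?thesis by simp
  qed
  also have "B * nonlocal + 4 / real k * (\<Sum>i<m. weight i * (slope i)\<^sup>2) + 4 * (real k + 1) * (\<Sum>p<m. (slope p)\<^sup>2 * near p)
     = B * nonlocal + (\<Sum>p<m. (4 / real k * weight p + 4 * (real k + 1) * near p) * (slope p)\<^sup>2)"
    by (simp add: sum_distrib_left sum.distrib[symmetric] algebra_simps)
  also have "\<dots> \<le> B * nonlocal + (\<Sum>p<m. link p * (slope p)\<^sup>2)"
    unfolding link_def using rho_pos mesh_pos by (intro add_left_mono sum_mono mult_right_mono) auto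
  also have "\<dots> \<le> B * energy"
  proof -
    have "0 \<le> (\<Sum>p<m. link p * (slope p)\<^sup>2)" using link_pos by (intro sum_nonneg mult_nonneg_nonneg) (auto simp: less_imp_le)
    then have "(\<Sum>p<m. link p * (slope p)\<^sup>2) \<le> B * (\<Sum>p<m. link p * (slope p)\<^sup>2)" using B1 mult_right_mono[of 1 B] by simp
    then show ?thesis unfolding energy_eq by (simp add: distrib_left)
  qed
  finally show ?thesis unfolding B_def .
qed

lemma cell_integrable: "integrable \<Omega> (Z :: 'a \<Rightarrow> real) \<Longrightarrow> integrable \<Omega> (\<lambda>p. g (cell p) * Z p)"
  by (rule disc(1))

lemma cell_expectation: "integrable \<Omega> (Z :: 'a \<Rightarrow> real) \<Longrightarrow> (\<integral>p. g (cell p) * Z p \<partial>\<Omega>) = (\<Sum>i\<le>m. g i * (\<integral>p. of_bool (cell p = i) * Z p \<partial>\<Omega>))"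
  by (rule disc(2))

lemma cell_pair_integrable: "integrable \<Omega> (Z :: 'a \<Rightarrow> real) \<Longrightarrow> integrable \<Omega> (W :: 'a \<Rightarrow> real) \<Longrightarrow> integrable (\<Omega> \<Otimes>\<^sub>M \<Omega>) (\<lambda>z. G (cell (fst z)) (cell (snd z)) * (Z (fst z) * W (snd z)))"
  by (rule disc_pair(1))

lemma cell_pair_expectation: "integrable \<Omega> (Z :: 'a \<Rightarrow> real) \<Longrightarrow> integrable \<Omega> (W :: 'a \<Rightarrow> real) \<Longrightarrow> (\<integral>z. G (cell (fst z)) (cell (snd z)) * (Z (fst z) * W (snd z)) \<partial>(\<Omega> \<Otimes>\<^sub>M \<Omega>)) =
      (\<Sum>i\<le>m. \<Sum>j\<le>m. G i j * ((\<integral>p. of_bool (cell p = i) * Z p \<partial>\<Omega>) * (\<integral>p. of_bool (cell p = j) * W p \<partial>\<Omega>)))"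
  by (rule disc_pair(2))

text \<open>Error of the first moment relative to \<open>sqrt energy\<close>: the oscillation of
  \<open>interp\<close> inside a cell, and the shift of \<open>X\<close> by node rounding and
  \<open>center\<close>, at most two meshes. It tends to 0 with the mesh for fixed \<rho>.\<close>

definition defect :: real where "defect = R * sqrt (mesh / \<rho>) + 2 * mesh * sqrt (2 * R / \<rho>)"

lemma slope_bound:
  assumes "i < m"
  shows "slope i * mesh \<le> sqrt energy * sqrt (mesh / \<rho>)"
proof -
  have "\<rho> * mesh * (slope i)\<^sup>2 \<le> (\<Sum>p<m. \<rho> * mesh * (slope p)\<^sup>2)"
    by (rule member_le_sum) (use assms rho_pos mesh_pos in auto)
  then have "\<rho> * mesh * (slope i)\<^sup>2 \<le> energy" using link_slope_le_energy by linarith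
  then have "mesh / \<rho> * (\<rho> * mesh * (slope i)\<^sup>2) \<le> mesh / \<rho> * energy"
    using rho_pos mesh_pos by (intro mult_left_mono) auto
  then have "(slope i * mesh)\<^sup>2 \<le> energy * (mesh / \<rho>)" using rho_pos by (simp add: power2_eq_square mult_ac)
  then show ?thesis unfolding real_sqrt_mult[symmetric] by (rule real_le_rsqrt)
qed

lemma h_bound:
  assumes "i \<le> m"
  shows "0 \<le> h i" "h i \<le> sqrt energy * sqrt (2 * R / \<rho>)"
proof -
  show "0 \<le> h i" using h_mono[of 0 i] assms h0 by simp
  have im: "h i \<le> h m" using h_mono assms by simp
  have hm: "h m = (\<Sum>p<m. slope p * mesh)"
    using sum_lessThan_telescope[of h m] h0 unfolding diff_slope by simp
  have "(h m)\<^sup>2 \<le> (\<Sum>p<m. (slope p * mesh)\<^sup>2) * real m"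
    unfolding hm using sum_squared_le_sum_of_squares[of "\<lambda>p. slope p * mesh" "{..<m}"] by simp
  also have "\<dots> = 2 * R / \<rho> * (\<Sum>p<m. \<rho> * mesh * (slope p)\<^sup>2)"
    unfolding sum_distrib_left sum_distrib_right
    by (intro sum.cong refl) (use rho_pos m_pos in \<open>simp add: mesh_def power2_eq_square field_simps\<close>)
  also have "\<dots> \<le> 2 * R / \<rho> * energy"
    using rho_pos R_pos link_slope_le_energy by (intro mult_left_mono) auto
  finally have "(h m)\<^sup>2 \<le> energy * (2 * R / \<rho>)" by (simp add: mult.commute)
  then have "h m \<le> sqrt energy * sqrt (2 * R / \<rho>)" unfolding real_sqrt_mult[symmetric] by (rule real_le_rsqrt)
  with im show "h i \<le> sqrt energy * sqrt (2 * R / \<rho>)" by simp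
qed

text \<open>Testing the Euler equation with \<open>h\<close> itself identifies \<open>energy\<close>
  with the discretized first moment; passing from grid values back to \<open>X\<close> and
  \<open>interp\<close> costs the defect.\<close>

lemma interp_mean: "\<bar>(\<integral>p. X p * interp (X p) \<partial>\<Omega>) - energy\<bar> \<le> sqrt energy * defect"
proof -
  have e: "energy = (\<integral>p. (node (cell p) - center) * h (cell p) \<partial>\<Omega>)"
    unfolding disc1(2)[of "\<lambda>i. (node i - center) * h i"] energy_def h_eq by (simp add: mult.assoc)
  have I1: "integrable \<Omega> (\<lambda>p. (node (cell p) - center) * h (cell p))"
    by (rule disc1(1)[of "\<lambda>i. (node i - center) * h i"])
  have diff: "\<bar>X p * interp (X p) - (node (cell p) - center) * h (cell p)\<bar> \<le> sqrt energy * defect" if p: "p \<in> space \<Omega>" for p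
  proof -
    note c = cell_range[OF p] and s = interp_cell_bounds[OF cell_range[OF p]]
    have "X p * interp (X p) - (node (cell p) - center) * h (cell p) =
       X p * (interp (X p) - h (cell p)) + (X p - node (cell p) + center) * h (cell p)"
      by (simp add: algebra_simps)
    also have "\<bar>\<dots>\<bar> \<le> \<bar>X p\<bar> * \<bar>interp (X p) - h (cell p)\<bar> + \<bar>X p - node (cell p) + center\<bar> * \<bar>h (cell p)\<bar>"
      by (rule order_trans[OF abs_triangle_ineq]) (simp add: abs_mult)
    also have "\<dots> \<le> R * (sqrt energy * sqrt (mesh / \<rho>)) + (2 * mesh) * (sqrt energy * sqrt (2 * R / \<rho>))"
    proof (intro add_mono mult_mono)
      show "\<bar>X p\<bar> \<le> R" using X_range[OF p] by auto
      show "\<bar>interp (X p) - h (cell p)\<bar> \<le> sqrt energy * sqrt (mesh / \<rho>)" using s slope_bound[OF c(1)] by linarith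
      show "\<bar>X p - node (cell p) + center\<bar> \<le> 2 * mesh" using node_cell_close[OF p] center_bound by linarith
      show "\<bar>h (cell p)\<bar> \<le> sqrt energy * sqrt (2 * R / \<rho>)" using h_bound[OF cell_le[OF p]] by linarith
    qed (use R_pos mesh_pos in auto)
    also have "\<dots> = sqrt energy * defect" by (simp add: defect_def algebra_simps)
    finally show ?thesis .
  qed
  have I2: "integrable \<Omega> (\<lambda>p. X p * interp (X p) - (node (cell p) - center) * h (cell p))"
    by (rule integrable_const_bound[of _ "sqrt energy * defect"]) (use diff in auto)
  have I3: "integrable \<Omega> (\<lambda>p. X p * interp (X p))"
    using Bochner_Integration.integrable_add[OF I2 I1] by simp
  have d: "(\<integral>p. X p * interp (X p) \<partial>\<Omega>) - energy = (\<integral>p. X p * interp (X p) - (node (cell p) - center) * h (cell p) \<partial>\<Omega>)"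
    unfolding e by (rule Bochner_Integration.integral_diff[OF I3 I1, symmetric])
  have "(\<integral>p. \<bar>X p * interp (X p) - (node (cell p) - center) * h (cell p)\<bar> \<partial>\<Omega>) \<le> (\<integral>p. sqrt energy * defect \<partial>\<Omega>)"
    by (rule integral_mono[OF integrable_abs[OF I2] _ diff]) simp
  then have "(\<integral>p. \<bar>X p * interp (X p) - (node (cell p) - center) * h (cell p)\<bar> \<partial>\<Omega>) \<le> sqrt energy * defect"
    by (simp add: prob_space)
  then show ?thesis unfolding d by (rule order_trans[OF integral_abs_bound])
qed

text \<open>The Stein inequality for \<open>interp\<close> bounds the first moment by a multiple of
  \<open>sqrt energy\<close>, while the first moment is \<open>energy\<close> up to the defect; one
  power of \<open>sqrt energy\<close> cancels.\<close>

lemma energy_bound: "energy \<le> (D * sqrt ((1 + 1 / real k) ^ 3) + defect)\<^sup>2"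
proof -
  define B where "B = (1 + 1 / real k) ^ 3"
  have B0: "B \<ge> 0" by (simp add: B_def)
  define I where "I = (\<integral>p. X p * interp (X p) \<partial>\<Omega>)"
  have "I\<^sup>2 \<le> D\<^sup>2 * (B * energy)"
    unfolding I_def B_def by (rule order_trans[OF X_stein[OF interp_DERIV continuous_interp'] mult_left_mono[OF interp_energy]]) simp
  also have "\<dots> = (D * sqrt B * sqrt energy)\<^sup>2" using B0 energy_nonneg by (simp add: power_mult_distrib)
  finally have "I \<le> D * sqrt B * sqrt energy"
    by (rule power2_le_imp_le) (use D_nonneg B0 energy_nonneg in auto)
  then have le: "energy \<le> sqrt energy * (D * sqrt B + defect)"
    using interp_mean unfolding I_def[symmetric] by (simp add: algebra_simps abs_le_iff)
  have c0: "D * sqrt B + defect \<ge> 0"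
    unfolding defect_def using D_nonneg B0 R_pos mesh_pos rho_pos by (intro add_nonneg_nonneg mult_nonneg_nonneg) auto
  have "sqrt energy \<le> D * sqrt B + defect"
  proof (cases "energy = 0")
    case False
    then have "sqrt energy > 0" using energy_nonneg by simp
    moreover have "sqrt energy * sqrt energy \<le> sqrt energy * (D * sqrt B + defect)" using le energy_nonneg by simp
    ultimately show ?thesis by (rule mult_left_le_imp_le[rotated])
  qed (use c0 in simp)
  then have "(sqrt energy)\<^sup>2 \<le> (D * sqrt B + defect)\<^sup>2" using energy_nonneg by (intro power_mono) auto
  then show ?thesis using energy_nonneg by (simp add: B_def)
qed

text \<open>On null cells the conditional mean of \<open>Y\<close> is filled in by a threshold value, which keeps it monotone.\<close>

definition threshold :: "nat \<Rightarrow> real" where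
  "threshold i = Sup (insert (-2) (Y ` {p \<in> space \<Omega>. cell p < i}))"

definition mean_Y :: "nat \<Rightarrow> real" where
  "mean_Y i = (if weight i = 0 then threshold i else (\<integral>p. of_bool (cell p = i) * Y p \<partial>\<Omega>) / weight i)"

lemma threshold_bdd: "bdd_above (insert (-2) (Y ` {p \<in> space \<Omega>. cell p < i}))"
  by (rule bdd_aboveI[of _ 2]) (auto dest: Y_range)

lemma below_threshold: "p \<in> space \<Omega> \<Longrightarrow> cell p < i \<Longrightarrow> Y p \<le> threshold i"
  unfolding threshold_def by (intro cSup_upper threshold_bdd) auto

lemma above_threshold: "p \<in> space \<Omega> \<Longrightarrow> i \<le> cell p \<Longrightarrow> threshold i \<le> Y p"
  unfolding threshold_def using comono_cell[of _ p] Y_range[of p] by (intro cSup_least) auto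

lemma threshold_mono: "threshold i \<le> threshold (Suc i)"
  unfolding threshold_def by (intro cSup_subset_mono threshold_bdd) auto

lemma weight_mean_Y: "weight i * mean_Y i = (\<integral>p. of_bool (cell p = i) * Y p \<partial>\<Omega>)"
proof (cases "weight i = 0")
  case True
  have I: "integrable \<Omega> (\<lambda>p. of_bool (cell p = i) :: real)" by (rule disc1(1)[of "\<lambda>j. of_bool (j = i)"])
  have "\<bar>\<integral>p. of_bool (cell p = i) * Y p \<partial>\<Omega>\<bar> \<le> (\<integral>p. \<bar>of_bool (cell p = i) * Y p\<bar> \<partial>\<Omega>)" by (rule integral_abs_bound)
  also have "\<dots> \<le> (\<integral>p. of_bool (cell p = i) * 2 \<partial>\<Omega>)"
    by (intro integral_mono integrable_abs integrable_mult_left I cell_integrable[OF integrable_Y, of "\<lambda>j. of_bool (j = i)"])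
       (auto dest: Y_range simp: abs_le_iff)
  also have "\<dots> = 0" using True by (simp add: weight_def)
  finally show ?thesis using True by simp
qed (simp add: mean_Y_def)

text \<open>By comonotonicity every value of \<open>Y\<close> on cell \<open>i\<close> lies between
  two consecutive thresholds, and so does an average. This interlacing gives monotonicity across
  null cells too.\<close>

lemma mean_Y_bounds: "threshold i \<le> mean_Y i" "mean_Y i \<le> threshold (Suc i)"
proof -
  have I: "integrable \<Omega> (\<lambda>p. of_bool (cell p = i) :: real)" by (rule disc1(1)[of "\<lambda>j. of_bool (j = i)"])
  have IY: "integrable \<Omega> (\<lambda>p. of_bool (cell p = i) * Y p)" by (rule cell_integrable[OF integrable_Y, of "\<lambda>j. of_bool (j = i)"])
  have "threshold i \<le> mean_Y i \<and> mean_Y i \<le> threshold (Suc i)"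
  proof (cases "weight i = 0")
    case False
    then have w: "weight i > 0" using weight_nonneg[of i] by linarith
    have "(\<integral>p. of_bool (cell p = i) * threshold i \<partial>\<Omega>) \<le> (\<integral>p. of_bool (cell p = i) * Y p \<partial>\<Omega>)"
      by (intro integral_mono integrable_mult_left I IY) (auto intro: above_threshold)
    moreover have "(\<integral>p. of_bool (cell p = i) * Y p \<partial>\<Omega>) \<le> (\<integral>p. of_bool (cell p = i) * threshold (Suc i) \<partial>\<Omega>)"
      by (intro integral_mono integrable_mult_left I IY) (auto intro: below_threshold)
    ultimately show ?thesis using w False by (simp add: mean_Y_def weight_def[symmetric] le_divide_eq divide_le_eq mult.commute)
  qed (simp add: mean_Y_def threshold_mono)
  then show "threshold i \<le> mean_Y i" "mean_Y i \<le> threshold (Suc i)" by auto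
qed

lemma mean_Y_mono: "mean_Y i \<le> mean_Y (Suc i)"
  using mean_Y_bounds(2)[of i] mean_Y_bounds(1)[of "Suc i"] by linarith

section \<open>Two lower bounds for the correlation of the grid variable with
  \<open>Y\<close>\<close>

definition corr :: real where "corr = (\<integral>p. node (cell p) * Y p \<partial>\<Omega>)"

text \<open>The grid version of \<open>a \<Delta>Y / \<Delta>X\<close>, the truncated kernel
  replacing the inverse square of the distance.\<close>

definition flow :: "'a \<times> 'a \<Rightarrow> real" where
  "flow z = kernel (dist_idx (cell (fst z)) (cell (snd z))) * (h (cell (fst z)) - h (cell (snd z))) * (Y (fst z) - Y (snd z))"

lemma flow_corr:
  shows "integrable (\<Omega> \<Otimes>\<^sub>M \<Omega>) flow" and "(\<integral>z. flow z \<partial>(\<Omega> \<Otimes>\<^sub>M \<Omega>)) \<le> corr"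
proof -
  define G where "G i j = kernel (dist_idx i j) * (h i - h j)" for i j
  have one: "integrable \<Omega> (\<lambda>_. 1 :: real)" by simp
  note P1 = cell_pair_integrable[OF integrable_Y one, of G] cell_pair_expectation[OF integrable_Y one, of G]
    and P2 = cell_pair_integrable[OF one integrable_Y, of G] cell_pair_expectation[OF one integrable_Y, of G]
  have fl: "flow z = G (cell (fst z)) (cell (snd z)) * (Y (fst z) * 1) - G (cell (fst z)) (cell (snd z)) * (1 * Y (snd z))" for z
    by (simp add: flow_def G_def algebra_simps)
  show "integrable (\<Omega> \<Otimes>\<^sub>M \<Omega>) flow"
    unfolding fl[abs_def] by (rule Bochner_Integration.integrable_diff[OF P1(1) P2(1)])
  have "(\<integral>z. flow z \<partial>(\<Omega> \<Otimes>\<^sub>M \<Omega>)) = (\<Sum>i\<le>m. \<Sum>j\<le>m. G i j * (weight i * mean_Y i * weight j)) - (\<Sum>i\<le>m. \<Sum>j\<le>m. G i j * (weight i * (weight j * mean_Y j)))"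
    unfolding fl[abs_def] Bochner_Integration.integral_diff[OF P1(1) P2(1)] P1(2) P2(2) weight_mean_Y by (simp add: weight_def)
  also have "\<dots> = (\<Sum>i\<le>m. \<Sum>j\<le>m. cond i j * (h i - h j) * (mean_Y i - mean_Y j))"
    unfolding sum_subtractf[symmetric] by (intro sum.cong refl) (simp add: G_def cond_def algebra_simps)
  also have "\<dots> \<le> chain_form m (\<lambda>i. link i / mesh\<^sup>2) cond h mean_Y"
  proof -
    have "0 \<le> (\<Sum>i<m. link i / mesh\<^sup>2 * (h (Suc i) - h i) * (mean_Y (Suc i) - mean_Y i))"
      using mean_Y_mono h_mono link_pos by (intro sum_nonneg mult_nonneg_nonneg) (auto simp: less_imp_le)
    then show ?thesis unfolding chain_form_def by simp
  qed
  also have "\<dots> = (\<Sum>i\<le>m. (node i - center) * (\<integral>p. of_bool (cell p = i) * Y p \<partial>\<Omega>))"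
    unfolding h_eq weight_mean_Y[symmetric] by (intro sum.cong) auto
  also have "\<dots> = (\<integral>p. (node (cell p) - center) * Y p \<partial>\<Omega>)"
    by (rule cell_expectation[OF integrable_Y, of "\<lambda>i. node i - center", symmetric])
  also have "\<dots> = (\<integral>p. node (cell p) * Y p \<partial>\<Omega>) - center * (\<integral>p. Y p \<partial>\<Omega>)"
    using cell_integrable[OF integrable_Y, of node] integrable_Y by (simp add: left_diff_distrib)
  also have "\<dots> = corr" unfolding corr_def Y_mean by simp
  finally show "(\<integral>z. flow z \<partial>(\<Omega> \<Otimes>\<^sub>M \<Omega>)) \<le> corr" .
qed

definition expansion :: "'a \<times> 'a \<Rightarrow> real" where
  "expansion z = (node (cell (fst z)) - node (cell (snd z))) / (Y (fst z) - Y (snd z))"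

lemma flow_expansion_nonneg:
  assumes "z \<in> space (\<Omega> \<Otimes>\<^sub>M \<Omega>)"
  shows "flow z \<ge> 0" "expansion z \<ge> 0"
proof -
  have z: "fst z \<in> space \<Omega>" "snd z \<in> space \<Omega>" using assms by (auto simp: space_pair_measure)
  have nm: "node i \<le> node j" if "i \<le> j" for i j using that mesh_pos by (simp add: node_def mult_right_mono)
  consider "cell (fst z) < cell (snd z)" | "cell (fst z) = cell (snd z)" | "cell (snd z) < cell (fst z)" by linarith
  then have "flow z \<ge> 0 \<and> expansion z \<ge> 0"
  proof cases
    case 1
    then have "h (cell (fst z)) - h (cell (snd z)) \<le> 0" "Y (fst z) - Y (snd z) \<le> 0" "node (cell (fst z)) - node (cell (snd z)) \<le> 0"
      using h_mono cell_le[OF z(2)] comono_cell[OF z] nm by auto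
    then show ?thesis unfolding flow_def expansion_def mult.assoc using kernel_nonneg
      by (intro conjI mult_nonneg_nonneg mult_nonpos_nonpos divide_nonpos_nonpos) auto
  next
    case 3
    then have "h (cell (fst z)) - h (cell (snd z)) \<ge> 0" "Y (fst z) - Y (snd z) \<ge> 0" "node (cell (fst z)) - node (cell (snd z)) \<ge> 0"
      using h_mono cell_le[OF z(1)] comono_cell[OF z(2,1)] nm by auto
    then show ?thesis unfolding flow_def expansion_def mult.assoc using kernel_nonneg
      by (intro conjI mult_nonneg_nonneg divide_nonneg_nonneg) auto
  qed (simp add: flow_def expansion_def)
  then show "flow z \<ge> 0" "expansion z \<ge> 0" by auto
qed

lemma node_sum: "c \<le> m \<Longrightarrow> node c = - R + mesh * (\<Sum>i\<in>{1..m}. of_bool (i \<le> c))"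
proof -
  assume "c \<le> m"
  have "(\<Sum>i\<in>{1..m}. of_bool (i \<le> c)) = real (card {i\<in>{1..m}. i \<le> c})"
    by (simp add: of_bool_def sum.If_cases Int_def)
  also have "{i\<in>{1..m}. i \<le> c} = {1..c}" using \<open>c \<le> m\<close> by auto
  finally show ?thesis by (simp add: node_def)
qed

text \<open>Comonotonicity makes the event \<open>i \<le> cell p\<close> an upper level set of
  \<open>Y\<close>, up to the null event that \<open>Y\<close> equals the threshold.\<close>

lemma AE_threshold: "AE p in \<Omega>. \<forall>i. of_bool (i \<le> cell p) = (indicator {threshold i<..} (Y p) :: real)"
proof -
  have "AE p in \<Omega>. \<forall>i. Y p \<noteq> threshold i" unfolding AE_all_countable using Y_null by blast
  with AE_space show ?thesis
  proof eventually_elim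
    case (elim p)
    show ?case
    proof
      fix i
      have "threshold i \<noteq> Y p" using elim by metis
      then show "of_bool (i \<le> cell p) = (indicator {threshold i<..} (Y p) :: real)"
        using elim below_threshold[of p i] above_threshold[of p i] by (cases "i \<le> cell p") (auto simp: indicator_def order_less_le)
    qed
  qed
qed

text \<open>The node is a sum of \<open>m\<close> steps in the cell index, almost everywhere steps
  in \<open>Y\<close>, and \<open>Y_step\<close> applies to each. Extended nonnegative integrals
  yield integrability along with the bound.\<close>

lemma expansion_corr:
  shows "integrable (\<Omega> \<Otimes>\<^sub>M \<Omega>) expansion" and "(\<integral>z. expansion z \<partial>(\<Omega> \<Otimes>\<^sub>M \<Omega>)) \<le> corr"
proof -
  define q where "q i z = (indicator {threshold i<..} (Y (fst z)) - indicator {threshold i<..} (Y (snd z))) / (Y (fst z) - Y (snd z))" for i z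
  have q0: "q i z \<ge> 0" for i z
    unfolding q_def by (auto simp: indicator_def divide_nonneg_nonneg divide_nonpos_nonpos)
  have [measurable]: "q i \<in> borel_measurable (\<Omega> \<Otimes>\<^sub>M \<Omega>)" for i unfolding q_def by measurable
  define a where "a i = (\<integral>p. Y p * indicator {threshold i<..} (Y p) \<partial>\<Omega>)" for i
  have a0: "a i \<ge> 0" for i unfolding a_def by (rule Y_tail_nonneg)
  have [measurable]: "expansion \<in> borel_measurable (\<Omega> \<Otimes>\<^sub>M \<Omega>)" unfolding expansion_def by measurable
  have pairAE: "AE z in \<Omega> \<Otimes>\<^sub>M \<Omega>. expansion z = mesh * (\<Sum>i\<in>{1..m}. q i z)"
  proof -
    have *: "AE x in \<Omega>. AE y in \<Omega>. expansion (x, y) = mesh * (\<Sum>i\<in>{1..m}. q i (x, y))"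
      using AE_threshold AE_space
    proof eventually_elim
      case x: (elim x)
      show ?case using AE_threshold AE_space
      proof eventually_elim
        case y: (elim y)
        have "node (cell x) - node (cell y) = mesh * (\<Sum>i\<in>{1..m}. of_bool (i \<le> cell x) - of_bool (i \<le> cell y))"
          using node_sum[OF cell_le[of x]] node_sum[OF cell_le[of y]] x(2) y(2) by (simp add: sum_subtractf algebra_simps)
        then show "expansion (x, y) = mesh * (\<Sum>i\<in>{1..m}. q i (x, y))"
          unfolding expansion_def q_def fst_conv snd_conv using x(1) y(1) by (simp add: sum_divide_distrib[symmetric])
      qed
    qed
    show ?thesis by (rule pair.AE_pair_measure[OF _ *]) measurable
  qed
  have nn: "(\<integral>\<^sup>+ z. ennreal (expansion z) \<partial>(\<Omega> \<Otimes>\<^sub>M \<Omega>)) \<le> ennreal corr"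
  proof -
    have "(\<integral>\<^sup>+ z. ennreal (expansion z) \<partial>(\<Omega> \<Otimes>\<^sub>M \<Omega>)) = (\<integral>\<^sup>+ z. (\<Sum>i\<in>{1..m}. ennreal mesh * ennreal (q i z)) \<partial>(\<Omega> \<Otimes>\<^sub>M \<Omega>))"
    proof (rule nn_integral_cong_AE)
      show "AE z in \<Omega> \<Otimes>\<^sub>M \<Omega>. ennreal (expansion z) = (\<Sum>i\<in>{1..m}. ennreal mesh * ennreal (q i z))"
        using pairAE
      proof eventually_elim
        case (elim z)
        then show ?case using mesh_pos q0
          by (simp add: sum_distrib_left[symmetric] ennreal_mult sum_nonneg sum_ennreal)
      qed
    qed
    also have "\<dots> = (\<Sum>i\<in>{1..m}. ennreal mesh * (\<integral>\<^sup>+ z. ennreal (q i z) \<partial>(\<Omega> \<Otimes>\<^sub>M \<Omega>)))"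
      by (subst nn_integral_sum) (auto simp: nn_integral_cmult)
    also have "\<dots> \<le> (\<Sum>i\<in>{1..m}. ennreal mesh * ennreal (a i))"
      unfolding q_def a_def by (intro sum_mono mult_left_mono Y_step) auto
    also have "\<dots> = ennreal (mesh * (\<Sum>i\<in>{1..m}. a i))"
      using mesh_pos a0 by (simp add: sum_distrib_left[symmetric] ennreal_mult sum_nonneg sum_ennreal)
    also have "mesh * (\<Sum>i\<in>{1..m}. a i) = corr"
    proof -
      have I: "integrable \<Omega> (\<lambda>p. of_bool (i \<le> cell p) * Y p)" for i by (rule cell_integrable[OF integrable_Y, of "\<lambda>c. of_bool (i \<le> c)"])
      have a: "a i = (\<integral>p. of_bool (i \<le> cell p) * Y p \<partial>\<Omega>)" for i
        unfolding a_def
      proof (rule integral_cong_AE)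
        show "AE p in \<Omega>. Y p * indicator {threshold i<..} (Y p) = of_bool (i \<le> cell p) * Y p"
          using AE_threshold by eventually_elim (simp add: mult.commute)
      qed auto
      have "corr = (\<integral>p. - R * Y p + mesh * (\<Sum>i\<in>{1..m}. of_bool (i \<le> cell p) * Y p) \<partial>\<Omega>)"
        unfolding corr_def
      proof (rule Bochner_Integration.integral_cong[OF refl])
        fix p assume p: "p \<in> space \<Omega>"
        show "node (cell p) * Y p = - R * Y p + mesh * (\<Sum>i\<in>{1..m}. of_bool (i \<le> cell p) * Y p)"
          unfolding node_sum[OF cell_le[OF p]] sum_distrib_right[symmetric] distrib_right mult.assoc ..
      qed
      also have "\<dots> = (\<integral>p. - R * Y p \<partial>\<Omega>) + (\<integral>p. mesh * (\<Sum>i\<in>{1..m}. of_bool (i \<le> cell p) * Y p) \<partial>\<Omega>)"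
        by (intro Bochner_Integration.integral_add integrable_mult_right integrable_Y Bochner_Integration.integrable_sum I)
      also have "\<dots> = mesh * (\<Sum>i\<in>{1..m}. a i)"
        unfolding integral_mult_right_zero Y_mean a by (subst Bochner_Integration.integral_sum) (auto simp: I)
      finally show ?thesis by simp
    qed
    finally show ?thesis .
  qed
  note e0 = flow_expansion_nonneg(2)
  show I: "integrable (\<Omega> \<Otimes>\<^sub>M \<Omega>) expansion"
    using nn by (intro integrableI_nonneg) (auto intro!: AE_I2 e0 simp: less_top[symmetric] top_unique)
  have "ennreal (\<integral>z. expansion z \<partial>(\<Omega> \<Otimes>\<^sub>M \<Omega>)) \<le> ennreal corr"
    using nn nn_integral_eq_integral[OF I] e0 by (simp add: AE_I2)
  \<comment> \<open>\<open>ennreal\<close> maps negative numbers to 0, so the bound returns to the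
    reals only for nonnegative \<open>corr\<close>; the flow estimate provides this.\<close>
  moreover have "corr \<ge> 0"
  proof -
    have "0 \<le> (\<integral>z. flow z \<partial>(\<Omega> \<Otimes>\<^sub>M \<Omega>))"
      by (intro integral_nonneg_AE AE_I2 flow_expansion_nonneg(1))
    then show ?thesis using flow_corr(2) by linarith
  qed
  ultimately show "(\<integral>z. expansion z \<partial>(\<Omega> \<Otimes>\<^sub>M \<Omega>)) \<le> corr" by (simp add: ennreal_le_iff)
qed

text \<open>AM-GM applies to \<open>expansion\<close> and \<open>flow\<close>, whose product
  \<open>P\<close> is the discrete \<open>a\<close>. Its first moment comes from testing the Euler
  equation with \<open>node\<close>, its second moment from the energy; both miss the link terms,
  which are estimated separately.\<close>

lemma grid_distance:
  "(\<integral>p. (node (cell p) - Y p)\<^sup>2 \<partial>\<Omega>) \<le> 1 - 2 * (\<integral>p. (node (cell p))\<^sup>2 \<partial>\<Omega>) + 3 * center\<^sup>2 + energy + 9 / 4 * (\<Sum>p<m. link p)"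
proof -
  define V2 where "V2 = (\<integral>p. (node (cell p))\<^sup>2 \<partial>\<Omega>)"
  have V2: "V2 = (\<Sum>i\<le>m. weight i * (node i)\<^sup>2)" unfolding V2_def by (rule disc1(2)[of "\<lambda>i. (node i)\<^sup>2"])
  define P where "P i j = kernel (dist_idx i j) * (h i - h j) * (node i - node j)" for i j
  note I1 = disc_pair1(1)[of P] and I2 = disc_pair1(1)[of "\<lambda>i j. (P i j)\<^sup>2"]
  have "(\<integral>z. 3 * P (cell (fst z)) (cell (snd z)) - (P (cell (fst z)) (cell (snd z)))\<^sup>2 \<partial>(\<Omega> \<Otimes>\<^sub>M \<Omega>)) \<le> (\<integral>z. expansion z + flow z \<partial>(\<Omega> \<Otimes>\<^sub>M \<Omega>))"
  proof (rule integral_mono_AE)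
    show "AE z in \<Omega> \<Otimes>\<^sub>M \<Omega>. 3 * P (cell (fst z)) (cell (snd z)) - (P (cell (fst z)) (cell (snd z)))\<^sup>2 \<le> expansion z + flow z"
      using Y_AE_neq AE_space
    proof eventually_elim
      case (elim z)
      have "expansion z * flow z = P (cell (fst z)) (cell (snd z))"
        unfolding expansion_def flow_def P_def using elim(1) by simp
      then show ?case using amgm_quartic[OF flow_expansion_nonneg(2)[OF elim(2)] flow_expansion_nonneg(1)[OF elim(2)]] by simp
    qed
  qed (intro Bochner_Integration.integrable_diff Bochner_Integration.integrable_add integrable_mult_right I1 I2 expansion_corr flow_corr)+
  also have "\<dots> \<le> 2 * corr"
    using expansion_corr flow_corr by simp
  also have "(\<integral>z. 3 * P (cell (fst z)) (cell (snd z)) - (P (cell (fst z)) (cell (snd z)))\<^sup>2 \<partial>(\<Omega> \<Otimes>\<^sub>M \<Omega>))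
    = 3 * (\<Sum>i\<le>m. \<Sum>j\<le>m. weight i * weight j * P i j) - (\<Sum>i\<le>m. \<Sum>j\<le>m. weight i * weight j * (P i j)\<^sup>2)"
    using I1 I2 disc_pair1(2)[of P] disc_pair1(2)[of "\<lambda>i j. (P i j)\<^sup>2"] by simp
  finally have key: "3 * (\<Sum>i\<le>m. \<Sum>j\<le>m. weight i * weight j * P i j) - (\<Sum>i\<le>m. \<Sum>j\<le>m. weight i * weight j * (P i j)\<^sup>2) \<le> 2 * corr" .
  have first: "(\<Sum>i\<le>m. \<Sum>j\<le>m. weight i * weight j * P i j) = V2 - center\<^sup>2 - (\<Sum>p<m. link p * slope p)"
  proof -
    have "chain_form m (\<lambda>i. link i / mesh\<^sup>2) cond h node = V2 - center\<^sup>2"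
    proof -
      have "(\<Sum>i\<le>m. weight i * (node i - center) * node i) = V2 - center * center"
        unfolding V2 unfolding center_def[of] sum_distrib_left sum_subtractf[symmetric]
        by (intro sum.cong refl) (simp add: power2_eq_square algebra_simps)
      then show ?thesis unfolding h_eq by (simp add: power2_eq_square)
    qed
    moreover have "(\<Sum>i<m. link i / mesh\<^sup>2 * (h (Suc i) - h i) * (node (Suc i) - node i)) = (\<Sum>p<m. link p * slope p)"
      using mesh_pos by (intro sum.cong refl) (simp add: slope_def node_def power2_eq_square field_simps)
    moreover have "(\<Sum>i\<le>m. \<Sum>j\<le>m. cond i j * (h i - h j) * (node i - node j)) = (\<Sum>i\<le>m. \<Sum>j\<le>m. weight i * weight j * P i j)"
      by (intro sum.cong refl) (simp add: cond_def P_def)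
    ultimately show ?thesis unfolding chain_form_def by simp
  qed
  have second: "(\<Sum>i\<le>m. \<Sum>j\<le>m. weight i * weight j * (P i j)\<^sup>2) \<le> energy - (\<Sum>p<m. link p * (slope p)\<^sup>2)"
  proof -
    have "weight i * weight j * (P i j)\<^sup>2 \<le> cond i j * (h i - h j)\<^sup>2" for i j
    proof -
      \<comment> \<open>One of the two kernels in the square is absorbed by the squared node
        distance.\<close>
      have "weight i * weight j * (P i j)\<^sup>2 = cond i j * (h i - h j)\<^sup>2 * (kernel (dist_idx i j) * (node i - node j)\<^sup>2)"
        by (simp add: P_def cond_def power2_eq_square)
      also have "\<dots> \<le> cond i j * (h i - h j)\<^sup>2 * 1"
        using cond_nonneg by (intro mult_left_mono kernel_node) auto
      finally show ?thesis by simp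
    qed
    then have "(\<Sum>i\<le>m. \<Sum>j\<le>m. weight i * weight j * (P i j)\<^sup>2) \<le> nonlocal"
      unfolding nonlocal_def by (intro sum_mono)
    then show ?thesis unfolding energy_eq by simp
  qed
  have third: "3 * (\<Sum>p<m. link p * slope p) - (\<Sum>p<m. link p * (slope p)\<^sup>2) \<le> 9 / 4 * (\<Sum>p<m. link p)"
  proof -
    \<comment> \<open>The maximum is at \<open>s = 3 / 2\<close>: the link energy kept from the
      second moment pays for the link term lost in the first, up to a multiple of the total link
      strength.\<close>
    have "3 * s - s\<^sup>2 \<le> 9 / 4" for s :: real
      using zero_le_power2[of "s - 3 / 2"] by (simp add: power2_eq_square algebra_simps)
    then have "link p * (3 * slope p - (slope p)\<^sup>2) \<le> link p * (9 / 4)" for p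
      using link_pos[of p] by (intro mult_left_mono) auto
    then have "(\<Sum>p<m. link p * (3 * slope p - (slope p)\<^sup>2)) \<le> (\<Sum>p<m. link p * (9 / 4))" by (intro sum_mono)
    moreover have "(\<Sum>p<m. link p * (3 * slope p - (slope p)\<^sup>2)) = 3 * (\<Sum>p<m. link p * slope p) - (\<Sum>p<m. link p * (slope p)\<^sup>2)"
      by (simp add: right_diff_distrib sum_subtractf sum_distrib_left algebra_simps)
    moreover have "(\<Sum>p<m. link p * (9 / 4)) = 9 / 4 * (\<Sum>p<m. link p)"
      by (simp add: sum_distrib_left mult.commute)
    ultimately show ?thesis by linarith
  qed
  have IY2: "integrable \<Omega> (\<lambda>p. (Y p)\<^sup>2)"
  proof (rule integrable_const_bound[of _ 4])
    show "AE p in \<Omega>. norm ((Y p)\<^sup>2) \<le> 4"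
    proof (rule AE_I2)
      fix p assume "p \<in> space \<Omega>"
      then have "\<bar>Y p\<bar> \<le> \<bar>2\<bar>" using Y_range[of p] by (auto simp: abs_le_iff)
      then have "(Y p)\<^sup>2 \<le> 2\<^sup>2" unfolding abs_le_square_iff .
      then show "norm ((Y p)\<^sup>2) \<le> 4" by simp
    qed
  qed measurable
  have "(\<integral>p. (node (cell p) - Y p)\<^sup>2 \<partial>\<Omega>) = (\<integral>p. (node (cell p))\<^sup>2 - 2 * (node (cell p) * Y p) + (Y p)\<^sup>2 \<partial>\<Omega>)"
    by (intro Bochner_Integration.integral_cong) (auto simp: power2_diff)
  also have "\<dots> = V2 - 2 * corr + 1"
    using disc1(1)[of "\<lambda>i. (node i)\<^sup>2"] cell_integrable[OF integrable_Y, of node] IY2 Y_var unfolding V2_def corr_def by simp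
  finally show ?thesis using key first second third unfolding V2_def by (simp add: algebra_simps)
qed

lemma distance_bound:
  "(\<integral>p. (X p - Y p)\<^sup>2 \<partial>\<Omega>) \<le> 1 - 2 * (\<integral>p. (X p)\<^sup>2 \<partial>\<Omega>) + 4 * R * mesh + 3 * mesh\<^sup>2 + 2 * mesh * (R + 2) + mesh\<^sup>2
     + (D * sqrt ((1 + 1 / real k) ^ 3) + (R * sqrt (mesh / \<rho>) + 2 * mesh * sqrt (2 * R / \<rho>)))\<^sup>2
     + 9 / 4 * (2 * R * \<rho> + 4 / real k + 4 * (real k + 1) * (2 * real k + 1) * (\<integral>z. of_bool (close z) \<partial>(\<Omega> \<Otimes>\<^sub>M \<Omega>)))"
proof -
  have node_R: "\<bar>node (cell p)\<bar> \<le> R" if "p \<in> space \<Omega>" for p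
    using cell_range[OF that] X_range[OF that] mesh_pos by (auto simp: node_def abs_le_iff)
  have Ib: "integrable \<Omega> f" if "f \<in> borel_measurable \<Omega>" "\<And>p. p \<in> space \<Omega> \<Longrightarrow> \<bar>f p\<bar> \<le> K" for f :: "'a \<Rightarrow> real" and K
    by (rule integrable_const_bound[of _ K]) (use that in auto)
  have sq: "\<bar>x\<^sup>2\<bar> \<le> K\<^sup>2" if "\<bar>x\<bar> \<le> K" for x K :: real
    using power_mono[OF that, of 2] by simp
  have Ixy: "integrable \<Omega> (\<lambda>p. (X p - Y p)\<^sup>2)"
  proof (rule Ib[of _ "(R + 2)\<^sup>2"])
    fix p assume p: "p \<in> space \<Omega>"
    have "\<bar>X p - Y p\<bar> \<le> R + 2" using X_range[OF p] Y_range[OF p] by (auto simp: abs_le_iff)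
    then show "\<bar>(X p - Y p)\<^sup>2\<bar> \<le> (R + 2)\<^sup>2" by (rule sq)
  qed measurable
  have Iny: "integrable \<Omega> (\<lambda>p. (node (cell p) - Y p)\<^sup>2)"
  proof (rule Ib[of _ "(R + 2)\<^sup>2"])
    fix p assume p: "p \<in> space \<Omega>"
    have "\<bar>node (cell p) - Y p\<bar> \<le> R + 2" using node_R[OF p] Y_range[OF p] by (auto simp: abs_le_iff)
    then show "\<bar>(node (cell p) - Y p)\<^sup>2\<bar> \<le> (R + 2)\<^sup>2" by (rule sq)
  qed measurable
  have "(\<integral>p. (X p - Y p)\<^sup>2 \<partial>\<Omega>) \<le> (\<integral>p. (node (cell p) - Y p)\<^sup>2 + (2 * mesh * (R + 2) + mesh\<^sup>2) \<partial>\<Omega>)"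
  proof (intro integral_mono Ixy Bochner_Integration.integrable_add Iny)
    fix p assume p: "p \<in> space \<Omega>"
    define a b where "a = X p - node (cell p)" and "b = node (cell p) - Y p"
    have a: "0 \<le> a" "a \<le> mesh" using cell_range[OF p] by (auto simp: a_def)
    have b: "b \<le> R + 2" using node_R[OF p] Y_range[OF p] by (auto simp: b_def abs_le_iff)
    have "a * b \<le> mesh * (R + 2)"
      using mult_left_mono[OF b a(1)] mult_right_mono[OF a(2), of "R + 2"] R_pos by linarith
    moreover have "a\<^sup>2 \<le> mesh\<^sup>2" using a by (intro power_mono) auto
    moreover have "X p - Y p = a + b" by (simp add: a_def b_def)
    ultimately show "(X p - Y p)\<^sup>2 \<le> (node (cell p) - Y p)\<^sup>2 + (2 * mesh * (R + 2) + mesh\<^sup>2)"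
      unfolding b_def[symmetric] by (simp add: power2_sum algebra_simps)
  qed auto
  also have "\<dots> = (\<integral>p. (node (cell p) - Y p)\<^sup>2 \<partial>\<Omega>) + (2 * mesh * (R + 2) + mesh\<^sup>2)"
    using Iny by (simp add: prob_space)
  finally have 1: "(\<integral>p. (X p - Y p)\<^sup>2 \<partial>\<Omega>) \<le> (\<integral>p. (node (cell p) - Y p)\<^sup>2 \<partial>\<Omega>) + (2 * mesh * (R + 2) + mesh\<^sup>2)" .
  have "(\<integral>p. (X p)\<^sup>2 \<partial>\<Omega>) \<le> (\<integral>p. (node (cell p))\<^sup>2 + 2 * R * mesh \<partial>\<Omega>)"
  proof (intro integral_mono Bochner_Integration.integrable_add disc1(1)[of "\<lambda>i. (node i)\<^sup>2"])
    show "integrable \<Omega> (\<lambda>p. (X p)\<^sup>2)"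
    proof (rule Ib[of _ "R\<^sup>2"])
      fix p assume "p \<in> space \<Omega>"
      then have "\<bar>X p\<bar> \<le> R" using X_range[of p] by (auto simp: abs_le_iff)
      then show "\<bar>(X p)\<^sup>2\<bar> \<le> R\<^sup>2" by (rule sq)
    qed measurable
    fix p assume p: "p \<in> space \<Omega>"
    have "(X p)\<^sup>2 - (node (cell p))\<^sup>2 = (X p - node (cell p)) * (X p + node (cell p))" by (simp add: power2_eq_square algebra_simps)
    also have "\<dots> \<le> mesh * (2 * R)"
    proof -
      have "(X p - node (cell p)) * (X p + node (cell p)) \<le> (X p - node (cell p)) * (2 * R)"
        using cell_range[OF p] node_R[OF p] X_range[OF p] by (intro mult_left_mono) (auto simp: abs_le_iff)
      also have "\<dots> \<le> mesh * (2 * R)" using cell_range[OF p] R_pos by (intro mult_right_mono) auto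
      finally show ?thesis .
    qed
    finally show "(X p)\<^sup>2 \<le> (node (cell p))\<^sup>2 + 2 * R * mesh" by (simp add: algebra_simps)
  qed auto
  also have "\<dots> = (\<integral>p. (node (cell p))\<^sup>2 \<partial>\<Omega>) + 2 * R * mesh"
    using disc1(1)[of "\<lambda>i. (node i)\<^sup>2"] by (simp add: prob_space)
  finally have 2: "(\<integral>p. (X p)\<^sup>2 \<partial>\<Omega>) \<le> (\<integral>p. (node (cell p))\<^sup>2 \<partial>\<Omega>) + 2 * R * mesh" .
  have 3: "center\<^sup>2 \<le> mesh\<^sup>2" using sq[OF center_bound] by simp
  show ?thesis using grid_distance 1 2 3 energy_bound[unfolded defect_def] link_sum by argo
qed

end

text \<open>The centered nodes increase and have weighted sum 0, so the equilibrium exists and is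
  monotone.\<close>

lemma (in stein_grid) grid_bound:
  "(\<integral>p. (X p - Y p)\<^sup>2 \<partial>\<Omega>) \<le> 1 - 2 * (\<integral>p. (X p)\<^sup>2 \<partial>\<Omega>) + 4 * R * mesh + 3 * mesh\<^sup>2 + 2 * mesh * (R + 2) + mesh\<^sup>2
     + (D * sqrt ((1 + 1 / real k) ^ 3) + (R * sqrt (mesh / \<rho>) + 2 * mesh * sqrt (2 * R / \<rho>)))\<^sup>2
     + 9 / 4 * (2 * R * \<rho> + 4 / real k + 4 * (real k + 1) * (2 * real k + 1) * (\<integral>z. of_bool (close z) \<partial>(\<Omega> \<Otimes>\<^sub>M \<Omega>)))"
proof -
  have cond: "(\<lambda>i j. kernel (nat \<bar>int i - int j\<bar>) * weight i * weight j) = cond"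
    by (simp add: fun_eq_iff cond_def dist_idx_def)
  have l: "link i / mesh\<^sup>2 > 0" for i using link_pos mesh_pos by simp
  have \<xi>: "mono (\<lambda>i. node i - center)" using mesh_pos by (auto simp: mono_def node_def mult_right_mono)
  have s0: "(\<Sum>i\<le>m. weight i * (node i - center)) = 0"
    unfolding right_diff_distrib sum_subtractf sum_distrib_right[symmetric] weight_sum center_def by simp
  obtain h where "h 0 = 0" "\<And>i j. i \<le> j \<Longrightarrow> j \<le> m \<Longrightarrow> h i \<le> h j"
    "\<And>f. chain_form m (\<lambda>i. link i / mesh\<^sup>2) cond h f = (\<Sum>i\<le>m. weight i * (node i - center) * f i)"
    by (rule chain_equilibrium[where K = kernel and w = weight and l = "\<lambda>i. link i / mesh\<^sup>2", OF l weight_nonneg kernel_nonneg kernel_antimono \<xi> s0, unfolded cond]) blast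
  then interpret grid_equilibrium \<Omega> X Y R D m k \<rho> h by unfold_locales auto
  show ?thesis by (rule distance_bound)
qed

section \<open>Refining the grid and removing the regularization\<close>

context comonotone_stein begin

text \<open>Only the mesh shrinks here. A pair with distinct \<open>X\<close> is eventually farther
  apart than \<open>k + 1\<close> meshes, so dominated convergence sends the probability of close
  pairs to 0.\<close>

lemma distance_limit:
  assumes "k > 0" "\<rho> > 0"
  shows "(\<integral>p. (X p - Y p)\<^sup>2 \<partial>\<Omega>) \<le> 1 - 2 * (\<integral>p. (X p)\<^sup>2 \<partial>\<Omega>) + (D * sqrt ((1 + 1 / real k) ^ 3))\<^sup>2 + 9 / 4 * (2 * R * \<rho> + 4 / real k)"
proof -
  interpret G: stein_grid \<Omega> X Y R D "Suc n" k \<rho> for n using assms by unfold_locales auto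
  have mesh: "(\<lambda>n. G.mesh n) \<longlonglongrightarrow> 0"
    unfolding G.mesh_def using tendsto_mult_right_zero[OF LIMSEQ_Suc[OF lim_1_over_n], of "2 * R"] by simp
  have sq: "(\<lambda>n. sqrt (G.mesh n / \<rho>)) \<longlonglongrightarrow> 0"
    using tendsto_real_sqrt[OF tendsto_divide[OF mesh tendsto_const, of \<rho>]] assms by simp
  have cl: "(\<lambda>n. \<integral>z. of_bool (G.close n z) \<partial>(\<Omega> \<Otimes>\<^sub>M \<Omega>)) \<longlonglongrightarrow> (0::real)"
  proof -
    have "(\<lambda>n. \<integral>z. of_bool (G.close n z) \<partial>(\<Omega> \<Otimes>\<^sub>M \<Omega>)) \<longlonglongrightarrow> (\<integral>z. 0 \<partial>(\<Omega> \<Otimes>\<^sub>M \<Omega>) :: real)"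
    proof (rule integral_dominated_convergence[where w="\<lambda>_. 1"])
      show "AE z in \<Omega> \<Otimes>\<^sub>M \<Omega>. (\<lambda>n. of_bool (G.close n z) :: real) \<longlonglongrightarrow> 0"
      proof (rule AE_I2)
        fix z
        show "(\<lambda>n. of_bool (G.close n z) :: real) \<longlonglongrightarrow> 0"
        proof (cases "X (fst z) = X (snd z)")
          case False
          have "(\<lambda>n. (real k + 1) * G.mesh n) \<longlonglongrightarrow> 0" using tendsto_mult_right_zero[OF mesh] .
          from order_tendstoD(2)[OF this, of "\<bar>X (fst z) - X (snd z)\<bar>"]
          have "\<forall>\<^sub>F n in sequentially. (real k + 1) * G.mesh n < \<bar>X (fst z) - X (snd z)\<bar>"
            using False by simp
          then have "\<forall>\<^sub>F n in sequentially. of_bool (G.close n z) = (0::real)"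
            by eventually_elim (auto simp: G.close_def)
          then show ?thesis by (rule tendsto_eventually)
        qed (simp add: G.close_def)
      qed
    qed auto
    then show ?thesis by simp
  qed
  have lim: "(\<lambda>n. 1 - 2 * (\<integral>p. (X p)\<^sup>2 \<partial>\<Omega>) + 4 * R * G.mesh n + 3 * (G.mesh n)\<^sup>2 + 2 * G.mesh n * (R + 2) + (G.mesh n)\<^sup>2
     + (D * sqrt ((1 + 1 / real k) ^ 3) + (R * sqrt (G.mesh n / \<rho>) + 2 * G.mesh n * sqrt (2 * R / \<rho>)))\<^sup>2
     + 9 / 4 * (2 * R * \<rho> + 4 / real k + 4 * (real k + 1) * (2 * real k + 1) * (\<integral>z. of_bool (G.close n z) \<partial>(\<Omega> \<Otimes>\<^sub>M \<Omega>))))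
    \<longlonglongrightarrow> 1 - 2 * (\<integral>p. (X p)\<^sup>2 \<partial>\<Omega>) + 4 * R * 0 + 3 * 0\<^sup>2 + 2 * 0 * (R + 2) + 0\<^sup>2
     + (D * sqrt ((1 + 1 / real k) ^ 3) + (R * 0 + 2 * 0 * sqrt (2 * R / \<rho>)))\<^sup>2
     + 9 / 4 * (2 * R * \<rho> + 4 / real k + 4 * (real k + 1) * (2 * real k + 1) * 0)"
    by (intro tendsto_add tendsto_diff tendsto_mult tendsto_power tendsto_const mesh sq cl)
  have "(\<integral>p. (X p - Y p)\<^sup>2 \<partial>\<Omega>) \<le> 1 - 2 * (\<integral>p. (X p)\<^sup>2 \<partial>\<Omega>) + 4 * R * 0 + 3 * 0\<^sup>2 + 2 * 0 * (R + 2) + 0\<^sup>2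
     + (D * sqrt ((1 + 1 / real k) ^ 3) + (R * 0 + 2 * 0 * sqrt (2 * R / \<rho>)))\<^sup>2
     + 9 / 4 * (2 * R * \<rho> + 4 / real k + 4 * (real k + 1) * (2 * real k + 1) * 0)"
    by (rule LIMSEQ_le_const[OF lim]) (use G.grid_bound in blast)
  then show ?thesis by simp
qed

text \<open>With \<open>k = n + 1\<close> and \<open>\<rho> = 1 / (n + 1)\<close> both
  regularizations disappear in a single limit.\<close>

theorem comonotone_distance: "(\<integral>p. (X p - Y p)\<^sup>2 \<partial>\<Omega>) \<le> 1 - 2 * (\<integral>p. (X p)\<^sup>2 \<partial>\<Omega>) + D\<^sup>2"
proof -
  have z: "(\<lambda>n. 1 / real (Suc n)) \<longlonglongrightarrow> 0" by (rule LIMSEQ_Suc[OF lim_1_over_n])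
  have z4: "(\<lambda>n. 4 / real (Suc n)) \<longlonglongrightarrow> 0" using tendsto_mult_right_zero[OF z, of 4] by simp
  have lim: "(\<lambda>n. 1 - 2 * (\<integral>p. (X p)\<^sup>2 \<partial>\<Omega>) + (D * sqrt ((1 + 1 / real (Suc n)) ^ 3))\<^sup>2 + 9 / 4 * (2 * R * (1 / real (Suc n)) + 4 / real (Suc n)))
     \<longlonglongrightarrow> 1 - 2 * (\<integral>p. (X p)\<^sup>2 \<partial>\<Omega>) + (D * sqrt ((1 + 0) ^ 3))\<^sup>2 + 9 / 4 * (2 * R * 0 + 0)"
    by (intro tendsto_add tendsto_diff tendsto_mult tendsto_power tendsto_const tendsto_real_sqrt z z4)
  have "(\<integral>p. (X p - Y p)\<^sup>2 \<partial>\<Omega>) \<le> 1 - 2 * (\<integral>p. (X p)\<^sup>2 \<partial>\<Omega>) + (D * sqrt ((1 + 0) ^ 3))\<^sup>2 + 9 / 4 * (2 * R * 0 + 0)"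
    by (rule LIMSEQ_le_const[OF lim]) (use distance_limit[of "Suc _" "1 / real (Suc _)"] in auto)
  then show ?thesis by simp
qed

end

section \<open>The transport inequality\<close>

text \<open>The distribution function is 1 at \<open>a\<close> and 0 below \<open>-a\<close>; its
  Galois relation with the pseudoinverse carries this over to the quantiles.\<close>

lemma (in cdf_distribution) quantile_range:
  assumes supp: "AE x in M. x \<in> {-a..a}" and \<omega>: "0 < \<omega>" "\<omega> < 1"
  shows "-a \<le> I \<omega>" "I \<omega> \<le> a"
proof -
  have "C a = 1" unfolding cdf_def by (subst prob_eq_1) (use supp in \<open>auto elim!: eventually_mono\<close>)
  then show "I \<omega> \<le> a" using pseudoinverse[OF \<omega>, of a] \<omega> by simp
  show "-a \<le> I \<omega>"
  proof (rule ccontr)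
    assume "\<not> -a \<le> I \<omega>"
    then obtain x where x: "I \<omega> < x" "x < -a" using dense[of "I \<omega>" "-a"] by auto
    have "C x = 0" unfolding cdf_def measure_eq_0_null_sets[symmetric]
    proof -
      have "AE y in M. y \<notin> {..x}" using supp by eventually_elim (use x in auto)
      then have "{..x} \<in> null_sets M" by (subst AE_iff_null_sets) auto
      then show "measure M {..x} = 0" by (rule measure_eq_0_null_sets)
    qed
    then show False using pseudoinverse[OF \<omega>, of x] x \<omega> by simp
  qed
qed

text \<open>Both laws are realized on the unit interval by their quantile functions; these increase
  in the same parameter and so form the comonotone coupling.\<close>

theorem stein_transport:
  fixes \<mu> :: "real measure"
  assumes \<mu>: "bounded_support \<mu> b" and D: "D \<ge> 0"
    and poly: "\<And>P :: real poly. (\<integral>x. x * poly P x \<partial>\<mu>)\<^sup>2 \<le> D\<^sup>2 * (\<integral>z. (dquot (poly P) (poly (pderiv P)) z)\<^sup>2 \<partial>(\<mu> \<Otimes>\<^sub>M \<mu>))"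
  obtains \<pi> :: "(real \<times> real) measure" where "prob_space \<pi>" "sets \<pi> = sets borel" "distr \<pi> borel fst = \<mu>" "distr \<pi> borel snd = semicircle"
    "(\<integral>\<^sup>+ (x, y). ennreal (\<bar>x - y\<bar>\<^sup>2) \<partial>\<pi>) \<le> ennreal (1 - 2 * (\<integral>x. x\<^sup>2 \<partial>\<mu>) + D\<^sup>2)"
proof -
  interpret \<mu>: bounded_support \<mu> b by (rule \<mu>)
  interpret M: cdf_distribution \<mu> by unfold_locales simp
  interpret S: cdf_distribution semicircle by unfold_locales simp
  define \<Omega> where "\<Omega> = restrict_space lborel {0<..<1::real}"
  have sp: "space \<Omega> = {0<..<1}" by (simp add: \<Omega>_def space_restrict_space)
  define X Y where "X = M.I" and "Y = S.I"
  have Xm[measurable]: "X \<in> borel_measurable \<Omega>" and Ym[measurable]: "Y \<in> borel_measurable \<Omega>"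
    unfolding X_def Y_def \<Omega>_def using M.measurable_CI S.measurable_CI
    by (simp_all cong: measurable_cong_sets add: sets_restrict_space)
  have dX: "distr \<Omega> borel X = \<mu>" and dY: "distr \<Omega> borel Y = semicircle"
    unfolding X_def Y_def \<Omega>_def by (rule M.distr_I_eq_M, rule S.distr_I_eq_M)
  interpret \<Omega>: prob_space \<Omega>
    by (auto simp add: \<Omega>_def emeasure_restrict_space space_restrict_space intro!: prob_spaceI)
  have pX: "\<mu> \<Otimes>\<^sub>M \<mu> = distr (\<Omega> \<Otimes>\<^sub>M \<Omega>) (borel \<Otimes>\<^sub>M borel) (\<lambda>(p, q). (X p, X q))"
    using pair_measure_distr[OF Xm Xm] \<mu>.sigma_finite_measure_axioms unfolding dX by simp
  have pY: "semicircle \<Otimes>\<^sub>M semicircle = distr (\<Omega> \<Otimes>\<^sub>M \<Omega>) (borel \<Otimes>\<^sub>M borel) (\<lambda>(p, q). (Y p, Y q))"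
    using pair_measure_distr[OF Ym Ym] SC.sigma_finite_measure_axioms unfolding dY by simp
  have iX: "(\<integral>x. f x \<partial>\<mu>) = (\<integral>p. f (X p) \<partial>\<Omega>)" if "f \<in> borel_measurable borel" for f :: "real \<Rightarrow> real"
    using integral_distr[OF Xm that] unfolding dX .
  have iY: "(\<integral>x. f x \<partial>semicircle) = (\<integral>p. f (Y p) \<partial>\<Omega>)" if "f \<in> borel_measurable borel" for f :: "real \<Rightarrow> real"
    using integral_distr[OF Ym that] unfolding dY .
  \<comment> \<open>The constant polynomial 1 has difference quotient 0, so the hypothesis itself
    forces the mean to vanish.\<close>
  have mean: "(\<integral>x. x \<partial>\<mu>) = 0"
  proof -
    have "(\<integral>x. x \<partial>\<mu>)\<^sup>2 \<le> D\<^sup>2 * (\<integral>z. (dquot (poly 1) (poly (pderiv 1)) z)\<^sup>2 \<partial>(\<mu> \<Otimes>\<^sub>M \<mu>))" using poly[of 1] by simp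
    also have "(\<lambda>z. (dquot (poly 1) (poly (pderiv 1)) z)\<^sup>2) = (\<lambda>_. 0::real)" by (auto simp: dquot_def)
    finally show ?thesis by simp
  qed
  \<comment> \<open>Enlarging the bound makes it positive and makes the upper estimate for
    \<open>X\<close> strict.\<close>
  define R where "R = b + 1"
  interpret comonotone_stein \<Omega> X Y R D
  proof unfold_locales
    show "X \<in> borel_measurable \<Omega>" "Y \<in> borel_measurable \<Omega>" by measurable
    show "R > 0" using \<mu>.R_nonneg by (simp add: R_def)
    show "D \<ge> 0" by (rule D)
    show "-R \<le> X p \<and> X p < R" if "p \<in> space \<Omega>" for p
      using M.quantile_range[OF \<mu>.AE_support, of p] that by (auto simp: sp X_def R_def)
    show "-2 \<le> Y p \<and> Y p \<le> 2" if "p \<in> space \<Omega>" for p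
      using S.quantile_range[OF AE_semicircle, of p] that by (auto simp: sp Y_def)
    show "Y p \<le> Y q" if "p \<in> space \<Omega>" "q \<in> space \<Omega>" "X p < X q" for p q
    proof -
      have "p \<le> q"
      proof (rule ccontr)
        assume "\<not> p \<le> q"
        then have "X q \<le> X p" using that M.mono_I unfolding X_def sp by (intro mono_onD[OF M.mono_I]) auto
        then show False using that by simp
      qed
      then show ?thesis using that unfolding Y_def sp by (intro mono_onD[OF S.mono_I]) auto
    qed
    show "(\<integral>p. X p \<partial>\<Omega>) = 0" using iX[of "\<lambda>x. x"] mean by simp
    fix f g :: "real \<Rightarrow> real"
    assume f: "\<And>x. (f has_real_derivative g x) (at x)" and g: "continuous_on UNIV g"
    note [measurable] = \<mu>.C1_measurable[OF f]
    have "(\<integral>z. ((f (fst z) - f (snd z)) / (fst z - snd z))\<^sup>2 \<partial>(\<mu> \<Otimes>\<^sub>M \<mu>)) =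
       (\<integral>z. ((f (X (fst z)) - f (X (snd z))) / (X (fst z) - X (snd z)))\<^sup>2 \<partial>(\<Omega> \<Otimes>\<^sub>M \<Omega>))"
      unfolding pX by (subst integral_distr) (auto simp: case_prod_beta')
    then show "(\<integral>p. X p * f (X p) \<partial>\<Omega>)\<^sup>2 \<le> D\<^sup>2 * (\<integral>z. ((f (X (fst z)) - f (X (snd z))) / (X (fst z) - X (snd z)))\<^sup>2 \<partial>(\<Omega> \<Otimes>\<^sub>M \<Omega>))"
      using \<mu>.C1_inequality_off_diagonal[OF poly f g] iX[of "\<lambda>x. x * f x"] by simp
  next
    have "(\<integral>s. s \<partial>semicircle) = 0" using integral_cheb[of 1] by simp
    then show "(\<integral>p. Y p \<partial>\<Omega>) = 0" using iY[of "\<lambda>x. x"] by simp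
    have sq: "s\<^sup>2 = s * poly (cheb 1) s" for s by (simp add: power2_eq_square)
    have "(\<integral>s. s\<^sup>2 \<partial>semicircle) = 1" unfolding sq using integral_x_cheb[of 1] by simp
    then show "(\<integral>p. (Y p)\<^sup>2 \<partial>\<Omega>) = 1" using iY[of "\<lambda>x. x\<^sup>2"] by simp
    fix t
    have "(\<integral>\<^sup>+ z. ennreal ((indicator {t<..} (fst z) - indicator {t<..} (snd z)) / (fst z - snd z)) \<partial>(semicircle \<Otimes>\<^sub>M semicircle)) =
      (\<integral>\<^sup>+ z. ennreal ((indicator {t<..} (Y (fst z)) - indicator {t<..} (Y (snd z))) / (Y (fst z) - Y (snd z))) \<partial>(\<Omega> \<Otimes>\<^sub>M \<Omega>))"
      unfolding pY by (subst nn_integral_distr) (auto simp: case_prod_beta')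
    then show "(\<integral>\<^sup>+ z. ennreal ((indicator {t<..} (Y (fst z)) - indicator {t<..} (Y (snd z))) / (Y (fst z) - Y (snd z))) \<partial>(\<Omega> \<Otimes>\<^sub>M \<Omega>))
        \<le> ennreal (\<integral>p. Y p * indicator {t<..} (Y p) \<partial>\<Omega>)"
      using semicircle_step[of t] iY[of "\<lambda>s. s * indicator {t<..} s"] by simp
    have "AE s in semicircle. s \<noteq> t"
      by (rule AE_I[of _ _ "{t}"]) (auto simp: semicircle_null_singleton)
    then have "AE s in distr \<Omega> borel Y. s \<noteq> t" unfolding dY .
    then show "AE p in \<Omega>. Y p \<noteq> t" by (subst (asm) AE_distr_iff) auto
  qed
  define \<pi> where "\<pi> = distr \<Omega> borel (\<lambda>p. (X p, Y p))"
  have XY[measurable]: "(\<lambda>p. (X p, Y p)) \<in> borel_measurable \<Omega>" by measurable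
  show ?thesis
  proof (rule that[of \<pi>])
    show "prob_space \<pi>" unfolding \<pi>_def by (rule \<Omega>.prob_space_distr) measurable
    show "sets \<pi> = sets borel" by (simp add: \<pi>_def)
    have bf: "fst \<in> borel_measurable (borel :: (real \<times> real) measure)" "snd \<in> borel_measurable (borel :: (real \<times> real) measure)"
      by (auto intro!: borel_measurable_continuous_onI continuous_intros)
    show "distr \<pi> borel fst = \<mu>" unfolding \<pi>_def distr_distr[OF bf(1) XY] by (simp add: o_def dX)
    show "distr \<pi> borel snd = semicircle" unfolding \<pi>_def distr_distr[OF bf(2) XY] by (simp add: o_def dY)
    have I: "integrable \<Omega> (\<lambda>p. (X p - Y p)\<^sup>2)"
    proof (rule \<Omega>.integrable_const_bound[of _ "(R + 2)\<^sup>2"])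
      show "AE p in \<Omega>. norm ((X p - Y p)\<^sup>2) \<le> (R + 2)\<^sup>2"
      proof (rule AE_I2)
        fix p assume "p \<in> space \<Omega>"
        then have "\<bar>X p - Y p\<bar> \<le> R + 2" using X_range[of p] Y_range[of p] by auto
        then have "\<bar>X p - Y p\<bar>\<^sup>2 \<le> (R + 2)\<^sup>2" by (intro power_mono) auto
        then show "norm ((X p - Y p)\<^sup>2) \<le> (R + 2)\<^sup>2" by simp
      qed
    qed measurable
    have "(\<integral>\<^sup>+ z. ennreal ((fst z - snd z)\<^sup>2) \<partial>\<pi>) = (\<integral>\<^sup>+ p. ennreal ((X p - Y p)\<^sup>2) \<partial>\<Omega>)"
      unfolding \<pi>_def using bf by (subst nn_integral_distr) auto
    also have "\<dots> = ennreal (\<integral>p. (X p - Y p)\<^sup>2 \<partial>\<Omega>)" by (rule nn_integral_eq_integral[OF I]) auto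
    also have "\<dots> \<le> ennreal (1 - 2 * (\<integral>x. x\<^sup>2 \<partial>\<mu>) + D\<^sup>2)"
      using comonotone_distance iX[of "\<lambda>x. x\<^sup>2"] by (intro ennreal_leI) simp
    finally show "(\<integral>\<^sup>+ (x, y). ennreal (\<bar>x - y\<bar>\<^sup>2) \<partial>\<pi>) \<le> ennreal (1 - 2 * (\<integral>x. x\<^sup>2 \<partial>\<mu>) + D\<^sup>2)"
      by (simp add: case_prod_beta')
  qed
qed

section \<open>The Hausdorff moment problem\<close>

text \<open>The two products are compared factor by factor. The condition \<open>2 * j < n\<close>
  keeps every factor in the unit interval \<open>[-1, 1]\<close>, including the negative ones with
  \<open>k < i\<close>.\<close>

lemma norm_binomial_ratio_diff:
  assumes "k \<le> n" "2 * j < n"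
  shows "\<bar>(real k / real n) ^ j - (\<Prod>i<j. (real k - real i) / (real n - real i))\<bar> \<le> (real j)\<^sup>2 / (real n - real j)"
proof -
  have "norm ((\<Prod>i<j. real k / real n) - (\<Prod>i<j. (real k - real i) / (real n - real i)))
     \<le> (\<Sum>i<j. norm (real k / real n - (real k - real i) / (real n - real i)))"
    by (rule norm_prod_diff) (use assms in \<open>auto simp: abs_divide divide_le_eq\<close>)
  also have "\<dots> \<le> (\<Sum>i<j. real j / (real n - real j))"
  proof (rule sum_mono)
    fix i assume i: "i \<in> {..<j}"
    have e: "real k / real n - (real k - real i) / (real n - real i) = real i * (real n - real k) / (real n * (real n - real i))"
      using assms i by (simp add: field_simps)
    have "norm (real k / real n - (real k - real i) / (real n - real i)) = real i * (real n - real k) / (real n * (real n - real i))"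
      unfolding e real_norm_def using assms i by (intro abs_of_nonneg divide_nonneg_nonneg mult_nonneg_nonneg) auto
    also have "\<dots> \<le> (real j * real n) / (real n * (real n - real j))"
      using assms i by (intro frac_le mult_mono mult_pos_pos) auto
    also have "\<dots> = real j / (real n - real j)" using assms by simp
    finally show "norm (real k / real n - (real k - real i) / (real n - real i)) \<le> real j / (real n - real j)" .
  qed
  finally show ?thesis by (simp add: power2_eq_square)
qed

lemma binomial_ratio:
  assumes "j \<le> k" "k \<le> n"
  shows "real ((n - j) choose (k - j)) = real (n choose k) * (\<Prod>i<j. (real k - real i) / (real n - real i))"
  using assms
proof (induction j)
  case (Suc j)
  have "(k - j) * ((n - j) choose (k - j)) = (n - j) * ((n - j - 1) choose (k - j - 1))"
    using Suc.prems by (intro times_binomial_minus1_eq) auto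
  then have "real (k - j) * real ((n - j) choose (k - j)) = real (n - j) * real ((n - Suc j) choose (k - Suc j))"
    by (metis of_nat_mult diff_Suc_eq_diff_pred diff_commute One_nat_def)
  then have "real ((n - Suc j) choose (k - Suc j)) = real ((n - j) choose (k - j)) * ((real k - real j) / (real n - real j))"
    using Suc.prems by (simp add: field_simps of_nat_diff)
  then show ?case using Suc by simp
qed simp

text \<open>The Bernstein weights of the functional define probability measures on
  \<open>{k / n | k \<le> n}\<close>, and Helly's theorem provides a limit point. Moments are compared through the factorial
  moments, which the weights reproduce exactly.\<close>

theorem hausdorff_moment:
  fixes L :: "complex poly \<Rightarrow> complex"
  assumes add: "\<And>p q. L (p + q) = L p + L q" and smult: "\<And>c p. L (smult c p) = c * L p" and one: "L 1 = 1"
    and pos: "\<And>k l. L ([:0, 1:] ^ k * [:1, -1:] ^ l) \<in> \<real>\<^sub>\<ge>\<^sub>0"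
  shows "\<exists>M. real_distribution M \<and> (AE x in M. x \<in> {0..1}) \<and> (\<forall>j. L ([:0, 1:] ^ j) = complex_of_real (\<integral>x. x ^ j \<partial>M))"
proof -
  define X Y where "X = [:0, 1 :: complex:]" and "Y = [:1, -1 :: complex:]"
  have XY: "X + Y = 1" by (simp add: X_def Y_def one_pCons)
  have L0: "L 0 = 0" using smult[of 0 0] by simp
  have Lsum: "L (\<Sum>i\<in>I. g i) = (\<Sum>i\<in>I. L (g i))" if "finite I" for I :: "nat set" and g
    using that by (induction rule: finite_induct) (auto simp: L0 add)
  define v where "v n k = Re (L (X ^ k * Y ^ (n - k)))" for n k
  have v: "L (X ^ k * Y ^ (n - k)) = complex_of_real (v n k)" "v n k \<ge> 0" for n k
    using pos[of k "n - k"] unfolding v_def X_def Y_def by (auto simp: complex_nonneg_Reals_iff complex_eq_iff)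
  have expand: "L (X ^ j) = complex_of_real (\<Sum>k\<le>n. real (n choose k) * v n k * (\<Prod>i<j. (real k - real i) / (real n - real i)))"
    if "j \<le> n" for n j
  proof -
    \<comment> \<open>Multiplying by a power of \<open>X + Y = 1\<close> raises the monomial to
      Bernstein degree \<open>n\<close>.\<close>
    have "X ^ j = X ^ j * (X + Y) ^ (n - j)" by (simp add: XY)
    also have "\<dots> = (\<Sum>i\<le>n - j. smult (of_nat ((n - j) choose i)) (X ^ (i + j) * Y ^ (n - j - i)))"
      unfolding binomial_ring sum_distrib_left by (intro sum.cong) (auto simp: power_add of_nat_poly ac_simps)
    finally have "L (X ^ j) = (\<Sum>i\<le>n - j. of_nat ((n - j) choose i) * L (X ^ (i + j) * Y ^ (n - (i + j))))"
      by (simp add: Lsum smult add.commute)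
    also have "\<dots> = (\<Sum>i\<le>n - j. complex_of_real (real ((n - j) choose i) * v n (i + j)))"
      by (simp add: v)
    also have "\<dots> = (\<Sum>k\<in>{j..n}. complex_of_real (real ((n - j) choose (k - j)) * v n k))"
      by (rule sum.reindex_bij_witness[of _ "\<lambda>k. k - j" "\<lambda>i. i + j"]) (use that in auto)
    also have "\<dots> = (\<Sum>k\<in>{j..n}. complex_of_real (real (n choose k) * v n k * (\<Prod>i<j. (real k - real i) / (real n - real i))))"
      by (intro sum.cong) (auto simp: binomial_ratio)
    also have "\<dots> = (\<Sum>k\<le>n. complex_of_real (real (n choose k) * v n k * (\<Prod>i<j. (real k - real i) / (real n - real i))))"
    proof (rule sum.mono_neutral_left)
      show "\<forall>k\<in>{..n} - {j..n}. complex_of_real (real (n choose k) * v n k * (\<Prod>i<j. (real k - real i) / (real n - real i))) = 0"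
      proof
        fix k assume "k \<in> {..n} - {j..n}"
        then have "k < j" by auto
        \<comment> \<open>The factor with \<open>i = k\<close> is 0, so the sum may start at 0
          instead of \<open>j\<close>.\<close>
        then have "(\<Prod>i<j. (real k - real i) / (real n - real i)) = 0" by (intro prod_zero) auto
        then show "complex_of_real (real (n choose k) * v n k * (\<Prod>i<j. (real k - real i) / (real n - real i))) = 0" by simp
      qed
    qed auto
    finally show ?thesis by simp
  qed
  define wt where "wt n k = real (n choose k) * v n k" for n k
  have wt0: "wt n k \<ge> 0" for n k by (simp add: wt_def v)
  have wt1: "(\<Sum>k\<le>n. wt n k) = 1" for n
  proof -
    have "complex_of_real (\<Sum>k\<le>n. wt n k) = 1" using expand[of 0 n] one by (simp add: wt_def)
    then show ?thesis by (simp only: of_real_eq_1_iff)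
  qed
  define M where "M n = distr (point_measure {..n} (\<lambda>k. ennreal (wt n k))) borel (\<lambda>k. real k / real n)" for n
  have int: "(\<integral>x. g x \<partial>M n) = (\<Sum>k\<le>n. wt n k * g (real k / real n))"
    if [measurable]: "g \<in> borel_measurable borel" for g :: "real \<Rightarrow> real" and n
    unfolding M_def by (subst integral_distr) (auto simp: lebesgue_integral_point_measure_finite wt0)
  have em: "emeasure (M n) (space (M n)) = 1" for n
    unfolding M_def using wt1[of n] wt0
    by (subst emeasure_distr) (auto simp: emeasure_point_measure_finite space_point_measure sum_ennreal)
  have prob: "prob_space (M n)" for n using em by (rule prob_spaceI)
  have dist: "real_distribution (M n)" for n
    unfolding real_distribution_def real_distribution_axioms_def using prob by (auto simp: M_def)
  have supp: "AE x in M n. x \<in> {0..1}" for n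
    unfolding M_def by (subst AE_distr_iff) (auto intro!: AE_I2 simp: space_point_measure divide_le_eq_1)
  have tight: "tight M"
    unfolding tight_def
  proof (intro conjI allI impI)
    fix e :: real assume "e > 0"
    interpret real_distribution "M n" for n by (rule dist)
    have "measure (M n) {-1<..1} = 1" for n
      using supp[of n] by (subst prob_eq_1) (auto elim!: eventually_mono)
    then show "\<exists>a b. a < b \<and> (\<forall>n. 1 - e < measure (M n) {a<..b})"
      using \<open>e > 0\<close> by (intro exI[of _ "-1"] exI[of _ 1]) auto
  qed (rule dist)
  obtain r N where r: "strict_mono r" and N: "real_distribution N" and conv: "weak_conv_m (M \<circ> r) N"
    using tight_imp_convergent_subsubsequence[OF tight strict_mono_id] by (auto simp: o_def)
  interpret N: real_distribution N by (rule N)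
  have lim: "(\<lambda>n. \<integral>x. g x \<partial>M (r n)) \<longlonglongrightarrow> (\<integral>x. g x \<partial>N)" if "\<And>x. isCont g x" "\<And>x. norm (g x) \<le> B" for g :: "real \<Rightarrow> real" and B
    using weak_conv_imp_integral_bdd_continuous_conv[OF _ N conv, of g B] dist that by (auto simp: o_def)
  have suppN: "AE x in N. x \<in> {0..1}"
  proof -
    \<comment> \<open>Bounded, continuous, nonnegative and zero exactly on \<open>[0, 1]\<close>: a
      test function through which the support passes to the weak limit.\<close>
    define g where "g x = min 1 \<bar>x - max 0 (min 1 x)\<bar>" for x :: real
    have g: "isCont g x" "norm (g x) \<le> 1" "g x \<ge> 0" for x
      unfolding g_def[abs_def] by (auto intro!: continuous_intros)
    have [measurable]: "g \<in> borel_measurable borel" unfolding g_def[abs_def] by measurable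
    have "(\<integral>x. g x \<partial>M n) = 0" for n
      unfolding int[OF \<open>g \<in> borel_measurable borel\<close>]
    proof (intro sum.neutral ballI)
      fix k assume "k \<in> {..n}"
      then have "real k / real n \<le> 1" by (cases "n = 0") (auto simp: divide_le_eq_1)
      then show "wt n k * g (real k / real n) = 0" by (simp add: g_def)
    qed
    then have "(\<integral>x. g x \<partial>N) = 0" using lim[of g 1, OF g(1,2)] by (simp add: LIMSEQ_const_iff)
    moreover have "integrable N g" by (rule N.integrable_const_bound[of _ 1]) (use g in auto)
    ultimately have "AE x in N. g x = 0"
      using integral_nonneg_eq_0_iff_AE[of N g] g(3) by auto
    then show ?thesis by eventually_elim (auto simp: g_def min_def max_def split: if_splits)
  qed
  have "L (X ^ j) = complex_of_real (\<integral>x. x ^ j \<partial>N)" for j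
  proof -
    \<comment> \<open>Clamping makes the power bounded on the line, as weak convergence requires,
      without changing it on the supports.\<close>
    define g where "g x = (max 0 (min 1 x)) ^ j" for x :: real
    have g: "isCont g x" "norm (g x) \<le> 1" for x
      unfolding g_def[abs_def] by (auto intro!: continuous_intros power_le_one)
    have [measurable]: "g \<in> borel_measurable borel" unfolding g_def[abs_def] by measurable
    have "(\<integral>x. g x \<partial>N) = (\<integral>x. x ^ j \<partial>N)"
    proof (rule integral_cong_AE)
      show "AE x in N. g x = x ^ j" using suppN by eventually_elim (auto simp: g_def)
    qed auto
    then have "(\<lambda>n. \<integral>x. g x \<partial>M (r n)) \<longlonglongrightarrow> (\<integral>x. x ^ j \<partial>N)" using lim[of g 1, OF g] by simp
    moreover have "(\<lambda>n. \<integral>x. g x \<partial>M (r n)) \<longlonglongrightarrow> Re (L (X ^ j))"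
    proof -
      have "(\<lambda>n. \<integral>x. g x \<partial>M n) \<longlonglongrightarrow> Re (L (X ^ j))"
      proof (rule LIM_zero_cancel, rule Lim_null_comparison)
        show "(\<lambda>n. (real j)\<^sup>2 / (real n - real j)) \<longlonglongrightarrow> 0"
          by (intro tendsto_divide_0[OF tendsto_const] filterlim_at_top_imp_at_infinity
              filterlim_tendsto_add_at_top[of "\<lambda>_. - real j", simplified] filterlim_real_sequentially) auto
        have "norm ((\<integral>x. g x \<partial>M n) - Re (L (X ^ j))) \<le> (real j)\<^sup>2 / (real n - real j)" if n: "2 * j < n" for n
        proof -
          have "(\<integral>x. g x \<partial>M n) = (\<Sum>k\<le>n. wt n k * (real k / real n) ^ j)"
            unfolding int[OF \<open>g \<in> borel_measurable borel\<close>]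
          proof (intro sum.cong refl)
            fix k assume "k \<in> {..n}"
            then have "real k / real n \<le> 1" by (cases "n = 0") (auto simp: divide_le_eq_1)
            then show "wt n k * g (real k / real n) = wt n k * (real k / real n) ^ j" by (simp add: g_def)
          qed
          moreover have "Re (L (X ^ j)) = (\<Sum>k\<le>n. wt n k * (\<Prod>i<j. (real k - real i) / (real n - real i)))"
            using n by (subst expand[of j n]) (simp_all only: wt_def Re_complex_of_real)
          ultimately have "(\<integral>x. g x \<partial>M n) - Re (L (X ^ j)) =
              (\<Sum>k\<le>n. wt n k * ((real k / real n) ^ j - (\<Prod>i<j. (real k - real i) / (real n - real i))))"
            by (simp add: sum_subtractf right_diff_distrib)
          also have "norm \<dots> \<le> (\<Sum>k\<le>n. wt n k * ((real j)\<^sup>2 / (real n - real j)))"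
          proof (rule sum_norm_le)
            fix k assume "k \<in> {..n}"
            then show "norm (wt n k * ((real k / real n) ^ j - (\<Prod>i<j. (real k - real i) / (real n - real i)))) \<le> wt n k * ((real j)\<^sup>2 / (real n - real j))"
              using norm_binomial_ratio_diff[of k n j] n wt0[of n k] by (simp add: abs_mult mult_left_mono del: times_divide_eq_right)
          qed
          also have "\<dots> = (real j)\<^sup>2 / (real n - real j)"
            unfolding sum_distrib_right[symmetric] wt1 by simp
          finally show ?thesis .
        qed
        then show "\<forall>\<^sub>F n in sequentially. norm ((\<integral>x. g x \<partial>M n) - Re (L (X ^ j))) \<le> (real j)\<^sup>2 / (real n - real j)"
          unfolding eventually_sequentially by (intro exI[of _ "Suc (2 * j)"]) auto
      qed
      then show ?thesis using r by (rule LIMSEQ_subseq_LIMSEQ[unfolded o_def])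
    qed
    ultimately have "Re (L (X ^ j)) = (\<integral>x. x ^ j \<partial>N)" by (rule LIMSEQ_unique[symmetric])
    moreover have "Im (L (X ^ j)) = 0" using v[of j j] by simp
    ultimately show ?thesis by (simp add: complex_eq_iff)
  qed
  then show ?thesis using N suppN unfolding X_def by blast
qed

section \<open>Polynomials of a self-adjoint operator\<close>

lemma cinner_add_left: "cinner (x + y) z = cinner x z + cinner y z"
  by (metis cinner_add_right cinner_commute complex_cnj_add)

lemma cinner_scaleC_left: "cinner (c *\<^sub>C x) z = cnj c * cinner x z"
  by (metis cinner_commute cinner_scaleC_right complex_cnj_mult)

lemma cinner_scaleR_right: "cinner x (r *\<^sub>R y) = complex_of_real r * cinner x y"
  by (metis cinner_scaleC_right scaleC_of_real)

lemma cinner_scaleR_left: "cinner (r *\<^sub>R x) y = complex_of_real r * cinner x y"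
  by (metis cinner_scaleC_left complex_cnj_complex_of_real scaleC_of_real)

lemma cinner_0_right [simp]: "cinner x 0 = 0"
  using cinner_scaleR_right[of x 0 x] by simp

lemma cinner_0_left [simp]: "cinner 0 x = 0"
  using cinner_scaleR_left[of 0 x x] by simp

lemma cinner_minus_right: "cinner x (- y) = - cinner x y"
  using cinner_scaleR_right[of x "-1" y] by simp

lemma cinner_minus_left: "cinner (- x) y = - cinner x y"
  using cinner_scaleR_left[of "-1" x y] by simp

lemma cinner_diff_right: "cinner x (y - z) = cinner x y - cinner x z"
  using cinner_add_right[of x y "- z"] by (simp add: cinner_minus_right)

lemma cinner_diff_left: "cinner (x - y) z = cinner x z - cinner y z"
  using cinner_add_left[of x "- y" z] by (simp add: cinner_minus_left)

lemma cinner_sum_right: "cinner x (\<Sum>i\<in>I. f i) = (\<Sum>i\<in>I. cinner x (f i))"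
  by (induction I rule: infinite_finite_induct) (auto simp: cinner_add_right)

lemma cinner_sum_left: "cinner (\<Sum>i\<in>I. f i) x = (\<Sum>i\<in>I. cinner (f i) x)"
  by (induction I rule: infinite_finite_induct) (auto simp: cinner_add_left)

lemma scaleC_0_right [simp]: "c *\<^sub>C (0::'a::complex_hilbert) = 0"
  using scaleC_add_right[of c 0 "0::'a"] by simp

lemma scaleC_0_left [simp]: "0 *\<^sub>C (x::'a::complex_hilbert) = 0"
  using scaleC_of_real[of 0 x] by simp

lemma scaleC_1_left [simp]: "1 *\<^sub>C (x::'a::complex_hilbert) = x"
  using scaleC_of_real[of 1 x] by simp

lemma scaleC_sum_right: "c *\<^sub>C (\<Sum>i\<in>I. f i :: 'a::complex_hilbert) = (\<Sum>i\<in>I. c *\<^sub>C f i)"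
  by (induction I rule: infinite_finite_induct) (auto simp: scaleC_add_right)

lemma norm_eq_cinner: "(norm x)\<^sup>2 = Re (cinner x x)"
  by (simp add: cinner_self)

lemma cinner_cauchy_schwarz: "cmod (cinner x y) \<le> norm x * norm y"
proof (cases "y = 0")
  case False
  then have n: "norm y > 0" by simp
  define c where "c = cinner y x / complex_of_real ((norm y)\<^sup>2)"
  have cy: "c * cinner x y = complex_of_real ((cmod (cinner x y))\<^sup>2 / (norm y)\<^sup>2)"
    unfolding c_def cinner_commute[of y x] of_real_divide complex_norm_square by (simp add: mult.commute)
  have cc: "c * cnj c * cinner y y = complex_of_real ((cmod (cinner x y))\<^sup>2 / (norm y)\<^sup>2)"
    unfolding c_def cinner_commute[of y x] cinner_self of_real_divide complex_norm_square using n
    by (simp add: field_simps power2_eq_square)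
  have cx: "cnj c * cinner y x = complex_of_real ((cmod (cinner x y))\<^sup>2 / (norm y)\<^sup>2)"
    using arg_cong[OF cy, of cnj] by (simp add: cinner_commute[of y x])
  have "cinner (x - c *\<^sub>C y) (x - c *\<^sub>C y) = cinner x x - c * cinner x y - cnj c * cinner y x + c * cnj c * cinner y y"
    by (simp add: cinner_diff_left cinner_diff_right cinner_scaleC_left cinner_scaleC_right algebra_simps)
  then have "cinner (x - c *\<^sub>C y) (x - c *\<^sub>C y) = complex_of_real ((norm x)\<^sup>2 - (cmod (cinner x y))\<^sup>2 / (norm y)\<^sup>2)"
    unfolding cy cc cx by (simp add: cinner_self)
  then have "(norm (x - c *\<^sub>C y))\<^sup>2 = (norm x)\<^sup>2 - (cmod (cinner x y))\<^sup>2 / (norm y)\<^sup>2"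
    unfolding cinner_self of_real_eq_iff .
  then have "(cmod (cinner x y))\<^sup>2 / (norm y)\<^sup>2 \<le> (norm x)\<^sup>2" by (smt (verit) zero_le_power2)
  then have "(cmod (cinner x y))\<^sup>2 \<le> (norm x * norm y)\<^sup>2" using n by (simp add: divide_le_eq power_mult_distrib)
  then show ?thesis by (rule power2_le_imp_le) simp
qed simp

lemma bounded_bilinear_cinner: "bounded_bilinear (cinner :: 'a::complex_hilbert \<Rightarrow> 'a \<Rightarrow> complex)"
proof
  show "\<exists>K. \<forall>a b::'a. norm (cinner a b) \<le> norm a * norm b * K"
    using cinner_cauchy_schwarz by (intro exI[of _ 1]) auto
qed (simp_all add: cinner_add_left cinner_add_right cinner_scaleR_left cinner_scaleR_right scaleR_conv_of_real)

lemmas tendsto_cinner [tendsto_intros] = bounded_bilinear.tendsto[OF bounded_bilinear_cinner]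

lemma cinner_ext: "(\<And>y. cinner y x = cinner y x') \<Longrightarrow> x = x'"
  using cinner_self[of "x - x'"] by (simp add: cinner_diff_right)

text \<open>Polarization: the diagonal at \<open>x + y\<close> makes the form antisymmetric, and
  replacing \<open>y\<close> by \<open>\<i> *\<^sub>C y\<close> makes it symmetric.\<close>

lemma sesquilinear_zero:
  fixes B :: "'a::complex_hilbert \<Rightarrow> 'a \<Rightarrow> complex"
  assumes "\<And>x y z. B (x + y) z = B x z + B y z" "\<And>x y z. B x (y + z) = B x y + B x z"
    "\<And>c x y. B (c *\<^sub>C x) y = cnj c * B x y" "\<And>c x y. B x (c *\<^sub>C y) = c * B x y" "\<And>x. B x x = 0"
  shows "B x y = 0"
proof -
  have 1: "B x y + B y x = 0" for x y using assms(5)[of "x + y"] assms(5)[of x] assms(5)[of y] unfolding assms(1,2) by (simp add: add.commute)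
  have "B x (\<i> *\<^sub>C y) + B (\<i> *\<^sub>C y) x = 0" by (rule 1)
  then have "\<i> * (B x y - B y x) = 0" unfolding assms(3,4) by (simp add: algebra_simps)
  then have "B x y = B y x" by simp
  with 1[of x y] show ?thesis by simp
qed

lemma clinear_opsD: "T \<in> clinear_ops \<Longrightarrow> T (c *\<^sub>C x) = c *\<^sub>C T x"
  by (simp add: clinear_ops_def)

lemma clinear_ops_eqI:
  assumes "T \<in> clinear_ops" "U \<in> clinear_ops" "\<And>x. cinner x (T x) = cinner x (U x)"
  shows "T = U"
proof (rule blinfun_eqI)
  fix x
  have "cinner y (T x) - cinner y (U x) = 0" for y
    by (rule sesquilinear_zero[of "\<lambda>y x. cinner y (T x) - cinner y (U x)"])
       (use assms in \<open>auto simp: cinner_add_left cinner_add_right cinner_scaleC_left cinner_scaleC_right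
          clinear_opsD blinfun.add_right algebra_simps\<close>)
  then show "T x = U x" by (intro cinner_ext) auto
qed

lemma self_adjointI_real:
  assumes T: "T \<in> clinear_ops" and "\<And>x. cinner x (T x) \<in> \<real>"
  shows "self_adjoint T"
proof -
  have "cinner (T x) x = cinner x (T x)" for x
    using assms(2)[of x] by (metis Reals_cnj_iff cinner_commute)
  note diag = this
  have "cinner (T x) y - cinner x (T y) = 0" for x y
    by (rule sesquilinear_zero[of "\<lambda>x y. cinner (T x) y - cinner x (T y)"], unfold diag)
       (simp_all add: cinner_add_left cinner_add_right cinner_scaleC_left cinner_scaleC_right
          clinear_opsD[OF T] blinfun.add_right algebra_simps)
  then show ?thesis using T by (auto simp: self_adjoint_def is_adjoint_def)
qed

lemma self_adjointD: "self_adjoint T \<Longrightarrow> cinner (T x) y = cinner x (T y)"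
  by (simp add: self_adjoint_def is_adjoint_def)

lemma is_adjoint_unique: "is_adjoint T U \<Longrightarrow> is_adjoint T V \<Longrightarrow> U = V"
  unfolding is_adjoint_def by (intro blinfun_eqI cinner_ext) (metis cinner_commute)

lemma adj_eqI: "is_adjoint T U \<Longrightarrow> adj T = U"
  unfolding adj_def using is_adjoint_unique by (intro the_equality) auto

lemma adj_self_adjoint: "self_adjoint T \<Longrightarrow> adj T = T"
  by (intro adj_eqI) (simp add: self_adjoint_def)

lemma blinfun_eq_iff: "f = g \<longleftrightarrow> (\<forall>x. blinfun_apply f x = blinfun_apply g x)"
  by (auto intro: blinfun_eqI)

lemma pcompose_power: "pcompose (p ^ n) q = pcompose p q ^ n" for p q :: "'a::comm_ring_1 poly"
  by (induction n) (auto simp: pcompose_mult pcompose_1)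

lemma commutant_id: "id_blinfun \<in> commutant X"
  by (auto simp: commutant_def clinear_ops_def intro!: blinfun_eqI)

lemma commutant_0: "0 \<in> commutant X"
  by (auto simp: commutant_def clinear_ops_def intro!: blinfun_eqI)

lemma commutant_add: "S \<in> commutant X \<Longrightarrow> T \<in> commutant X \<Longrightarrow> S + T \<in> commutant X"
  by (auto simp: commutant_def clinear_ops_def blinfun.add_left blinfun.add_right scaleC_add_right blinfun_eq_iff)

lemma op_scaleC_minus1: "op_scaleC (-1) T = - T"
proof (rule blinfun_eqI)
  fix x show "op_scaleC (-1) T x = (- T) x" using scaleC_of_real[of "-1" "T x"] by (simp add: blinfun.minus_left)
qed

lemma commutant_compose: "S \<in> commutant X \<Longrightarrow> T \<in> commutant X \<Longrightarrow> S o\<^sub>L T \<in> commutant X"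
  by (auto simp: commutant_def clinear_ops_def blinfun_eq_iff)

lemma commutant_scaleC: "X \<subseteq> clinear_ops \<Longrightarrow> T \<in> commutant X \<Longrightarrow> op_scaleC c T \<in> commutant X"
  by (auto simp: commutant_def clinear_ops_def blinfun_eq_iff scaleC_scaleC mult.commute subset_iff)

text \<open>Commutation relations and complex linearity pass to strong limits, so operators built by
  approximation stay in the algebra.\<close>

lemma commutant_limit:
  fixes T :: "nat \<Rightarrow> ('h::complex_hilbert) op" and U :: "'h op"
  assumes "\<And>n. T n \<in> commutant X" "\<And>x. (\<lambda>n. T n x) \<longlonglongrightarrow> U x"
  shows "U \<in> commutant X"
proof -
  have "U (c *\<^sub>C x) = c *\<^sub>C U x" for c x
  proof -
    have "(\<lambda>n. c *\<^sub>C T n x) \<longlonglongrightarrow> c *\<^sub>C U x"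
      by (intro bounded_linear.tendsto[OF bounded_linear_scaleC] assms)
    moreover have "T n (c *\<^sub>C x) = c *\<^sub>C T n x" for n using assms(1)[of n] by (auto simp: commutant_def clinear_ops_def)
    ultimately show ?thesis using assms(2)[of "c *\<^sub>C x"] LIMSEQ_unique by auto
  qed
  moreover have "U (V x) = V (U x)" if "V \<in> X" for V x
  proof -
    have "(\<lambda>n. V (T n x)) \<longlonglongrightarrow> V (U x)" by (intro tendsto_intros assms)
    moreover have "T n (V x) = V (T n x)" for n using assms(1)[of n] that by (auto simp: commutant_def blinfun_eq_iff)
    ultimately show ?thesis using assms(2)[of "V x"] LIMSEQ_unique by auto
  qed
  ultimately show ?thesis by (auto simp: commutant_def clinear_ops_def blinfun_eq_iff)
qed

section \<open>Powers and polynomials of one operator\<close>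

lemma op_power_0 [simp]: "op_power T 0 = id_blinfun"
  by (simp add: op_power_def)

lemma op_power_Suc: "op_power T (Suc n) = T o\<^sub>L op_power T n"
  by (simp add: op_power_def)

lemma op_power_add: "op_power T (m + n) x = op_power T m (op_power T n x)"
  by (induction m) (auto simp: op_power_Suc)

lemma op_power_self_adjoint: "self_adjoint T \<Longrightarrow> cinner (op_power T n x) y = cinner x (op_power T n y)"
proof (induction n arbitrary: x y)
  case (Suc n)
  have "op_power T n (T y) = T (op_power T n y)"
    using op_power_add[of T n 1 y] op_power_add[of T 1 n y] by (simp add: op_power_Suc)
  then show ?case using Suc by (simp add: op_power_Suc self_adjointD)
qed simp

lemma op_poly_apply:
  assumes "degree P \<le> n"
  shows "op_poly P T x = (\<Sum>m\<le>n. coeff P m *\<^sub>C op_power T m x)"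
proof -
  have "op_poly P T x = (\<Sum>m\<le>degree P. coeff P m *\<^sub>C op_power T m x)"
    by (simp add: op_poly_def blinfun.sum_left)
  also have "\<dots> = (\<Sum>m\<le>n. coeff P m *\<^sub>C op_power T m x)"
    by (rule sum.mono_neutral_left) (use assms in \<open>auto simp: coeff_eq_0\<close>)
  finally show ?thesis .
qed

lemma op_poly_add: "op_poly (P + Q) T = op_poly P T + op_poly Q T"
proof (rule blinfun_eqI)
  fix x
  define n where "n = max (degree P) (degree Q)"
  have n: "degree P \<le> n" "degree Q \<le> n" "degree (P + Q) \<le> n" unfolding n_def by (auto intro: degree_add_le_max)
  show "op_poly (P + Q) T x = (op_poly P T + op_poly Q T) x"
    by (simp add: blinfun.add_left op_poly_apply[OF n(1)] op_poly_apply[OF n(2)] op_poly_apply[OF n(3)]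
       scaleC_add_left sum.distrib)
qed

lemma op_poly_smult: "op_poly (smult c P) T = op_scaleC c (op_poly P T)"
proof (rule blinfun_eqI)
  fix x
  have n: "degree (smult c P) \<le> degree P" by simp
  show "op_poly (smult c P) T x = op_scaleC c (op_poly P T) x"
    by (simp add: op_poly_apply[OF n] op_poly_apply[OF order_refl] scaleC_sum_right scaleC_scaleC)
qed

lemma op_poly_0 [simp]: "op_poly 0 T = 0"
  by (simp add: op_poly_def blinfun_eq_iff)

lemma op_poly_pCons:
  assumes "T \<in> clinear_ops"
  shows "op_poly (pCons a P) T x = a *\<^sub>C x + T (op_poly P T x)"
proof -
  have "degree (pCons a P) \<le> Suc (degree P)" by (rule degree_pCons_le)
  then have "op_poly (pCons a P) T x = (\<Sum>m\<le>Suc (degree P). coeff (pCons a P) m *\<^sub>C op_power T m x)"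
    by (rule op_poly_apply)
  also have "\<dots> = a *\<^sub>C x + (\<Sum>m\<le>degree P. coeff P m *\<^sub>C T (op_power T m x))"
    unfolding sum.atMost_Suc_shift by (simp add: op_power_Suc)
  also have "(\<Sum>m\<le>degree P. coeff P m *\<^sub>C T (op_power T m x)) = T (op_poly P T x)"
    by (simp add: op_poly_apply[OF order_refl] blinfun.sum_right clinear_opsD[OF assms])
  finally show ?thesis .
qed

lemma op_poly_1 [simp]: "op_poly 1 T = id_blinfun"
  by (auto simp: op_poly_def blinfun_eq_iff)

lemma op_poly_X: "op_poly [:0, 1:] T = T"
  by (rule blinfun_eqI) (simp add: op_poly_def op_power_Suc blinfun.add_left)

lemma op_poly_mult:
  assumes "T \<in> clinear_ops"
  shows "op_poly (P * Q) T = op_poly P T o\<^sub>L op_poly Q T"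
proof (rule blinfun_eqI)
  fix x
  show "op_poly (P * Q) T x = (op_poly P T o\<^sub>L op_poly Q T) x"
  proof (induction P arbitrary: x)
    case (pCons a P)
    have "op_poly (pCons a P * Q) T x = op_poly (smult a Q) T x + op_poly (pCons 0 (P * Q)) T x"
      by (simp add: op_poly_add blinfun.add_left)
    then show ?case using pCons by (simp add: op_poly_smult op_poly_pCons[OF assms])
  qed simp
qed

lemma op_poly_power: "op_poly ([:0, 1:] ^ j) T = op_power T j" if "T \<in> clinear_ops"
  by (induction j) (auto simp: op_poly_mult[OF that] op_power_Suc op_poly_X simp del: mult_pCons_left)

lemma op_poly_commutant:
  assumes "X \<subseteq> clinear_ops" "T \<in> commutant X"
  shows "op_poly P T \<in> commutant X"
proof -
  have T: "T \<in> clinear_ops" using assms by (auto simp: commutant_def)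
  show ?thesis
  proof (induction P)
    case (pCons a P)
    have "op_poly (pCons a P) T = op_scaleC a id_blinfun + (T o\<^sub>L op_poly P T)"
      by (rule blinfun_eqI) (simp add: op_poly_pCons[OF T] blinfun.add_left)
    then show ?case using pCons assms by (auto intro!: commutant_add commutant_compose commutant_scaleC commutant_id)
  qed (simp add: commutant_0)
qed

lemma op_poly_real_self_adjoint:
  assumes T: "self_adjoint T" and P: "\<And>m. coeff P m \<in> \<real>"
  shows "cinner (op_poly P T x) y = cinner x (op_poly P T y)"
  by (simp add: op_poly_apply[OF order_refl] cinner_sum_left cinner_sum_right cinner_scaleC_left cinner_scaleC_right
      op_power_self_adjoint[OF T] Reals_cnj_iff[THEN iffD1, OF P])

lemma real_coeff_mult:
  fixes P Q :: "complex poly"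
  assumes "\<And>m. coeff P m \<in> \<real>" "\<And>m. coeff Q m \<in> \<real>"
  shows "coeff (P * Q) m \<in> \<real>"
  unfolding coeff_mult using assms by (intro sum_in_Reals Reals_mult)

lemma real_coeff_power:
  fixes P :: "complex poly"
  assumes "\<And>m. coeff P m \<in> \<real>" shows "coeff (P ^ n) m \<in> \<real>"
  by (induction n arbitrary: m) (auto simp: coeff_1 intro!: real_coeff_mult assms)

text \<open>The even part of \<open>(R + T)^k (R - T)^l\<close> is an explicit square, and the remaining factor is one of
  \<open>1\<close>, \<open>R + T\<close>, \<open>R - T\<close>, \<open>R\<^sup>2 - T\<^sup>2\<close>.\<close>

lemma bernstein_operator_positive:
  assumes T: "self_adjoint T" and R: "norm T \<le> R"
  shows "cinner x (op_poly ([:complex_of_real R, 1:] ^ k * [:complex_of_real R, -1:] ^ l) T x) \<in> \<real>\<^sub>\<ge>\<^sub>0"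
proof -
  define A B where "A = [:complex_of_real R, 1:]" and "B = [:complex_of_real R, -1:]"
  have TC: "T \<in> clinear_ops" using T by (simp add: self_adjoint_def)
  have AB: "coeff A m \<in> \<real>" "coeff B m \<in> \<real>" for m by (auto simp: A_def B_def coeff_pCons split: nat.splits)
  define C where "C = A ^ (k div 2) * B ^ (l div 2)"
  define E where "E = A ^ (k mod 2) * B ^ (l mod 2)"
  have Cr: "coeff C m \<in> \<real>" for m unfolding C_def by (intro real_coeff_mult real_coeff_power AB)
  have Er: "coeff E m \<in> \<real>" for m unfolding E_def by (intro real_coeff_mult real_coeff_power AB)
  have "A ^ k * B ^ l = C * (E * C)"
  proof -
    have "A ^ k = A ^ (k div 2) * A ^ (k mod 2) * A ^ (k div 2)"
      unfolding power_add[symmetric] by (rule arg_cong[where f="\<lambda>n. A ^ n"]) presburger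
    moreover have "B ^ l = B ^ (l div 2) * B ^ (l mod 2) * B ^ (l div 2)"
      unfolding power_add[symmetric] by (rule arg_cong[where f="\<lambda>n. B ^ n"]) presburger
    ultimately show ?thesis unfolding C_def E_def by (simp only: mult_ac)
  qed
  then have eq: "cinner x (op_poly (A ^ k * B ^ l) T x) = cinner (op_poly C T x) (op_poly E T (op_poly C T x))"
    by (simp add: op_poly_mult[OF TC] op_poly_real_self_adjoint[OF T Cr])
  define y where "y = op_poly C T x"
  have Tn: "norm (T y) \<le> R * norm y" using norm_blinfun[of T y] R by (meson mult_right_mono norm_ge_zero order_trans)
  have R0: "R \<ge> 0" using R norm_ge_zero[of T] by linarith
  have re: "Re (cinner y (T y)) \<le> R * (norm y)\<^sup>2" "- (R * (norm y)\<^sup>2) \<le> Re (cinner y (T y))"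
  proof -
    have "\<bar>Re (cinner y (T y))\<bar> \<le> norm y * norm (T y)" using abs_Re_le_cmod cinner_cauchy_schwarz order_trans by blast
    also have "\<dots> \<le> norm y * (R * norm y)" using Tn by (intro mult_left_mono) auto
    finally show "Re (cinner y (T y)) \<le> R * (norm y)\<^sup>2" "- (R * (norm y)\<^sup>2) \<le> Re (cinner y (T y))"
      by (auto simp: power2_eq_square mult_ac abs_le_iff)
  qed
  have "Re (cinner y (op_poly E T y)) \<ge> 0"
  proof -
    consider "k mod 2 = 0" "l mod 2 = 0" | "k mod 2 = 0" "l mod 2 = 1" | "k mod 2 = 1" "l mod 2 = 0" | "k mod 2 = 1" "l mod 2 = 1"
      by linarith
    then show ?thesis
    proof cases
      case 1
      then show ?thesis by (simp add: E_def cinner_self)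
    next
      case 2
      then have "op_poly E T y = complex_of_real R *\<^sub>C y - T y"
        using scaleC_of_real[of "-1" y] by (simp add: E_def B_def op_poly_pCons[OF TC] blinfun.minus_right)
      then show ?thesis using re by (simp add: cinner_diff_right cinner_scaleC_right cinner_self)
    next
      case 3
      then have "op_poly E T y = complex_of_real R *\<^sub>C y + T y"
        by (simp add: E_def A_def op_poly_pCons[OF TC])
      then show ?thesis using re by (simp add: cinner_add_right cinner_scaleC_right cinner_self)
    next
      case 4
      have "E = [:complex_of_real (R\<^sup>2), 0, -1:]" using 4 by (simp add: E_def A_def B_def power2_eq_square)
      then have "op_poly E T y = complex_of_real (R\<^sup>2) *\<^sub>C y - T (T y)"
        using scaleC_of_real[of "-1" y] by (simp add: op_poly_pCons[OF TC] blinfun.minus_right)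
      then have "Re (cinner y (op_poly E T y)) = R\<^sup>2 * (norm y)\<^sup>2 - (norm (T y))\<^sup>2"
        by (simp add: cinner_diff_right cinner_scaleC_right cinner_self self_adjointD[OF T, symmetric])
      moreover have "(norm (T y))\<^sup>2 \<le> (R * norm y)\<^sup>2" using Tn by (intro power_mono) auto
      ultimately show ?thesis by (simp add: power_mult_distrib)
    qed
  qed
  moreover have "cinner y (op_poly E T y) \<in> \<real>"
    using op_poly_real_self_adjoint[OF T Er, of y y] by (metis Reals_cnj_iff cinner_commute)
  ultimately show ?thesis using eq unfolding A_def B_def y_def
    by (metis complex_is_Real_iff complex_nonneg_Reals_iff)
qed

text \<open>The affine map \<open>Z\<close> carries \<open>[-R, R]\<close> onto
  \<open>[0, 1]\<close>, and the positivity required by \<open>hausdorff_moment\<close> becomes that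
  of \<open>(R + T)^k (R - T)^l\<close>. The measure found on \<open>[0, 1]\<close> is then pushed
  back.\<close>

lemma moment_measure_unit:
  assumes T: "self_adjoint T" and R: "norm T \<le> R" "R > 0" and x: "norm x = 1"
  shows "\<exists>M. real_distribution M \<and> (AE t in M. t \<in> {-R..R}) \<and>
    (\<forall>j. cinner x (op_power T j x) = complex_of_real (\<integral>t. t ^ j \<partial>M))"
proof -
  have TC: "T \<in> clinear_ops" using T by (simp add: self_adjoint_def)
  define Z where "Z = [:1/2, complex_of_real (1 / (2 * R)):]"
  define L where "L p = cinner x (op_poly (pcompose p Z) T x)" for p
  have Ladd: "L (p + q) = L p + L q" for p q
    by (simp add: L_def pcompose_add op_poly_add blinfun.add_left cinner_add_right)
  have Lsmult: "L (smult c p) = c * L p" for c p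
    by (simp add: L_def pcompose_smult op_poly_smult cinner_scaleC_right)
  have "\<exists>M. real_distribution M \<and> (AE x in M. x \<in> {0..1}) \<and> (\<forall>j. L ([:0, 1:] ^ j) = complex_of_real (\<integral>x. x ^ j \<partial>M))"
  proof (rule hausdorff_moment)
    show "L 1 = 1" using x by (simp add: L_def pcompose_1 cinner_self)
    fix k l
    define s where "s = complex_of_real (1 / (2 * R))"
    have 1: "pcompose [:0, 1:] Z = smult s [:complex_of_real R, 1:]"
      using R by (simp add: pcompose_pCons Z_def s_def)
    have 2: "pcompose [:1, -1:] Z = smult s [:complex_of_real R, -1:]"
      using R by (simp add: pcompose_pCons Z_def s_def)
    have "pcompose ([:0, 1:] ^ k * [:1, -1:] ^ l) Z = smult (complex_of_real ((1 / (2 * R)) ^ (k + l))) ([:complex_of_real R, 1:] ^ k * [:complex_of_real R, -1:] ^ l)"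
      unfolding pcompose_mult pcompose_power 1 2 smult_power by (simp add: s_def power_add mult.commute)
    then have "L ([:0, 1:] ^ k * [:1, -1:] ^ l) = complex_of_real ((1 / (2 * R)) ^ (k + l)) *
        cinner x (op_poly ([:complex_of_real R, 1:] ^ k * [:complex_of_real R, -1:] ^ l) T x)"
      by (simp add: L_def op_poly_smult cinner_scaleC_right)
    then show "L ([:0, 1:] ^ k * [:1, -1:] ^ l) \<in> \<real>\<^sub>\<ge>\<^sub>0"
      using bernstein_operator_positive[OF T R(1), of x k l] R by (simp only: nonneg_Reals_mult_I nonneg_Reals_of_real_iff zero_le_power zero_le_divide_iff) auto
  qed (rule Ladd Lsmult)+
  then obtain N where N: "real_distribution N" "AE x in N. x \<in> {0..1}" "\<And>j. L ([:0, 1:] ^ j) = complex_of_real (\<integral>x. x ^ j \<partial>N)"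
    by blast
  interpret N: real_distribution N by (rule N)
  have int: "integrable N (\<lambda>x. x ^ j)" for j
  proof (rule N.integrable_const_bound[of _ 1])
    show "AE x in N. norm (x ^ j) \<le> 1" using N(2) by eventually_elim (auto intro: power_le_one)
  qed auto
  have Lpoly: "L p = (\<integral>x. poly p (complex_of_real x) \<partial>N) \<and> integrable N (\<lambda>x. poly p (complex_of_real x))" for p
  proof -
    have p: "p = (\<Sum>i\<le>degree p. smult (coeff p i) ([:0, 1:] ^ i))"
      by (metis (no_types, lifting) poly_as_sum_of_monoms monom_altdef sum.cong)
    have L0: "L 0 = 0" using Lsmult[of 0 0] by simp
    have "L (\<Sum>i\<in>I. smult (coeff p i) ([:0, 1:] ^ i)) = (\<integral>x. poly (\<Sum>i\<in>I. smult (coeff p i) ([:0, 1:] ^ i)) (complex_of_real x) \<partial>N)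
      \<and> integrable N (\<lambda>x. poly (\<Sum>i\<in>I. smult (coeff p i) ([:0, 1:] ^ i)) (complex_of_real x))" if "finite I" for I
      using that
    proof (induction rule: finite_induct)
      case (insert i I)
      have i: "integrable N (\<lambda>x. coeff p i * complex_of_real x ^ i)"
        using integrable_of_real[OF int[of i], where 'a=complex] by (intro integrable_mult_right) simp
      have "(\<integral>x. coeff p i * complex_of_real x ^ i \<partial>N) = coeff p i * L ([:0, 1:] ^ i)"
        unfolding N(3) integral_mult_right_zero by (simp flip: of_real_power)
      then have "coeff p i * L ([:0, 1:] ^ i) = (\<integral>x. coeff p i * complex_of_real x ^ i \<partial>N)" by (rule sym)
      then show ?case using insert i by (simp add: Ladd Lsmult)
    qed (simp add: L0)
    from this[of "{..degree p}"] p show ?thesis by simp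
  qed
  define Y where "Y = [:complex_of_real (- R), complex_of_real (2 * R):]"
  have "pcompose Y Z = [:0, 1:]" using R by (simp add: Y_def Z_def pcompose_pCons)
  then have YZ: "pcompose (Y ^ j) Z = [:0, 1:] ^ j" for j by (simp add: pcompose_power)
  have mom: "cinner x (op_power T j x) = complex_of_real (\<integral>t. (2 * R * t - R) ^ j \<partial>N)" for j
  proof -
    have "cinner x (op_power T j x) = L (Y ^ j)" unfolding L_def YZ op_poly_power[OF TC] ..
    also have "\<dots> = (\<integral>t. complex_of_real ((2 * R * t - R) ^ j) \<partial>N)"
      using Lpoly[of "Y ^ j"] by (simp add: Y_def algebra_simps)
    finally show ?thesis by (simp only: integral_complex_of_real)
  qed
  show ?thesis
  proof (intro exI[of _ "distr N borel (\<lambda>t. 2 * R * t - R)"] conjI allI)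
    show "real_distribution (distr N borel (\<lambda>t. 2 * R * t - R))"
      by (intro N.real_distribution_distr) simp
    have "AE t in N. 2 * R * t - R \<in> {-R..R}"
      using N(2) by eventually_elim (use R in \<open>auto simp: mult_left_le\<close>)
    then show "AE t in distr N borel (\<lambda>t. 2 * R * t - R). t \<in> {-R..R}"
      by (subst AE_distr_iff) auto
    show "cinner x (op_power T j x) = complex_of_real (\<integral>t. t ^ j \<partial>distr N borel (\<lambda>t. 2 * R * t - R))" for j
      unfolding mom by (subst integral_distr) auto
  qed
qed

text \<open>Normalize \<open>x\<close> and multiply the mass by \<open>(norm x)\<^sup>2\<close>. In
  the degenerate cases \<open>T = 0\<close> and \<open>x = 0\<close> the unit mass at 0 is taken
  before this rescaling.\<close>

lemma moment_measure:
  assumes T: "self_adjoint T"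
  shows "\<exists>M. finite_measure M \<and> sets M = sets borel \<and> (AE t in M. t \<in> {- norm T..norm T}) \<and>
    (\<forall>j. cinner x (op_power T j x) = complex_of_real (\<integral>t. t ^ j \<partial>M))"
proof -
  define u where "u = x /\<^sub>R norm x"
  have x: "x = norm x *\<^sub>R u" by (cases "x = 0") (auto simp: u_def)
  have "\<exists>M. real_distribution M \<and> (AE t in M. t \<in> {- norm T..norm T}) \<and>
    (\<forall>j. norm x \<noteq> 0 \<longrightarrow> cinner u (op_power T j u) = complex_of_real (\<integral>t. t ^ j \<partial>M))"
  proof (cases "norm T > 0 \<and> x \<noteq> 0")
    case True
    then have "norm u = 1" by (simp add: u_def)
    then show ?thesis using moment_measure_unit[OF T order_refl, of u] True by auto
  next
    case False
    have pr: "prob_space (return borel (0::real))" by (rule prob_space_return) simp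
    then have rd: "real_distribution (return borel 0)" unfolding real_distribution_def real_distribution_axioms_def by simp
    have "cinner u (op_power T j u) = complex_of_real (\<integral>t. t ^ j \<partial>return borel 0)" if "x \<noteq> 0" for j
    proof -
      have "norm u = 1" using that by (simp add: u_def)
      moreover have "T = 0" using False that by auto
      ultimately show ?thesis using prob_space.prob_space[OF pr] by (cases j) (auto simp: integral_return op_power_Suc cinner_self)
    qed
    then show ?thesis by (intro exI[of _ "return borel 0"]) (auto simp: rd AE_return)
  qed
  then obtain M where M: "real_distribution M" "AE t in M. t \<in> {- norm T..norm T}"
    "\<And>j. norm x \<noteq> 0 \<Longrightarrow> cinner u (op_power T j u) = complex_of_real (\<integral>t. t ^ j \<partial>M)" by blast
  interpret M: real_distribution M by (rule M)
  define N where "N = density M (\<lambda>_. ennreal ((norm x)\<^sup>2))"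
  have "finite_measure N"
    by (rule finite_measureI) (simp add: N_def emeasure_density M.emeasure_space_1 ennreal_mult_eq_top_iff)
  moreover have "AE t in N. t \<in> {- norm T..norm T}"
    unfolding N_def using M(2) by (subst AE_density) (auto elim: eventually_mono)
  moreover have "cinner x (op_power T j x) = complex_of_real (\<integral>t. t ^ j \<partial>N)" for j
  proof -
    have "cinner x (op_power T j x) = complex_of_real ((norm x)\<^sup>2) * cinner u (op_power T j u)"
      by (subst (1 2) x) (simp add: blinfun.scaleR_right cinner_scaleR_left cinner_scaleR_right power2_eq_square)
    also have "\<dots> = complex_of_real ((norm x)\<^sup>2 * (\<integral>t. t ^ j \<partial>M))"
      using M(3) by (cases "norm x = 0") auto
    also have "(norm x)\<^sup>2 * (\<integral>t. t ^ j \<partial>M) = (\<integral>t. t ^ j \<partial>N)"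
      unfolding N_def by (subst integral_density) auto
    finally show ?thesis .
  qed
  ultimately show ?thesis by (intro exI[of _ N]) (auto simp: N_def)
qed

section \<open>Borel functional calculus\<close>

lemma weierstrass_complex_poly:
  fixes g :: "real \<Rightarrow> real"
  assumes "continuous_on {a..b} g" "e > 0"
  obtains p :: "complex poly" where "\<And>x. x \<in> {a..b} \<Longrightarrow> cmod (poly p (complex_of_real x) - complex_of_real (g x)) < e"
proof -
  obtain q where q: "real_polynomial_function q" "\<And>x. x \<in> {a..b} \<Longrightarrow> \<bar>g x - q x\<bar> < e"
    using Stone_Weierstrass_real_polynomial_function[OF compact_Icc assms] by blast
  then obtain c n where c: "q = (\<lambda>x. \<Sum>i\<le>n. c i * x ^ i)"
    unfolding real_polynomial_function_iff_sum by auto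
  define p where "p = (\<Sum>i\<le>n. monom (complex_of_real (c i)) i)"
  have "poly p (complex_of_real x) = complex_of_real (q x)" for x
    by (simp add: p_def c poly_sum poly_monom)
  then have "cmod (poly p (complex_of_real x) - complex_of_real (g x)) = \<bar>g x - q x\<bar>" for x
    by (metis norm_of_real of_real_diff abs_minus_commute)
  then show ?thesis using q(2) by (intro that[of p]) auto
qed

lemma norm_add_square_le: "(norm (a + b))\<^sup>2 \<le> 2 * (norm a)\<^sup>2 + 2 * (norm b)\<^sup>2" for a b :: "'a::real_normed_vector"
proof -
  have "(norm (a + b))\<^sup>2 \<le> (norm a + norm b)\<^sup>2" by (intro power_mono norm_triangle_ineq) auto
  also have "\<dots> \<le> 2 * (norm a)\<^sup>2 + 2 * (norm b)\<^sup>2" using sum_squares_bound[of "norm a" "norm b"] by (simp add: power2_sum)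
  finally show ?thesis .
qed

lemma norm_diff_square_le: "(norm (a - b))\<^sup>2 \<le> 2 * (norm a)\<^sup>2 + 2 * (norm b)\<^sup>2" for a b :: "'a::real_normed_vector"
  using norm_add_square_le[of a "- b"] by simp

text \<open>\<open>C\<close> will be the commutant of \<open>M\<close>. Presenting \<open>M\<close>
  as a commutant makes membership stable under polynomials and strong limits.\<close>

locale operator_calculus =
  fixes F :: "('h::complex_hilbert) op" and M C :: "'h op set"
  assumes M_eq: "M = commutant C" and C_clinear: "C \<subseteq> clinear_ops" and FM: "F \<in> M" and F_sa: "self_adjoint F"
begin

definition r :: real where "r = norm F"

text \<open>A chosen solution of the moment problem at each vector;
  \<open>proj_scalar_measure\<close> later identifies it with the scalar spectral measure.\<close>

definition spec :: "'h \<Rightarrow> real measure" where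
  "spec x = (SOME N. finite_measure N \<and> sets N = sets borel \<and> (AE t in N. t \<in> {- norm F..norm F}) \<and>
    (\<forall>j. cinner x (op_power F j x) = complex_of_real (\<integral>t. t ^ j \<partial>N)))"

lemma spec_props: "finite_measure (spec x) \<and> sets (spec x) = sets borel \<and> (AE t in spec x. t \<in> {- norm F..norm F}) \<and>
    (\<forall>j. cinner x (op_power F j x) = complex_of_real (\<integral>t. t ^ j \<partial>spec x))"
  unfolding spec_def by (rule someI_ex) (rule moment_measure[OF F_sa])

sublocale spec: finite_measure "spec x" for x
  using spec_props by blast

lemma sets_spec [simp, measurable_cong]: "sets (spec x) = sets borel"
  using spec_props by blast

lemma space_spec [simp]: "space (spec x) = UNIV"
  using sets_eq_imp_space_eq[OF sets_spec] by simp

lemma AE_spec: "AE t in spec x. t \<in> {-r..r}"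
  using spec_props unfolding r_def by blast

lemma spec_moment: "cinner x (op_power F j x) = complex_of_real (\<integral>t. t ^ j \<partial>spec x)"
  using spec_props by blast

lemma spec_mass: "measure (spec x) UNIV = (norm x)\<^sup>2"
  using spec_moment[of x 0] unfolding cinner_self by (simp add: cinner_self flip: of_real_power)

lemma F_clinear: "F \<in> clinear_ops"
  using F_sa by (simp add: self_adjoint_def)

lemma M_clinear: "T \<in> M \<Longrightarrow> T \<in> clinear_ops"
  unfolding M_eq commutant_def by simp

text \<open>Boundedness is asked only on the interval that carries every \<open>spec x\<close>, so
  polynomials belong to the class.\<close>

definition bdd :: "(real \<Rightarrow> complex) \<Rightarrow> bool" where
  "bdd h \<longleftrightarrow> h \<in> borel_measurable borel \<and> (\<exists>K. \<forall>t\<in>{-r..r}. cmod (h t) \<le> K)"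

lemma bddI: "h \<in> borel_measurable borel \<Longrightarrow> (\<And>t. t \<in> {-r..r} \<Longrightarrow> cmod (h t) \<le> K) \<Longrightarrow> bdd h"
  unfolding bdd_def by blast

lemma bdd_measurable [measurable_dest]: "bdd h \<Longrightarrow> h \<in> borel_measurable borel"
  unfolding bdd_def by blast

lemma bddE:
  assumes "bdd h" obtains K where "K \<ge> 0" "\<And>t. t \<in> {-r..r} \<Longrightarrow> cmod (h t) \<le> K"
proof -
  obtain K where K: "\<forall>t\<in>{-r..r}. cmod (h t) \<le> K" using assms unfolding bdd_def by blast
  show ?thesis by (rule that[of "max K 0"]) (use K in \<open>auto simp: le_max_iff_disj\<close>)
qed

lemma bdd_add: assumes "bdd h" "bdd g" shows "bdd (\<lambda>t. h t + g t)"
proof -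
  obtain K L where K: "\<And>t. t \<in> {-r..r} \<Longrightarrow> cmod (h t) \<le> K" and L: "\<And>t. t \<in> {-r..r} \<Longrightarrow> cmod (g t) \<le> L"
    using assms by (metis bddE)
  note [measurable] = bdd_measurable[OF assms(1)] bdd_measurable[OF assms(2)]
  show ?thesis by (rule bddI[of _ "K + L"]) (auto intro!: norm_triangle_le add_mono K L)
qed

lemma bdd_mult: assumes "bdd h" "bdd g" shows "bdd (\<lambda>t. h t * g t)"
proof -
  obtain K L where K: "K \<ge> 0" "\<And>t. t \<in> {-r..r} \<Longrightarrow> cmod (h t) \<le> K" and L: "\<And>t. t \<in> {-r..r} \<Longrightarrow> cmod (g t) \<le> L"
    using assms by (metis bddE)
  note [measurable] = bdd_measurable[OF assms(1)] bdd_measurable[OF assms(2)]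
  show ?thesis by (rule bddI[of _ "K * L"]) (auto simp: norm_mult intro!: mult_mono K L)
qed

lemma bdd_const: "bdd (\<lambda>_. c)"
  by (rule bddI[of _ "cmod c"]) auto

lemma bdd_cmult: "bdd h \<Longrightarrow> bdd (\<lambda>t. c * h t)"
  using bdd_mult[OF bdd_const] .

lemma bdd_diff: "bdd h \<Longrightarrow> bdd g \<Longrightarrow> bdd (\<lambda>t. h t - g t)"
  using bdd_add[of h "\<lambda>t. - 1 * g t"] bdd_cmult[of g "-1"] by simp

lemma continuous_bdd:
  assumes "continuous_on UNIV h" shows "bdd h"
proof -
  have "compact (h ` {-r..r})" by (intro compact_continuous_image continuous_on_subset[OF assms]) auto
  then obtain K where "\<And>t. t \<in> {-r..r} \<Longrightarrow> cmod (h t) \<le> K"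
    using compact_imp_bounded bounded_iff by (metis imageI)
  then show ?thesis by (intro bddI borel_measurable_continuous_onI assms)
qed

lemma bdd_poly: "bdd (\<lambda>t. poly P (complex_of_real t))"
  by (intro continuous_bdd continuous_intros)

lemma bdd_integrable: assumes "bdd h" shows "integrable (spec x) h"
proof -
  obtain K where K: "\<And>t. t \<in> {-r..r} \<Longrightarrow> cmod (h t) \<le> K" using assms by (metis bddE)
  note [measurable] = bdd_measurable[OF assms]
  show ?thesis
  proof (rule spec.integrable_const_bound[of _ K])
    show "AE t in spec x. cmod (h t) \<le> K" using AE_spec by eventually_elim (rule K)
  qed auto
qed

lemma bdd_integrable_square: assumes "bdd h" shows "integrable (spec x) (\<lambda>t. (cmod (h t))\<^sup>2)"
proof -
  obtain K where K: "\<And>t. t \<in> {-r..r} \<Longrightarrow> cmod (h t) \<le> K" using assms by (metis bddE)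
  note [measurable] = bdd_measurable[OF assms]
  show ?thesis
  proof (rule spec.integrable_const_bound[of _ "K\<^sup>2"])
    show "AE t in spec x. norm ((cmod (h t))\<^sup>2) \<le> K\<^sup>2" using AE_spec by eventually_elim (auto intro!: power_mono K)
  qed auto
qed

text \<open>The squared norm in \<open>L\<^sup>2(spec x)\<close>, unrelated to the energy of grid
  functions. Working with squares causes the factors 2 in the triangle inequalities.\<close>

definition energy :: "'h \<Rightarrow> (real \<Rightarrow> complex) \<Rightarrow> real" where
  "energy x h = (\<integral>t. (cmod (h t))\<^sup>2 \<partial>spec x)"

lemma energy_nonneg: "energy x h \<ge> 0"
  unfolding energy_def by (intro integral_nonneg_AE) auto

lemma energy_diff_le: assumes "bdd h" "bdd g" shows "energy x (\<lambda>t. h t - g t) \<le> 2 * energy x h + 2 * energy x g"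
proof -
  have "energy x (\<lambda>t. h t - g t) \<le> (\<integral>t. 2 * (cmod (h t))\<^sup>2 + 2 * (cmod (g t))\<^sup>2 \<partial>spec x)"
    unfolding energy_def by (intro integral_mono bdd_integrable_square bdd_diff assms Bochner_Integration.integrable_add integrable_mult_right norm_diff_square_le)
  also have "\<dots> = 2 * energy x h + 2 * energy x g"
    unfolding energy_def using bdd_integrable_square[OF assms(1)] bdd_integrable_square[OF assms(2)] by simp
  finally show ?thesis .
qed

lemma energy_triangle: assumes "bdd h" "bdd g" "bdd k"
  shows "energy x (\<lambda>t. h t - k t) \<le> 2 * energy x (\<lambda>t. h t - g t) + 2 * energy x (\<lambda>t. g t - k t)"
proof -
  have "(\<lambda>t. h t - k t) = (\<lambda>t. (h t - g t) - (k t - g t))" by auto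
  then have "energy x (\<lambda>t. h t - k t) \<le> 2 * energy x (\<lambda>t. h t - g t) + 2 * energy x (\<lambda>t. k t - g t)"
    using energy_diff_le[OF bdd_diff[OF assms(1,2)] bdd_diff[OF assms(3,2)]] by simp
  also have "energy x (\<lambda>t. k t - g t) = energy x (\<lambda>t. g t - k t)" by (simp add: energy_def norm_minus_commute)
  finally show ?thesis .
qed

text \<open>The pointwise bound \<open>c \<le> e + c\<^sup>2 / e\<close> with \<open>e\<close> just
  above the \<open>L\<^sup>2\<close> norm compares the two norms on a finite measure; the summand
  \<open>1 / (n + 1)\<close> keeps \<open>e\<close> positive.\<close>

lemma energy_tendsto_L1:
  assumes d: "\<And>n. bdd (d n)" and lim: "(\<lambda>n. energy x (d n)) \<longlonglongrightarrow> 0"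
  shows "(\<lambda>n. \<integral>t. cmod (d n t) \<partial>spec x) \<longlonglongrightarrow> 0"
proof -
  define e where "e n = sqrt (energy x (d n)) + 1 / real (Suc n)" for n
  have e0: "e n > 0" for n unfolding e_def using energy_nonneg by (intro add_nonneg_pos) auto
  have elim: "e \<longlonglongrightarrow> 0"
    unfolding e_def using tendsto_add[OF tendsto_real_sqrt[OF lim] LIMSEQ_Suc[OF lim_1_over_n]] by simp
  have bound: "(\<integral>t. cmod (d n t) \<partial>spec x) \<le> e n * (measure (spec x) UNIV + 1)" for n
  proof -
    have pt: "cmod (d n t) \<le> e n + (cmod (d n t))\<^sup>2 / e n" for t
    proof -
      define a where "a = cmod (d n t)"
      have "0 \<le> (a - e n)\<^sup>2" by simp
      then have "2 * a * e n \<le> a\<^sup>2 + (e n)\<^sup>2" by (simp add: power2_diff)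
      moreover have "0 \<le> a * e n" using e0[of n] by (simp add: a_def)
      moreover have "(e n + a\<^sup>2 / e n) * e n = (e n)\<^sup>2 + a\<^sup>2" using e0[of n] by (simp add: power2_eq_square distrib_right)
      ultimately have "a * e n \<le> (e n + a\<^sup>2 / e n) * e n" by linarith
      then show ?thesis unfolding a_def[symmetric] using e0[of n] by (rule mult_right_le_imp_le)
    qed
    have "(\<integral>t. cmod (d n t) \<partial>spec x) \<le> (\<integral>t. e n + (cmod (d n t))\<^sup>2 / e n \<partial>spec x)"
      by (intro integral_mono integrable_norm bdd_integrable d Bochner_Integration.integrable_add integrable_divide bdd_integrable_square pt) auto
    also have "\<dots> = e n * measure (spec x) UNIV + energy x (d n) / e n"
      unfolding energy_def using bdd_integrable_square[OF d] by simp
    also have "energy x (d n) / e n \<le> e n"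
    proof -
      have "sqrt (energy x (d n)) \<le> e n" by (simp add: e_def)
      then have "(sqrt (energy x (d n)))\<^sup>2 \<le> (e n)\<^sup>2" using energy_nonneg by (intro power_mono) auto
      then show ?thesis using e0[of n] energy_nonneg by (simp add: divide_le_eq power2_eq_square)
    qed
    finally show ?thesis by (simp add: algebra_simps)
  qed
  show ?thesis
  proof (rule Lim_null_comparison)
    show "\<forall>\<^sub>F n in sequentially. norm (\<integral>t. cmod (d n t) \<partial>spec x) \<le> e n * (measure (spec x) UNIV + 1)"
      using bound by (simp add: abs_of_nonneg integral_nonneg_AE)
    show "(\<lambda>n. e n * (measure (spec x) UNIV + 1)) \<longlonglongrightarrow> 0" using tendsto_mult_left_zero[OF elim] .
  qed
qed

lemma energy_tendsto:
  assumes u: "\<And>n. bdd (u n)" "bdd v" and lim: "(\<lambda>n. energy x (\<lambda>t. u n t - v t)) \<longlonglongrightarrow> 0"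
  shows "(\<lambda>n. energy x (u n)) \<longlonglongrightarrow> energy x v" "(\<lambda>n. \<integral>t. u n t \<partial>spec x) \<longlonglongrightarrow> (\<integral>t. v t \<partial>spec x)"
proof -
  obtain K where K: "K \<ge> 0" "\<And>t. t \<in> {-r..r} \<Longrightarrow> cmod (v t) \<le> K" using bddE[OF u(2)] by blast
  have d: "bdd (\<lambda>t. u n t - v t)" for n by (intro bdd_diff u)
  note L1 = energy_tendsto_L1[OF d lim]
  show "(\<lambda>n. energy x (u n)) \<longlonglongrightarrow> energy x v"
  proof (rule LIM_zero_cancel, rule Lim_null_comparison)
    show "(\<lambda>n. energy x (\<lambda>t. u n t - v t) + 2 * K * (\<integral>t. cmod (u n t - v t) \<partial>spec x)) \<longlonglongrightarrow> 0"
      using tendsto_add[OF lim tendsto_mult_right_zero[OF L1]] by simp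
    have "norm (energy x (u n) - energy x v) \<le> energy x (\<lambda>t. u n t - v t) + 2 * K * (\<integral>t. cmod (u n t - v t) \<partial>spec x)" for n
    proof -
      have "energy x (u n) - energy x v = (\<integral>t. (cmod (u n t))\<^sup>2 - (cmod (v t))\<^sup>2 \<partial>spec x)"
        unfolding energy_def by (intro Bochner_Integration.integral_diff[symmetric] bdd_integrable_square u)
      also have "norm \<dots> \<le> (\<integral>t. norm ((cmod (u n t))\<^sup>2 - (cmod (v t))\<^sup>2) \<partial>spec x)" by (rule integral_norm_bound)
      also have "\<dots> \<le> (\<integral>t. (cmod (u n t - v t))\<^sup>2 + 2 * K * cmod (u n t - v t) \<partial>spec x)"
      proof (rule integral_mono_AE)
        show "AE t in spec x. norm ((cmod (u n t))\<^sup>2 - (cmod (v t))\<^sup>2) \<le> (cmod (u n t - v t))\<^sup>2 + 2 * K * cmod (u n t - v t)"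
          using AE_spec
        proof eventually_elim
          fix t assume t: "t \<in> {-r..r}"
          define a b c where "a = cmod (u n t)" and "b = cmod (v t)" and "c = cmod (u n t - v t)"
          have abc: "\<bar>a - b\<bar> \<le> c" "0 \<le> b" "b \<le> K" "0 \<le> a" unfolding a_def b_def c_def using norm_triangle_ineq3 K(2)[OF t] by auto
          have "a\<^sup>2 - b\<^sup>2 = (a - b) * (a + b)" by (simp add: power2_eq_square algebra_simps)
          then have "norm (a\<^sup>2 - b\<^sup>2) = \<bar>a - b\<bar> * (a + b)" using abc by (simp add: abs_mult)
          also have "\<dots> \<le> c * (c + 2 * K)" using abc by (intro mult_mono) auto
          finally show "norm (a\<^sup>2 - b\<^sup>2) \<le> c\<^sup>2 + 2 * K * c" by (simp add: power2_eq_square algebra_simps)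
        qed
      qed (intro integrable_norm Bochner_Integration.integrable_diff Bochner_Integration.integrable_add integrable_mult_right bdd_integrable_square bdd_integrable u d)+
      also have "\<dots> = energy x (\<lambda>t. u n t - v t) + 2 * K * (\<integral>t. cmod (u n t - v t) \<partial>spec x)"
        unfolding energy_def using bdd_integrable_square[OF d] integrable_norm[OF bdd_integrable[OF d]] by simp
      finally show ?thesis .
    qed
    then show "\<forall>\<^sub>F n in sequentially. norm (energy x (u n) - energy x v) \<le> energy x (\<lambda>t. u n t - v t) + 2 * K * (\<integral>t. cmod (u n t - v t) \<partial>spec x)"
      by (intro always_eventually allI)
  qed
  show "(\<lambda>n. \<integral>t. u n t \<partial>spec x) \<longlonglongrightarrow> (\<integral>t. v t \<partial>spec x)"
  proof (rule LIM_zero_cancel, rule Lim_null_comparison[OF _ L1], intro always_eventually allI)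
    fix n
    have "(\<integral>t. u n t \<partial>spec x) - (\<integral>t. v t \<partial>spec x) = (\<integral>t. u n t - v t \<partial>spec x)"
      by (intro Bochner_Integration.integral_diff[symmetric] bdd_integrable u)
    then show "norm ((\<integral>t. u n t \<partial>spec x) - (\<integral>t. v t \<partial>spec x)) \<le> (\<integral>t. cmod (u n t - v t) \<partial>spec x)"
      using integral_norm_bound[of "spec x" "\<lambda>t. u n t - v t"] by simp
  qed
qed

lemma inner_poly: "cinner x (op_poly P F x) = (\<integral>t. poly P (complex_of_real t) \<partial>spec x)"
proof -
  have I: "integrable (spec x) (\<lambda>t. coeff P m * complex_of_real (t ^ m))" for m
    by (intro bdd_integrable bdd_cmult continuous_bdd continuous_intros)
  have "cinner x (op_poly P F x) = (\<Sum>m\<le>degree P. coeff P m * complex_of_real (\<integral>t. t ^ m \<partial>spec x))"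
    by (simp add: op_poly_apply[OF order_refl] cinner_sum_right cinner_scaleC_right spec_moment)
  also have "\<dots> = (\<Sum>m\<le>degree P. \<integral>t. coeff P m * complex_of_real (t ^ m) \<partial>spec x)"
    by (simp only: integral_mult_right_zero integral_complex_of_real)
  also have "\<dots> = (\<integral>t. (\<Sum>m\<le>degree P. coeff P m * complex_of_real (t ^ m)) \<partial>spec x)"
    by (rule Bochner_Integration.integral_sum[symmetric]) (rule I)
  finally show ?thesis by (simp add: poly_altdef)
qed

lemma norm_poly: "(norm (op_poly P F x))\<^sup>2 = energy x (\<lambda>t. poly P (complex_of_real t))"
proof -
  let ?n = "degree P"
  have I: "integrable (spec x) (\<lambda>t. cnj (coeff P m) * coeff P l * complex_of_real (t ^ (m + l)))" for m l
    by (intro bdd_integrable bdd_cmult continuous_bdd continuous_intros)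
  have "complex_of_real ((norm (op_poly P F x))\<^sup>2) = (\<Sum>m\<le>?n. \<Sum>l\<le>?n. cnj (coeff P m) * coeff P l * complex_of_real (\<integral>t. t ^ (m + l) \<partial>spec x))"
    unfolding cinner_self[symmetric]
    by (simp add: op_poly_apply[OF order_refl] cinner_sum_right cinner_sum_left cinner_scaleC_left cinner_scaleC_right
       op_power_self_adjoint[OF F_sa] op_power_add[symmetric] spec_moment mult.assoc sum_distrib_left)
       (rule trans[OF sum.swap], simp add: mult.commute mult.left_commute)
  also have "\<dots> = (\<Sum>m\<le>?n. \<Sum>l\<le>?n. \<integral>t. cnj (coeff P m) * coeff P l * complex_of_real (t ^ (m + l)) \<partial>spec x)"
    by (simp only: integral_mult_right_zero integral_complex_of_real)
  also have "\<dots> = (\<integral>t. (\<Sum>m\<le>?n. \<Sum>l\<le>?n. cnj (coeff P m) * coeff P l * complex_of_real (t ^ (m + l))) \<partial>spec x)"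
    by (subst Bochner_Integration.integral_sum, intro Bochner_Integration.integrable_sum I)
       (intro sum.cong refl Bochner_Integration.integral_sum[symmetric] I)
  also have "(\<lambda>t. \<Sum>m\<le>?n. \<Sum>l\<le>?n. cnj (coeff P m) * coeff P l * complex_of_real (t ^ (m + l))) =
      (\<lambda>t. complex_of_real ((cmod (poly P (complex_of_real t)))\<^sup>2))"
  proof
    fix t
    have "complex_of_real ((cmod (poly P (complex_of_real t)))\<^sup>2) = cnj (poly P (complex_of_real t)) * poly P (complex_of_real t)"
      unfolding complex_norm_square by (rule mult.commute)
    also have "\<dots> = (\<Sum>m\<le>?n. \<Sum>l\<le>?n. cnj (coeff P m) * coeff P l * complex_of_real (t ^ (m + l)))"
      unfolding poly_altdef cnj_sum sum_product by (intro sum.cong refl) (simp add: power_add)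
    finally show "(\<Sum>m\<le>?n. \<Sum>l\<le>?n. cnj (coeff P m) * coeff P l * complex_of_real (t ^ (m + l))) = complex_of_real ((cmod (poly P (complex_of_real t)))\<^sup>2)" ..
  qed
  also have "(\<integral>t. complex_of_real ((cmod (poly P (complex_of_real t)))\<^sup>2) \<partial>spec x) = complex_of_real (energy x (\<lambda>t. poly P (complex_of_real t)))"
    unfolding energy_def by (rule integral_complex_of_real)
  finally show ?thesis by (simp only: of_real_eq_iff)
qed

text \<open>\<open>calc h T\<close> expresses \<open>T = h(F)\<close>: at every vector \<open>x\<close>, some polynomials approximate \<open>h\<close> in \<open>L\<^sup>2(spec x)\<close> and
  simultaneously \<open>T x\<close> in norm.\<close>

definition calc :: "(real \<Rightarrow> complex) \<Rightarrow> 'h op \<Rightarrow> bool" where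
  "calc h T \<longleftrightarrow> bdd h \<and> T \<in> M \<and>
    (\<forall>x. \<forall>e>0. \<exists>P. norm (op_poly P F x - T x) < e \<and> energy x (\<lambda>t. poly P (complex_of_real t) - h t) < e)"

lemma calc_bdd: "calc h T \<Longrightarrow> bdd h" and calc_M: "calc h T \<Longrightarrow> T \<in> M"
  unfolding calc_def by blast+

lemma calc_seq:
  assumes "calc h T"
  obtains P where "(\<lambda>n. op_poly (P n) F x) \<longlonglongrightarrow> T x" "(\<lambda>n. energy x (\<lambda>t. poly (P n) (complex_of_real t) - h t)) \<longlonglongrightarrow> 0"
proof -
  have "\<exists>P. norm (op_poly P F x - T x) < 1 / real (Suc n) \<and> energy x (\<lambda>t. poly P (complex_of_real t) - h t) < 1 / real (Suc n)" for n
    using assms unfolding calc_def by (simp del: of_nat_Suc)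
  then obtain P where P: "\<And>n. norm (op_poly (P n) F x - T x) < 1 / real (Suc n)"
    "\<And>n. energy x (\<lambda>t. poly (P n) (complex_of_real t) - h t) < 1 / real (Suc n)" by metis
  note z = LIMSEQ_Suc[OF lim_1_over_n]
  show ?thesis
  proof (rule that[of P])
    show "(\<lambda>n. op_poly (P n) F x) \<longlonglongrightarrow> T x"
      by (rule LIM_zero_cancel, rule Lim_null_comparison[OF _ z]) (use P(1) in \<open>auto intro!: always_eventually less_imp_le\<close>)
    show "(\<lambda>n. energy x (\<lambda>t. poly (P n) (complex_of_real t) - h t)) \<longlonglongrightarrow> 0"
      by (rule Lim_null_comparison[OF _ z]) (use P(2) energy_nonneg in \<open>auto intro!: always_eventually less_imp_le\<close>)
  qed
qed

lemma calc_inner: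
  assumes "calc h T" shows "cinner x (T x) = (\<integral>t. h t \<partial>spec x)"
proof -
  obtain P where P: "(\<lambda>n. op_poly (P n) F x) \<longlonglongrightarrow> T x" "(\<lambda>n. energy x (\<lambda>t. poly (P n) (complex_of_real t) - h t)) \<longlonglongrightarrow> 0"
    using calc_seq[OF assms] by blast
  have "(\<lambda>n. cinner x (op_poly (P n) F x)) \<longlonglongrightarrow> cinner x (T x)" by (intro tendsto_intros P)
  then show ?thesis using energy_tendsto(2)[OF bdd_poly calc_bdd[OF assms] P(2)] unfolding inner_poly by (rule LIMSEQ_unique)
qed

text \<open>The isometry between operator values and functions in \<open>L\<^sup>2(spec x)\<close>:
  \<open>norm_poly\<close> is the polynomial case and both sides pass to the limit. It yields
  uniqueness of the calculus and Cauchy estimates.\<close>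

lemma calc_norm_diff:
  assumes "calc h T" "calc g U" shows "(norm (T x - U x))\<^sup>2 = energy x (\<lambda>t. h t - g t)"
proof -
  obtain P where P: "(\<lambda>n. op_poly (P n) F x) \<longlonglongrightarrow> T x" "(\<lambda>n. energy x (\<lambda>t. poly (P n) (complex_of_real t) - h t)) \<longlonglongrightarrow> 0"
    using calc_seq[OF assms(1)] by blast
  obtain Q where Q: "(\<lambda>n. op_poly (Q n) F x) \<longlonglongrightarrow> U x" "(\<lambda>n. energy x (\<lambda>t. poly (Q n) (complex_of_real t) - g t)) \<longlonglongrightarrow> 0"
    using calc_seq[OF assms(2)] by blast
  have od: "op_poly (P n - Q n) F x = op_poly (P n) F x - op_poly (Q n) F x" for n
    using op_poly_add[of "P n - Q n" "Q n" F] by (simp add: blinfun.add_left)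
  have 1: "(\<lambda>n. (norm (op_poly (P n - Q n) F x))\<^sup>2) \<longlonglongrightarrow> (norm (T x - U x))\<^sup>2"
    unfolding od by (intro tendsto_intros P Q)
  have "(\<lambda>n. energy x (\<lambda>t. poly (P n - Q n) (complex_of_real t))) \<longlonglongrightarrow> energy x (\<lambda>t. h t - g t)"
  proof (rule energy_tendsto(1)[OF bdd_poly bdd_diff[OF calc_bdd calc_bdd, OF assms]])
    have b: "energy x (\<lambda>t. poly (P n - Q n) (complex_of_real t) - (h t - g t)) \<le>
       2 * energy x (\<lambda>t. poly (P n) (complex_of_real t) - h t) + 2 * energy x (\<lambda>t. poly (Q n) (complex_of_real t) - g t)" for n
      using energy_diff_le[OF bdd_diff[OF bdd_poly calc_bdd[OF assms(1)]] bdd_diff[OF bdd_poly calc_bdd[OF assms(2)]], of x "P n" "Q n"]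
      by (simp add: algebra_simps)
    have "(\<lambda>n. 2 * energy x (\<lambda>t. poly (P n) (complex_of_real t) - h t) + 2 * energy x (\<lambda>t. poly (Q n) (complex_of_real t) - g t)) \<longlonglongrightarrow> 2 * 0 + 2 * 0"
      by (intro tendsto_intros P Q)
    then have z: "(\<lambda>n. 2 * energy x (\<lambda>t. poly (P n) (complex_of_real t) - h t) + 2 * energy x (\<lambda>t. poly (Q n) (complex_of_real t) - g t)) \<longlonglongrightarrow> 0"
      by simp
    show "(\<lambda>n. energy x (\<lambda>t. poly (P n - Q n) (complex_of_real t) - (h t - g t))) \<longlonglongrightarrow> 0"
    proof (rule Lim_null_comparison[OF _ z], intro always_eventually allI)
      fix n
      show "norm (energy x (\<lambda>t. poly (P n - Q n) (complex_of_real t) - (h t - g t))) \<le>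
        2 * energy x (\<lambda>t. poly (P n) (complex_of_real t) - h t) + 2 * energy x (\<lambda>t. poly (Q n) (complex_of_real t) - g t)"
        unfolding real_norm_def abs_of_nonneg[OF energy_nonneg] by (rule b)
    qed
  qed
  with 1 show ?thesis unfolding norm_poly by (rule LIMSEQ_unique)
qed

lemma calc_poly: "calc (\<lambda>t. poly P (complex_of_real t)) (op_poly P F)"
proof -
  have "op_poly P F \<in> M" using op_poly_commutant[OF C_clinear] FM by (simp add: M_eq)
  then show ?thesis unfolding calc_def using bdd_poly by (auto intro!: exI[of _ P] simp: energy_def)
qed

lemma calc_0: "calc (\<lambda>_. 0) 0"
  using calc_poly[of 0] by simp

lemma calc_id: "calc (\<lambda>_. 1) id_blinfun"
  using calc_poly[of 1] by simp

lemma calc_norm: "calc h T \<Longrightarrow> (norm (T x))\<^sup>2 = energy x h"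
  using calc_norm_diff[OF _ calc_0, of h T x] by simp

lemma calc_cong:
  assumes "calc h T" "\<And>t. t \<in> {-r..r} \<Longrightarrow> h t = g t" and [measurable]: "g \<in> borel_measurable borel"
  shows "calc g T"
proof -
  note [measurable] = bdd_measurable[OF calc_bdd[OF assms(1)]]
  have "bdd g" using assms calc_bdd[OF assms(1)] unfolding bdd_def by auto
  moreover have "energy x (\<lambda>t. poly P (complex_of_real t) - h t) = energy x (\<lambda>t. poly P (complex_of_real t) - g t)" for x P
    unfolding energy_def
  proof (rule integral_cong_AE)
    have [measurable]: "(\<lambda>t. poly P (complex_of_real t)) \<in> borel_measurable borel" by (rule bdd_measurable[OF bdd_poly])
    show "(\<lambda>t. (cmod (poly P (complex_of_real t) - h t))\<^sup>2) \<in> borel_measurable (spec x)" by measurable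
    show "(\<lambda>t. (cmod (poly P (complex_of_real t) - g t))\<^sup>2) \<in> borel_measurable (spec x)" by measurable
    show "AE t in spec x. (cmod (poly P (complex_of_real t) - h t))\<^sup>2 = (cmod (poly P (complex_of_real t) - g t))\<^sup>2"
      using AE_spec by eventually_elim (simp add: assms(2))
  qed
  ultimately show ?thesis using assms(1) unfolding calc_def by simp
qed

lemma calc_unique: "calc h T \<Longrightarrow> calc h U \<Longrightarrow> T = U"
  using calc_norm_diff[of h T h U] by (intro blinfun_eqI) (simp add: energy_def)

lemma calc_add:
  assumes "calc h T" "calc g U" shows "calc (\<lambda>t. h t + g t) (T + U)"
  unfolding calc_def
proof (intro conjI allI impI)
  show "bdd (\<lambda>t. h t + g t)" by (intro bdd_add calc_bdd[OF assms(1)] calc_bdd[OF assms(2)])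
  show "T + U \<in> M" using calc_M[OF assms(1)] calc_M[OF assms(2)] unfolding M_eq by (rule commutant_add)
  fix x and e :: real assume "e > 0"
  then have "e / 4 > 0" by simp
  then obtain P Q where P: "norm (op_poly P F x - T x) < e / 4" "energy x (\<lambda>t. poly P (complex_of_real t) - h t) < e / 4"
    and Q: "norm (op_poly Q F x - U x) < e / 4" "energy x (\<lambda>t. poly Q (complex_of_real t) - g t) < e / 4"
    using assms unfolding calc_def by meson
  have "norm (op_poly (P + Q) F x - (T + U) x) \<le> norm (op_poly P F x - T x) + norm (op_poly Q F x - U x)"
    unfolding op_poly_add blinfun.add_left add_diff_add by (rule norm_triangle_ineq)
  moreover have "energy x (\<lambda>t. poly (P + Q) (complex_of_real t) - (h t + g t)) \<le>
      2 * energy x (\<lambda>t. poly P (complex_of_real t) - h t) + 2 * energy x (\<lambda>t. g t - poly Q (complex_of_real t))"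
    using energy_diff_le[OF bdd_diff[OF bdd_poly calc_bdd[OF assms(1)]] bdd_diff[OF calc_bdd[OF assms(2)] bdd_poly], of x P Q]
    by (simp add: algebra_simps)
  moreover have "energy x (\<lambda>t. g t - poly Q (complex_of_real t)) = energy x (\<lambda>t. poly Q (complex_of_real t) - g t)"
    by (simp add: energy_def norm_minus_commute)
  ultimately show "\<exists>P. norm (op_poly P F x - (T + U) x) < e \<and> energy x (\<lambda>t. poly P (complex_of_real t) - (h t + g t)) < e"
    using P Q \<open>e > 0\<close> by (intro exI[of _ "P + Q"]) auto
qed

lemma calc_scale:
  assumes "calc h T" shows "calc (\<lambda>t. c * h t) (op_scaleC c T)"
  unfolding calc_def
proof (intro conjI allI impI)
  show "bdd (\<lambda>t. c * h t)" by (intro bdd_cmult calc_bdd[OF assms(1)])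
  show "op_scaleC c T \<in> M" using calc_M[OF assms(1)] commutant_scaleC[OF C_clinear] unfolding M_eq by blast
  fix x and e :: real assume "e > 0"
  define k where "k = 1 + cmod c + (cmod c)\<^sup>2"
  have k: "k > 0" "cmod c \<le> k" "(cmod c)\<^sup>2 \<le> k" unfolding k_def
    using norm_ge_zero[of c] zero_le_power2[of "cmod c"] by linarith+
  have "e / k > 0" using \<open>e > 0\<close> k by simp
  then obtain P where P: "norm (op_poly P F x - T x) < e / k" "energy x (\<lambda>t. poly P (complex_of_real t) - h t) < e / k"
    using assms unfolding calc_def by meson
  have "op_scaleC c T x = c *\<^sub>C T x" by simp
  have sd: "c *\<^sub>C a - c *\<^sub>C b = c *\<^sub>C (a - b)" for a b :: 'h
    using scaleC_add_right[of c "a - b" b] by (simp add: algebra_simps)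
  have "norm (op_poly (smult c P) F x - op_scaleC c T x) = cmod c * norm (op_poly P F x - T x)"
    by (simp add: op_poly_smult sd norm_scaleC)
  also have "\<dots> \<le> k * norm (op_poly P F x - T x)" using k by (intro mult_right_mono) auto
  also have "\<dots> < e" using P(1) k by (simp add: less_divide_eq mult.commute)
  finally have 1: "norm (op_poly (smult c P) F x - op_scaleC c T x) < e" .
  have "energy x (\<lambda>t. poly (smult c P) (complex_of_real t) - c * h t) = (cmod c)\<^sup>2 * energy x (\<lambda>t. poly P (complex_of_real t) - h t)"
    unfolding energy_def by (simp add: right_diff_distrib[symmetric] norm_mult power_mult_distrib)
  also have "\<dots> \<le> k * energy x (\<lambda>t. poly P (complex_of_real t) - h t)" using k energy_nonneg by (intro mult_right_mono) auto
  also have "\<dots> < e" using P(2) k by (simp add: less_divide_eq mult.commute)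
  finally show "\<exists>P. norm (op_poly P F x - op_scaleC c T x) < e \<and> energy x (\<lambda>t. poly P (complex_of_real t) - c * h t) < e"
    using 1 by blast
qed

lemma calc_diff: "calc h T \<Longrightarrow> calc g U \<Longrightarrow> calc (\<lambda>t. h t - g t) (T - U)"
  using calc_add[OF _ calc_scale[of g U "-1"], of h T] by (simp add: op_scaleC_minus1)

lemma calc_sum:
  "finite I \<Longrightarrow> (\<And>i. i \<in> I \<Longrightarrow> calc (h i) (T i)) \<Longrightarrow> calc (\<lambda>t. \<Sum>i\<in>I. h i t) (\<Sum>i\<in>I. T i)"
  by (induction I rule: finite_induct) (auto simp: calc_0 intro!: calc_add)

text \<open>Dominated convergence gives convergence in every \<open>L\<^sup>2(spec x)\<close>, and
  the isometry makes \<open>T n x\<close> Cauchy. The mass of \<open>spec x\<close> is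
  \<open>(norm x)\<^sup>2\<close>, which bounds the limit operator.\<close>

lemma calc_limit:
  assumes c: "\<And>n. calc (h n) (T n)" and g[measurable]: "g \<in> borel_measurable borel"
    and bd: "\<And>n t. t \<in> {-r..r} \<Longrightarrow> cmod (h n t) \<le> K" and lim: "\<And>t. t \<in> {-r..r} \<Longrightarrow> (\<lambda>n. h n t) \<longlonglongrightarrow> g t"
  obtains U where "calc g U" "\<And>x. (\<lambda>n. T n x) \<longlonglongrightarrow> U x"
proof -
  note [measurable] = bdd_measurable[OF calc_bdd[OF c]]
  have gK: "cmod (g t) \<le> K" if "t \<in> {-r..r}" for t
    by (rule LIMSEQ_le_const2[OF tendsto_norm[OF lim[OF that]]]) (use bd that in auto)
  have bg: "bdd g" by (rule bddI[OF g gK])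
  have el: "(\<lambda>n. energy x (\<lambda>t. h n t - g t)) \<longlonglongrightarrow> 0" for x
  proof -
    have "(\<lambda>n. \<integral>t. (cmod (h n t - g t))\<^sup>2 \<partial>spec x) \<longlonglongrightarrow> (\<integral>t. 0 \<partial>spec x)"
    proof (rule integral_dominated_convergence[where w="\<lambda>_. (2 * K)\<^sup>2"])
      show "AE t in spec x. (\<lambda>n. (cmod (h n t - g t))\<^sup>2) \<longlonglongrightarrow> 0"
        using AE_spec
      proof eventually_elim
        fix t assume "t \<in> {-r..r}"
        then have "(\<lambda>n. (cmod (h n t - g t))\<^sup>2) \<longlonglongrightarrow> (cmod (g t - g t))\<^sup>2" by (intro tendsto_intros lim)
        then show "(\<lambda>n. (cmod (h n t - g t))\<^sup>2) \<longlonglongrightarrow> 0" by simp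
      qed
      show "AE t in spec x. norm ((cmod (h n t - g t))\<^sup>2) \<le> (2 * K)\<^sup>2" for n
        using AE_spec
      proof eventually_elim
        fix t assume t: "t \<in> {-r..r}"
        have "cmod (h n t - g t) \<le> 2 * K" using norm_triangle_ineq4[of "h n t" "g t"] bd[OF t, of n] gK[OF t] by linarith
        then have "(cmod (h n t - g t))\<^sup>2 \<le> (2 * K)\<^sup>2" by (intro power_mono) auto
        then show "norm ((cmod (h n t - g t))\<^sup>2) \<le> (2 * K)\<^sup>2" by simp
      qed
    qed auto
    then show ?thesis by (simp add: energy_def)
  qed
  have cau: "Cauchy (\<lambda>n. T n x)" for x
  proof (rule metric_CauchyI)
    fix e :: real assume "e > 0"
    then have "e\<^sup>2 / 4 > 0" by simp
    then obtain N where N: "\<And>n. n \<ge> N \<Longrightarrow> norm (energy x (\<lambda>t. h n t - g t) - 0) < e\<^sup>2 / 4"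
      using LIMSEQ_D[OF el] by blast
    have "dist (T i x) (T j x) < e" if "i \<ge> N" "j \<ge> N" for i j
    proof -
      have "(norm (T i x - T j x))\<^sup>2 \<le> 2 * energy x (\<lambda>t. h i t - g t) + 2 * energy x (\<lambda>t. g t - h j t)"
        unfolding calc_norm_diff[OF c c] by (rule energy_triangle[OF calc_bdd[OF c] bg calc_bdd[OF c]])
      also have "energy x (\<lambda>t. g t - h j t) = energy x (\<lambda>t. h j t - g t)" by (simp add: energy_def norm_minus_commute)
      also have "2 * energy x (\<lambda>t. h i t - g t) + 2 * energy x (\<lambda>t. h j t - g t) < e\<^sup>2"
        using N[OF that(1)] N[OF that(2)] by (simp add: abs_less_iff)
      finally show ?thesis unfolding dist_norm using \<open>e > 0\<close> by (intro power2_less_imp_less[of _ e]) auto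
    qed
    then show "\<exists>N. \<forall>m\<ge>N. \<forall>n\<ge>N. dist (T m x) (T n x) < e" by blast
  qed
  define U0 where "U0 x = lim (\<lambda>n. T n x)" for x
  have U0: "(\<lambda>n. T n x) \<longlonglongrightarrow> U0 x" for x
    using cau[of x] unfolding U0_def by (simp add: Cauchy_convergent_iff convergent_LIMSEQ_iff)
  have Kx: "norm (T n x) \<le> norm x * \<bar>K\<bar>" for n x
  proof -
    have "(norm (T n x))\<^sup>2 \<le> (\<integral>t. K\<^sup>2 \<partial>spec x)"
      unfolding calc_norm[OF c] energy_def
    proof (rule integral_mono_AE)
      show "AE t in spec x. (cmod (h n t))\<^sup>2 \<le> K\<^sup>2" using AE_spec by eventually_elim (intro power_mono bd, auto)
    qed (use bdd_integrable_square[OF calc_bdd[OF c]] in auto)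
    also have "\<dots> = (norm x * \<bar>K\<bar>)\<^sup>2" by (simp add: spec_mass power_mult_distrib)
    finally show ?thesis by (rule power2_le_imp_le) simp
  qed
  have bl: "bounded_linear U0"
  proof (rule bounded_linear_intro[of _ "\<bar>K\<bar>"])
    show "U0 (x + y) = U0 x + U0 y" for x y
      using tendsto_add[OF U0[of x] U0[of y]] U0[of "x + y"] by (simp add: blinfun.add_right LIMSEQ_unique)
    show "U0 (s *\<^sub>R x) = s *\<^sub>R U0 x" for s x
      using tendsto_scaleR[OF tendsto_const U0[of x], of s] U0[of "s *\<^sub>R x"] by (simp add: blinfun.scaleR_right LIMSEQ_unique)
    show "norm (U0 x) \<le> norm x * \<bar>K\<bar>" for x
      by (rule LIMSEQ_le_const2[OF tendsto_norm[OF U0]]) (use Kx in auto)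
  qed
  define U where "U = Blinfun U0"
  have U: "(\<lambda>n. T n x) \<longlonglongrightarrow> U x" for x using U0 unfolding U_def bounded_linear_Blinfun_apply[OF bl] .
  have UM: "U \<in> M" unfolding M_eq by (rule commutant_limit[OF _ U]) (use calc_M[OF c] M_eq in auto)
  have "calc g U"
    unfolding calc_def
  proof (intro conjI allI impI bg UM)
    fix x and e :: real assume "e > 0"
    obtain N1 where N1: "\<And>n. n \<ge> N1 \<Longrightarrow> norm (energy x (\<lambda>t. h n t - g t) - 0) < e / 4"
      using LIMSEQ_D[OF el, of "e/4"] \<open>e > 0\<close> by auto
    obtain N2 where N2: "\<And>n. n \<ge> N2 \<Longrightarrow> norm (T n x - U x) < e / 4"
      using LIMSEQ_D[OF U, of "e/4"] \<open>e > 0\<close> by auto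
    define n where "n = max N1 N2"
    obtain P where P: "norm (op_poly P F x - T n x) < e / 4" "energy x (\<lambda>t. poly P (complex_of_real t) - h n t) < e / 4"
      using c[of n] \<open>e > 0\<close> unfolding calc_def by (meson divide_pos_pos zero_less_numeral)
    have "norm (op_poly P F x - U x) \<le> norm (op_poly P F x - T n x) + norm (T n x - U x)"
      using norm_triangle_ineq[of "op_poly P F x - T n x" "T n x - U x"] by simp
    moreover have "energy x (\<lambda>t. poly P (complex_of_real t) - g t) \<le> 2 * energy x (\<lambda>t. poly P (complex_of_real t) - h n t) + 2 * energy x (\<lambda>t. h n t - g t)"
      by (rule energy_triangle[OF bdd_poly calc_bdd[OF c] bg])
    ultimately show "\<exists>P. norm (op_poly P F x - U x) < e \<and> energy x (\<lambda>t. poly P (complex_of_real t) - g t) < e"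
      using P N1[of n] N2[of n] \<open>e > 0\<close> by (intro exI[of _ P]) (auto simp: n_def abs_less_iff)
  qed
  then show ?thesis using U that by blast
qed

lemma calc_continuous:
  assumes f: "continuous_on UNIV f"
  shows "\<exists>T. calc (\<lambda>t. complex_of_real (f t)) T"
proof -
  have "\<exists>p. \<forall>t\<in>{-r..r}. cmod (poly p (complex_of_real t) - complex_of_real (f t)) < 1 / real (Suc n)" for n
    using weierstrass_complex_poly[OF continuous_on_subset[OF f subset_UNIV], of "1 / real (Suc n)" "-r" r]
    by (metis of_nat_0_less_iff zero_less_Suc zero_less_divide_1_iff)
  then obtain p where p: "\<And>n t. t \<in> {-r..r} \<Longrightarrow> cmod (poly (p n) (complex_of_real t) - complex_of_real (f t)) < 1 / real (Suc n)"
    by metis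
  have "bdd (\<lambda>t. complex_of_real (f t))" by (intro continuous_bdd continuous_intros f)
  then obtain K where K: "\<And>t. t \<in> {-r..r} \<Longrightarrow> cmod (complex_of_real (f t)) \<le> K" using bddE by blast
  have [measurable]: "f \<in> borel_measurable borel" by (rule borel_measurable_continuous_onI[OF f])
  show ?thesis
  proof (rule calc_limit[of "\<lambda>n t. poly (p n) (complex_of_real t)" "\<lambda>n. op_poly (p n) F" "\<lambda>t. complex_of_real (f t)" "K + 1"])
    fix n t assume t: "t \<in> {-r..r}"
    have "1 / real (Suc n) \<le> 1" by simp
    then show "cmod (poly (p n) (complex_of_real t)) \<le> K + 1"
      using norm_triangle_ineq2[of "poly (p n) (complex_of_real t)" "complex_of_real (f t)"] p[OF t, of n] K[OF t] by linarith
  next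
    fix t assume t: "t \<in> {-r..r}"
    show "(\<lambda>n. poly (p n) (complex_of_real t)) \<longlonglongrightarrow> complex_of_real (f t)"
      by (rule LIM_zero_cancel, rule Lim_null_comparison[OF _ LIMSEQ_Suc[OF lim_1_over_n]])
         (use p[OF t] in \<open>auto intro!: always_eventually less_imp_le\<close>)
  qed (auto intro: calc_poly)
qed

text \<open>Closed sets generate the Borel sets and are stable under intersection, and their
  indicators are limits of continuous cutoffs; complements and countable disjoint unions follow by
  differences and bounded limits.\<close>

lemma calc_indicator:
  assumes "B \<in> sets borel"
  shows "\<exists>T. calc (\<lambda>t. complex_of_real (indicator B t)) T"
proof -
  have "Int_stable (Collect closed :: real set set)" by (auto simp: Int_stable_def)
  moreover have "(Collect closed :: real set set) \<subseteq> Pow UNIV" by simp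
  moreover have "B \<in> sigma_sets UNIV (Collect closed)" using assms by (simp add: borel_eq_closed)
  ultimately show ?thesis
  proof (induction B rule: sigma_sets_induct_disjoint)
    case (basic A)
    show ?case
    \<comment> \<open>By convention \<open>infdist t {}\<close> is 0, which would turn the cutoffs
      into the constant 1.\<close>
    proof (cases "A = {}")
      case True
      then show ?thesis using calc_0 by auto
    next
      case False
      have cl: "closed A" using basic by simp
      define f where "f n t = max 0 (1 - real n * infdist t A)" for n t
      have "\<exists>T. calc (\<lambda>t. complex_of_real (f n t)) T" for n
        unfolding f_def by (intro calc_continuous continuous_intros)
      then obtain T where T: "\<And>n. calc (\<lambda>t. complex_of_real (f n t)) (T n)" by metis
      have [measurable]: "A \<in> sets borel" using cl by simp
      show ?thesis
      proof (rule calc_limit[OF T, where g = "\<lambda>t. complex_of_real (indicator A t)" and K = 1])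
        show "cmod (complex_of_real (f n t)) \<le> 1" for n t by (simp add: f_def infdist_nonneg)
        fix t
        show "(\<lambda>n. complex_of_real (f n t)) \<longlonglongrightarrow> complex_of_real (indicator A t)"
        proof (cases "t \<in> A")
          case True
          then show ?thesis by (simp add: f_def)
        next
          case nA: False
          have "infdist t A \<noteq> 0" using in_closed_iff_infdist_zero[OF cl False] nA by simp
          then have pos: "infdist t A > 0" using infdist_nonneg[of t A] by linarith
          obtain N where N: "1 / infdist t A < real N" using reals_Archimedean2 by blast
          have "f n t = 0" if "n \<ge> N" for n
          proof -
            have "1 / infdist t A < real n" using N that by simp
            then have "1 < real n * infdist t A" using pos by (simp add: divide_less_eq)
            then show ?thesis by (simp add: f_def)
          qed
          then show ?thesis using nA by (intro tendsto_eventually) (auto simp: eventually_sequentially)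
        qed
      qed auto
    qed
  next
    case empty
    then show ?case using calc_0 by auto
  next
    case (compl A)
    then obtain T where "calc (\<lambda>t. complex_of_real (indicator A t)) T" by blast
    from calc_diff[OF calc_id this] show ?case
      by (intro exI[of _ "id_blinfun - T"]) (simp add: indicator_compl Compl_eq_Diff_UNIV[symmetric])
  next
    case (union A)
    then obtain T where T: "\<And>i. calc (\<lambda>t. complex_of_real (indicator (A i) t)) (T i)" by metis
    have [measurable]: "A i \<in> sets borel" for i using union by (auto simp: borel_eq_closed)
    show ?case
    proof (rule calc_limit[of "\<lambda>n t. \<Sum>i<n. complex_of_real (indicator (A i) t)" "\<lambda>n. \<Sum>i<n. T i" "\<lambda>t. complex_of_real (indicator (\<Union>i. A i) t)" 1])
      show "calc (\<lambda>t. \<Sum>i<n. complex_of_real (indicator (A i) t)) (\<Sum>i<n. T i)" for n by (intro calc_sum T) auto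
      have part: "(\<Sum>i<n. complex_of_real (indicator (A i) t)) = complex_of_real (indicator (\<Union>i<n. A i) t)" for n t
      proof -
        have "disjoint_family_on A {..<n}" using union(1) by (simp add: disjoint_family_on_def)
        then have "(indicator (\<Union>i<n. A i) t :: real) = (\<Sum>i<n. indicator (A i) t)"
          by (rule indicator_UN_disjoint[OF finite_lessThan])
        then show ?thesis by simp
      qed
      show "cmod (\<Sum>i<n. complex_of_real (indicator (A i) t)) \<le> 1" for n t unfolding part by (simp add: indicator_def)
      show "(\<lambda>n. \<Sum>i<n. complex_of_real (indicator (A i) t)) \<longlonglongrightarrow> complex_of_real (indicator (\<Union>i. A i) t)" for t
        unfolding part by (intro tendsto_of_real LIMSEQ_indicator_UN)
    qed auto
  qed
qed

end

text \<open>A comparable pair is a directed set with its larger member as supremum, so normality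
  already contains monotonicity.\<close>

lemma normal_on_mono:
  fixes M :: "('h::complex_hilbert) op set"
  assumes "normal_on M \<tau>" "a \<in> M" "b \<in> M" "self_adjoint a" "self_adjoint b" "op_le a b"
  shows "Re (\<tau> a) \<le> Re (\<tau> b)"
proof -
  have refl: "op_le x x" for x :: "'h op" by (simp add: op_le_def)
  have "is_op_lub M {a, b} b" using assms refl by (auto simp: is_op_lub_def)
  moreover have "\<forall>d\<in>{a, b}. \<forall>e\<in>{a, b}. \<exists>f\<in>{a, b}. op_le d f \<and> op_le e f"
    using assms(6) refl by (intro ballI bexI[of _ b]) auto
  ultimately have "Re (\<tau> b) = (SUP d\<in>{a, b}. Re (\<tau> d))"
    using assms(1)[unfolded normal_on_def, THEN spec[of _ "{a, b}"], THEN spec[of _ b]] assms(2-5) by auto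
  then show ?thesis by (simp add: cSup_insert sup_real_def)
qed

section \<open>Order properties of the calculus and the spectral projections\<close>

context operator_calculus begin

lemma calc_self_adjoint:
  assumes "calc (\<lambda>t. complex_of_real (u t)) T"
  shows "self_adjoint T"
proof (rule self_adjointI_real)
  show "T \<in> clinear_ops" using calc_M[OF assms] M_clinear by blast
  show "cinner x (T x) \<in> \<real>" for x unfolding calc_inner[OF assms] integral_complex_of_real by simp
qed

lemma calc_op_le:
  assumes T: "calc (\<lambda>t. complex_of_real (u t)) T" and U: "calc (\<lambda>t. complex_of_real (v t)) U"
    and le: "\<And>t. t \<in> {-r..r} \<Longrightarrow> u t \<le> v t"
  shows "op_le T U"
  unfolding op_le_def
proof
  fix x
  have "calc (\<lambda>t. complex_of_real (v t - u t)) (U - T)" using calc_diff[OF U T] by simp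
  from calc_inner[OF this] have "cinner x ((U - T) x) = complex_of_real (\<integral>t. v t - u t \<partial>spec x)"
    unfolding integral_complex_of_real .
  moreover have "0 \<le> (\<integral>t. v t - u t \<partial>spec x)"
  proof (rule integral_nonneg_AE)
    show "AE t in spec x. 0 \<le> v t - u t" using AE_spec[of x] by eventually_elim (use le in auto)
  qed
  ultimately show "cinner x ((U - T) x) \<in> \<real>\<^sub>\<ge>\<^sub>0" by simp
qed

text \<open>Induction over nonnegative Borel functions, starting from indicators. The bound on
  \<open>[-r, r]\<close> is inherited because summands and increasing approximants lie below the
  function they build.\<close>

lemma calc_nonneg_real:
  fixes u :: "real \<Rightarrow> real"
  assumes [measurable]: "u \<in> borel_measurable borel" and "\<And>t. 0 \<le> u t" "\<And>t. t \<in> {-r..r} \<Longrightarrow> u t \<le> K"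
  shows "\<exists>T. calc (\<lambda>t. complex_of_real (u t)) T"
  using assms
proof (induction u arbitrary: K rule: borel_measurable_induct_real)
  case (set A)
  then show ?case by (intro calc_indicator)
next
  case (mult u c)
  show ?case
  proof (cases "c = 0")
    case True
    then show ?thesis using calc_0 by auto
  next
    case False
    have "\<exists>T. calc (\<lambda>t. complex_of_real (u t)) T"
    proof (rule mult.IH)
      show "u t \<le> K / c" if "t \<in> {-r..r}" for t
        using mult.prems(1)[OF that] mult.hyps False by (simp add: pos_le_divide_eq mult.commute)
    qed
    then obtain T where "calc (\<lambda>t. complex_of_real (u t)) T" by blast
    from calc_scale[OF this, of "complex_of_real c"] show ?thesis by auto
  qed
next
  case (add u v)
  have "u t \<le> K" "v t \<le> K" if "t \<in> {-r..r}" for t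
    using add.prems(1)[OF that] add.hyps(2)[of t] add.hyps(4)[of t] by auto
  then obtain T U where "calc (\<lambda>t. complex_of_real (u t)) T" "calc (\<lambda>t. complex_of_real (v t)) U"
    using add.IH by blast
  from calc_add[OF this(2,1)] show ?case by auto
next
  case (seq U)
  have le: "U i t \<le> u t" for i t
    by (rule incseq_le) (use seq in \<open>auto simp: incseq_def le_fun_def\<close>)
  have UK: "U i t \<le> K" if "t \<in> {-r..r}" for i t using le[of i t] seq.prems(1)[OF that] by linarith
  then obtain T where T: "\<And>i. calc (\<lambda>t. complex_of_real (U i t)) (T i)" using seq.IH by metis
  have [measurable]: "u \<in> borel_measurable borel" by (rule borel_measurable_LIMSEQ_real[OF _ seq.hyps(1)]) (use seq in auto)
  show ?case
  proof (rule calc_limit[OF T, where g = "\<lambda>t. complex_of_real (u t)" and K = K])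
    show "cmod (complex_of_real (U n t)) \<le> K" if "t \<in> {-r..r}" for n t using UK[OF that] seq.hyps(2) by simp
    show "(\<lambda>n. complex_of_real (U n t)) \<longlonglongrightarrow> complex_of_real (u t)" for t by (intro tendsto_of_real) (use seq in auto)
  qed auto
qed

lemma calc_exists:
  assumes "bdd h"
  shows "\<exists>T. calc h T"
proof -
  note [measurable] = bdd_measurable[OF assms]
  obtain K where K: "K \<ge> 0" "\<And>t. t \<in> {-r..r} \<Longrightarrow> cmod (h t) \<le> K" using bddE[OF assms] by blast
  have part: "\<exists>T. calc (\<lambda>t. complex_of_real (p (h t))) T"
    if [measurable]: "p \<in> borel_measurable borel" and p: "\<And>z. \<bar>p z\<bar> \<le> cmod z" for p :: "complex \<Rightarrow> real"
  proof -
    have b: "\<bar>p (h t)\<bar> \<le> K" if "t \<in> {-r..r}" for t using p K(2)[OF that] order_trans by blast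
    have "\<exists>T. calc (\<lambda>t. complex_of_real (max 0 (p (h t)))) T"
      by (rule calc_nonneg_real[of _ K]) (use b K in \<open>auto simp: abs_le_iff\<close>)
    moreover have "\<exists>T. calc (\<lambda>t. complex_of_real (max 0 (- p (h t)))) T"
      by (rule calc_nonneg_real[of _ K]) (use b K in \<open>auto simp: abs_le_iff\<close>)
    ultimately obtain T U where TU: "calc (\<lambda>t. complex_of_real (max 0 (p (h t)))) T" "calc (\<lambda>t. complex_of_real (max 0 (- p (h t)))) U" by blast
    have "(\<lambda>t. complex_of_real (max 0 (p (h t))) - complex_of_real (max 0 (- p (h t)))) = (\<lambda>t. complex_of_real (p (h t)))"
      by (auto simp: max_def)
    then show ?thesis using calc_diff[OF TU] by auto
  qed
  obtain T U where TU: "calc (\<lambda>t. complex_of_real (Re (h t))) T" "calc (\<lambda>t. complex_of_real (Im (h t))) U"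
    using part[of Re] part[of Im] abs_Re_le_cmod abs_Im_le_cmod by fastforce
  have "calc (\<lambda>t. complex_of_real (Re (h t)) + \<i> * complex_of_real (Im (h t))) (T + op_scaleC \<i> U)"
    by (intro calc_add calc_scale TU)
  then show ?thesis by (auto simp flip: complex_eq)
qed

definition proj :: "real set \<Rightarrow> 'h op" where
  "proj B = (SOME T. calc (\<lambda>t. complex_of_real (indicator B t)) T)"

lemma calc_proj: "B \<in> sets borel \<Longrightarrow> calc (\<lambda>t. complex_of_real (indicator B t)) (proj B)"
  unfolding proj_def by (rule someI_ex) (rule calc_indicator)

lemma proj_inner: "B \<in> sets borel \<Longrightarrow> cinner x (proj B x) = complex_of_real (measure (spec x) B)"
  using calc_inner[OF calc_proj, of B x] by simp

text \<open>Quadratic forms determine the operators, and both forms are the integral of the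
  indicator, which equals its own square.\<close>

lemma proj_idem:
  assumes B: "B \<in> sets borel" shows "proj B o\<^sub>L proj B = proj B"
proof (rule clinear_ops_eqI)
  have PM: "proj B \<in> M" using calc_M[OF calc_proj[OF B]] .
  show "proj B \<in> clinear_ops" using PM by (rule M_clinear)
  show "proj B o\<^sub>L proj B \<in> clinear_ops" using commutant_compose PM unfolding M_eq by (intro M_clinear) (auto simp: M_eq)
  fix x
  have sa: "self_adjoint (proj B)" by (rule calc_self_adjoint[OF calc_proj[OF B]])
  have "cinner x ((proj B o\<^sub>L proj B) x) = complex_of_real ((norm (proj B x))\<^sup>2)"
    by (simp add: self_adjointD[OF sa, symmetric] cinner_self)
  also have "(norm (proj B x))\<^sup>2 = (\<integral>t. indicator B t \<partial>spec x)"
    unfolding calc_norm[OF calc_proj[OF B]] energy_def by (intro Bochner_Integration.integral_cong) (auto simp: indicator_def)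
  also have "complex_of_real \<dots> = cinner x (proj B x)" unfolding proj_inner[OF B] using B by simp
  finally show "cinner x ((proj B o\<^sub>L proj B) x) = cinner x (proj B x)" .
qed

lemma proj_sum:
  fixes A :: "nat \<Rightarrow> real set"
  assumes A: "\<And>i. A i \<in> sets borel" and disj: "disjoint_family A"
  shows "(\<Sum>i<n. proj (A i)) = proj (\<Union>i<n. A i)"
proof (rule calc_unique)
  have part: "(\<Sum>i<n. complex_of_real (indicator (A i) t)) = complex_of_real (indicator (\<Union>i<n. A i) t)" for t
  proof -
    have "disjoint_family_on A {..<n}" using disj by (simp add: disjoint_family_on_def)
    then have "(indicator (\<Union>i<n. A i) t :: real) = (\<Sum>i<n. indicator (A i) t)"
      by (rule indicator_UN_disjoint[OF finite_lessThan])
    then show ?thesis by simp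
  qed
  show "calc (\<lambda>t. complex_of_real (indicator (\<Union>i<n. A i) t)) (\<Sum>i<n. proj (A i))"
    unfolding part[symmetric] by (intro calc_sum calc_proj A) auto
  show "calc (\<lambda>t. complex_of_real (indicator (\<Union>i<n. A i) t)) (proj (\<Union>i<n. A i))"
    by (intro calc_proj) (use A in auto)
qed

lemma proj_UN_limit:
  assumes A: "\<And>i. A i \<in> sets borel"
  shows "(\<lambda>n. proj (\<Union>i<n. A i) x) \<longlonglongrightarrow> proj (\<Union>i. A i) x"
proof -
  have [measurable]: "A i \<in> sets borel" for i by (rule A)
  obtain U where U: "calc (\<lambda>t. complex_of_real (indicator (\<Union>i. A i) t)) U" "\<And>x. (\<lambda>n. proj (\<Union>i<n. A i) x) \<longlonglongrightarrow> U x"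
  proof (rule calc_limit[of "\<lambda>n t. complex_of_real (indicator (\<Union>i<n. A i) t)" "\<lambda>n. proj (\<Union>i<n. A i)" "\<lambda>t. complex_of_real (indicator (\<Union>i. A i) t)" 1])
    show "calc (\<lambda>t. complex_of_real (indicator (\<Union>i<n. A i) t)) (proj (\<Union>i<n. A i))" for n by (intro calc_proj) measurable
    show "(\<lambda>n. complex_of_real (indicator (\<Union>i<n. A i) t)) \<longlonglongrightarrow> complex_of_real (indicator (\<Union>i. A i) t)" for t
      by (intro tendsto_of_real LIMSEQ_indicator_UN)
  qed (auto simp: indicator_def)
  have "U = proj (\<Union>i. A i)" by (rule calc_unique[OF U(1) calc_proj]) measurable
  then show ?thesis using U(2) by simp
qed

lemma proj_pvm: "projection_valued_measure proj"
  unfolding projection_valued_measure_def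
proof (intro conjI ballI allI impI)
  show "self_adjoint (proj B)" if "B \<in> sets borel" for B by (rule calc_self_adjoint[OF calc_proj[OF that]])
  show "proj B o\<^sub>L proj B = proj B" if "B \<in> sets borel" for B by (rule proj_idem[OF that])
  have "calc (\<lambda>t. complex_of_real (indicator UNIV t)) id_blinfun" using calc_id by simp
  then show "proj UNIV = id_blinfun" by (rule calc_unique[OF calc_proj[OF borel_open[OF open_UNIV]]])
next
  fix A :: "nat \<Rightarrow> real set" and x
  assume A: "range A \<subseteq> sets borel" "disjoint_family A"
  have A': "A i \<in> sets borel" for i using A by auto
  show "(\<lambda>n. proj (A n) x) sums proj (\<Union>n. A n) x"
    unfolding sums_def blinfun.sum_left[symmetric] proj_sum[OF A' A(2)] by (rule proj_UN_limit[OF A'])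
qed

lemma proj_scalar_measure: "scalar_measure proj x = spec x"
proof -
  have "scalar_measure proj x = measure_of UNIV (sets borel) (emeasure (spec x))"
    unfolding scalar_measure_def
  proof (rule measure_of_eq)
    fix B :: "real set" assume "B \<in> sigma_sets UNIV (sets borel)"
    then have "B \<in> sets borel" using sets.sigma_sets_eq[of "borel :: real measure"] by simp
    then show "ennreal (Re (cinner x (proj B x))) = emeasure (spec x) B"
      by (simp add: proj_inner spec.emeasure_eq_measure)
  qed simp
  also have "\<dots> = spec x" using measure_of_of_measure[of "spec x"] by simp
  finally show ?thesis .
qed

lemma calc_spectral_integral: "calc h T \<Longrightarrow> is_spectral_integral proj h T"
  unfolding is_spectral_integral_def proj_scalar_measure using calc_inner M_clinear calc_M by blast

lemma calc_F: "calc complex_of_real F"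
  using calc_poly[of "[:0, 1:]"] by (simp add: op_poly_X)

lemma proj_spectral_measure: "is_spectral_measure F proj"
  unfolding is_spectral_measure_def
proof (intro conjI proj_pvm calc_spectral_integral calc_F)
  have "calc (\<lambda>t. complex_of_real (indicator {- norm F..norm F} t)) id_blinfun"
    by (rule calc_cong[OF calc_id]) (auto simp: r_def)
  then show "proj {- norm F..norm F} = id_blinfun" by (intro calc_unique[OF calc_proj]) auto
qed

end

section \<open>The distribution of a self-adjoint element\<close>

locale traced_calculus = operator_calculus F M C for F :: "('h::complex_hilbert) op" and M C +
  fixes \<tau> :: "'h op \<Rightarrow> complex"
  assumes state: "state_on M \<tau>" and normal: "normal_on M \<tau>"
begin

lemma tau_add: "a \<in> M \<Longrightarrow> b \<in> M \<Longrightarrow> \<tau> (a + b) = \<tau> a + \<tau> b"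
  using state unfolding state_on_def by blast

lemma tau_scale: "a \<in> M \<Longrightarrow> \<tau> (op_scaleC c a) = c * \<tau> a"
  using state unfolding state_on_def by blast

lemma tau_id: "\<tau> id_blinfun = 1"
  using state unfolding state_on_def by blast

lemma tau_square: "a \<in> M \<Longrightarrow> self_adjoint a \<Longrightarrow> \<tau> (a o\<^sub>L a) \<in> \<real>\<^sub>\<ge>\<^sub>0"
  using state adj_self_adjoint[of a] unfolding state_on_def by metis

lemma tau_0: "\<tau> 0 = 0"
proof -
  have "0 \<in> M" unfolding M_eq by (rule commutant_0)
  from tau_scale[OF this, of 0] show ?thesis by (simp add: op_scaleC_def zero_blinfun_def)
qed

lemma tau_sum: "finite I \<Longrightarrow> (\<And>i. i \<in> I \<Longrightarrow> a i \<in> M) \<Longrightarrow> \<tau> (\<Sum>i\<in>I. a i) = (\<Sum>i\<in>I. \<tau> (a i)) \<and> (\<Sum>i\<in>I. a i) \<in> M"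
proof (induction I rule: finite_induct)
  case empty
  then show ?case using tau_0 commutant_0[of C] by (simp add: M_eq)
next
  case (insert i I)
  then show ?case using tau_add[of "a i" "\<Sum>i\<in>I. a i"] commutant_add[of "a i" C "\<Sum>i\<in>I. a i"] by (simp add: M_eq)
qed

text \<open>The calculus preserves order and increasing limits become strong limits. A strong limit
  is the least upper bound because \<open>op_le\<close> is a closed condition on quadratic forms, so
  normality applies to the range of \<open>T\<close>.\<close>

lemma calc_normal:
  assumes T: "\<And>n. calc (\<lambda>t. complex_of_real (u n t)) (T n)" and U: "calc (\<lambda>t. complex_of_real (v t)) U"
    and inc: "\<And>t. t \<in> {-r..r} \<Longrightarrow> incseq (\<lambda>n. u n t)" and lim: "\<And>t. t \<in> {-r..r} \<Longrightarrow> (\<lambda>n. u n t) \<longlonglongrightarrow> v t"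
    and bd: "\<And>n t. t \<in> {-r..r} \<Longrightarrow> \<bar>u n t\<bar> \<le> K"
  shows "(\<lambda>n. Re (\<tau> (T n))) \<longlonglongrightarrow> Re (\<tau> U)"
proof -
  have TM: "T n \<in> M" "self_adjoint (T n)" for n using calc_M[OF T] calc_self_adjoint[OF T] by auto
  have UM: "U \<in> M" "self_adjoint U" using calc_M[OF U] calc_self_adjoint[OF U] by auto
  have Tmono: "op_le (T i) (T j)" if "i \<le> j" for i j
    by (rule calc_op_le[OF T T]) (use inc that in \<open>auto simp: incseq_def\<close>)
  have TU: "op_le (T n) U" for n
    by (rule calc_op_le[OF T U]) (use incseq_le[OF inc lim] in auto)
  obtain U' where U': "calc (\<lambda>t. complex_of_real (v t)) U'" "\<And>x. (\<lambda>n. T n x) \<longlonglongrightarrow> U' x"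
  proof (rule calc_limit[OF T bdd_measurable[OF calc_bdd[OF U]], where K = K])
    show "cmod (complex_of_real (u n t)) \<le> K" if "t \<in> {-r..r}" for n t using bd[OF that] by simp
    show "(\<lambda>n. complex_of_real (u n t)) \<longlonglongrightarrow> complex_of_real (v t)" if "t \<in> {-r..r}" for t
      by (rule tendsto_of_real[OF lim[OF that]])
  qed blast
  then have conv: "(\<lambda>n. T n x) \<longlonglongrightarrow> U x" for x using calc_unique[OF U'(1) U] by simp
  have "is_op_lub M (range T) U"
    unfolding is_op_lub_def
  proof (intro conjI ballI impI UM)
    show "op_le d U" if "d \<in> range T" for d using that TU by auto
    fix b assume b: "b \<in> M" "self_adjoint b" "\<forall>d\<in>range T. op_le d b"
    show "op_le U b"
      unfolding op_le_def
    proof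
      fix x
      have l: "(\<lambda>n. cinner x (b x - T n x)) \<longlonglongrightarrow> cinner x (b x - U x)" by (intro tendsto_intros conv)
      have "cinner x (b x - T n x) \<in> \<real>\<^sub>\<ge>\<^sub>0" for n using b(3) by (auto simp: op_le_def blinfun.diff_left)
      from closed_sequentially[OF closed_nonneg_Reals_complex this l]
      have "cinner x (b x - U x) \<in> \<real>\<^sub>\<ge>\<^sub>0" .
      then show "cinner x ((b - U) x) \<in> \<real>\<^sub>\<ge>\<^sub>0" by (simp add: blinfun.diff_left)
    qed
  qed
  moreover have "\<forall>d\<in>range T. \<forall>e\<in>range T. \<exists>f\<in>range T. op_le d f \<and> op_le e f"
  proof safe
    fix i j
    show "\<exists>f\<in>range T. op_le (T i) f \<and> op_le (T j) f"
      by (intro bexI[of _ "T (max i j)"] conjI Tmono) auto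
  qed
  ultimately have "Re (\<tau> U) = (SUP d\<in>range T. Re (\<tau> d))"
    using normal[unfolded normal_on_def, THEN spec[of _ "range T"], THEN spec[of _ U]] TM by auto
  then have sup: "Re (\<tau> U) = (SUP n. Re (\<tau> (T n)))" by (simp add: image_image)
  have "incseq (\<lambda>n. Re (\<tau> (T n)))"
    unfolding incseq_def by (intro allI impI normal_on_mono[OF normal] TM Tmono)
  moreover have "bdd_above (range (\<lambda>n. Re (\<tau> (T n))))"
    by (rule bdd_aboveI[of _ "Re (\<tau> U)"]) (auto intro!: normal_on_mono[OF normal] TM UM TU)
  ultimately show ?thesis unfolding sup by (intro LIMSEQ_incseq_SUP)
qed

text \<open>The values of \<tau> at the squares of \<open>a\<close> and
  \<open>a + id_blinfun\<close> are real, and they differ by twice the value at \<open>a\<close>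
  plus 1.\<close>

lemma tau_real:
  assumes "a \<in> M" "self_adjoint a" shows "\<tau> a = complex_of_real (Re (\<tau> a))"
proof -
  have idM: "id_blinfun \<in> M" unfolding M_eq by (rule commutant_id)
  have aa: "a o\<^sub>L a \<in> M" using assms commutant_compose unfolding M_eq by blast
  have bM: "a + id_blinfun \<in> M" using assms idM commutant_add unfolding M_eq by blast
  have bsa: "self_adjoint (a + id_blinfun)"
    using assms(2) M_clinear[OF bM] by (auto simp: self_adjoint_def is_adjoint_def blinfun.add_left cinner_add_left cinner_add_right)
  have "(a + id_blinfun) o\<^sub>L (a + id_blinfun) = (a o\<^sub>L a) + (a + (a + id_blinfun))"
    by (rule blinfun_eqI) (simp add: blinfun.add_left blinfun.add_right)
  then have "\<tau> ((a + id_blinfun) o\<^sub>L (a + id_blinfun)) = \<tau> (a o\<^sub>L a) + (\<tau> a + (\<tau> a + 1))"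
    using tau_add[OF aa] tau_add[OF assms(1)] bM assms(1) idM tau_id commutant_add[of a C] by (simp add: M_eq)
  moreover have "Im (\<tau> ((a + id_blinfun) o\<^sub>L (a + id_blinfun))) = 0" "Im (\<tau> (a o\<^sub>L a)) = 0"
    using tau_square[OF bM bsa] tau_square[OF assms] by (auto simp: complex_nonneg_Reals_iff)
  ultimately have "Im (\<tau> a) = 0" by simp
  then show ?thesis by (simp add: complex_eq_iff)
qed

definition law :: "real measure" where
  "law = measure_of UNIV (sets borel) (\<lambda>B. ennreal (Re (\<tau> (proj B))))"

lemma proj_M: "B \<in> sets borel \<Longrightarrow> proj B \<in> M"
  using calc_M[OF calc_proj] .

lemma proj_sa: "B \<in> sets borel \<Longrightarrow> self_adjoint (proj B)"
  using calc_self_adjoint[OF calc_proj] .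

lemma tau_proj_nonneg: "B \<in> sets borel \<Longrightarrow> Re (\<tau> (proj B)) \<ge> 0"
  using tau_square[OF proj_M proj_sa, of B] proj_idem[of B] by (simp add: complex_nonneg_Reals_iff)

lemma proj_empty: "proj {} = 0"
  using calc_unique[OF calc_proj, of "{}" 0] calc_0 by simp

lemma sets_law [simp, measurable_cong]: "sets law = sets borel"
  unfolding law_def using sets.sets_measure_of_eq[of "borel :: real measure"] by (simp only: space_borel)

lemma space_law [simp]: "space law = UNIV"
  using sets_eq_imp_space_eq[OF sets_law] by simp

text \<open>Finite additivity comes from linearity of \<tau>, continuity from below from its
  normality through \<open>calc_normal\<close>.\<close>

lemma emeasure_law:
  assumes "B \<in> sets borel" shows "emeasure law B = ennreal (Re (\<tau> (proj B)))"
proof (rule emeasure_measure_of[OF law_def])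
  show "positive (sets law) (\<lambda>B. ennreal (Re (\<tau> (proj B))))" by (simp add: positive_def proj_empty tau_0)
  show "countably_additive (sets law) (\<lambda>B. ennreal (Re (\<tau> (proj B))))"
  proof (rule countably_additiveI)
    fix A :: "nat \<Rightarrow> real set" assume A: "range A \<subseteq> sets law" "disjoint_family A"
    have A': "A i \<in> sets borel" for i using A by auto
    have U: "(\<Union>i. A i) \<in> sets borel" "(\<Union>i<n. A i) \<in> sets borel" for n using A' by auto
    have "(\<lambda>n. Re (\<tau> (proj (\<Union>i<n. A i)))) \<longlonglongrightarrow> Re (\<tau> (proj (\<Union>i. A i)))"
    proof (rule calc_normal[OF calc_proj[OF U(2)] calc_proj[OF U(1)]])
      show "incseq (\<lambda>n. indicator (\<Union>i<n. A i) t :: real)" for t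
        by (auto simp: incseq_def indicator_def)
      show "(\<lambda>n. indicator (\<Union>i<n. A i) t :: real) \<longlonglongrightarrow> indicator (\<Union>i. A i) t" for t
        by (rule LIMSEQ_indicator_UN)
      show "\<bar>indicator (\<Union>i<n. A i) t :: real\<bar> \<le> 1" for n t by (simp add: indicator_def)
    qed
    moreover have "Re (\<tau> (proj (\<Union>i<n. A i))) = (\<Sum>i<n. Re (\<tau> (proj (A i))))" for n
      using tau_sum[of "{..<n}" "\<lambda>i. proj (A i)"] proj_M[OF A'] by (simp add: proj_sum[OF A' A(2), symmetric] Re_sum)
    ultimately have "(\<lambda>i. Re (\<tau> (proj (A i)))) sums Re (\<tau> (proj (\<Union>i. A i)))" by (simp add: sums_def)
    then show "(\<Sum>i. ennreal (Re (\<tau> (proj (A i))))) = ennreal (Re (\<tau> (proj (\<Union>i. A i))))"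
      using tau_proj_nonneg[OF A'] by (intro sums_unique[symmetric] sums_ennreal[THEN iffD2]) (auto intro: tau_proj_nonneg U)
  qed
qed (use assms in auto)

lemma proj_UNIV: "proj UNIV = id_blinfun"
  using proj_pvm by (simp add: projection_valued_measure_def)

lemma prob_space_law: "prob_space law"
  by (rule prob_spaceI) (simp add: emeasure_law proj_UNIV tau_id)

lemma AE_law: "AE t in law. t \<in> {-r..r}"
proof -
  interpret prob_space law by (rule prob_space_law)
  have "proj {-r..r} = id_blinfun" using proj_spectral_measure by (simp add: is_spectral_measure_def r_def)
  then have "prob {-r..r} = 1" by (simp add: measure_def emeasure_law tau_id)
  then show ?thesis by (subst (asm) prob_eq_1) auto
qed

lemma law_bounded_support: "bounded_support law r"
proof -
  interpret prob_space law by (rule prob_space_law)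
  show ?thesis by unfold_locales (use AE_law in auto)
qed

lemma law_integrable: assumes "bdd h" shows "integrable law h"
proof -
  interpret prob_space law by (rule prob_space_law)
  obtain K where K: "\<And>t. t \<in> {-r..r} \<Longrightarrow> cmod (h t) \<le> K" using assms by (metis bddE)
  note [measurable] = bdd_measurable[OF assms]
  show ?thesis
  proof (rule integrable_const_bound[of _ K])
    show "AE t in law. cmod (h t) \<le> K" using AE_law by eventually_elim (rule K)
  qed auto
qed

text \<open>Indicators hold by the definition of \<open>law\<close>. Increasing limits pass through
  \<open>calc_normal\<close> on the operator side and through dominated convergence on the side of
  the measure.\<close>

lemma tau_calc_nonneg:
  fixes u :: "real \<Rightarrow> real"
  assumes "u \<in> borel_measurable borel" "\<And>t. 0 \<le> u t" "\<And>t. t \<in> {-r..r} \<Longrightarrow> u t \<le> K" "calc (\<lambda>t. complex_of_real (u t)) T"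
  shows "Re (\<tau> T) = (\<integral>t. u t \<partial>law)"
  using assms
proof (induction u arbitrary: T K rule: borel_measurable_induct_real)
  case (set A)
  then have "T = proj A" using calc_unique calc_proj by blast
  then show ?case using set by (simp add: measure_def emeasure_law tau_proj_nonneg)
next
  case (mult u c)
  show ?case
  proof (cases "c = 0")
    case True
    then have "T = 0" using mult.prems calc_unique[OF _ calc_0] by simp
    then show ?thesis using True tau_0 by simp
  next
    case False
    have uK: "u t \<le> K / c" if "t \<in> {-r..r}" for t
      using mult.prems(1)[OF that] mult.hyps False by (simp add: pos_le_divide_eq mult.commute)
    obtain S where S: "calc (\<lambda>t. complex_of_real (u t)) S" using calc_nonneg_real[OF mult.hyps(2,3) uK] by blast
    have "T = op_scaleC (complex_of_real c) S"
      using calc_unique[OF mult.prems(2)] calc_scale[OF S, of "complex_of_real c"] by simp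
    then show ?thesis using mult.IH[OF uK S] tau_scale[OF calc_M[OF S]] by simp
  qed
next
  case (add u v)
  have K: "u t \<le> K" "v t \<le> K" if "t \<in> {-r..r}" for t
    using add.prems(1)[OF that] add.hyps(2)[of t] add.hyps(4)[of t] by auto
  obtain S U where S: "calc (\<lambda>t. complex_of_real (u t)) S" and U: "calc (\<lambda>t. complex_of_real (v t)) U"
    using calc_nonneg_real[OF add.hyps(1,2) K(1)] calc_nonneg_real[OF add.hyps(3,4) K(2)] by blast
  have "T = U + S" using calc_unique[OF add.prems(2)] calc_add[OF U S] by simp
  moreover have "integrable law u" "integrable law v"
    using law_integrable[OF calc_bdd[OF S]] law_integrable[OF calc_bdd[OF U]] by (simp_all add: complex_of_real_integrable_eq)
  ultimately show ?case using add.IH(1)[OF K(1) S] add.IH(2)[OF K(2) U] tau_add[OF calc_M[OF U] calc_M[OF S]] by simp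
next
  case (seq U)
  interpret prob_space law by (rule prob_space_law)
  have inc: "incseq (\<lambda>i. U i t)" for t using seq by (auto simp: incseq_def le_fun_def)
  have lim: "(\<lambda>i. U i t) \<longlonglongrightarrow> u t" for t using seq by auto
  have le: "U i t \<le> u t" for i t by (rule incseq_le[OF inc lim])
  have UK: "U i t \<le> K" if "t \<in> {-r..r}" for i t using le[of i t] seq.prems(1)[OF that] by linarith
  have "\<exists>S. calc (\<lambda>t. complex_of_real (U i t)) S" for i using calc_nonneg_real[OF seq.hyps(1,2) UK] by blast
  then obtain S where S: "\<And>i. calc (\<lambda>t. complex_of_real (U i t)) (S i)" by metis
  have [measurable]: "U i \<in> borel_measurable borel" for i by (rule seq.hyps(1))
  have [measurable]: "u \<in> borel_measurable borel" by (rule borel_measurable_LIMSEQ_real[OF lim]) auto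
  have "(\<lambda>i. Re (\<tau> (S i))) \<longlonglongrightarrow> Re (\<tau> T)"
    by (rule calc_normal[OF S seq.prems(2) inc lim, of K]) (use UK seq.hyps(2) in auto)
  moreover have "(\<lambda>i. \<integral>t. U i t \<partial>law) \<longlonglongrightarrow> (\<integral>t. u t \<partial>law)"
  proof (rule integral_dominated_convergence[where w="\<lambda>_. K"])
    show "AE t in law. norm (U i t) \<le> K" for i
      using AE_law by eventually_elim (use UK seq.hyps(2) in auto)
  qed (use lim in auto)
  moreover have "Re (\<tau> (S i)) = (\<integral>t. U i t \<partial>law)" for i by (rule seq.IH[OF UK S])
  ultimately show ?case using LIMSEQ_unique by simp
qed

lemma tau_calc_real:
  assumes "calc (\<lambda>t. complex_of_real (u t)) T"
  shows "\<tau> T = complex_of_real (\<integral>t. u t \<partial>law)"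
proof -
  have um[measurable]: "u \<in> borel_measurable borel"
    using measurable_compose[OF bdd_measurable[OF calc_bdd[OF assms]] borel_measurable_Re] by simp
  obtain K where K: "K \<ge> 0" "\<And>t. t \<in> {-r..r} \<Longrightarrow> \<bar>u t\<bar> \<le> K" using bddE[OF calc_bdd[OF assms]] by (metis norm_of_real)
  have b: "max 0 (u t) \<le> K" "max 0 (- u t) \<le> K" if "t \<in> {-r..r}" for t using K(1) K(2)[OF that] by auto
  obtain P N where P: "calc (\<lambda>t. complex_of_real (max 0 (u t))) P" and N: "calc (\<lambda>t. complex_of_real (max 0 (- u t))) N"
    using calc_nonneg_real[of "\<lambda>t. max 0 (u t)" K] calc_nonneg_real[of "\<lambda>t. max 0 (- u t)" K] b by auto
  have eq: "u t = max 0 (u t) - max 0 (- u t)" for t by (auto simp: max_def)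
  have "T = P - N"
  proof (rule calc_unique[OF assms])
    have "(\<lambda>t. complex_of_real (max 0 (u t)) - complex_of_real (max 0 (- u t))) = (\<lambda>t. complex_of_real (u t))"
      using eq by (metis of_real_diff)
    then show "calc (\<lambda>t. complex_of_real (u t)) (P - N)" using calc_diff[OF P N] by simp
  qed
  then have "P = T + N" by simp
  then have "\<tau> P = \<tau> T + \<tau> N" using tau_add[OF calc_M[OF assms] calc_M[OF N]] by simp
  moreover have "Re (\<tau> P) = (\<integral>t. max 0 (u t) \<partial>law)" by (rule tau_calc_nonneg[OF _ _ b(1) P]) auto
  moreover have "Re (\<tau> N) = (\<integral>t. max 0 (- u t) \<partial>law)" by (rule tau_calc_nonneg[OF _ _ b(2) N]) auto
  moreover have "(\<integral>t. u t \<partial>law) = (\<integral>t. max 0 (u t) \<partial>law) - (\<integral>t. max 0 (- u t) \<partial>law)"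
  proof -
    have "integrable law (\<lambda>t. max 0 (u t))" "integrable law (\<lambda>t. max 0 (- u t))"
      using law_integrable[OF calc_bdd[OF P]] law_integrable[OF calc_bdd[OF N]] by (simp_all add: complex_of_real_integrable_eq)
    then show ?thesis by (subst (1) eq[abs_def]) (rule Bochner_Integration.integral_diff)
  qed
  ultimately have "Re (\<tau> T) = (\<integral>t. u t \<partial>law)" by simp
  then show ?thesis using tau_real[OF calc_M[OF assms] calc_self_adjoint[OF assms]] by simp
qed

lemma tau_calc:
  assumes "calc h T" shows "\<tau> T = (\<integral>t. h t \<partial>law)"
proof -
  note [measurable] = bdd_measurable[OF calc_bdd[OF assms]]
  have part: "bdd (\<lambda>t. complex_of_real (p (h t)))"
    if [measurable]: "p \<in> borel_measurable borel" and p: "\<And>z. \<bar>p z\<bar> \<le> cmod z" for p :: "complex \<Rightarrow> real"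
  proof -
    obtain K where K: "K \<ge> 0" "\<And>t. t \<in> {-r..r} \<Longrightarrow> cmod (h t) \<le> K" using bddE[OF calc_bdd[OF assms]] by blast
    show ?thesis by (rule bddI[of _ K]) (use order_trans[OF p K(2)] in auto)
  qed
  have bR: "bdd (\<lambda>t. complex_of_real (Re (h t)))" by (rule part) (auto simp: abs_Re_le_cmod)
  have bI: "bdd (\<lambda>t. complex_of_real (Im (h t)))" by (rule part) (auto simp: abs_Im_le_cmod)
  obtain A B where A: "calc (\<lambda>t. complex_of_real (Re (h t))) A" and B: "calc (\<lambda>t. complex_of_real (Im (h t))) B"
    using calc_exists[OF bR] calc_exists[OF bI] by blast
  have "T = A + op_scaleC \<i> B"
    using calc_unique[OF assms] calc_add[OF A calc_scale[OF B, of \<i>]] by (simp flip: complex_eq)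
  moreover have "op_scaleC \<i> B \<in> M" using calc_M[OF calc_scale[OF B]] .
  ultimately have "\<tau> T = complex_of_real (\<integral>t. Re (h t) \<partial>law) + \<i> * complex_of_real (\<integral>t. Im (h t) \<partial>law)"
    using tau_add[OF calc_M[OF A]] tau_scale[OF calc_M[OF B]] tau_calc_real[OF A] tau_calc_real[OF B] by simp
  also have "\<dots> = (\<integral>t. h t \<partial>law)"
    using law_integrable[OF calc_bdd[OF assms]] by (simp add: complex_eq_iff)
  finally show ?thesis .
qed

theorem is_distribution_law: "is_distribution \<tau> F law"
  unfolding is_distribution_def
proof (intro conjI ballI impI prob_space_law sets_law)
  fix h :: "real \<Rightarrow> complex" assume h: "h \<in> borel_measurable borel" "bounded (range h)"
  obtain K where "\<And>t. cmod (h t) \<le> K" using h(2) unfolding bounded_iff by auto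
  then have "bdd h" using h(1) by (intro bddI) auto
  then obtain T where T: "calc h T" using calc_exists by blast
  show "\<exists>T. is_borel_calculus F h T \<and> \<tau> T = (\<integral>t. h t \<partial>law)"
    unfolding is_borel_calculus_def using proj_spectral_measure calc_spectral_integral[OF T] tau_calc[OF T] by blast
qed

lemma tau_power: "\<tau> (op_power F j) = complex_of_real (\<integral>t. t ^ j \<partial>law)"
proof -
  have "calc (\<lambda>t. complex_of_real (t ^ j)) (op_power F j)"
    using calc_poly[of "[:0, 1:] ^ j"] by (simp add: op_poly_power[OF F_clinear] poly_power)
  then show ?thesis by (rule tau_calc_real)
qed

end

section \<open>Free Stein kernels\<close>

lemma coeff_poly_tensor: "coeff (poly_tensor i j) b = (if j = b then monom 1 i else 0)"
  by (simp add: poly_tensor_def)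

text \<open>\<open>X^a\<close> tensor \<open>X^b\<close> arises exactly once, from the monomial of
  degree \<open>a + b + 1\<close> at \<open>k = a + 1\<close>.\<close>

lemma coeff_free_difference_quotient:
  "coeff (coeff (free_difference_quotient P) b) a = coeff P (Suc (a + b))"
proof -
  have inner: "(\<Sum>k = 1..m. coeff (coeff (poly_tensor (k - 1) (m - k)) b) a) = (if m = Suc (a + b) then 1 else 0)" for m
  proof -
    have "coeff (coeff (poly_tensor (k - 1) (m - k)) b) a = (if k = Suc a then if m = Suc (a + b) then 1 else 0 else 0)"
      if k: "k \<in> {1..m}" for k
    proof -
      obtain l where "k = Suc l" using k by (cases k) auto
      moreover have "m - Suc l = b \<longleftrightarrow> m = Suc (l + b)" using k \<open>k = Suc l\<close> by auto
      ultimately show ?thesis by (simp add: coeff_poly_tensor)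
    qed
    then have "(\<Sum>k = 1..m. coeff (coeff (poly_tensor (k - 1) (m - k)) b) a)
        = (\<Sum>k = 1..m. if k = Suc a then if m = Suc (a + b) then 1 else 0 else 0)"
      by (intro sum.cong refl)
    also have "\<dots> = (if m = Suc (a + b) then 1 else 0)" by (subst sum.delta) auto
    finally show ?thesis .
  qed
  have "coeff (coeff (free_difference_quotient P) b) a
      = (\<Sum>m\<le>degree P. coeff P m * (\<Sum>k = 1..m. coeff (coeff (poly_tensor (k - 1) (m - k)) b) a))"
    unfolding free_difference_quotient_def
    by (simp only: coeff_sum coeff_smult mult_pCons_left mult_zero_left pCons_0_0 add_0_right sum_distrib_left)
  also have "\<dots> = (\<Sum>m\<le>degree P. if m = Suc (a + b) then coeff P m else 0)"
    unfolding inner by (intro sum.cong refl) simp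
  also have "\<dots> = coeff P (Suc (a + b))"
    by (subst sum.delta) (auto simp: coeff_eq_0)
  finally show ?thesis .
qed

text \<open>Padding with zero coefficients gives one square range of indices, on which the tensor
  can be compared with the scalar difference quotient.\<close>

lemma eval_tensor_free_difference_quotient:
  assumes n: "degree P \<le> n"
  shows "eval_tensor \<iota> tens F (free_difference_quotient P) =
    (\<Sum>b<n. \<Sum>a<n. coeff P (Suc (a + b)) *\<^sub>C tens (\<iota> (op_power F a)) (\<iota> (op_power F b)))"
proof -
  let ?Q = "free_difference_quotient P"
  let ?t = "\<lambda>b a. coeff (coeff ?Q b) a *\<^sub>C tens (\<iota> (op_power F a)) (\<iota> (op_power F b))"
  have z: "coeff (coeff ?Q b) a = 0" if "n \<le> a \<or> n \<le> b" for a b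
    unfolding coeff_free_difference_quotient using n that by (intro coeff_eq_0) auto
  have "(\<Sum>a\<le>degree (coeff ?Q b). ?t b a) = (\<Sum>a<n. ?t b a)" for b
    by (rule sum.mono_neutral_cong) (auto simp: z coeff_eq_0)
  then have "eval_tensor \<iota> tens F ?Q = (\<Sum>b\<le>degree ?Q. \<Sum>a<n. ?t b a)"
    unfolding eval_tensor_def by simp
  also have "\<dots> = (\<Sum>b<n. \<Sum>a<n. ?t b a)"
    by (rule sum.mono_neutral_cong) (auto simp: z coeff_eq_0)
  finally show ?thesis unfolding coeff_free_difference_quotient .
qed

lemma poly_as_sum_lessThan:
  fixes P :: "'a::comm_semiring_1 poly"
  assumes "degree P < q" shows "poly P x = (\<Sum>a<q. coeff P a * x ^ a)"
  unfolding poly_altdef by (rule sum.mono_neutral_left) (use assms in \<open>auto simp: coeff_eq_0\<close>)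

text \<open>Horner's scheme: the quotient of \<open>c + X P\<close> is \<open>P(x)\<close> plus
  \<open>y\<close> times the quotient of \<open>P\<close>. The bounds \<open>p\<close> and
  \<open>q\<close> are separate because an induction step lowers only \<open>p\<close>. The
  coefficients are those of the free difference quotient.\<close>

lemma dquot_poly:
  assumes "degree P \<le> p" "degree P \<le> q"
  shows "dquot (poly P) (poly (pderiv P)) (x, y) = (\<Sum>b<p. \<Sum>a<q. coeff P (Suc (a + b)) * (x ^ a * y ^ b))"
  using assms
proof (induction P arbitrary: p q)
  case 0
  then show ?case by (simp add: dquot_def)
next
  case (pCons c P)
  show ?case
  proof (cases "P = 0")
    case True
    then show ?thesis by (simp add: dquot_def)
  next
    case False
    then obtain p' where p: "p = Suc p'" "degree P \<le> p'" and q: "degree P < q"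
      using pCons.prems by (cases p) auto
    have step: "dquot (poly (pCons c P)) (poly (pderiv (pCons c P))) (x, y)
        = poly P x + y * dquot (poly P) (poly (pderiv P)) (x, y)"
    proof (cases "x = y")
      case False
      then have "x - y \<noteq> 0" by simp
      then show ?thesis using False by (simp add: dquot_def field_simps)
    qed (simp add: dquot_def pderiv_pCons)
    have "(\<Sum>b<p. \<Sum>a<q. coeff (pCons c P) (Suc (a + b)) * (x ^ a * y ^ b))
        = (\<Sum>a<q. coeff P a * x ^ a) + (\<Sum>b<p'. \<Sum>a<q. coeff P (Suc (a + b)) * (x ^ a * y ^ Suc b))"
      unfolding p(1) sum.lessThan_Suc_shift by simp
    also have "(\<Sum>b<p'. \<Sum>a<q. coeff P (Suc (a + b)) * (x ^ a * y ^ Suc b))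
        = y * (\<Sum>b<p'. \<Sum>a<q. coeff P (Suc (a + b)) * (x ^ a * y ^ b))"
      by (simp add: sum_distrib_left mult.left_commute)
    also have "\<dots> = y * dquot (poly P) (poly (pderiv P)) (x, y)"
      using pCons.IH[OF p(2), of q] q by simp
    also have "(\<Sum>a<q. coeff P a * x ^ a) = poly P x" by (rule poly_as_sum_lessThan[OF q, symmetric])
    finally show ?thesis unfolding step by simp
  qed
qed

lemma (in bounded_support) integrable_power: "integrable \<mu> (\<lambda>x. x ^ j)"
proof (rule integrable_const_bound[of _ "R ^ j"])
  show "AE x in \<mu>. norm (x ^ j) \<le> R ^ j"
    using AE_support
  proof eventually_elim
    case (elim x)
    then show ?case unfolding norm_power by (intro power_mono) auto
  qed
qed simp

lemma (in bounded_support) integral_dquot_square: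
  assumes n: "degree P \<le> n"
  shows "(\<integral>z. (dquot (poly P) (poly (pderiv P)) z)\<^sup>2 \<partial>(\<mu> \<Otimes>\<^sub>M \<mu>)) =
    (\<Sum>i\<in>{..<n} \<times> {..<n}. \<Sum>j\<in>{..<n} \<times> {..<n}. coeff P (Suc (snd i + fst i)) * coeff P (Suc (snd j + fst j)) *
       ((\<integral>x. x ^ (snd i + snd j) \<partial>\<mu>) * (\<integral>x. x ^ (fst i + fst j) \<partial>\<mu>)))"
proof -
  let ?I = "{..<n} \<times> {..<n}"
  let ?c = "\<lambda>i. coeff P (Suc (snd i + fst i))"
  have "(dquot (poly P) (poly (pderiv P)) z)\<^sup>2 =
      (\<Sum>i\<in>?I. \<Sum>j\<in>?I. ?c i * ?c j * (fst z ^ (snd i + snd j) * snd z ^ (fst i + fst j)))" for z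
  proof -
    have "dquot (poly P) (poly (pderiv P)) z = (\<Sum>i\<in>?I. ?c i * (fst z ^ snd i * snd z ^ fst i))"
      using dquot_poly[OF n n, of "fst z" "snd z"] by (simp add: sum.cartesian_product case_prod_beta)
    then show ?thesis unfolding power2_eq_square
      by (simp only: sum_product) (intro sum.cong refl, simp add: power_add)
  qed
  then have "(\<integral>z. (dquot (poly P) (poly (pderiv P)) z)\<^sup>2 \<partial>(\<mu> \<Otimes>\<^sub>M \<mu>)) =
     (\<integral>z. (\<Sum>i\<in>?I. \<Sum>j\<in>?I. ?c i * ?c j * (fst z ^ (snd i + snd j) * snd z ^ (fst i + fst j))) \<partial>(\<mu> \<Otimes>\<^sub>M \<mu>))"
    by simp
  also have "\<dots> = (\<Sum>i\<in>?I. \<Sum>j\<in>?I. ?c i * ?c j * (\<integral>z. fst z ^ (snd i + snd j) * snd z ^ (fst i + fst j) \<partial>(\<mu> \<Otimes>\<^sub>M \<mu>)))"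
    by (simp add: Bochner_Integration.integral_sum Bochner_Integration.integrable_sum pair_prod(1)[OF integrable_power integrable_power])
  finally show ?thesis by (simp add: pair_prod(2)[OF integrable_power integrable_power])
qed

lemma poly_map_poly_complex_of_real:
  "poly (map_poly complex_of_real P) (complex_of_real t) = complex_of_real (poly P t)"
  by (induction P) (auto simp: map_poly_pCons)

lemma ennreal_sqrt_le:
  assumes "K \<ge> 0" "c \<le> ennreal (K\<^sup>2)" shows "ennreal_sqrt c \<le> ennreal K"
proof -
  have "c \<noteq> \<infinity>" using assms(2) by (auto simp: top_unique)
  moreover have "enn2real c \<le> K\<^sup>2" using assms by (intro enn2real_leI) auto
  then have "sqrt (enn2real c) \<le> K" using assms(1) real_le_lsqrt by auto
  ultimately show ?thesis unfolding ennreal_sqrt_def by (simp add: ennreal_leI)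
qed

locale stein_setting = traced_calculus F M C \<tau>
  for F :: "('h::complex_hilbert) op" and M C \<tau> +
  fixes \<iota> :: "'h op \<Rightarrow> 'l::complex_hilbert" and tens :: "'l \<Rightarrow> 'l \<Rightarrow> 'k::complex_hilbert"
  assumes L2: "is_L2_completion M \<tau> \<iota>" and tensor: "is_hilbert_tensor_product tens"
begin

lemma op_power_M: "op_power F j \<in> M"
  using op_poly_commutant[OF C_clinear, of F "[:0, 1:] ^ j"] FM unfolding M_eq op_poly_power[OF F_clinear] by simp

lemma cinner_iota: "a \<in> M \<Longrightarrow> b \<in> M \<Longrightarrow> cinner (\<iota> a) (\<iota> b) = \<tau> (adj a o\<^sub>L b)"
  using L2 unfolding is_L2_completion_def by blast

lemma cinner_tens: "cinner (tens x y) (tens x' y') = cinner x x' * cinner y y'"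
  using tensor unfolding is_hilbert_tensor_product_def by blast

lemma cinner_iota_power:
  "cinner (\<iota> (op_power F i)) (\<iota> (op_power F j)) = complex_of_real (\<integral>t. t ^ (i + j) \<partial>law)"
proof -
  have "adj (op_power F i) = op_power F i"
    by (rule adj_eqI) (simp add: is_adjoint_def op_power_self_adjoint[OF F_sa])
  moreover have "op_power F i o\<^sub>L op_power F j = op_power F (i + j)"
    by (rule blinfun_eqI) (simp add: op_power_add)
  ultimately show ?thesis by (simp add: cinner_iota op_power_M tau_power)
qed

lemma cinner_iota_poly:
  "cinner (\<iota> F) (\<iota> (op_poly (map_poly complex_of_real P) F)) = complex_of_real (\<integral>t. t * poly P t \<partial>law)"
proof -
  let ?P = "map_poly complex_of_real P"
  have "op_poly ?P F \<in> M" using op_poly_commutant[OF C_clinear, of F ?P] FM unfolding M_eq by simp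
  then have "cinner (\<iota> F) (\<iota> (op_poly ?P F)) = \<tau> (F o\<^sub>L op_poly ?P F)"
    by (simp add: cinner_iota FM adj_self_adjoint[OF F_sa])
  also have "F o\<^sub>L op_poly ?P F = op_poly ([:0, 1:] * ?P) F"
    by (simp only: op_poly_mult[OF F_clinear] op_poly_X)
  also have "\<tau> \<dots> = complex_of_real (\<integral>t. t * poly P t \<partial>law)"
  proof (rule tau_calc_real)
    show "calc (\<lambda>t. complex_of_real (t * poly P t)) (op_poly ([:0, 1:] * ?P) F)"
      using calc_poly[of "[:0, 1:] * ?P"] by (simp add: poly_map_poly_complex_of_real)
  qed
  finally show ?thesis .
qed

text \<open>The Gram matrix of the tensors of powers of \<open>F\<close> consists of products of two
  moments of \<open>law\<close>, as does that of the monomials \<open>x^a y^b\<close> under the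
  product law; the coefficients agree.\<close>

lemma norm_eval_tensor:
  "(norm (eval_tensor \<iota> tens F (free_difference_quotient (map_poly complex_of_real P))))\<^sup>2
     = (\<integral>z. (dquot (poly P) (poly (pderiv P)) z)\<^sup>2 \<partial>(law \<Otimes>\<^sub>M law))"
proof -
  let ?n = "degree P" and ?P = "map_poly complex_of_real P"
  \<comment> \<open>An index is a pair \<open>(b, a)\<close> in the order of summation of
    \<open>eval_tensor\<close>, so \<open>snd\<close> is the exponent of the left leg.\<close>
  let ?I = "{..<?n} \<times> {..<?n}"
  let ?c = "\<lambda>i. coeff P (Suc (snd i + fst i))"
  let ?T = "\<lambda>i. tens (\<iota> (op_power F (snd i))) (\<iota> (op_power F (fst i)))"
  have eq: "eval_tensor \<iota> tens F (free_difference_quotient ?P) = (\<Sum>i\<in>?I. complex_of_real (?c i) *\<^sub>C ?T i)"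
    using eval_tensor_free_difference_quotient[of ?P ?n \<iota> tens F]
    by (simp add: degree_map_poly coeff_map_poly sum.cartesian_product case_prod_beta)
  have "complex_of_real ((norm (eval_tensor \<iota> tens F (free_difference_quotient ?P)))\<^sup>2) =
      (\<Sum>i\<in>?I. \<Sum>j\<in>?I. complex_of_real (?c i) * complex_of_real (?c j) * cinner (?T i) (?T j))"
    unfolding cinner_self[symmetric] eq cinner_sum_left
    by (intro sum.cong refl)
       (simp add: cinner_sum_right cinner_scaleC_left cinner_scaleC_right sum_distrib_left mult.assoc mult.left_commute)
  also have "\<dots> = complex_of_real (\<Sum>i\<in>?I. \<Sum>j\<in>?I. ?c i * ?c j *
       ((\<integral>x. x ^ (snd i + snd j) \<partial>law) * (\<integral>x. x ^ (fst i + fst j) \<partial>law)))"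
    by (simp only: cinner_tens cinner_iota_power of_real_sum of_real_mult)
  finally show ?thesis
    unfolding bounded_support.integral_dquot_square[OF law_bounded_support order_refl] of_real_eq_iff .
qed

text \<open>The polynomial \<open>X\<close> has free difference quotient 1 tensor 1, so the kernel
  identity evaluates the cross term of \<open>norm (A - ?E)\<close> as the second moment of
  \<open>law\<close>. The expanded square is then the bound of \<open>stein_transport\<close> for
  \<open>D = norm A\<close>.\<close>

lemma stein_kernel_coupling:
  assumes A: "free_stein_kernel \<iota> tens F A"
  obtains \<pi> :: "(real \<times> real) measure" where "prob_space \<pi>" "sets \<pi> = sets borel" "distr \<pi> borel fst = law" "distr \<pi> borel snd = semicircle"
    "(\<integral>\<^sup>+ (x, y). ennreal (\<bar>x - y\<bar>\<^sup>2) \<partial>\<pi>) \<le> ennreal ((norm (A - tens (\<iota> id_blinfun) (\<iota> id_blinfun)))\<^sup>2)"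
proof -
  let ?E = "tens (\<iota> id_blinfun) (\<iota> id_blinfun)"
  have kernel: "complex_of_real (\<integral>t. t * poly P t \<partial>law)
      = cinner A (eval_tensor \<iota> tens F (free_difference_quotient (map_poly complex_of_real P)))" for P
    using A cinner_iota_poly[of P] unfolding free_stein_kernel_def by metis
  have poly: "(\<integral>x. x * poly P x \<partial>law)\<^sup>2 \<le> (norm A)\<^sup>2 * (\<integral>z. (dquot (poly P) (poly (pderiv P)) z)\<^sup>2 \<partial>(law \<Otimes>\<^sub>M law))" for P
  proof -
    let ?T = "eval_tensor \<iota> tens F (free_difference_quotient (map_poly complex_of_real P))"
    have "\<bar>\<integral>x. x * poly P x \<partial>law\<bar> = cmod (cinner A ?T)" unfolding kernel[symmetric] by simp
    also have "\<dots> \<le> norm A * norm ?T" by (rule cinner_cauchy_schwarz)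
    finally have "\<bar>\<integral>x. x * poly P x \<partial>law\<bar>\<^sup>2 \<le> (norm A * norm ?T)\<^sup>2" by (intro power_mono) auto
    then show ?thesis by (simp add: power_mult_distrib norm_eval_tensor)
  qed
  have "map_poly complex_of_real [:0, 1:] = [:0, 1:]" by (simp add: map_poly_pCons)
  moreover have "eval_tensor \<iota> tens F (free_difference_quotient [:0, 1:]) = ?E"
    by (subst eval_tensor_free_difference_quotient[where n = 1]) auto
  ultimately have AE: "cinner A ?E = complex_of_real (\<integral>t. t\<^sup>2 \<partial>law)"
    using kernel[of "[:0, 1:]"] by (simp add: power2_eq_square)
  have "cinner ?E ?E = 1"
    using cinner_iota_power[of 0 0] prob_space.prob_space[OF prob_space_law] by (simp add: cinner_tens)
  moreover have "cinner ?E A = complex_of_real (\<integral>t. t\<^sup>2 \<partial>law)"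
    using AE by (subst cinner_commute) simp
  ultimately have "(norm (A - ?E))\<^sup>2 = 1 - 2 * (\<integral>t. t\<^sup>2 \<partial>law) + (norm A)\<^sup>2"
    unfolding norm_eq_cinner cinner_diff_left cinner_diff_right by (simp add: AE)
  then show ?thesis using stein_transport[OF law_bounded_support norm_ge_zero poly] that by metis
qed

end

theorem proposition2p7:
  fixes M :: "('h::complex_hilbert) op set" and \<tau> :: "'h op \<Rightarrow> complex"
    and N :: "('g::complex_hilbert) op set" and \<sigma> :: "'g op \<Rightarrow> complex"
    and \<iota> :: "'h op \<Rightarrow> 'l::complex_hilbert" and tens :: "'l \<Rightarrow> 'l \<Rightarrow> 'k::complex_hilbert"
    and F :: "'h op" and S :: "'g op"
  assumes "tracial_W_star_space M \<tau>"
    and "is_L2_completion M \<tau> \<iota>"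
    and "is_hilbert_tensor_product tens"
    and "tracial_W_star_space N \<sigma>" and "standard_semicircular N \<sigma> S"
    and "F \<in> M" and "self_adjoint F"
  shows "W2 \<tau> F \<sigma> S \<le> free_stein_discrepancy \<iota> tens F"
proof -
  have M: "M = commutant (commutant M)" "state_on M \<tau>" "normal_on M \<tau>"
    using assms(1) by (simp_all add: tracial_W_star_space_def von_neumann_algebra_def)
  \<comment> \<open>A von Neumann algebra is the commutant of its own commutant, the form in which
    the calculus receives \<open>M\<close>.\<close>
  interpret stein_setting F M "commutant M" \<tau> \<iota> tens
    by unfold_locales (use M assms in \<open>auto simp: commutant_def\<close>)
  have S: "is_distribution \<sigma> S semicircle" using assms(5) by (simp add: standard_semicircular_def)
  show ?thesis
    unfolding free_stein_discrepancy_def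
  proof (rule INF_greatest)
    fix A assume "A \<in> {A. free_stein_kernel \<iota> tens F A}"
    then have "free_stein_kernel \<iota> tens F A" by simp
    then obtain \<pi> where \<pi>: "prob_space \<pi>" "sets \<pi> = sets borel" "distr \<pi> borel fst = law" "distr \<pi> borel snd = semicircle"
      and le: "(\<integral>\<^sup>+ (x, y). ennreal (\<bar>x - y\<bar>\<^sup>2) \<partial>\<pi>) \<le> ennreal ((norm (A - tens (\<iota> id_blinfun) (\<iota> id_blinfun)))\<^sup>2)"
      by (rule stein_kernel_coupling)
    \<comment> \<open>The cost bound depends on the kernel \<open>A\<close> but the marginals do
      not, so every kernel bounds the same infimum over couplings.\<close>
    have "\<pi> \<in> couplings \<tau> F \<sigma> S" using \<pi> S is_distribution_law by (simp add: couplings_def)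
    then have "(INF \<pi>\<in>couplings \<tau> F \<sigma> S. \<integral>\<^sup>+ (x, y). ennreal (\<bar>x - y\<bar>\<^sup>2) \<partial>\<pi>)
        \<le> ennreal ((norm (A - tens (\<iota> id_blinfun) (\<iota> id_blinfun)))\<^sup>2)"
      using le by (rule INF_lower2)
    then show "W2 \<tau> F \<sigma> S \<le> ennreal (norm (A - tens (\<iota> id_blinfun) (\<iota> id_blinfun)))"
      unfolding W2_def by (intro ennreal_sqrt_le) auto
  qed
qed

end
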